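(* Let $A$ be a self-adjoint operator in a separable Hilbert space $\mathcal H$ whose spectrum is $\sigma(A)=\{\mu_k\}_{k\in\mathbb N}$ with $0<\mu_1<\mu_2<\dots$ and $\mu_k\to+\infty$; the eigenvalues $\mu_k$ may have arbitrary, possibly infinite, multiplicities. Let $P_k^0$ be the orthogonal spectral projection of $A$ onto the eigenspace of $\mu_k$, and let $r_1=\frac12(\mu_2-\mu_1)$, $r_k=\frac12\min\{\mu_k-\mu_{k-1},\mu_{k+1}-\mu_k\}$ for $k\ge2$. Let $v:\operatorname{Dom}(A^{1/2})\times\operatorname{Dom}(A^{1/2})\to\mathbb C$ be a sesquilinear form, and suppose that there is a sequence $\{\omega_j\}_{j\in\mathbb N}$ of non-negative numbers such that $$|v(P_j^0f,P_k^0g)|\le\omega_j\omega_k\|P_j^0f\|\|P_k^0g\|,\qquad j,k\in\mathbb N,\ f,g\in\operatorname{Dom}(A^{1/2}),$$ and $$\sum_{j=1}^\infty\frac{\omega_j^2}{\mu_j}<\infty,\qquad \sum_{\substack{j=1\\ j\ne n}}^\infty\frac{\omega_j^2}{|\mu_n-\mu_j|}+\frac{\omega_n^2}{r_n}=o(1),\quad n\to\infty.$$ Let $T$ be the m-sectorial operator associated with the closed sectorial form $t=a+v$, $\operatorname{Dom}(t)=\operatorname{Dom}(A^{1/2})$, where $a(f,g)=\langle A^{1/2}f,A^{1/2}g\rangle$. Let $N_0\in\mathbb N$ and $h_1,h_2>0$ be such that $\sigma(T)\subset\Pi_0\cup\bigcup_{k>N_0}\Pi_k$, where $\Pi_0=\{z\in\mathbb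 C: -h_1<\operatorname{Re}z\le\mu_{N_0}+r_{N_0},\ |\operatorname{Im}z|\le h_2\}$ and $\Pi_k=\{z\in\mathbb C:|z-\mu_k|<r_k\}$, and such that the Riesz projections $$S_0=\frac1{2\pi i}\int_{\partial\Pi_0}(z-T)^{-1}\,dz,\qquad P_k=\frac1{2\pi i}\int_{\partial\Pi_k}(z-T)^{-1}\,dz,\quad k>N_0,$$ are well-defined, disjoint and satisfy $\operatorname{rank}(S_0)=\operatorname{rank}\big(\sum_{k=1}^{N_0}P_k^0\big)$ and $\operatorname{rank}(P_k)=\operatorname{rank}(P_k^0)$ for $k>N_0$ (such $N_0,h_1,h_2$ exist). Then the system $\{S_0\}\cup\{P_k\}_{k>N_0}$ is complete and there exists a boundedly invertible bounded operator $W$ on $\mathcal H$ such that $$S_0=W^{-1}\Big(\sum_{k=1}^{N_0}P_k^0\Big)W,\qquad P_k=W^{-1}P_k^0W,\quad k>N_0.$$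
   Context: $T$ is obtained from $t$ by Kato's first representation theorem: $\operatorname{Dom}(T)\subset\operatorname{Dom}(t)$ and $\langle Tf,g\rangle=t(f,g)$ for $f\in\operatorname{Dom}(T)$, $g\in\operatorname{Dom}(t)$; under the hypotheses $v$ is relatively form-bounded with respect to $a$ with bound $0$, so $t$ is closed and sectorial. Contours are positively oriented. "Well-defined" includes that the contours lie in the resolvent set of $T$; "disjoint" means that products of two different projections of the system vanish. Rank is the dimension of the range, a value in $\{0,1,2,\dots\}\cup\{\infty\}$. A system of projections is complete if the closed linear span of the union of their ranges is the whole of $\mathcal H$. *)

theory Defs
  imports
    "HOL-Complex_Analysis.Complex_Analysis"
    "HOL-Library.Landau_Symbols"
    "HOL-Library.Extended_Nat"
begin

section \<open>Complex Hilbert spaces\<close>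

text \<open>
  The complex inner product is linear in the first argument.  Its real part is the inner product
  of the underlying real inner product space, so norm, topology and convergence are those of
  the library classes.
\<close>

class complex_inner = real_inner +
  fixes scaleC :: "complex \<Rightarrow> 'a \<Rightarrow> 'a" (infixr \<open>*\<^sub>C\<close> 75)
    and cinner :: "'a \<Rightarrow> 'a \<Rightarrow> complex"
  assumes scaleC_add_right: "a *\<^sub>C (x + y) = a *\<^sub>C x + a *\<^sub>C y"
    and scaleC_add_left: "(a + b) *\<^sub>C x = a *\<^sub>C x + b *\<^sub>C x"
    and scaleC_scaleC: "a *\<^sub>C b *\<^sub>C x = (a * b) *\<^sub>C x"
    and scaleC_of_real: "complex_of_real r *\<^sub>C x = r *\<^sub>R x"
    and cinner_commute: "cinner x y = cnj (cinner y x)"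
    and cinner_add_left: "cinner (x + y) z = cinner x z + cinner y z"
    and cinner_scaleC_left: "cinner (a *\<^sub>C x) y = a * cinner x y"
    and Re_cinner: "Re (cinner x y) = inner x y"

class complex_hilbert = complex_inner + complete_space
begin
subclass banach ..
end

instantiation complex :: complex_hilbert
begin
definition "scaleC_complex (a :: complex) (x :: complex) = a * x"
definition "cinner_complex (x :: complex) (y :: complex) = x * cnj y"
instance
  by standard
     (auto simp: scaleC_complex_def cinner_complex_def algebra_simps inner_complex_def
        scaleR_conv_of_real)
end

global_interpretation complex_vector: vector_space "scaleC :: complex \<Rightarrow> 'a \<Rightarrow> 'a :: complex_inner"
  defines csubspace = complex_vector.subspace
    and cspan = complex_vector.span
    and cdependent = complex_vector.dependent
    and crepresentation = complex_vector.representation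
    and cextend_basis = complex_vector.extend_basis
    and cdim = complex_vector.dim
proof
  fix x :: 'a
  show "1 *\<^sub>C x = x"
    using scaleC_of_real [of 1 x] by simp
qed (simp_all add: scaleC_add_right scaleC_add_left scaleC_scaleC)

definition bounded_clinear :: "('h::complex_inner \<Rightarrow> 'h) \<Rightarrow> bool" where
  "bounded_clinear W \<longleftrightarrow> bounded_linear W \<and> (\<forall>c x. W (c *\<^sub>C x) = c *\<^sub>C W x)"

definition boundedly_invertible :: "('h::complex_inner \<Rightarrow> 'h) \<Rightarrow> bool" where
  "boundedly_invertible W \<longleftrightarrow> bij W \<and> bounded_clinear (inv W)"

definition orth_proj :: "'h::complex_inner set \<Rightarrow> 'h \<Rightarrow> 'h" where
  "orth_proj S x = (THE y. y \<in> S \<and> (\<forall>s\<in>S. cinner (x - y) s = 0))"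

definition op_rank :: "('h::complex_inner \<Rightarrow> 'h) \<Rightarrow> enat" where
  "op_rank P =
     (if \<exists>B. finite B \<and> range P \<subseteq> cspan B then enat (cdim (range P)) else \<infinity>)"


section \<open>Unbounded operators\<close>

text \<open>
  An operator is a pair of a domain \<open>D\<close> and a function \<open>A\<close>; the values of \<open>A\<close> outside \<open>D\<close> are
  irrelevant.
\<close>

definition linear_op :: "'h::complex_inner set \<Rightarrow> ('h \<Rightarrow> 'h) \<Rightarrow> bool" where
  "linear_op D A \<longleftrightarrow> csubspace D \<and>
     (\<forall>f\<in>D. \<forall>g\<in>D. A (f + g) = A f + A g) \<and> (\<forall>c. \<forall>f\<in>D. A (c *\<^sub>C f) = c *\<^sub>C A f)"

text \<open>For densely defined \<open>A\<close> this is the graph of the adjoint operator.\<close>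

definition adjoint_graph :: "'h::complex_inner set \<Rightarrow> ('h \<Rightarrow> 'h) \<Rightarrow> ('h \<times> 'h) set" where
  "adjoint_graph D A = {(g, h). \<forall>f\<in>D. cinner (A f) g = cinner f h}"

definition selfadjoint :: "'h::complex_inner set \<Rightarrow> ('h \<Rightarrow> 'h) \<Rightarrow> bool" where
  "selfadjoint D A \<longleftrightarrow>
     linear_op D A \<and> closure D = UNIV \<and> adjoint_graph D A = {(f, A f) | f. f \<in> D}"

text \<open>\<open>op_resolvent D A z\<close> is the inverse of \<open>z - A\<close>.\<close>

definition op_resolvent ::
    "'h::complex_inner set \<Rightarrow> ('h \<Rightarrow> 'h) \<Rightarrow> complex \<Rightarrow> 'h \<Rightarrow> 'h" where
  "op_resolvent D A z = inv_into D (\<lambda>f. z *\<^sub>C f - A f)"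

definition resolvent_set :: "'h::complex_inner set \<Rightarrow> ('h \<Rightarrow> 'h) \<Rightarrow> complex set" where
  "resolvent_set D A =
     {z. bij_betw (\<lambda>f. z *\<^sub>C f - A f) D UNIV \<and> bounded_clinear (op_resolvent D A z)}"

definition op_spectrum :: "'h::complex_inner set \<Rightarrow> ('h \<Rightarrow> 'h) \<Rightarrow> complex set" where
  "op_spectrum D A = - resolvent_set D A"

definition eigenspace :: "'h::complex_inner set \<Rightarrow> ('h \<Rightarrow> 'h) \<Rightarrow> complex \<Rightarrow> 'h set" where
  "eigenspace D A z = {f \<in> D. A f = z *\<^sub>C f}"

text \<open>
  \<open>(DB, B)\<close> is the square root of \<open>(D, A)\<close>: the unique non-negative self-adjoint
  operator whose square, with its natural domain, is \<open>A\<close>.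
\<close>

definition is_sqrt_op ::
    "'h::complex_inner set \<Rightarrow> ('h \<Rightarrow> 'h) \<Rightarrow> 'h set \<Rightarrow> ('h \<Rightarrow> 'h) \<Rightarrow> bool" where
  "is_sqrt_op D A DB B \<longleftrightarrow> selfadjoint DB B \<and> (\<forall>f\<in>DB. 0 \<le> Re (cinner (B f) f)) \<and>
     D = {f \<in> DB. B f \<in> DB} \<and> (\<forall>f\<in>D. A f = B (B f))"


section \<open>Sesquilinear forms and m-sectorial operators\<close>

text \<open>
  The closed sector with vertex \<open>\<gamma>\<close> and half-angle \<open>arctan c\<close> about the half-line
  from \<open>\<gamma>\<close> to plus infinity.
\<close>

definition sector :: "real \<Rightarrow> real \<Rightarrow> complex set" where
  "sector \<gamma> c = {z. \<gamma> \<le> Re z \<and> \<bar>Im z\<bar> \<le> c * (Re z - \<gamma>)}"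

definition sesquilinear_on ::
    "'h::complex_inner set \<Rightarrow> ('h \<Rightarrow> 'h \<Rightarrow> complex) \<Rightarrow> bool" where
  "sesquilinear_on D v \<longleftrightarrow> csubspace D \<and>
     (\<forall>f\<in>D. \<forall>g\<in>D. \<forall>h\<in>D. v (f + g) h = v f h + v g h \<and> v h (f + g) = v h f + v h g) \<and>
     (\<forall>c. \<forall>f\<in>D. \<forall>g\<in>D. v (c *\<^sub>C f) g = c * v f g \<and> v f (c *\<^sub>C g) = cnj c * v f g)"

definition sectorial_form :: "'h::complex_inner set \<Rightarrow> ('h \<Rightarrow> 'h \<Rightarrow> complex) \<Rightarrow> bool" where
  "sectorial_form D t \<longleftrightarrow> sesquilinear_on D t \<and>
     (\<exists>\<gamma> c. 0 \<le> c \<and> (\<forall>f\<in>D. norm f = 1 \<longrightarrow> t f f \<in> sector \<gamma> c))"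

definition closed_sectorial_form ::
    "'h::complex_inner set \<Rightarrow> ('h \<Rightarrow> 'h \<Rightarrow> complex) \<Rightarrow> bool" where
  "closed_sectorial_form D t \<longleftrightarrow> sectorial_form D t \<and>
     (\<forall>u x. range u \<subseteq> D \<and> u \<longlonglongrightarrow> x \<and>
        ((\<lambda>(m, n). t (u m - u n) (u m - u n)) \<longlongrightarrow> 0) (sequentially \<times>\<^sub>F sequentially)
        \<longrightarrow> x \<in> D \<and> (\<lambda>n. t (u n - x) (u n - x)) \<longlonglongrightarrow> 0)"

text \<open>
  Note that \<open>op_resolvent D A (- z)\<close> is minus the inverse of \<open>A + z\<close>.
\<close>

definition m_accretive :: "'h::complex_inner set \<Rightarrow> ('h \<Rightarrow> 'h) \<Rightarrow> bool" where
  "m_accretive D A \<longleftrightarrow> linear_op D A \<and>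
     (\<forall>z. 0 < Re z \<longrightarrow> - z \<in> resolvent_set D A \<and>
        (\<forall>f. norm (op_resolvent D A (- z) f) \<le> norm f / Re z))"

text \<open>Sectorial and quasi-m-accretive, as in Kato's book.\<close>

definition m_sectorial :: "'h::complex_inner set \<Rightarrow> ('h \<Rightarrow> 'h) \<Rightarrow> bool" where
  "m_sectorial D A \<longleftrightarrow>
     (\<exists>\<gamma> c. 0 \<le> c \<and> (\<forall>f\<in>D. norm f = 1 \<longrightarrow> cinner (A f) f \<in> sector \<gamma> c)) \<and>
     (\<exists>\<alpha>. m_accretive D (\<lambda>f. A f + \<alpha> *\<^sub>R f))"

text \<open>
  By the first representation theorem a densely defined closed sectorial form determines \<open>(D, T)\<close>
  uniquely.
\<close>

definition m_sectorial_op_of_form ::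
    "'h::complex_inner set \<Rightarrow> ('h \<Rightarrow> 'h \<Rightarrow> complex) \<Rightarrow> 'h set \<Rightarrow> ('h \<Rightarrow> 'h) \<Rightarrow> bool" where
  "m_sectorial_op_of_form Dt t D T \<longleftrightarrow>
     m_sectorial D T \<and> D \<subseteq> Dt \<and> (\<forall>f\<in>D. \<forall>g\<in>Dt. cinner (T f) g = t f g)"


section \<open>Riesz projections\<close>

text \<open>
  The contour integral of the resolvent, with the factor \<open>1 / (2 \<pi> \<i>)\<close>, is taken in the
  Banach space of bounded operators and mirrors the library's scalar
  \<^const>\<open>has_contour_integral\<close>.  It is meaningful when the contour lies in the resolvent set.
\<close>

definition riesz_projection ::
    "'h::complex_hilbert set \<Rightarrow> ('h \<Rightarrow> 'h) \<Rightarrow> (real \<Rightarrow> complex) \<Rightarrow> 'h \<Rightarrow> 'h" where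
  "riesz_projection D T \<gamma> f =
     (1 / (2 * of_real pi * \<i>)) *\<^sub>C
       blinfun_apply
         (integral {0..1} (\<lambda>s. Blinfun (\<lambda>g.
            vector_derivative \<gamma> (at s within {0..1}) *\<^sub>C op_resolvent D T (\<gamma> s) g))) f"

text \<open>Sequences are indexed from 1; their values at 0 are irrelevant.\<close>

definition gap_radius :: "(nat \<Rightarrow> real) \<Rightarrow> nat \<Rightarrow> real" where
  "gap_radius \<mu> k =
     (if k = 1 then (\<mu> 2 - \<mu> 1) / 2 else min (\<mu> k - \<mu> (k - 1)) (\<mu> (k + 1) - \<mu> k) / 2)"

definition Pi_zero :: "(nat \<Rightarrow> real) \<Rightarrow> nat \<Rightarrow> real \<Rightarrow> real \<Rightarrow> complex set" where
  "Pi_zero \<mu> N h\<^sub>1 h\<^sub>2 =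
     {z. - h\<^sub>1 < Re z \<and> Re z \<le> \<mu> N + gap_radius \<mu> N \<and> \<bar>Im z\<bar> \<le> h\<^sub>2}"

definition Pi_disc :: "(nat \<Rightarrow> real) \<Rightarrow> nat \<Rightarrow> complex set" where
  "Pi_disc \<mu> k = {z. cmod (z - of_real (\<mu> k)) < gap_radius \<mu> k}"

definition contour_zero :: "(nat \<Rightarrow> real) \<Rightarrow> nat \<Rightarrow> real \<Rightarrow> real \<Rightarrow> real \<Rightarrow> complex" where
  "contour_zero \<mu> N h\<^sub>1 h\<^sub>2 =
     rectpath (Complex (- h\<^sub>1) (- h\<^sub>2)) (Complex (\<mu> N + gap_radius \<mu> N) h\<^sub>2)"

definition contour_disc :: "(nat \<Rightarrow> real) \<Rightarrow> nat \<Rightarrow> real \<Rightarrow> complex" where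
  "contour_disc \<mu> k = circlepath (of_real (\<mu> k)) (gap_radius \<mu> k)"

text \<open>
  \<open>spectrum_localized\<close> collects the conditions on \<open>N\<close>, \<open>h\<^sub>1\<close> and \<open>h\<^sub>2\<close>; \<open>P0 k\<close> stands for the
  spectral projections of the unperturbed operator.
\<close>

definition spectrum_localized ::
    "'h::complex_hilbert set \<Rightarrow> ('h \<Rightarrow> 'h) \<Rightarrow> (nat \<Rightarrow> real) \<Rightarrow> (nat \<Rightarrow> 'h \<Rightarrow> 'h) \<Rightarrow>
       nat \<Rightarrow> real \<Rightarrow> real \<Rightarrow> bool" where
  "spectrum_localized D T \<mu> P0 N h\<^sub>1 h\<^sub>2 \<longleftrightarrow>
     1 \<le> N \<and> 0 < h\<^sub>1 \<and> 0 < h\<^sub>2 \<and>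
     op_spectrum D T \<subseteq> Pi_zero \<mu> N h\<^sub>1 h\<^sub>2 \<union> (\<Union>k\<in>{N<..}. Pi_disc \<mu> k) \<and>
     path_image (contour_zero \<mu> N h\<^sub>1 h\<^sub>2) \<subseteq> resolvent_set D T \<and>
     (\<forall>k>N. path_image (contour_disc \<mu> k) \<subseteq> resolvent_set D T) \<and>
     (let S = riesz_projection D T (contour_zero \<mu> N h\<^sub>1 h\<^sub>2);
          P = (\<lambda>k. riesz_projection D T (contour_disc \<mu> k))
      in (\<forall>k>N. S \<circ> P k = (\<lambda>_. 0) \<and> P k \<circ> S = (\<lambda>_. 0)) \<and>
         (\<forall>j>N. \<forall>k>N. j \<noteq> k \<longrightarrow> P j \<circ> P k = (\<lambda>_. 0)) \<and>
         op_rank S = op_rank (\<lambda>f. \<Sum>k=1..N. P0 k f) \<and>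
         (\<forall>k>N. op_rank (P k) = op_rank (P0 k)))"

definition complete_system :: "('h::complex_inner \<Rightarrow> 'h) set \<Rightarrow> bool" where
  "complete_system \<P> \<longleftrightarrow> closure (cspan (\<Union>P\<in>\<P>. range P)) = UNIV"

end

(*
  Writing T = A^(1/2) (1 + V) A^(1/2) with a bounded operator V, the resolvent of T differs from
  that of A by a quantity controlled, as a form, by the sum eps(z) of w_j^2 / |z - mu_j|; this is
  small on the circles about mu_k for large k and on a large rectangle enclosing the first N
  points. A Schur test shows that the squares of the norms of P_k^0 (P_k - P_k^0) f, k > N, sum to
  a small multiple of |f|^2, and the rectangle projection S_N is close to E_N, the sum of the
  P_k^0 with k <= N. Hence, in Kato's manner, W = E_N S_N + sum_(k > N) P_k^0 P_k is a small
  perturbation of the identity and intertwines the two systems. For smaller N, Cauchy's theorem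
  decomposes S_N into S_0 and finitely many P_k, and W is corrected on the range of S_N by
  isomorphisms between the ranges, which are separable Hilbert spaces of equal dimension.
  Completeness follows from that of the orthogonal system.
*)
theory Submission
  imports Defs
begin

section \<open>Hilbert space preliminaries\<close>

text \<open>Near the low eigenvalues the perturbation need not be small, so one rectangle replaces
  the first circles: on its right side and far away \<open>eps\<close> is small. The resolvent
  estimate keeps the product form \<open>alpha z f * alpha z g\<close>, because on the vertical line
  through \<open>X N\<close> the square of each factor is dominated by a combination of Poisson
  kernels, whose integrals are at most \<pi> whatever the height of the rectangle. In the Schur test
  the two indices play different roles: \<open>k\<close> exceeds \<open>N\<close>, where
  \<open>sigma\<close> is at most \<delta>, while \<open>j\<close> runs over all indices, where
  \<open>sigma\<close> is only bounded by \<open>C\<close>. Hence \<delta> is chosen after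
  \<open>C\<close>, and \<open>N\<close> after both. Two facts come from soft arguments: the
  eigenspaces of \<open>A\<close> span a dense subspace by comparing resolvent norms at real points,
  with no spectral measure; \<open>V\<close> is bounded by Baire's theorem, since the block bounds
  alone say nothing about \<open>v\<close> on infinite sums of blocks. Multiplicities may be
  infinite, and \<open>op_rank\<close> has a single value for all infinite ranks; separability makes
  that value determine the Hilbert dimension.\<close>

lemma cinner_add_right: "cinner x (y + z) = cinner x y + cinner x z"
  by (metis cinner_add_left cinner_commute complex_cnj_add)

lemma cinner_scaleC_right: "cinner x (a *\<^sub>C y) = cnj a * cinner x y"
  by (metis cinner_commute cinner_scaleC_left complex_cnj_mult)

lemma cinner_self: "cinner x x = of_real ((norm x)\<^sup>2)"
proof -
  have "Im (cinner x x) = 0"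
    by (metis cinner_commute cnj.simps(2) equation_minus_iff neg_equal_zero)
  then show ?thesis
    by (simp add: complex_eq_iff Re_cinner power2_norm_eq_inner)
qed

lemma norm_scaleC: "norm (a *\<^sub>C x) = cmod a * norm x"
proof -
  have "complex_of_real ((norm (a *\<^sub>C x))\<^sup>2) = a * cnj a * of_real ((norm x)\<^sup>2)"
    by (metis cinner_self cinner_scaleC_left cinner_scaleC_right mult.assoc)
  also have "\<dots> = of_real ((cmod a * norm x)\<^sup>2)"
    by (simp add: complex_norm_square[symmetric] power_mult_distrib)
  finally have "(norm (a *\<^sub>C x))\<^sup>2 = (cmod a * norm x)\<^sup>2"
    by (simp only: of_real_eq_iff)
  then show ?thesis
    by (simp add: power2_eq_iff_nonneg)
qed

lemma cmod_cinner_le: "cmod (cinner x y) \<le> norm x * norm y"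
proof (cases "cinner x y = 0")
  case False
  \<comment> \<open>A unimodular factor that makes the product real and non-negative, so that the
    Cauchy-Schwarz inequality of the underlying real space applies.\<close>
  define c where "c = cnj (cinner x y) / cmod (cinner x y)"
  have c: "cmod c = 1" "c * cinner x y = of_real (cmod (cinner x y))"
    using False by (simp_all add: c_def norm_divide complex_norm_square[symmetric] power2_eq_square
        mult.commute[of "cnj _"])
  have "cmod (cinner x y) = Re (cinner (c *\<^sub>C x) y)"
    by (simp add: cinner_scaleC_left c)
  also have "\<dots> \<le> norm (c *\<^sub>C x) * norm y"
    by (simp add: Re_cinner norm_cauchy_schwarz)
  finally show ?thesis
    by (simp add: norm_scaleC c)
qed simp

interpretation cinner: bounded_bilinear cinner
proof
  show "cinner (r *\<^sub>R a) b = r *\<^sub>R cinner a b" for r and a b :: 'a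
    by (metis cinner_scaleC_left scaleC_of_real scaleR_conv_of_real)
  show "cinner a (r *\<^sub>R b) = r *\<^sub>R cinner a b" for r and a b :: 'a
    by (metis cinner_scaleC_right complex_cnj_complex_of_real scaleC_of_real scaleR_conv_of_real)
  show "\<exists>K. \<forall>(a::'a) b. cmod (cinner a b) \<le> norm a * norm b * K"
    by (rule exI[of _ 1]) (simp add: cmod_cinner_le)
qed (simp_all add: cinner_add_left cinner_add_right)

interpretation scaleC: bounded_bilinear "scaleC :: complex \<Rightarrow> 'a \<Rightarrow> 'a::complex_inner"
proof
  show "(r *\<^sub>R a) *\<^sub>C b = r *\<^sub>R a *\<^sub>C b" for r a and b :: 'a
    by (metis scaleC_of_real scaleC_scaleC scaleR_conv_of_real)
  show "a *\<^sub>C (r *\<^sub>R b) = r *\<^sub>R a *\<^sub>C b" for r a and b :: 'a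
    by (metis mult.commute scaleC_of_real scaleC_scaleC)
  show "\<exists>K. \<forall>a (b::'a). norm (a *\<^sub>C b) \<le> norm a * norm b * K"
    by (rule exI[of _ 1]) (simp add: norm_scaleC)
qed (simp_all add: scaleC_add_left scaleC_add_right)

lemma cinner_zero [simp]: "cinner 0 x = 0" "cinner x 0 = 0"
  by (rule cinner.zero_left, rule cinner.zero_right)

lemma cinner_eqI: "x = y" if "\<And>z. cinner x z = cinner y z"
proof -
  have "cinner (x - y) (x - y) = 0"
    using that[of "x - y"] by (simp add: cinner.diff_left)
  then show ?thesis
    by (simp add: cinner_self)
qed

lemma inner_conv_Re_cinner: "inner x y = Re (cinner x y)"
  by (simp add: Re_cinner)

lemma csubspace_scaleR: "csubspace M \<Longrightarrow> x \<in> M \<Longrightarrow> r *\<^sub>R x \<in> M"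
  by (metis complex_vector.subspace_scale scaleC_of_real)

section \<open>Bounded complex-linear operators\<close>

lemma bounded_clinearI:
  assumes "\<And>x y. W (x + y) = W x + W y" "\<And>c x. W (c *\<^sub>C x) = c *\<^sub>C W x"
    and "\<And>x. norm (W x) \<le> K * norm x"
  shows "bounded_clinear W"
  unfolding bounded_clinear_def
proof
  show "bounded_linear W"
  proof (rule bounded_linear_intro[where K = K])
    show "W (r *\<^sub>R x) = r *\<^sub>R W x" for r x
      by (metis assms(2) scaleC_of_real)
  qed (use assms in \<open>auto simp: mult.commute\<close>)
qed (use assms in auto)

lemma bounded_clinear_bounded_linear: "bounded_clinear W \<Longrightarrow> bounded_linear W"
  by (simp add: bounded_clinear_def)

lemma
  assumes "bounded_clinear W"
  shows bounded_clinear_add: "W (x + y) = W x + W y"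
    and bounded_clinear_scaleC: "W (c *\<^sub>C x) = c *\<^sub>C W x"
    and bounded_clinear_zero: "W 0 = 0"
    and bounded_clinear_diff: "W (x - y) = W x - W y"
    and bounded_clinear_minus: "W (- x) = - W x"
    and bounded_clinear_sum: "W (\<Sum>i\<in>I. f i) = (\<Sum>i\<in>I. W (f i))"
    and bounded_clinear_bound: "\<exists>K>0. \<forall>x. norm (W x) \<le> K * norm x"
    and bounded_clinear_tendsto: "(g \<longlongrightarrow> l) F \<Longrightarrow> ((\<lambda>n. W (g n)) \<longlongrightarrow> W l) F"
    and bounded_clinear_sums: "h sums l \<Longrightarrow> (\<lambda>n. W (h n)) sums W l"
proof -
  have W: "bounded_linear W"
    using assms by (rule bounded_clinear_bounded_linear)
  interpret W: bounded_linear W by fact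
  show "W (x + y) = W x + W y" "W 0 = 0" "W (x - y) = W x - W y" "W (- x) = - W x"
    "W (\<Sum>i\<in>I. f i) = (\<Sum>i\<in>I. W (f i))"
    by (rule W.add W.zero W.diff linear_neg[OF W.linear] W.sum)+
  show "W (c *\<^sub>C x) = c *\<^sub>C W x"
    using assms by (simp add: bounded_clinear_def)
  show "\<exists>K>0. \<forall>x. norm (W x) \<le> K * norm x"
    using W.pos_bounded by (metis mult.commute)
  show "((\<lambda>n. W (g n)) \<longlongrightarrow> W l) F" if "(g \<longlongrightarrow> l) F"
    using that by (rule W.tendsto)
  show "(\<lambda>n. W (h n)) sums W l" if "h sums l"
    using that by (rule W.sums)
qed

lemma bounded_clinear_ident: "bounded_clinear (\<lambda>x. x)"
  by (rule bounded_clinearI[where K = 1]) auto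

lemma bounded_clinear_const0: "bounded_clinear (\<lambda>x. 0)"
  by (rule bounded_clinearI[where K = 1]) auto

lemma bounded_clinear_compose:
  assumes "bounded_clinear V" "bounded_clinear W"
  shows "bounded_clinear (\<lambda>x. V (W x))"
  using bounded_linear_compose[of V W] assms by (simp add: bounded_clinear_def)

lemma bounded_clinear_add_fun:
  assumes "bounded_clinear V" "bounded_clinear W"
  shows "bounded_clinear (\<lambda>x. V x + W x)"
  using assms by (simp add: bounded_clinear_def bounded_linear_add scaleC_add_right)

lemma bounded_clinear_diff_fun:
  assumes "bounded_clinear V" "bounded_clinear W"
  shows "bounded_clinear (\<lambda>x. V x - W x)"
  using assms by (simp add: bounded_clinear_def bounded_linear_sub scaleC.diff_right)

lemma bounded_clinear_scaleC_fun:
  assumes "bounded_clinear V"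
  shows "bounded_clinear (\<lambda>x. c *\<^sub>C V x)"
proof -
  obtain K where K: "\<And>x. norm (V x) \<le> K * norm x"
    using bounded_clinear_bound[OF assms] by auto
  show ?thesis
  proof (rule bounded_clinearI[where K = "cmod c * K"])
    show "norm (c *\<^sub>C V x) \<le> cmod c * K * norm x" for x
      using K[of x] by (simp add: norm_scaleC mult.assoc mult_left_mono)
  qed (simp_all add: bounded_clinear_add[OF assms] bounded_clinear_scaleC[OF assms]
      scaleC_add_right scaleC_scaleC mult.commute)
qed

lemma bounded_clinear_sum_fun:
  assumes "\<And>i. i \<in> I \<Longrightarrow> bounded_clinear (V i)"
  shows "bounded_clinear (\<lambda>x. \<Sum>i\<in>I. V i x)"
  using assms
  by (induction I rule: infinite_finite_induct)
    (auto intro: bounded_clinear_const0 bounded_clinear_add_fun)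

lemma bounded_clinear_inv:
  assumes W: "bounded_clinear W" "bij W" and C: "\<And>x. norm x \<le> C * norm (W x)"
  shows "bounded_clinear (inv W)"
proof -
  have WI: "W (inv W x) = x" and IW: "inv W (W x) = x" for x
    using W(2) by (simp_all add: bij_is_surj surj_f_inv_f bij_is_inj)
  show ?thesis
  proof (rule bounded_clinearI[where K = C])
    show "inv W (x + y) = inv W x + inv W y" for x y
      using IW[of "inv W x + inv W y"] by (simp add: bounded_clinear_add[OF W(1)] WI)
    show "inv W (c *\<^sub>C x) = c *\<^sub>C inv W x" for c x
      using IW[of "c *\<^sub>C inv W x"] by (simp add: bounded_clinear_scaleC[OF W(1)] WI)
    show "norm (inv W x) \<le> C * norm x" for x
      using C[of "inv W x"] by (simp add: WI)
  qed
qed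

text \<open>Solving \<open>x - Y x = y\<close> means finding a fixed point of the map that sends
  \<open>x\<close> to \<open>y + Y x\<close>. It is a contraction, so Banach's theorem yields
  injectivity and surjectivity together; the lower bound \<open>(1 - c') * norm x\<close> then
  bounds the inverse.\<close>

lemma bij_id_minus_contraction:
  fixes Y :: "'h::complex_hilbert \<Rightarrow> 'h"
  assumes Y: "bounded_clinear Y" and c: "c < 1" and le: "\<And>x. norm (Y x) \<le> c * norm x"
  shows "bij (\<lambda>x. x - Y x)" and "bounded_clinear (inv (\<lambda>x. x - Y x))"
proof -
  \<comment> \<open>A contraction constant has to be non-negative, which \<open>c\<close> need not
    be.\<close>
  define c' where "c' = max c 0"
  have c': "0 \<le> c'" "c' < 1" "norm (Y x) \<le> c' * norm x" for x
    using c le[of x] mult_right_mono[of c c' "norm x"] by (auto simp: c'_def)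
  have "\<exists>!x. y + Y x = x" for y
  proof (rule banach_fix_type[OF c'(1,2)], intro allI)
    show "dist (y + Y x) (y + Y z) \<le> c' * dist x z" for x z
      using c'(3)[of "x - z"] by (simp add: dist_norm bounded_clinear_diff[OF Y])
  qed
  then have "\<exists>!x. x - Y x = y" for y
    unfolding diff_eq_eq eq_commute[of _ "_ + Y _"] .
  then show bij: "bij (\<lambda>x. x - Y x)"
    unfolding bij_iff by (rule allI)
  show "bounded_clinear (inv (\<lambda>x. x - Y x))"
  proof (rule bounded_clinear_inv[OF _ bij, where C = "1 / (1 - c')"])
    show "bounded_clinear (\<lambda>x. x - Y x)"
      by (intro bounded_clinear_diff_fun bounded_clinear_ident Y)
    fix x
    have "norm x \<le> norm (x - Y x) + c' * norm x"
      using norm_triangle_sub[of x "Y x"] c'(3)[of x] by linarith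
    then have "(1 - c') * norm x \<le> norm (x - Y x)"
      by (simp add: algebra_simps)
    then show "norm x \<le> 1 / (1 - c') * norm (x - Y x)"
      using c' by (simp add: field_simps)
  qed
qed

section \<open>Orthogonal projection onto a closed subspace\<close>

lemma csubspace_closure:
  fixes M :: "'h::complex_inner set"
  assumes M: "csubspace M"
  shows "csubspace (closure M)"
proof (rule complex_vector.subspaceI)
  show "0 \<in> closure M"
    using complex_vector.subspace_0[OF M] closure_subset by blast
  show "x + y \<in> closure M" if x: "x \<in> closure M" and y: "y \<in> closure M" for x y
  proof -
    obtain u where "\<And>n. u n \<in> M" "u \<longlonglongrightarrow> x"
      using x unfolding closure_sequential by blast
    moreover obtain w where "\<And>n. w n \<in> M" "w \<longlonglongrightarrow> y"
      using y unfolding closure_sequential by blast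
    ultimately have *: "(\<lambda>n. u n + w n) \<longlonglongrightarrow> x + y" "\<And>n. u n + w n \<in> M"
      by (auto intro: tendsto_add complex_vector.subspace_add[OF M])
    then show ?thesis
      unfolding closure_sequential by (intro exI[of _ "\<lambda>n. u n + w n"]) simp
  qed
  show "c *\<^sub>C x \<in> closure M" if x: "x \<in> closure M" for c x
  proof -
    obtain u where "\<And>n. u n \<in> M" "u \<longlonglongrightarrow> x"
      using x unfolding closure_sequential by blast
    then have "(\<lambda>n. c *\<^sub>C u n) \<longlonglongrightarrow> c *\<^sub>C x" "\<And>n. c *\<^sub>C u n \<in> M"
      by (auto intro: scaleC.tendsto tendsto_const complex_vector.subspace_scale[OF M])
    then show ?thesis
      unfolding closure_sequential by (intro exI[of _ "\<lambda>n. c *\<^sub>C u n"]) simp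
  qed
qed

lemma norm_parallelogram:
  fixes u v :: "'a::real_inner"
  shows "(norm (u - v))\<^sup>2 + (norm (u + v))\<^sup>2 = 2 * (norm u)\<^sup>2 + 2 * (norm v)\<^sup>2"
  by (simp add: power2_norm_eq_inner inner_simps inner_commute)

text \<open>Midpoints of a minimizing sequence stay in \<open>M\<close> and are therefore no closer
  to \<open>x\<close> than \<open>d\<close>; with the parallelogram law this makes the sequence
  Cauchy.\<close>

lemma nearest_point_exists:
  fixes M :: "'h::complex_hilbert set"
  assumes M: "csubspace M" "closed M"
  shows "\<exists>y\<in>M. \<forall>s\<in>M. norm (x - y) \<le> norm (x - s)"
proof -
  define d where "d = Inf ((\<lambda>y. norm (x - y)) ` M)"
  have "0 \<in> M"
    using M by (simp add: complex_vector.subspace_0)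
  have bdd: "bdd_below ((\<lambda>y. norm (x - y)) ` M)"
    by (rule bdd_belowI[of _ 0]) auto
  have d_le: "d \<le> norm (x - y)" if "y \<in> M" for y
    unfolding d_def using that bdd by (auto intro: cInf_lower)
  have d0: "0 \<le> d"
    unfolding d_def using \<open>0 \<in> M\<close> by (intro cInf_greatest) auto
  have "\<exists>y\<in>M. norm (x - y) < d + 1 / Suc n" for n
  proof -
    have "d < d + 1 / Suc n" by simp
    then show ?thesis
      unfolding d_def using \<open>0 \<in> M\<close> bdd by (subst (asm) cInf_less_iff) auto
  qed
  then obtain Y where Y: "\<And>n. Y n \<in> M" "\<And>n. norm (x - Y n) < d + 1 / Suc n"
    by metis
  have dist_le: "(norm (Y m - Y n))\<^sup>2 \<le> 2 * (norm (x - Y m))\<^sup>2 + 2 * (norm (x - Y n))\<^sup>2 - 4 * d\<^sup>2" for m n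
  proof -
    have "(1/2) *\<^sub>R (Y m + Y n) \<in> M"
      using M Y by (simp add: csubspace_scaleR complex_vector.subspace_add)
    then have "d \<le> norm (x - (1/2) *\<^sub>R (Y m + Y n))"
      by (rule d_le)
    also have "x - (1/2) *\<^sub>R (Y m + Y n) = (1/2) *\<^sub>R ((x - Y m) + (x - Y n))"
    proof -
      have "(x - Y m) + (x - Y n) = (x + x) - (Y m + Y n)"
        by simp
      then show ?thesis
        by (simp only: scaleR_diff_right scaleR_half_double)
    qed
    finally have "(2 * d)\<^sup>2 \<le> (norm ((x - Y m) + (x - Y n)))\<^sup>2"
      using d0 by (intro power_mono) auto
    moreover have "(norm ((x - Y m) - (x - Y n)))\<^sup>2 = (norm (Y m - Y n))\<^sup>2"
      by (simp add: norm_minus_commute)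
    ultimately show ?thesis
      using norm_parallelogram[of "x - Y m" "x - Y n"] by (simp add: power_mult_distrib)
  qed
  have lim: "(\<lambda>n. norm (x - Y n)) \<longlonglongrightarrow> d"
  proof (rule tendsto_sandwich[of "\<lambda>_. d" _ _ "\<lambda>n. d + 1 / Suc n"])
    show "(\<lambda>n. d + 1 / Suc n) \<longlonglongrightarrow> d"
      using tendsto_add[OF tendsto_const[of d] LIMSEQ_inverse_real_of_nat]
      by (simp add: inverse_eq_divide)
  qed (use d_le Y in \<open>auto intro!: always_eventually less_imp_le\<close>)
  have "Cauchy Y"
  proof (rule metric_CauchyI)
    fix e :: real assume "e > 0"
    have "(\<lambda>n. (norm (x - Y n))\<^sup>2) \<longlonglongrightarrow> d\<^sup>2"
      by (intro tendsto_intros lim)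
    then have "\<forall>\<^sub>F n in sequentially. dist ((norm (x - Y n))\<^sup>2) (d\<^sup>2) < e\<^sup>2 / 4"
      using \<open>e > 0\<close> by (intro tendstoD) auto
    then obtain N where N: "\<And>n. n \<ge> N \<Longrightarrow> \<bar>(norm (x - Y n))\<^sup>2 - d\<^sup>2\<bar> < e\<^sup>2 / 4"
      by (auto simp: eventually_sequentially dist_real_def)
    have "dist (Y m) (Y n) < e" if "m \<ge> N" "n \<ge> N" for m n
    proof -
      have "(norm (Y m - Y n))\<^sup>2 < e\<^sup>2"
        using dist_le[of m n] N[OF that(1)] N[OF that(2)] by linarith
      then show ?thesis
        using \<open>e > 0\<close> by (simp add: dist_norm power_less_imp_less_base)
    qed
    then show "\<exists>M. \<forall>m\<ge>M. \<forall>n\<ge>M. dist (Y m) (Y n) < e" by blast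
  qed
  then obtain y where y: "Y \<longlonglongrightarrow> y"
    by (metis Cauchy_convergent convergent_def)
  have "y \<in> M"
    using M(2) Y(1) y by (metis closed_sequentially)
  moreover have "norm (x - y) = d"
    by (rule LIMSEQ_unique[OF _ lim]) (intro tendsto_intros y)
  ultimately show ?thesis
    using d_le by auto
qed

lemma norm_diff_scaleR_power2:
  fixes w s :: "'a::real_inner"
  shows "(norm (w - r *\<^sub>R s))\<^sup>2 = (norm w)\<^sup>2 - 2 * r * inner w s + r\<^sup>2 * (norm s)\<^sup>2"
  unfolding power2_norm_eq_inner
  by (simp add: inner_diff_left inner_diff_right inner_commute[of s w] power2_eq_square
      algebra_simps)

lemma nearest_point_orthogonal:
  fixes M :: "'h::complex_hilbert set"
  assumes M: "csubspace M" and y: "y \<in> M" "\<forall>s\<in>M. norm (x - y) \<le> norm (x - s)" and s: "s \<in> M"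
  shows "cinner (x - y) s = 0"
proof -
  have real: "inner (x - y) s = 0" if s: "s \<in> M" for s
  proof (cases "s = 0")
    case False
    \<comment> \<open>The real \<open>r\<close> for which \<open>r *\<^sub>R s\<close> is closest to
      \<open>x - y\<close>.\<close>
    define r where "r = inner (x - y) s / (norm s)\<^sup>2"
    have "y + r *\<^sub>R s \<in> M"
      using M y(1) s by (simp add: csubspace_scaleR complex_vector.subspace_add)
    then have "(norm (x - y))\<^sup>2 \<le> (norm (x - (y + r *\<^sub>R s)))\<^sup>2"
      using y(2) by (intro power_mono) auto
    also have "x - (y + r *\<^sub>R s) = (x - y) - r *\<^sub>R s"
      by simp
    also have "(norm ((x - y) - r *\<^sub>R s))\<^sup>2 =
        (norm (x - y))\<^sup>2 - 2 * r * inner (x - y) s + r\<^sup>2 * (norm s)\<^sup>2"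
      by (rule norm_diff_scaleR_power2)
    also have "\<dots> = (norm (x - y))\<^sup>2 - (inner (x - y) s)\<^sup>2 / (norm s)\<^sup>2"
      using False by (simp add: r_def power2_eq_square field_simps)
    finally have "(inner (x - y) s)\<^sup>2 / (norm s)\<^sup>2 \<le> 0" by simp
    then show ?thesis
      using False by (simp add: divide_le_0_iff)
  qed simp
  \<comment> \<open>Applied to \<open>\<i> *\<^sub>C s\<close>, the real statement gives the
    imaginary part.\<close>
  have "Re (cinner (x - y) (\<i> *\<^sub>C s)) = 0" "Re (cinner (x - y) s) = 0"
    using real s complex_vector.subspace_scale[OF M] by (simp_all add: Re_cinner)
  then show ?thesis
    by (simp add: complex_eq_iff cinner_scaleC_right)
qed

context
  fixes M :: "'h::complex_hilbert set"
  assumes M: "csubspace M" "closed M"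
begin

lemma orth_projI:
  assumes "y \<in> M" "\<And>s. s \<in> M \<Longrightarrow> cinner (x - y) s = 0"
  shows "orth_proj M x = y"
  unfolding orth_proj_def
proof (rule the_equality)
  fix z assume z: "z \<in> M \<and> (\<forall>s\<in>M. cinner (x - z) s = 0)"
  then have "y - z \<in> M"
    using assms M complex_vector.subspace_diff by blast
  then have "cinner (x - z) (y - z) - cinner (x - y) (y - z) = 0"
    using z assms by simp
  then have "cinner (y - z) (y - z) = 0"
    by (simp add: cinner.diff_left)
  then show "z = y"
    by (simp add: cinner_self)
qed (use assms in auto)

lemma
  shows orth_proj_in: "orth_proj M x \<in> M"
    and orth_proj_orthogonal: "s \<in> M \<Longrightarrow> cinner (x - orth_proj M x) s = 0"
proof -
  obtain y where "y \<in> M" "\<And>s. s \<in> M \<Longrightarrow> cinner (x - y) s = 0"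
    using nearest_point_exists[OF M, of x] nearest_point_orthogonal[OF M(1)] by metis
  then show "orth_proj M x \<in> M" "s \<in> M \<Longrightarrow> cinner (x - orth_proj M x) s = 0"
    using orth_projI[of y x] by auto
qed

lemma orth_proj_fixes: "x \<in> M \<Longrightarrow> orth_proj M x = x"
  by (rule orth_projI) auto

lemma cinner_orth_proj: "s \<in> M \<Longrightarrow> cinner (orth_proj M x) s = cinner x s"
  using orth_proj_orthogonal[of s x] by (simp add: cinner.diff_left)

lemma cinner_orth_proj': "s \<in> M \<Longrightarrow> cinner s (orth_proj M x) = cinner s x"
  by (metis cinner_orth_proj cinner_commute)

lemma orth_proj_sym: "cinner (orth_proj M x) y = cinner x (orth_proj M y)"
  by (metis cinner_orth_proj cinner_orth_proj' orth_proj_in)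

lemma bounded_clinear_orth_proj: "bounded_clinear (orth_proj M)"
proof (rule bounded_clinearI[where K = 1])
  show "orth_proj M (x + y) = orth_proj M x + orth_proj M y" for x y
    by (rule orth_projI)
      (simp_all add: orth_proj_in M complex_vector.subspace_add add_diff_add cinner_add_left
        orth_proj_orthogonal)
  show "orth_proj M (c *\<^sub>C x) = c *\<^sub>C orth_proj M x" for c x
    by (rule orth_projI)
      (simp_all add: orth_proj_in M complex_vector.subspace_scale cinner_scaleC_left
        orth_proj_orthogonal flip: scaleC.diff_right)
  show "norm (orth_proj M x) \<le> 1 * norm x" for x
  proof -
    have "cinner (orth_proj M x) (orth_proj M x) = cinner x (orth_proj M x)"
      by (simp add: cinner_orth_proj orth_proj_in)
    then have "cmod (of_real ((norm (orth_proj M x))\<^sup>2)) \<le> norm x * norm (orth_proj M x)"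
      using cmod_cinner_le[of x "orth_proj M x"] by (simp add: cinner_self)
    then have "norm (orth_proj M x) * norm (orth_proj M x) \<le> norm x * norm (orth_proj M x)"
      by (simp add: norm_power power2_eq_square norm_mult)
    then show ?thesis
      by (metis mult_1 mult_le_cancel_right norm_ge_zero norm_le_zero_iff not_le order.trans)
  qed
qed

end

section \<open>Representation of functionals and forms; orthogonal series\<close>

lemma riesz_representation:
  fixes \<phi> :: "'h::complex_hilbert \<Rightarrow> complex"
  assumes add: "\<And>x y. \<phi> (x + y) = \<phi> x + \<phi> y" and scale: "\<And>c x. \<phi> (c *\<^sub>C x) = c * \<phi> x"
    and bound: "\<And>x. cmod (\<phi> x) \<le> K * norm x"
  shows "\<exists>w. \<forall>x. \<phi> x = cinner x w"
proof (cases "\<forall>x. \<phi> x = 0")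
  case True
  then show ?thesis by (intro exI[of _ 0]) simp
next
  case False
  then obtain x0 where x0: "\<phi> x0 \<noteq> 0" by blast
  define M where "M = {x. \<phi> x = 0}"
  have lin: "bounded_linear \<phi>"
  proof (rule bounded_linear_intro[where K = K])
    show "\<phi> (r *\<^sub>R x) = r *\<^sub>R \<phi> x" for r x
      by (metis scale scaleC_of_real scaleR_conv_of_real)
  qed (use add bound in \<open>auto simp: mult.commute\<close>)
  have M: "csubspace M" "closed M"
  proof -
    have "\<phi> 0 = 0" using scale[of 0 0] by simp
    then show "csubspace M"
      by (intro complex_vector.subspaceI) (auto simp: M_def add scale)
    have "continuous_on UNIV \<phi>"
      using lin by (rule linear_continuous_on)
    then have "closed (\<phi> -` {0})"
      by (intro closed_vimage) auto
    moreover have "\<phi> -` {0} = M"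
      by (auto simp: M_def)
    ultimately show "closed M"
      by simp
  qed
  \<comment> \<open>The kernel of a non-zero functional has codimension 1, so \<open>p\<close> spans
    its orthogonal complement and the representing vector is a multiple of \<open>p\<close>.\<close>
  define p where "p = x0 - orth_proj M x0"
  have orth: "cinner s p = 0" if "s \<in> M" for s
    using orth_proj_orthogonal[OF M that, of x0] by (metis cinner_commute complex_cnj_zero p_def)
  have phi_p: "\<phi> p \<noteq> 0"
    using orth_proj_in[OF M, of x0] x0 bounded_linear.linear[OF lin]
    by (simp add: p_def linear_diff M_def)
  have "p \<noteq> 0"
    using phi_p scale[of 0 0] by auto
  have "\<phi> x = cinner x ((cnj (\<phi> p) / (norm p)\<^sup>2) *\<^sub>C p)" for x
  proof -
    have "\<phi> (x - (\<phi> x / \<phi> p) *\<^sub>C p) = 0"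
      using phi_p bounded_linear.linear[OF lin] by (simp add: linear_diff scale)
    then have "cinner (x - (\<phi> x / \<phi> p) *\<^sub>C p) p = 0"
      by (intro orth) (simp add: M_def)
    then have "cinner x p = (\<phi> x / \<phi> p) * (norm p)\<^sup>2"
      by (simp add: cinner.diff_left cinner_scaleC_left cinner_self)
    then show ?thesis
      using phi_p \<open>p \<noteq> 0\<close> by (simp add: cinner_scaleC_right)
  qed
  then show ?thesis by blast
qed

lemma bounded_sesquilinear_operator:
  fixes b :: "'h::complex_hilbert \<Rightarrow> 'h \<Rightarrow> complex"
  assumes add1: "\<And>x y z. b (x + y) z = b x z + b y z" and add2: "\<And>x y z. b x (y + z) = b x y + b x z"
    and scale1: "\<And>c x y. b (c *\<^sub>C x) y = c * b x y" and scale2: "\<And>c x y. b x (c *\<^sub>C y) = cnj c * b x y"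
    and bound: "\<And>x y. cmod (b x y) \<le> K * norm x * norm y"
  obtains V where "bounded_clinear V" "\<And>x y. cinner (V x) y = b x y"
proof -
  \<comment> \<open>\<open>b x\<close> is conjugate linear, so the representation theorem is applied
    to its conjugate.\<close>
  have "\<exists>w. \<forall>y. cnj (b x y) = cinner y w" for x
    using bound[of x] by (intro riesz_representation[where K = "K * norm x"]) (auto simp: add2 scale2)
  then obtain V where V: "\<And>x y. cnj (b x y) = cinner y (V x)"
    by metis
  have VV: "cinner (V x) y = b x y" for x y
    by (metis V cinner_commute complex_cnj_cnj)
  have "bounded_clinear V"
  proof (rule bounded_clinearI[where K = "\<bar>K\<bar>"])
    show "V (x + y) = V x + V y" for x y
      by (rule cinner_eqI) (simp add: VV cinner_add_left add1)
    show "V (c *\<^sub>C x) = c *\<^sub>C V x" for c x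
      by (rule cinner_eqI) (simp add: VV cinner_scaleC_left scale1)
    show "norm (V x) \<le> \<bar>K\<bar> * norm x" for x
    proof (cases "V x = 0")
      case False
      have "of_real ((norm (V x))\<^sup>2) = b x (V x)"
        using VV[of x "V x"] by (simp add: cinner_self)
      then have "(norm (V x))\<^sup>2 \<le> K * norm x * norm (V x)"
        using bound[of x "V x"] by (metis norm_of_real abs_of_nonneg zero_le_power2)
      also have "\<dots> \<le> \<bar>K\<bar> * norm x * norm (V x)"
        by (intro mult_right_mono) auto
      finally show ?thesis
        using False by (simp add: power2_eq_square)
    qed simp
  qed
  then show ?thesis
    using VV that by blast
qed

lemma bounded_clinear_adjoint:
  fixes X :: "'h::complex_hilbert \<Rightarrow> 'h"
  assumes X: "bounded_clinear X"
  obtains Z where "bounded_clinear Z" "\<And>x y. cinner (X x) y = cinner x (Z y)"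
proof -
  obtain K where K: "\<And>x. norm (X x) \<le> K * norm x"
    using bounded_clinear_bound[OF X] by auto
  obtain Z where Z: "bounded_clinear Z" "\<And>y x. cinner (Z y) x = cinner y (X x)"
  proof (rule bounded_sesquilinear_operator[where b = "\<lambda>y x. cinner y (X x)" and K = K])
    show "cmod (cinner x (X y)) \<le> K * norm x * norm y" for x y
      using cmod_cinner_le[of x "X y"] mult_left_mono[OF K[of y], of "norm x"]
      by (simp add: mult_ac)
  qed (auto simp: bounded_clinear_add[OF X] bounded_clinear_scaleC[OF X] cinner_add_left
      cinner_add_right cinner_scaleC_left cinner_scaleC_right)
  show ?thesis
    by (rule that[OF Z(1)]) (metis Z(2) cinner_commute)
qed

lemma norm_sum_orthogonal:
  fixes x :: "'i \<Rightarrow> 'h::complex_inner"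
  assumes "finite I" and "\<And>i j. i \<in> I \<Longrightarrow> j \<in> I \<Longrightarrow> i \<noteq> j \<Longrightarrow> cinner (x i) (x j) = 0"
  shows "(norm (\<Sum>i\<in>I. x i))\<^sup>2 = (\<Sum>i\<in>I. (norm (x i))\<^sup>2)"
  using assms
proof (induction I)
  case (insert a I)
  have "inner (x a) (\<Sum>i\<in>I. x i) = (\<Sum>i\<in>I. inner (x a) (x i))"
    by (simp add: inner_sum_right)
  also have "\<dots> = 0"
  proof (rule sum.neutral, rule ballI)
    fix i assume "i \<in> I"
    then have "cinner (x a) (x i) = 0"
      using insert.hyps by (intro insert.prems) auto
    then show "inner (x a) (x i) = 0"
      by (simp add: inner_conv_Re_cinner)
  qed
  finally have "inner (x a) (\<Sum>i\<in>I. x i) = 0" .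
  then show ?case
    using insert by (simp add: power2_norm_eq_inner inner_simps inner_commute)
qed simp

text \<open>By Pythagoras the squared norm of a block of the series is a block of the series of
  squared norms, which transfers the Cauchy criterion.\<close>

lemma orthogonal_series:
  fixes x :: "nat \<Rightarrow> 'h::complex_hilbert"
  assumes orth: "\<And>i j. i \<noteq> j \<Longrightarrow> cinner (x i) (x j) = 0" and sum: "summable (\<lambda>i. (norm (x i))\<^sup>2)"
  shows "summable x" and "(norm (suminf x))\<^sup>2 = (\<Sum>i. (norm (x i))\<^sup>2)"
proof -
  have norm_sum: "(norm (sum x I))\<^sup>2 = (\<Sum>i\<in>I. (norm (x i))\<^sup>2)" if "finite I" for I
    using orth by (intro norm_sum_orthogonal[OF that]) auto
  show s: "summable x"
    unfolding summable_Cauchy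
  proof (intro allI impI)
    fix e :: real assume "0 < e"
    then obtain N where N: "\<And>m n. m \<ge> N \<Longrightarrow> norm (\<Sum>i\<in>{m..<n}. (norm (x i))\<^sup>2) < e\<^sup>2"
      using sum unfolding summable_Cauchy by (meson zero_less_power)
    have "norm (sum x {m..<n}) < e" if "m \<ge> N" for m n
    proof -
      have "(norm (sum x {m..<n}))\<^sup>2 < e\<^sup>2"
        using N[OF that, of n] by (simp add: norm_sum sum_nonneg)
      then show ?thesis
        using \<open>0 < e\<close> by (simp add: power_less_imp_less_base)
    qed
    then show "\<exists>N. \<forall>m\<ge>N. \<forall>n. norm (sum x {m..<n}) < e" by blast
  qed
  have "(\<lambda>n. (norm (sum x {..<n}))\<^sup>2) \<longlonglongrightarrow> (norm (suminf x))\<^sup>2"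
    using summable_LIMSEQ[OF s] by (intro tendsto_intros)
  moreover have "(\<lambda>n. (norm (sum x {..<n}))\<^sup>2) \<longlonglongrightarrow> (\<Sum>i. (norm (x i))\<^sup>2)"
    using summable_LIMSEQ[OF sum] by (simp add: norm_sum)
  ultimately show "(norm (suminf x))\<^sup>2 = (\<Sum>i. (norm (x i))\<^sup>2)"
    by (rule LIMSEQ_unique)
qed

section \<open>Orthogonal resolutions of the identity\<close>

text \<open>The perturbation argument sees the unperturbed operator only through such a family and
  the sequence of eigenvalues. The ranges may have any dimension.\<close>

locale orth_family =
  fixes P :: "nat \<Rightarrow> 'h::complex_hilbert \<Rightarrow> 'h"
  assumes P_bounded: "bounded_clinear (P k)"
    and P_idem: "P k (P k x) = P k x"
    and P_orth: "j \<noteq> k \<Longrightarrow> P j (P k x) = 0"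
    and P_sym: "cinner (P k x) y = cinner x (P k y)"
    and P_sums: "(\<lambda>k. P k x) sums x"
begin

lemma P_ext: "x = y" if "\<And>k. P k x = P k y"
  using sums_unique2[OF P_sums[of x]] P_sums[of y] that by simp

lemma P_zero [simp]: "P k 0 = 0"
  by (rule bounded_clinear_zero[OF P_bounded])

lemma cinner_P_P: "j \<noteq> k \<Longrightarrow> cinner (P j x) (P k y) = 0"
  by (simp add: P_sym P_orth)

lemma norm_P_sums: "(\<lambda>k. (norm (P k x))\<^sup>2) sums (norm x)\<^sup>2"
proof -
  have "(\<lambda>k. cinner (P k x) x) sums cinner x x"
    by (intro bounded_linear.sums[OF cinner.bounded_linear_left] P_sums)
  moreover have "cinner (P k x) x = of_real ((norm (P k x))\<^sup>2)" for k
    by (metis P_idem P_sym cinner_self)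
  ultimately show ?thesis
    by (simp only: cinner_self sums_of_real_iff)
qed

lemma norm_P_summable: "summable (\<lambda>k. (norm (P k x))\<^sup>2)"
  using norm_P_sums by (rule sums_summable)

lemma P_series:
  assumes x: "\<And>k. P k (x k) = x k" and "summable (\<lambda>k. (norm (x k))\<^sup>2)"
  shows "x sums suminf x" and "(norm (suminf x))\<^sup>2 = (\<Sum>k. (norm (x k))\<^sup>2)"
    and "P j (suminf x) = x j"
proof -
  have "cinner (x j) (x k) = 0" if "j \<noteq> k" for j k
    by (metis cinner_P_P that x)
  note * = orthogonal_series[OF this assms(2)]
  show "x sums suminf x"
    using *(1) by (rule summable_sums)
  then have "(\<lambda>k. P j (x k)) sums P j (suminf x)"
    by (rule bounded_clinear_sums[OF P_bounded])
  moreover have "(\<lambda>k. P j (x k)) = (\<lambda>k. if k = j then x k else 0)"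
  proof
    show "P j (x k) = (if k = j then x k else 0)" for k
      using x[of k] P_orth[of j k "x k"] by auto
  qed
  ultimately show "P j (suminf x) = x j"
    using sums_single[of j x] sums_unique2 by simp
  show "(norm (suminf x))\<^sup>2 = (\<Sum>k. (norm (x k))\<^sup>2)"
    by (rule *(2))
qed

text \<open>The function of the unperturbed operator with value \<open>c k\<close> at the kth
  eigenvalue; meaningful for bounded \<open>c\<close>, where the orthogonal series
  converges.\<close>

definition diag :: "(nat \<Rightarrow> complex) \<Rightarrow> 'h \<Rightarrow> 'h" where
  "diag c x = (\<Sum>k. c k *\<^sub>C P k x)"

context
  fixes c :: "nat \<Rightarrow> complex" and C :: real
  assumes c: "\<And>k. cmod (c k) \<le> C"
begin

lemma norm_scaleC_P_le: "(norm (c k *\<^sub>C P k x))\<^sup>2 \<le> C\<^sup>2 * (norm (P k x))\<^sup>2"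
  using power_mono[OF c[of k], of 2] by (simp add: norm_scaleC power_mult_distrib mult_right_mono)

lemma diag_summable: "summable (\<lambda>k. (norm (c k *\<^sub>C P k x))\<^sup>2)"
proof (rule summable_comparison_test'[where N = 0])
  show "summable (\<lambda>k. C\<^sup>2 * (norm (P k x))\<^sup>2)"
    by (intro summable_mult norm_P_summable)
  show "norm ((norm (c k *\<^sub>C P k x))\<^sup>2) \<le> C\<^sup>2 * (norm (P k x))\<^sup>2" for k
    using norm_scaleC_P_le[of k x] by simp
qed

lemma P_diag: "P j (diag c x) = c j *\<^sub>C P j x"
  unfolding diag_def
  by (rule P_series(3)) (simp_all add: diag_summable bounded_clinear_scaleC[OF P_bounded] P_idem)

lemma norm_diag_le: "norm (diag c x) \<le> C * norm x"
proof -
  have "0 \<le> C"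
    using c[of 0] norm_ge_zero order_trans by blast
  have "(norm (diag c x))\<^sup>2 = (\<Sum>k. (norm (c k *\<^sub>C P k x))\<^sup>2)"
    unfolding diag_def
    by (rule P_series(2)) (simp_all add: diag_summable bounded_clinear_scaleC[OF P_bounded] P_idem)
  also have "\<dots> \<le> (\<Sum>k. C\<^sup>2 * (norm (P k x))\<^sup>2)"
    by (intro suminf_le norm_scaleC_P_le diag_summable summable_mult norm_P_summable)
  also have "\<dots> = (C * norm x)\<^sup>2"
    using sums_unique[OF sums_mult[OF norm_P_sums[of x], of "C\<^sup>2"]] by (simp add: power_mult_distrib)
  finally show ?thesis
    by (rule power2_le_imp_le) (simp add: \<open>0 \<le> C\<close>)
qed

lemma bounded_clinear_diag: "bounded_clinear (diag c)"
proof (rule bounded_clinearI)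
  show "diag c (x + y) = diag c x + diag c y" for x y
    by (rule P_ext) (simp add: P_diag bounded_clinear_add[OF P_bounded] scaleC_add_right)
  show "diag c (a *\<^sub>C x) = a *\<^sub>C diag c x" for a x
    by (rule P_ext) (simp add: P_diag bounded_clinear_scaleC[OF P_bounded] mult.commute)
qed (rule norm_diag_le)

end

definition inv_sqrt_diag :: "(nat \<Rightarrow> real) \<Rightarrow> 'h \<Rightarrow> 'h" where
  "inv_sqrt_diag m = diag (\<lambda>k. complex_of_real (1 / sqrt (m k)))"

lemma cinner_diag:
  assumes c: "\<And>k. cmod (c k) \<le> C"
  shows "cinner (diag c x) y = cinner x (diag (\<lambda>k. cnj (c k)) y)"
proof -
  have "(\<lambda>k. cinner (P k (diag c x)) y) sums cinner (diag c x) y"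
    by (intro bounded_linear.sums[OF cinner.bounded_linear_left] P_sums)
  moreover have "(\<lambda>k. cinner x (P k (diag (\<lambda>k. cnj (c k)) y))) sums
      cinner x (diag (\<lambda>k. cnj (c k)) y)"
    by (intro bounded_linear.sums[OF cinner.bounded_linear_right] P_sums)
  moreover have "cinner (P k (diag c x)) y = cinner x (P k (diag (\<lambda>k. cnj (c k)) y))" for k
    by (simp add: P_diag[OF c] P_diag[where C = C] c cinner_scaleC_left cinner_scaleC_right P_sym)
  ultimately show ?thesis
    using sums_unique2 by simp
qed

end

section \<open>Self-adjoint operators with discrete spectrum\<close>

lemma
  assumes "linear_op D A" and "f \<in> D"
  shows linear_op_add: "g \<in> D \<Longrightarrow> A (f + g) = A f + A g"
    and linear_op_scaleC: "A (c *\<^sub>C f) = c *\<^sub>C A f"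
    and linear_op_scaleR: "A (r *\<^sub>R f) = r *\<^sub>R A f"
    and linear_op_diff: "g \<in> D \<Longrightarrow> A (f - g) = A f - A g"
    and linear_op_in_add: "g \<in> D \<Longrightarrow> f + g \<in> D"
    and linear_op_in_diff: "g \<in> D \<Longrightarrow> f - g \<in> D"
    and linear_op_in_scaleC: "c *\<^sub>C f \<in> D"
    and linear_op_in_scaleR: "r *\<^sub>R f \<in> D"
proof -
  have D: "csubspace D" and add: "\<And>f g. f \<in> D \<Longrightarrow> g \<in> D \<Longrightarrow> A (f + g) = A f + A g"
    and scale: "\<And>c f. f \<in> D \<Longrightarrow> A (c *\<^sub>C f) = c *\<^sub>C A f"
    using assms by (auto simp: linear_op_def)
  show "A (c *\<^sub>C f) = c *\<^sub>C A f" "A (r *\<^sub>R f) = r *\<^sub>R A f"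
    using scale assms(2) by (simp_all flip: scaleC_of_real)
  show "c *\<^sub>C f \<in> D" "r *\<^sub>R f \<in> D"
    using D assms(2) by (simp_all add: complex_vector.subspace_scale flip: scaleC_of_real)
  assume g: "g \<in> D"
  then show "A (f + g) = A f + A g" "f + g \<in> D" and minus: "f - g \<in> D"
    using add assms(2) D by (simp_all add: complex_vector.subspace_add complex_vector.subspace_diff)
  show "A (f - g) = A f - A g"
    using add[OF minus g] by simp
qed

lemma
  assumes z: "z \<in> resolvent_set D A"
  shows op_resolvent_in: "op_resolvent D A z x \<in> D"
    and op_resolvent_right: "z *\<^sub>C op_resolvent D A z x - A (op_resolvent D A z x) = x"
    and op_resolvent_left: "f \<in> D \<Longrightarrow> op_resolvent D A z (z *\<^sub>C f - A f) = f"
    and bounded_clinear_op_resolvent: "bounded_clinear (op_resolvent D A z)"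
proof -
  have bij: "bij_betw (\<lambda>f. z *\<^sub>C f - A f) D UNIV"
    and "bounded_clinear (op_resolvent D A z)"
    using z by (auto simp: resolvent_set_def)
  then show "bounded_clinear (op_resolvent D A z)" by simp
  show "op_resolvent D A z x \<in> D" 
    unfolding op_resolvent_def using bij by (metis UNIV_I bij_betw_imp_surj_on inv_into_into)
  show "z *\<^sub>C op_resolvent D A z x - A (op_resolvent D A z x) = x"
    unfolding op_resolvent_def using bij_betw_inv_into_right[OF bij, of x] by simp
  show "op_resolvent D A z (z *\<^sub>C f - A f) = f" if "f \<in> D"
    unfolding op_resolvent_def using bij_betw_inv_into_left[OF bij that] by simp
qed

section \<open>Resolvents of self-adjoint operators\<close>

locale selfadjoint_op =
  fixes D :: "'h::complex_hilbert set" and A :: "'h \<Rightarrow> 'h"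
  assumes selfadjoint: "selfadjoint D A"
begin

lemma linear: "linear_op D A"
  using selfadjoint by (simp add: selfadjoint_def)

lemma symmetric: "f \<in> D \<Longrightarrow> g \<in> D \<Longrightarrow> cinner (A f) g = cinner f (A g)"
proof -
  assume "f \<in> D" "g \<in> D"
  then have "(g, A g) \<in> adjoint_graph D A"
    using selfadjoint by (auto simp: selfadjoint_def)
  then show ?thesis
    using \<open>f \<in> D\<close> by (simp add: adjoint_graph_def)
qed

lemma adjointI: "g \<in> D \<and> A g = h" if "\<And>f. f \<in> D \<Longrightarrow> cinner (A f) g = cinner f h"
proof -
  have "(g, h) \<in> adjoint_graph D A"
    using that by (simp add: adjoint_graph_def)
  then show ?thesis
    using selfadjoint by (auto simp: selfadjoint_def)
qed

lemma closed_graph: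
  assumes "\<And>n. u n \<in> D" "u \<longlonglongrightarrow> f" "(\<lambda>n. A (u n)) \<longlonglongrightarrow> h"
  shows "f \<in> D \<and> A f = h"
proof (rule adjointI)
  fix g assume "g \<in> D"
  then have "(\<lambda>n. cinner (A g) (u n)) = (\<lambda>n. cinner g (A (u n)))"
    using symmetric assms(1) by blast
  moreover have "(\<lambda>n. cinner (A g) (u n)) \<longlonglongrightarrow> cinner (A g) f"
    "(\<lambda>n. cinner g (A (u n))) \<longlonglongrightarrow> cinner g h"
    by (intro cinner.tendsto tendsto_const assms)+
  ultimately show "cinner (A g) f = cinner g h"
    by (metis LIMSEQ_unique)
qed

lemma resolvent_symmetric:
  assumes l: "complex_of_real l \<in> resolvent_set D A"
  shows "cinner (op_resolvent D A l x) y = cinner x (op_resolvent D A l y)"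
proof -
  let ?R = "op_resolvent D A (of_real l)"
  have "cinner (?R x) (of_real l *\<^sub>C ?R y - A (?R y)) = cinner (of_real l *\<^sub>C ?R x - A (?R x)) (?R y)"
    using symmetric[OF op_resolvent_in[OF l] op_resolvent_in[OF l]]
    by (simp add: cinner.diff_left cinner.diff_right cinner_scaleC_left cinner_scaleC_right)
  then show ?thesis
    by (simp add: op_resolvent_right[OF l])
qed

lemma resolvent_bounded_below:
  assumes z: "complex_of_real z \<in> resolvent_set D A"
  shows "\<exists>C. \<forall>u\<in>D. norm u \<le> C * norm (z *\<^sub>R u - A u)"
proof -
  obtain C where C: "\<And>x. norm (op_resolvent D A z x) \<le> C * norm x"
    using bounded_clinear_bound[OF bounded_clinear_op_resolvent[OF z]] by auto
  show ?thesis
    using C op_resolvent_left[OF z] by (metis scaleC_of_real)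
qed

text \<open>
  The norm \<open>\<rho>\<close> of a symmetric bounded operator is approximately attained, and on approximately
  maximizing vectors the square of the operator is close to \<open>\<rho>\<^sup>2\<close>; hence \<open>\<rho>\<close> or \<open>-\<rho>\<close> is in the
  approximate point spectrum.  This gives the bound for the resolvent without functional calculus.
\<close>

lemma resolvent_norm_bound:
  assumes l: "complex_of_real l \<in> resolvent_set D A"
    and N: "csubspace N" "\<And>x. x \<in> N \<Longrightarrow> op_resolvent D A l x \<in> N"
    and d: "d > 0"
    and lower: "\<And>s. s \<noteq> 0 \<Longrightarrow> \<bar>s\<bar> < d \<Longrightarrow>
      \<exists>C. \<forall>u\<in>D \<inter> N. norm u \<le> C * norm ((l + s) *\<^sub>R u - A u)"
    and y: "y \<in> N"
  shows "d * norm (op_resolvent D A l y) \<le> norm y"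
proof (rule ccontr)
  assume *: "\<not> ?thesis"
  define R where "R = op_resolvent D A (of_real l)"
  have R: "bounded_clinear R"
    unfolding R_def by (rule bounded_clinear_op_resolvent[OF l])
  have R_scaleR: "R (r *\<^sub>R x) = r *\<^sub>R R x" for r x
    using bounded_clinear_scaleC[OF R, of "of_real r" x] by (simp add: scaleC_of_real)
  obtain K where K: "\<And>x. norm (R x) \<le> K * norm x"
    using bounded_clinear_bound[OF R] by auto
  define X where "X = {norm (R x) | x. x \<in> N \<and> norm x = 1}"
  define \<rho> where "\<rho> = Sup X"
  have "y \<noteq> 0"
    using * bounded_clinear_zero[OF R] by (auto simp: R_def)
  have bdd: "bdd_above X"
  proof (rule bdd_aboveI[of _ K])
    fix a assume "a \<in> X"
    then obtain x where "norm x = 1" "a = norm (R x)"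
      by (auto simp: X_def)
    then show "a \<le> K"
      using K[of x] by simp
  qed
  have le: "norm (R x) \<le> \<rho> * norm x" if "x \<in> N" for x
  proof (cases "x = 0")
    case False
    have "norm (R ((1 / norm x) *\<^sub>R x)) \<in> X"
      using False N(1) that unfolding X_def by (auto intro!: exI csubspace_scaleR)
    then have "norm (R ((1 / norm x) *\<^sub>R x)) \<le> \<rho>"
      unfolding \<rho>_def using bdd by (rule cSup_upper)
    then show ?thesis
      using False by (simp add: R_scaleR field_simps)
  qed (simp add: bounded_clinear_zero[OF R])
  have "X \<noteq> {}"
    using \<open>y \<noteq> 0\<close> N(1) y unfolding X_def
    by (auto intro!: exI[of _ "(1 / norm y) *\<^sub>R y"] csubspace_scaleR)
  have "norm y < d * (\<rho> * norm y)"
    using * le[OF y] d by (smt (verit) R_def mult_left_mono)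
  then have \<rho>: "1 < d * \<rho>"
    using \<open>y \<noteq> 0\<close> by (simp add: mult.assoc[symmetric])
  then have "\<rho> > 0"
    using d by (metis less_trans zero_less_one zero_less_mult_pos)
  have low: "\<exists>C\<ge>0. \<forall>x\<in>N. norm x \<le> C * norm (R x - \<sigma> *\<^sub>R x)" if \<sigma>: "\<bar>\<sigma>\<bar> = \<rho>" for \<sigma>
  proof -
    have "\<sigma> \<noteq> 0"
      using \<sigma> \<open>\<rho> > 0\<close> by auto
    \<comment> \<open>An approximate eigenvalue \<open>\<sigma>\<close> of \<open>R\<close>
      corresponds to the approximate eigenvalue \<open>l - 1 / \<sigma>\<close> of \<open>A\<close>.
      If the claim fails, this point is within \<open>d\<close> of \<open>l\<close>, where
      \<open>lower\<close> excludes it.\<close>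
    have "\<bar>- 1 / \<sigma>\<bar> < d"
      using \<rho> \<sigma> \<open>\<rho> > 0\<close> by (simp add: abs_divide field_simps)
    then obtain C where C: "\<And>u. u \<in> D \<inter> N \<Longrightarrow> norm u \<le> C * norm ((l + - 1 / \<sigma>) *\<^sub>R u - A u)"
      using lower[of "- 1 / \<sigma>"] \<open>\<sigma> \<noteq> 0\<close> by auto
    have "norm x \<le> (\<bar>C\<bar> / \<rho> + 1) / \<rho> * norm (R x - \<sigma> *\<^sub>R x)" if "x \<in> N" for x
    proof -
      have in_D: "R x \<in> D \<inter> N"
        using N(2) that op_resolvent_in[OF l] by (simp add: R_def)
      have Rx: "l *\<^sub>R R x - A (R x) = x"
        using op_resolvent_right[OF l, of x] by (simp add: R_def scaleC_of_real)
      have "(l + - 1 / \<sigma>) *\<^sub>R R x - A (R x) = (l *\<^sub>R R x - A (R x)) - (1 / \<sigma>) *\<^sub>R R x"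
        by (simp add: scaleR_left_diff_distrib)
      also have "\<dots> = - ((1 / \<sigma>) *\<^sub>R (R x - \<sigma> *\<^sub>R x))"
        using \<open>\<sigma> \<noteq> 0\<close> by (simp add: Rx scaleR_right_diff_distrib)
      finally have "norm (R x) \<le> C * (norm (R x - \<sigma> *\<^sub>R x) / \<rho>)"
        using C[OF in_D] \<sigma> by simp
      also have "\<dots> \<le> \<bar>C\<bar> * (norm (R x - \<sigma> *\<^sub>R x) / \<rho>)"
        using \<open>\<rho> > 0\<close> by (intro mult_right_mono) auto
      finally have 1: "norm (R x) \<le> \<bar>C\<bar> / \<rho> * norm (R x - \<sigma> *\<^sub>R x)"
        by simp
      have "\<rho> * norm x = norm (R x - (R x - \<sigma> *\<^sub>R x))"
        using \<sigma> by simp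
      also have "\<dots> \<le> norm (R x) + norm (R x - \<sigma> *\<^sub>R x)"
        by (rule norm_triangle_ineq4)
      also have "\<dots> \<le> (\<bar>C\<bar> / \<rho> + 1) * norm (R x - \<sigma> *\<^sub>R x)"
        using 1 by (simp add: algebra_simps)
      finally show ?thesis
        using \<open>\<rho> > 0\<close> by (simp add: field_simps)
    qed
    then show ?thesis
      using \<open>\<rho> > 0\<close> by (intro exI[of _ "(\<bar>C\<bar> / \<rho> + 1) / \<rho>"]) auto
  qed
  obtain C1 where C1: "C1 \<ge> 0" "\<And>x. x \<in> N \<Longrightarrow> norm x \<le> C1 * norm (R x - \<rho> *\<^sub>R x)"
    using low[of \<rho>] \<open>\<rho> > 0\<close> by auto
  obtain C2 where C2: "C2 \<ge> 0" "\<And>x. x \<in> N \<Longrightarrow> norm x \<le> C2 * norm (R x + \<rho> *\<^sub>R x)"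
    using low[of "- \<rho>"] \<open>\<rho> > 0\<close> by auto
  have lower2: "norm x \<le> C2 * C1 * norm (R (R x) - \<rho>\<^sup>2 *\<^sub>R x)" if "x \<in> N" for x
  proof -
    have w: "R x + \<rho> *\<^sub>R x \<in> N"
      using N that by (simp add: R_def complex_vector.subspace_add csubspace_scaleR)
    have "norm x \<le> C2 * norm (R x + \<rho> *\<^sub>R x)"
      by (rule C2(2)[OF that])
    also have "\<dots> \<le> C2 * (C1 * norm (R (R x + \<rho> *\<^sub>R x) - \<rho> *\<^sub>R (R x + \<rho> *\<^sub>R x)))"
      using C2(1) by (intro mult_left_mono C1(2)[OF w])
    also have "R (R x + \<rho> *\<^sub>R x) - \<rho> *\<^sub>R (R x + \<rho> *\<^sub>R x) = R (R x) - \<rho>\<^sup>2 *\<^sub>R x"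
      by (simp add: bounded_clinear_add[OF R] R_scaleR power2_eq_square algebra_simps)
    finally show ?thesis by simp
  qed
  define C where "C = (C2 * C1)\<^sup>2"
  \<comment> \<open>For a unit vector whose image is within \<open>\<delta>\<close> of the maximal
    norm, the square of the defect \<open>R (R x) - \<rho>\<^sup>2 *\<^sub>R x\<close> is at most
    \<open>2 * \<rho> ^ 3 * \<delta>\<close>; this choice makes it too small for
    \<open>lower2\<close>.\<close>
  define \<delta> where "\<delta> = min \<rho> (1 / (C * (2 * \<rho> ^ 3) + 1))"
  have "C \<ge> 0" by (simp add: C_def)
  then have "0 < C * (2 * \<rho> ^ 3) + 1"
    using \<open>\<rho> > 0\<close> by (intro add_nonneg_pos) auto
  then have \<delta>: "0 < \<delta>" "\<delta> \<le> \<rho>" "(C * (2 * \<rho> ^ 3)) * \<delta> < 1"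
  proof -
    assume *: "0 < C * (2 * \<rho> ^ 3) + 1"
    then show "0 < \<delta>" "\<delta> \<le> \<rho>"
      using \<open>\<rho> > 0\<close> by (auto simp: \<delta>_def)
    have "(C * (2 * \<rho> ^ 3)) * \<delta> \<le> (C * (2 * \<rho> ^ 3)) * (1 / (C * (2 * \<rho> ^ 3) + 1))"
      using \<open>\<rho> > 0\<close> \<open>C \<ge> 0\<close> by (intro mult_left_mono) (auto simp: \<delta>_def)
    also have "\<dots> < 1"
      using * by (simp add: field_simps)
    finally show "(C * (2 * \<rho> ^ 3)) * \<delta> < 1" .
  qed
  then obtain x where x: "x \<in> N" "norm x = 1" "\<rho> - \<delta> < norm (R x)"
    using less_cSupD[OF \<open>X \<noteq> {}\<close>, of "\<rho> - \<delta>"] by (auto simp: \<rho>_def X_def)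
  have "norm (R (R x)) \<le> \<rho> * norm (R x)"
    using N(2)[OF x(1)] by (intro le) (simp add: R_def)
  then have "(norm (R (R x)))\<^sup>2 \<le> (\<rho> * norm (R x))\<^sup>2"
    by (intro power_mono) auto
  then have 1: "(norm (R (R x)))\<^sup>2 \<le> \<rho>\<^sup>2 * (norm (R x))\<^sup>2"
    by (simp add: power_mult_distrib)
  have 2: "inner (R (R x)) x = (norm (R x))\<^sup>2"
    using resolvent_symmetric[OF l, of "R x" x] by (simp add: inner_conv_Re_cinner R_def cinner_self)
  have "(norm (R (R x) - \<rho>\<^sup>2 *\<^sub>R x))\<^sup>2 \<le> \<rho>\<^sup>2 * (\<rho>\<^sup>2 - (norm (R x))\<^sup>2)"
    unfolding norm_diff_scaleR_power2 2 using 1 x(2)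
    by (simp add: algebra_simps power2_eq_square)
  also have "\<rho>\<^sup>2 - (norm (R x))\<^sup>2 \<le> 2 * \<rho> * \<delta>"
  proof -
    have "(\<rho> - \<delta>)\<^sup>2 \<le> (norm (R x))\<^sup>2"
      using x(3) \<delta> by (intro power_mono) auto
    then show ?thesis
      using \<delta> by (simp add: power2_eq_square algebra_simps) (smt (verit) mult_nonneg_nonneg)
  qed
  finally have 3: "(norm (R (R x) - \<rho>\<^sup>2 *\<^sub>R x))\<^sup>2 \<le> 2 * \<rho> ^ 3 * \<delta>"
    using \<open>\<rho> > 0\<close> by (simp add: power2_eq_square power3_eq_cube mult_ac)
  have "1 \<le> (C2 * C1 * norm (R (R x) - \<rho>\<^sup>2 *\<^sub>R x))\<^sup>2"
    using power_mono[OF lower2[OF x(1)], of 2] x(2) by simp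
  also have "\<dots> \<le> C * (2 * \<rho> ^ 3 * \<delta>)"
    unfolding power_mult_distrib[of _ "norm _"] C_def using 3 by (intro mult_left_mono) auto
  finally show False
    using \<delta>(3) by simp
qed

lemma bounded_below_real:
  assumes d: "d > 0" and l: "\<And>s. \<bar>s\<bar> < d \<Longrightarrow> complex_of_real (l + s) \<in> resolvent_set D A"
    and u: "u \<in> D"
  shows "d * norm u \<le> norm (l *\<^sub>R u - A u)"
proof -
  have l0: "complex_of_real l \<in> resolvent_set D A"
    using l[of 0] d by simp
  have "d * norm (op_resolvent D A l (l *\<^sub>R u - A u)) \<le> norm (l *\<^sub>R u - A u)"
    using resolvent_bounded_below[OF l]
    by (intro resolvent_norm_bound[OF l0, where N = UNIV] d) auto
  then show ?thesis
    using op_resolvent_left[OF l0 u] by (simp add: scaleC_of_real)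
qed

section \<open>Isolated points of the spectrum\<close>

context
  fixes m \<epsilon> :: real
  assumes \<epsilon>: "\<epsilon> > 0"
    and isolated: "\<And>s. s \<noteq> 0 \<Longrightarrow> \<bar>s\<bar> < \<epsilon> \<Longrightarrow> complex_of_real (m + s) \<in> resolvent_set D A"
begin

abbreviation (input) S where "S u \<equiv> A u - m *\<^sub>R u"

text \<open>The spectrum of \<open>S\<close> avoids all \<open>s\<close> with
  \<open>0 < \<bar>s\<bar> < \<epsilon>\<close>, so there
  \<open>\<epsilon> * \<bar>s\<bar> \<le> s\<^sup>2\<close>; this is the corresponding operator
  inequality. In place of a spectral measure it uses the points \<open>m + r\<close> in the middle
  of the gap, \<open>\<bar>r\<bar> = \<epsilon> / 2\<close>: they have distance at least
  \<open>\<epsilon> / 2\<close> from the spectrum, and expanding the square cancels the terms with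
  \<open>norm u\<close>.\<close>

lemma isolated_form_bound:
  assumes u: "u \<in> D"
  shows "\<epsilon> * \<bar>inner (S u) u\<bar> \<le> (norm (S u))\<^sup>2"
proof -
  have *: "2 * r * inner (S u) u \<le> (norm (S u))\<^sup>2" if r: "\<bar>r\<bar> = \<epsilon> / 2" for r
  proof -
    have "(\<epsilon> / 2) * norm u \<le> norm ((m + r) *\<^sub>R u - A u)"
    proof (rule bounded_below_real[OF _ _ u])
      fix s assume "\<bar>s\<bar> < \<epsilon> / 2"
      then have "r + s \<noteq> 0" "\<bar>r + s\<bar> < \<epsilon>"
        using r by (auto simp: abs_if split: if_splits)
      then show "complex_of_real (m + r + s) \<in> resolvent_set D A"
        using isolated[of "r + s"] by (simp add: add.assoc)
    qed (use \<epsilon> in simp)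
    then have "((\<epsilon> / 2) * norm u)\<^sup>2 \<le> (norm ((m + r) *\<^sub>R u - A u))\<^sup>2"
      using \<epsilon> by (intro power_mono) auto
    also have "norm ((m + r) *\<^sub>R u - A u) = norm (S u - r *\<^sub>R u)"
      by (metis (no_types, opaque_lifting) diff_diff_add norm_minus_commute scaleR_left_distrib)
    finally have "(\<epsilon> / 2)\<^sup>2 * (norm u)\<^sup>2 \<le> (norm (S u))\<^sup>2 - 2 * r * inner (S u) u + r\<^sup>2 * (norm u)\<^sup>2"
      by (simp only: norm_diff_scaleR_power2 power_mult_distrib)
    moreover have "r\<^sup>2 = (\<epsilon> / 2)\<^sup>2"
      using r by (metis power2_abs)
    ultimately show ?thesis by simp
  qed
  show ?thesis
    using *[of "\<epsilon> / 2"] *[of "- \<epsilon> / 2"] \<epsilon> by (auto simp: abs_if)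
qed

text \<open>Polarization gives a sum of squares, and normalizing \<open>S u\<close> and
  \<open>S w\<close> turns it into a product. Two arguments are needed because later
  \<open>S u\<close> approaches a limit while \<open>u\<close> itself need not converge.\<close>

lemma isolated_bilinear_bound:
  assumes u: "u \<in> D" and w: "w \<in> D"
  shows "\<epsilon> * inner (S u) w \<le> norm (S u) * norm (S w)"
proof -
  have S_sym: "inner (S x) y = inner x (S y)" if "x \<in> D" "y \<in> D" for x y
    using symmetric[OF that] by (simp add: inner_conv_Re_cinner cinner.diff_left cinner.diff_right
        cinner.scaleR_left cinner.scaleR_right)
  have *: "\<epsilon> * inner (S x) y \<le> ((norm (S x))\<^sup>2 + (norm (S y))\<^sup>2) / 2" if xy: "x \<in> D" "y \<in> D" for x y
  proof -
    have S_add: "S (x + y) = S x + S y" and S_diff: "S (x - y) = S x - S y"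
      using xy by (simp_all add: linear_op_add[OF linear] linear_op_diff[OF linear] algebra_simps)
    have "\<epsilon> * (4 * inner (S x) y) = \<epsilon> * inner (S (x + y)) (x + y) - \<epsilon> * inner (S (x - y)) (x - y)"
      unfolding S_add S_diff using S_sym[of x y] xy
      by (simp add: inner_add_left inner_add_right inner_diff_left inner_diff_right
          inner_commute algebra_simps)
    also have "\<dots> \<le> (norm (S (x + y)))\<^sup>2 + (norm (S (x - y)))\<^sup>2"
      using isolated_form_bound[of "x + y"] isolated_form_bound[of "x - y"] xy
        linear_op_in_add[OF linear] linear_op_in_diff[OF linear] \<epsilon>
      by (smt (verit) abs_ge_minus_self abs_ge_self mult_left_mono mult_minus_right)
    also have "\<dots> = 2 * (norm (S x))\<^sup>2 + 2 * (norm (S y))\<^sup>2"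
      unfolding S_add S_diff using norm_parallelogram[of "S x" "S y"] by simp
    finally show ?thesis by simp
  qed
  have scale: "S (r *\<^sub>R x) = r *\<^sub>R S x" if "x \<in> D" for r x
    using that by (simp add: linear_op_scaleR[OF linear] algebra_simps)
  show ?thesis
  proof (cases "S u = 0 \<or> S w = 0")
    case True
    then show ?thesis
      using S_sym[OF u w] by auto
  next
    case False
    define r s where "r = 1 / norm (S u)" and "s = 1 / norm (S w)"
    have "\<epsilon> * inner (S (r *\<^sub>R u)) (s *\<^sub>R w) \<le> ((norm (S (r *\<^sub>R u)))\<^sup>2 + (norm (S (s *\<^sub>R w)))\<^sup>2) / 2"
      using u w by (intro * linear_op_in_scaleR[OF linear])
    also have "\<dots> = 1"
      unfolding scale[OF u] scale[OF w] using False by (simp add: r_def s_def)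
    finally have "\<epsilon> * (r * s * inner (S u) w) \<le> 1"
      unfolding scale[OF u] by (simp add: mult_ac)
    then show ?thesis
      using False by (simp add: r_def s_def field_simps)
  qed
qed

text \<open>A vector orthogonal to the range of \<open>S\<close> is an eigenvector, because
  \<open>A\<close> is its own adjoint; so \<open>w\<close> lies in the closure of that range. In the
  bilinear bound \<open>S u\<close> can then be replaced by its limit \<open>w\<close>, which leaves
  \<open>norm w\<close> as a common factor.\<close>

lemma isolated_kernel_complement_bound:
  assumes w: "w \<in> D" and orth: "\<And>e. e \<in> eigenspace D A (of_real m) \<Longrightarrow> cinner w e = 0"
  shows "\<epsilon> * norm w \<le> norm (S w)"
proof -
  define M where "M = closure (S ` D)"
  have D: "csubspace D"
    using linear by (simp add: linear_op_def)
  have "csubspace (S ` D)"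
  proof (rule complex_vector.subspaceI)
    show "0 \<in> S ` D"
      using complex_vector.subspace_0[OF D] linear_op_scaleR[OF linear, of 0 0]
      by (intro image_eqI[of _ _ 0]) auto
    show "x + y \<in> S ` D" if "x \<in> S ` D" "y \<in> S ` D" for x y
    proof -
      obtain a b where "a \<in> D" "b \<in> D" "x = S a" "y = S b"
        using \<open>x \<in> S ` D\<close> \<open>y \<in> S ` D\<close> by auto
      moreover have "S (a + b) = S a + S b"
        using linear_op_add[OF linear \<open>a \<in> D\<close> \<open>b \<in> D\<close>] by (simp add: scaleR_add_right)
      ultimately show ?thesis
        using linear_op_in_add[OF linear \<open>a \<in> D\<close> \<open>b \<in> D\<close>] by (intro image_eqI[of _ _ "a + b"]) auto
    qed
    show "c *\<^sub>C x \<in> S ` D" if x: "x \<in> S ` D" for c x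
    proof -
      obtain a where "a \<in> D" "x = S a"
        using x by auto
      then show ?thesis
        using linear_op_in_scaleC[OF linear]
        by (intro image_eqI[of _ _ "c *\<^sub>C a"])
          (auto simp: linear_op_scaleC[OF linear] scaleC.diff_right scaleC.scaleR_right)
    qed
  qed
  then have M: "csubspace M" "closed M"
    by (simp_all add: M_def csubspace_closure)
  define p where "p = w - orth_proj M w"
  have p: "p \<in> D \<and> A p = m *\<^sub>R p"
  proof (rule adjointI)
    fix f assume "f \<in> D"
    then have "S f \<in> M"
      unfolding M_def
      using subsetD[OF closure_subset imageI[of f D "\<lambda>u. A u - m *\<^sub>R u"]] by simp
    then have "cinner p (S f) = 0"
      unfolding p_def by (rule orth_proj_orthogonal[OF M])
    then have "cinner (S f) p = 0"
      by (metis cinner_commute complex_cnj_zero)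
    then show "cinner (A f) p = cinner f (m *\<^sub>R p)"
      by (simp add: cinner.diff_left cinner.scaleR_left cinner.scaleR_right)
  qed
  then have "p \<in> eigenspace D A (of_real m)"
    by (simp add: eigenspace_def scaleC_of_real)
  then have "cinner w p = 0"
    by (rule orth)
  moreover have "cinner (orth_proj M w) p = 0"
    using orth_proj_orthogonal[OF M orth_proj_in[OF M], of w w]
    by (metis cinner_commute complex_cnj_zero p_def)
  ultimately have "cinner p p = 0"
    by (simp add: p_def cinner.diff_left)
  then have "w \<in> M"
    using orth_proj_in[OF M, of w] by (simp add: cinner_self p_def)
  then obtain y where y: "\<And>n. y n \<in> S ` D" "y \<longlonglongrightarrow> w"
    unfolding M_def closure_sequential by blast
  have "\<epsilon> * inner (y n) w \<le> norm (y n) * norm (S w)" for n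
    using y(1)[of n] isolated_bilinear_bound[OF _ w] by auto
  moreover have "(\<lambda>n. \<epsilon> * inner (y n) w) \<longlonglongrightarrow> \<epsilon> * inner w w"
    "(\<lambda>n. norm (y n) * norm (S w)) \<longlonglongrightarrow> norm w * norm (S w)"
    by (intro tendsto_intros y)+
  ultimately have "\<epsilon> * inner w w \<le> norm w * norm (S w)"
    using LIMSEQ_le by blast
  then have "norm w * (\<epsilon> * norm w) \<le> norm w * norm (S w)"
    by (simp add: power2_norm_eq_inner[symmetric] power2_eq_square mult_ac)
  then show ?thesis
    using \<epsilon> by (cases "w = 0") auto
qed

end

end

section \<open>Completeness of the eigenspaces\<close>

locale discrete_selfadjoint_op = selfadjoint_op D A
  for D :: "'h::complex_hilbert set" and A +
  fixes m :: "nat \<Rightarrow> real"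
  assumes spectrum: "op_spectrum D A = range (\<lambda>k. complex_of_real (m k))"
    and m_pos: "0 < m k" and m_mono: "strict_mono m"
begin

abbreviation E where "E k \<equiv> eigenspace D A (complex_of_real (m k))"

lemma resolvent_set_iff: "complex_of_real l \<in> resolvent_set D A \<longleftrightarrow> (\<forall>k. l \<noteq> m k)"
proof -
  have "complex_of_real l \<in> op_spectrum D A \<longleftrightarrow> (\<exists>k. l = m k)"
    unfolding spectrum by auto
  then show ?thesis
    unfolding op_spectrum_def by blast
qed

lemma m_separated: "\<exists>\<epsilon>>0. \<forall>j. j \<noteq> k \<longrightarrow> \<epsilon> \<le> \<bar>m j - m k\<bar>"
proof -
  define \<epsilon> where "\<epsilon> = (if k = 0 then m 1 - m 0 else min (m (Suc k) - m k) (m k - m (k - 1)))"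
  have "\<epsilon> > 0"
    using strict_monoD[OF m_mono, of 0 1] strict_monoD[OF m_mono, of k "Suc k"]
      strict_monoD[OF m_mono, of "k - 1" k] by (auto simp: \<epsilon>_def)
  moreover have "\<epsilon> \<le> \<bar>m j - m k\<bar>" if "j \<noteq> k" for j
  proof (cases "j < k")
    case True
    then have "m j \<le> m (k - 1)" "k \<noteq> 0"
      using strict_mono_less_eq[OF m_mono, of j "k - 1"] by auto
    then show ?thesis by (auto simp: \<epsilon>_def)
  next
    case False
    then have "m (Suc k) \<le> m j"
      using strict_mono_less_eq[OF m_mono, of "Suc k" j] that by auto
    then show ?thesis by (auto simp: \<epsilon>_def)
  qed
  ultimately show ?thesis by blast
qed

lemma eigenspace_complement_bound:
  "\<exists>\<epsilon>>0. \<forall>w\<in>D. (\<forall>e\<in>E k. cinner w e = 0) \<longrightarrow> \<epsilon> * norm w \<le> norm (A w - m k *\<^sub>R w)"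
proof -
  obtain \<epsilon> where \<epsilon>: "\<epsilon> > 0" "\<And>j. j \<noteq> k \<Longrightarrow> \<epsilon> \<le> \<bar>m j - m k\<bar>"
    using m_separated by blast
  have *: "complex_of_real (m k + s) \<in> resolvent_set D A" if "s \<noteq> 0" "\<bar>s\<bar> < \<epsilon>" for s
    unfolding resolvent_set_iff
  proof (intro allI notI)
    fix j assume "m k + s = m j"
    then show False
      using \<epsilon>(2)[of j] that by (cases "j = k") auto
  qed
  show ?thesis
    using isolated_kernel_complement_bound[OF \<epsilon>(1) *] \<epsilon>(1) by blast
qed

lemma eigenspace_subspace: "csubspace (E k)"
proof (rule complex_vector.subspaceI)
  have "csubspace D"
    using linear by (simp add: linear_op_def)
  then show "0 \<in> E k"
    using complex_vector.subspace_0 linear_op_scaleR[OF linear, of 0 0]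
    by (auto simp: eigenspace_def)
qed (auto simp: eigenspace_def linear_op_add[OF linear] linear_op_scaleC[OF linear]
    linear_op_in_add[OF linear] linear_op_in_scaleC[OF linear] scaleC_add_right mult.commute)

lemma eigenspace_closed: "closed (E k)"
  unfolding closed_sequential_limits
proof (intro allI impI, elim conjE)
  fix u l assume u: "\<forall>n. u n \<in> E k" "u \<longlonglongrightarrow> l"
  have "(\<lambda>n. A (u n)) \<longlonglongrightarrow> of_real (m k) *\<^sub>C l"
    using u by (auto simp: eigenspace_def intro: scaleC.tendsto)
  then have "l \<in> D \<and> A l = of_real (m k) *\<^sub>C l"
    using u by (intro closed_graph[of u]) (auto simp: eigenspace_def)
  then show "l \<in> E k"
    by (simp add: eigenspace_def)
qed

lemma eigenspace_orthogonal:
  assumes "j \<noteq> k" "x \<in> E j" "y \<in> E k"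
  shows "cinner x y = 0"
proof -
  have "of_real (m j) * cinner x y = cinner (A x) y"
    using assms by (simp add: eigenspace_def cinner_scaleC_left)
  also have "\<dots> = of_real (m k) * cinner x y"
    using assms symmetric[of x y] by (simp add: eigenspace_def cinner_scaleC_right)
  finally show ?thesis
    using strict_mono_eq[OF m_mono, of j k] assms(1) by simp
qed

text \<open>On the orthogonal complement \<open>N\<close> of all eigenspaces no real spectrum is
  left: at points \<open>m k\<close> the operator is bounded below by isolation, elsewhere by its
  resolvent. Hence \<open>resolvent_norm_bound\<close> holds on \<open>N\<close> with every
  \<open>d\<close>, and the resolvent at 0 must vanish there although it is injective.\<close>

lemma orthogonal_eigenspaces_eq_0:
  assumes x: "\<And>k e. e \<in> E k \<Longrightarrow> cinner x e = 0"
  shows "x = 0"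
proof -
  define N where "N = {x. \<forall>k. \<forall>e\<in>E k. cinner x e = 0}"
  have N: "csubspace N"
    by (rule complex_vector.subspaceI) (auto simp: N_def cinner_add_left cinner_scaleC_left)
  have l: "complex_of_real 0 \<in> resolvent_set D A"
    unfolding resolvent_set_iff using m_pos by (metis less_irrefl)
  let ?R = "op_resolvent D A (of_real 0)"
  have R: "?R y \<in> N" if "y \<in> N" for y
  proof -
    have "cinner (?R y) e = 0" if e: "e \<in> E k" for k e
    proof -
      define r where "r = - (1 / m k)"
      have "r *\<^sub>R e \<in> D" "A (r *\<^sub>R e) = - e"
        using e m_pos[of k] unfolding r_def
        by (simp_all only: eigenspace_def mem_Collect_eq linear_op_scaleR[OF linear]
            linear_op_in_scaleR[OF linear] scaleC_of_real) simp
      then have "?R e = r *\<^sub>R e"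
        using op_resolvent_left[OF l, of "r *\<^sub>R e"] by simp
      then have "cinner (?R y) e = cinner y (r *\<^sub>R e)"
        using resolvent_symmetric[OF l, of y e] by simp
      also have "\<dots> = 0"
        using \<open>y \<in> N\<close> e by (simp add: N_def cinner.scaleR_right)
      finally show ?thesis .
    qed
    then show ?thesis by (simp add: N_def)
  qed
  have lower: "\<exists>C. \<forall>u\<in>D \<inter> N. norm u \<le> C * norm ((0 + s) *\<^sub>R u - A u)" for s
  proof (cases "complex_of_real s \<in> resolvent_set D A")
    case True
    then show ?thesis
      using resolvent_bounded_below[OF True] by auto
  next
    case False
    then obtain k where k: "s = m k"
      by (auto simp: resolvent_set_iff)
    obtain \<epsilon> where \<epsilon>: "\<epsilon> > 0"
      "\<And>w. w \<in> D \<Longrightarrow> (\<And>e. e \<in> E k \<Longrightarrow> cinner w e = 0) \<Longrightarrow> \<epsilon> * norm w \<le> norm (A w - m k *\<^sub>R w)"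
      using eigenspace_complement_bound[of k] by blast
    have "norm u \<le> 1 / \<epsilon> * norm ((0 + s) *\<^sub>R u - A u)" if "u \<in> D \<inter> N" for u
      using \<epsilon>(2)[of u] that \<epsilon>(1) by (auto simp: k N_def norm_minus_commute field_simps)
    then show ?thesis by blast
  qed
  have "x \<in> N"
    using x by (simp add: N_def)
  then have bound: "d * norm (?R x) \<le> norm x" if "d > 0" for d
    using resolvent_norm_bound[OF l N R that lower] by simp
  have "norm (?R x) = 0"
  proof (rule ccontr)
    assume "norm (?R x) \<noteq> 0"
    then show False
      using bound[of "(norm x + 1) / norm (?R x)"] by (simp add: add_nonneg_pos)
  qed
  then have "?R x = 0" by simp
  moreover have "A 0 = 0"
    using linear_op_scaleR[OF linear op_resolvent_in[OF l], of 0] by simp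
  ultimately show ?thesis
    using op_resolvent_right[OF l, of x] by simp
qed

sublocale orth_family "\<lambda>k. orth_proj (E k)"
proof
  note E = eigenspace_subspace eigenspace_closed
  show "bounded_clinear (orth_proj (E k))" for k
    by (rule bounded_clinear_orth_proj[OF E])
  show "orth_proj (E k) (orth_proj (E k) x) = orth_proj (E k) x" for k x
    by (intro orth_proj_fixes orth_proj_in E)
  show "cinner (orth_proj (E k) x) y = cinner x (orth_proj (E k) y)" for k x y
    by (rule orth_proj_sym[OF E])
  show "orth_proj (E j) (orth_proj (E k) x) = 0" if "j \<noteq> k" for j k x
    using eigenspace_orthogonal[of k j "orth_proj (E k) x"] that orth_proj_in[OF E]
      complex_vector.subspace_0[OF E(1)] by (intro orth_projI[OF E]) auto
  fix x
  let ?p = "\<lambda>k. orth_proj (E k) x"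
  have orth: "cinner (?p j) (?p k) = 0" if "j \<noteq> k" for j k
    using that by (intro eigenspace_orthogonal[of j k] orth_proj_in E)
  have bessel: "(\<Sum>k<n. (norm (?p k))\<^sup>2) \<le> (norm x)\<^sup>2" for n
  proof -
    have *: "cinner x (?p k) = of_real ((norm (?p k))\<^sup>2)" for k
    proof -
      have "cinner (?p k) (?p k) = cinner x (?p k)"
        by (intro cinner_orth_proj orth_proj_in E)
      then show ?thesis
        by (simp add: cinner_self)
    qed
    have "inner x (\<Sum>k<n. ?p k) = (\<Sum>k<n. (norm (?p k))\<^sup>2)"
      by (simp add: inner_conv_Re_cinner cinner.sum_right *)
    moreover have "(norm (\<Sum>k<n. ?p k))\<^sup>2 = (\<Sum>k<n. (norm (?p k))\<^sup>2)"
      using orth by (intro norm_sum_orthogonal) auto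
    moreover have "0 \<le> (norm (x - 1 *\<^sub>R (\<Sum>k<n. ?p k)))\<^sup>2"
      by simp
    ultimately show ?thesis
      unfolding norm_diff_scaleR_power2 by simp
  qed
  have summable: "summable (\<lambda>k. (norm (?p k))\<^sup>2)"
    by (rule summableI_nonneg_bounded[OF _ bessel]) simp
  note s = summable_sums[OF orthogonal_series(1)[OF orth summable]]
  \<comment> \<open>Bessel's inequality gives convergence only; that the limit is \<open>x\<close>
    itself is the completeness just proved.\<close>
  have "x - suminf ?p = 0"
  proof (rule orthogonal_eigenspaces_eq_0)
    fix k e assume e: "e \<in> E k"
    have "(\<lambda>j. cinner (?p j) e) sums cinner (suminf ?p) e"
      by (intro bounded_linear.sums[OF cinner.bounded_linear_left] s)
    moreover have "cinner (?p j) e = (if j = k then cinner x e else 0)" for j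
      using eigenspace_orthogonal[of j k "?p j" e] e cinner_orth_proj[OF E e] orth_proj_in[OF E]
      by auto
    ultimately have "cinner (suminf ?p) e = cinner x e"
      using sums_single[of k "\<lambda>_. cinner x e"] sums_unique2 by simp
    then show "cinner (x - suminf ?p) e = 0"
      by (simp add: cinner.diff_left)
  qed
  then show "?p sums x"
    using s by simp
qed

lemma inverse_sqrt_bound: "cmod (complex_of_real (1 / sqrt (m k))) \<le> 1 / sqrt (m 0)"
proof -
  have "sqrt (m 0) \<le> sqrt (m k)"
    using strict_mono_less_eq[OF m_mono, of 0 k] by simp
  then show ?thesis
    using m_pos[of 0] m_pos[of k] by (simp add: frac_le norm_divide)
qed

section \<open>The square root on the eigenspaces\<close>

context
  fixes DB B
  assumes B: "is_sqrt_op D A DB B"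
begin

text \<open>On \<open>e\<close> the operator \<open>A - m k\<close> factors into
  \<open>B + sqrt (m k)\<close> after \<open>B - sqrt (m k)\<close>. The first factor annihilates
  \<open>w\<close>, so \<open>w\<close> would be an eigenvector of \<open>B\<close> with a negative
  eigenvalue unless it is zero.\<close>

lemma sqrt_op_eigenvector:
  assumes e: "e \<in> E k"
  shows "e \<in> DB \<and> B e = sqrt (m k) *\<^sub>R e"
proof -
  interpret B: selfadjoint_op DB B
    using B by unfold_locales (simp add: is_sqrt_op_def)
  have e': "e \<in> DB" "B e \<in> DB" "B (B e) = m k *\<^sub>R e"
    using e B by (auto simp: is_sqrt_op_def eigenspace_def scaleC_of_real)
  define w where "w = B e - sqrt (m k) *\<^sub>R e"
  have w: "w \<in> DB"
    using e' by (simp add: w_def linear_op_in_diff[OF B.linear] linear_op_in_scaleR[OF B.linear])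
  have "B w = - (sqrt (m k) *\<^sub>R w)"
    using e' m_pos[of k] less_imp_le[OF m_pos[of k]]
    by (simp add: w_def linear_op_diff[OF B.linear] linear_op_scaleR[OF B.linear]
        linear_op_in_scaleR[OF B.linear] algebra_simps)
  then have "Re (cinner (B w) w) = - (sqrt (m k) * (norm w)\<^sup>2)"
    by (simp add: cinner.minus_left cinner.scaleR_left cinner_self)
  moreover have "0 \<le> Re (cinner (B w) w)"
    using B w by (simp add: is_sqrt_op_def)
  ultimately have "sqrt (m k) * (norm w)\<^sup>2 \<le> 0"
    by simp
  then have "w = 0"
    using m_pos[of k] by (simp add: mult_le_0_iff not_le)
  then show ?thesis
    using e' by (simp add: w_def)
qed

text \<open>On finite sums of eigenvectors \<open>B\<close> undoes the diagonal operator; closedness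
  of \<open>B\<close> carries this to the limit and puts the limit into the domain.\<close>

lemma inverse_sqrt_op_in: "inv_sqrt_diag m x \<in> DB" (is "?K x \<in> DB")
  and sqrt_op_inverse_right: "B (inv_sqrt_diag m x) = x"
proof -
  interpret B: selfadjoint_op DB B
    using B by unfold_locales (simp add: is_sqrt_op_def)
  have DB: "csubspace DB"
    using B.linear by (simp add: linear_op_def)
  have PK: "orth_proj (E k) (?K x) = (1 / sqrt (m k)) *\<^sub>R orth_proj (E k) x" for k
    by (simp only: inv_sqrt_diag_def P_diag[OF inverse_sqrt_bound] scaleC_of_real)
  have fin: "(\<Sum>k<n. orth_proj (E k) (?K x)) \<in> DB \<and>
      B (\<Sum>k<n. orth_proj (E k) (?K x)) = (\<Sum>k<n. orth_proj (E k) x)" for n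
  proof (induction n)
    case 0
    then show ?case
      using complex_vector.subspace_0[OF DB] linear_op_scaleR[OF B.linear, of 0 0] by simp
  next
    case (Suc n)
    let ?e = "orth_proj (E n) x"
    have "?e \<in> DB" "B ?e = sqrt (m n) *\<^sub>R ?e"
      using sqrt_op_eigenvector[OF orth_proj_in[OF eigenspace_subspace eigenspace_closed]] by auto
    then have "orth_proj (E n) (?K x) \<in> DB" "B (orth_proj (E n) (?K x)) = ?e"
      using m_pos[of n] unfolding PK
      by (simp_all add: linear_op_in_scaleR[OF B.linear] linear_op_scaleR[OF B.linear])
    then show ?case
      using Suc by (simp add: linear_op_in_add[OF B.linear] linear_op_add[OF B.linear])
  qed
  have "?K x \<in> DB \<and> B (?K x) = x"
  proof (rule B.closed_graph)
    show "(\<lambda>n. \<Sum>k<n. orth_proj (E k) (?K x)) \<longlonglongrightarrow> ?K x"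
      using P_sums by (simp add: sums_def)
    show "(\<lambda>n. B (\<Sum>k<n. orth_proj (E k) (?K x))) \<longlonglongrightarrow> x"
      using P_sums[of x] fin by (simp add: sums_def)
  qed (use fin in blast)
  then show "?K x \<in> DB" "B (?K x) = x" by auto
qed

lemma sqrt_op_inverse_left:
  assumes u: "u \<in> DB"
  shows "inv_sqrt_diag m (B u) = u"
proof (rule P_ext)
  interpret B: selfadjoint_op DB B
    using B by unfold_locales (simp add: is_sqrt_op_def)
  note E = eigenspace_subspace eigenspace_closed
  fix k
  have "orth_proj (E k) (B u) = sqrt (m k) *\<^sub>R orth_proj (E k) u"
  proof (rule orth_projI[OF E])
    show "sqrt (m k) *\<^sub>R orth_proj (E k) u \<in> E k"
      by (intro csubspace_scaleR E orth_proj_in)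
    fix s assume s: "s \<in> E k"
    have "cinner (B u) s = sqrt (m k) *\<^sub>R cinner u s"
      using B.symmetric[OF u, of s] sqrt_op_eigenvector[OF s] by (simp add: cinner.scaleR_right)
    then show "cinner (B u - sqrt (m k) *\<^sub>R orth_proj (E k) u) s = 0"
      by (simp add: cinner.diff_left cinner.scaleR_left cinner_orth_proj[OF E s])
  qed
  then show "orth_proj (E k) (inv_sqrt_diag m (B u)) = orth_proj (E k) u"
    using m_pos[of k] by (simp only: inv_sqrt_diag_def P_diag[OF inverse_sqrt_bound] scaleC_of_real) simp
qed

end

end

section \<open>The perturbation as a bounded operator\<close>

text \<open>
  By Baire's theorem the closure of some sublevel set is a neighbourhood of zero; closedness then
  allows to pass from the closure to the sublevel set itself by successive approximation.
\<close>

lemma closed_quadratic_form_bounded: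
  fixes q :: "'h::banach \<Rightarrow> real"
  assumes nonneg: "\<And>x. 0 \<le> q x"
    and add: "\<And>x y. q (x + y) \<le> 2 * q x + 2 * q y"
    and scale: "\<And>r x. q (r *\<^sub>R x) = r\<^sup>2 * q x"
    and closed: "\<And>u x. u \<longlonglongrightarrow> x \<Longrightarrow> (\<And>e. e > 0 \<Longrightarrow> \<exists>N. \<forall>m\<ge>N. \<forall>n\<ge>N. q (u m - u n) < e) \<Longrightarrow>
      (\<lambda>n. q (u n - x)) \<longlonglongrightarrow> 0"
  shows "\<exists>C\<ge>0. \<forall>x. q x \<le> C * (norm x)\<^sup>2"
proof -
  have q_minus: "q (- x) = q x" for x
    using scale[of "-1" x] by simp
  define F where "F = (\<lambda>n::nat. {x. q x \<le> n})"
  have "\<exists>n. interior (closure (F n)) \<noteq> {}"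
  proof (rule ccontr)
    assume "\<not> ?thesis"
    then have "euclidean interior_of (\<Union> (range (\<lambda>n. closure (F n)))) = {}"
      by (intro Baire_category_alt disjI1 completely_metrizable_space_euclidean countable_image[OF countableI_type])
        (elim rangeE, simp)
    moreover have "\<Union> (range (\<lambda>n. closure (F n))) = UNIV"
    proof -
      have "x \<in> closure (F (nat \<lceil>q x\<rceil>))" for x
        by (rule subsetD[OF closure_subset]) (simp add: F_def real_nat_ceiling_ge)
      then show ?thesis by blast
    qed
    ultimately show False by (simp only: euclidean_interior_of) simp
  qed
  then obtain n a where "a \<in> interior (closure (F n))" by auto
  then obtain \<delta> where \<delta>: "\<delta> > 0" "ball a \<delta> \<subseteq> closure (F n)"
    by (meson mem_interior)
  have approx0: "\<exists>u. norm (x - u) < e \<and> q u \<le> n" if x: "norm x < \<delta>" and "e > 0" for x e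
  proof -
    have "a + x \<in> closure (F n)" "a - x \<in> closure (F n)"
      using \<delta>(2) x by (auto simp: dist_norm subset_iff)
    then obtain u w where u: "u \<in> F n" "dist u (a + x) < e" and w: "w \<in> F n" "dist w (a - x) < e"
      using \<open>e > 0\<close> by (meson closure_approachable)
    \<comment> \<open>Half the difference of points near \<open>a + x\<close> and
      \<open>a - x\<close> is near \<open>x\<close>: this moves the ball from \<open>a\<close> to
      the origin without enlarging \<open>n\<close>.\<close>
    define z where "z = (1/2) *\<^sub>R (u + - w)"
    have "q z \<le> (1/2)\<^sup>2 * (2 * q u + 2 * q w)"
      unfolding z_def scale using add[of u "- w"] by (intro mult_left_mono) (auto simp: q_minus)
    also have "\<dots> \<le> n"
      using u(1) w(1) by (simp add: F_def power2_eq_square)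
    finally have "q z \<le> n" .
    moreover have "x - z = (1/2) *\<^sub>R ((a + x - u) - (a - x - w))"
    proof -
      have "(a + x - u) - (a - x - w) = (x + x) - (u + - w)"
        by simp
      then show ?thesis
        by (simp only: z_def scaleR_diff_right scaleR_half_double)
    qed
    then have "norm (x - z) \<le> (norm (a + x - u) + norm (a - x - w)) / 2"
      using norm_triangle_ineq4[of "a + x - u" "a - x - w"] by simp
    then have "norm (x - z) < e"
      using u(2) w(2) by (simp add: dist_norm norm_minus_commute)
    ultimately show ?thesis by blast
  qed
  define C where "C = 4 * real n / \<delta>\<^sup>2"
  have "C \<ge> 0" by (simp add: C_def)
  have approx: "\<exists>u. norm (x - u) \<le> norm x / 2 \<and> q u \<le> C * (norm x)\<^sup>2" for x
  proof (cases "x = 0")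
    case True
    then show ?thesis
      using scale[of 0 0] by (intro exI[of _ 0]) auto
  next
    case False
    define r where "r = \<delta> / (2 * norm x)"
    have "r > 0" using \<delta> False by (simp add: r_def)
    have "norm (r *\<^sub>R x) < \<delta>"
      using \<delta> False by (simp add: r_def)
    then obtain u where u: "norm (r *\<^sub>R x - u) < r * (norm x / 2)" "q u \<le> n"
      using approx0[of "r *\<^sub>R x" "r * (norm x / 2)"] \<open>r > 0\<close> False by auto
    have "norm (x - (1 / r) *\<^sub>R u) = (1 / r) * norm (r *\<^sub>R x - u)"
    proof -
      have "x - (1 / r) *\<^sub>R u = (1 / r) *\<^sub>R (r *\<^sub>R x - u)"
        using \<open>r > 0\<close> by (simp add: scaleR_diff_right)
      then show ?thesis
        using \<open>r > 0\<close> by simp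
    qed
    also have "\<dots> \<le> norm x / 2"
      using u(1) \<open>r > 0\<close> by (simp add: field_simps)
    finally have 1: "norm (x - (1 / r) *\<^sub>R u) \<le> norm x / 2" .
    have "q ((1 / r) *\<^sub>R u) \<le> (1 / r)\<^sup>2 * n"
      unfolding scale using u(2) by (intro mult_left_mono) auto
    also have "\<dots> = C * (norm x)\<^sup>2"
      using False \<delta> by (simp add: r_def C_def field_simps power2_eq_square)
    finally show ?thesis using 1 by blast
  qed
  then obtain G where G: "\<And>x. norm (x - G x) \<le> norm x / 2" "\<And>x. q (G x) \<le> C * (norm x)\<^sup>2"
    by metis
  have "q x \<le> 8 * C * (norm x)\<^sup>2" for x
  proof -
    \<comment> \<open>The remainder after \<open>k\<close> approximations. Its norm halves each
      time, so the form of the next correction decays like \<open>1 / 4 ^ k\<close>, which beats the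
      factor 2 lost at every use of \<open>add\<close>.\<close>
    define res where "res = (\<lambda>k. ((\<lambda>y. y - G y) ^^ k) x)"
    have res_Suc: "res (Suc k) = res k - G (res k)" "res 0 = x" for k
      by (simp_all add: res_def)
    have res_le: "norm (res k) \<le> norm x / 2 ^ k" for k
    proof (induction k)
      case (Suc k)
      then show ?case using G(1)[of "res k"] by (simp add: res_Suc)
    qed (simp add: res_Suc)
    have qG: "q (G (res k)) \<le> C * (norm x)\<^sup>2 / 4 ^ k" for k
    proof -
      have "(norm (res k))\<^sup>2 \<le> (norm x / 2 ^ k)\<^sup>2"
        by (intro power_mono res_le) auto
      also have "\<dots> = (norm x)\<^sup>2 / 4 ^ k"
        by (simp add: power_divide power2_eq_square[of "2 ^ k"] flip: power_mult_distrib)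
      finally show ?thesis
        using G(2)[of "res k"] mult_left_mono[OF _ \<open>C \<ge> 0\<close>] by fastforce
    qed
    have diff: "res k - res (k + l) = (\<Sum>i<l. G (res (k + i)))" for k l
      by (induction l) (simp_all add: res_Suc algebra_simps)
    have q_diff: "q (res k - res (k + l)) \<le> 4 * (C * (norm x)\<^sup>2) / 4 ^ k" for k l
    proof (induction l arbitrary: k)
      case 0
      then show ?case using scale[of 0 0] \<open>C \<ge> 0\<close> by simp
    next
      case (Suc l)
      have "res k - res (k + Suc l) = G (res k) + (res (Suc k) - res (Suc k + l))"
        by (simp add: res_Suc)
      then have "q (res k - res (k + Suc l)) \<le> 2 * q (G (res k)) + 2 * q (res (Suc k) - res (Suc k + l))"
        using add by metis
      also have "\<dots> \<le> 2 * (C * (norm x)\<^sup>2 / 4 ^ k) + 2 * (4 * (C * (norm x)\<^sup>2) / 4 ^ Suc k)"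
        using qG[of k] Suc.IH[of "Suc k"] by linarith
      also have "\<dots> = 4 * (C * (norm x)\<^sup>2) / 4 ^ k"
        by simp
      finally show ?case .
    qed
    define S where "S = (\<lambda>k. x - res k)"
    have lim4: "(\<lambda>k. 4 * (C * (norm x)\<^sup>2) / 4 ^ k) \<longlonglongrightarrow> 0"
      using tendsto_mult_right_zero[OF LIMSEQ_divide_realpow_zero[of 4 1]]
      by (auto intro!: LIMSEQ_divide_realpow_zero)
    have "(\<lambda>n. q (S n - x)) \<longlonglongrightarrow> 0"
    proof (rule closed)
      have "res \<longlonglongrightarrow> 0"
        by (rule Lim_null_comparison[OF _ LIMSEQ_divide_realpow_zero[of 2 "norm x"]])
          (auto simp: res_le)
      then show "S \<longlonglongrightarrow> x"
        unfolding S_def using tendsto_diff[OF tendsto_const[of x]] by fastforce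
      fix e :: real assume "e > 0"
      then have "\<forall>\<^sub>F k in sequentially. 4 * (C * (norm x)\<^sup>2) / 4 ^ k < e"
        using lim4 by (rule order_tendstoD(2)[rotated])
      then obtain N where N: "\<And>k. k \<ge> N \<Longrightarrow> 4 * (C * (norm x)\<^sup>2) / 4 ^ k < e"
        by (auto simp: eventually_sequentially)
      have *: "q (res i - res j) < e" if "i \<ge> N" "i \<le> j" for i j
        using q_diff[of i "j - i"] N[OF that(1)] that(2) by simp
      have "q (S i - S j) < e" if "i \<ge> N" "j \<ge> N" for i j
        using *[of i j] *[of j i] that q_minus[of "res i - res j"] nat_le_linear[of i j]
        by (auto simp: S_def)
      then show "\<exists>N. \<forall>i\<ge>N. \<forall>j\<ge>N. q (S i - S j) < e" by blast
    qed
    then have "(\<lambda>n. 2 * (4 * (C * (norm x)\<^sup>2)) + 2 * q (S n - x)) \<longlonglongrightarrow> 2 * (4 * (C * (norm x)\<^sup>2)) + 2 * 0"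
      by (intro tendsto_intros)
    moreover have "q x \<le> 2 * (4 * (C * (norm x)\<^sup>2)) + 2 * q (S k - x)" for k
    proof -
      have "q (S k) \<le> 4 * (C * (norm x)\<^sup>2)"
        using q_diff[of 0 k] by (simp add: S_def res_Suc)
      moreover have "q x \<le> 2 * q (S k) + 2 * q (S k - x)"
        using add[of "S k" "- (S k - x)"] by (simp only: q_minus) simp
      ultimately show ?thesis by linarith
    qed
    ultimately have "q x \<le> 2 * (4 * (C * (norm x)\<^sup>2)) + 2 * 0"
      by (intro LIMSEQ_le_const) auto
    then show ?thesis by simp
  qed
  then show ?thesis
    using \<open>C \<ge> 0\<close> by (intro exI[of _ "8 * C"]) auto
qed

text \<open>Polarization writes \<open>4 * b x y\<close> as four values of the quadratic form, at
  vectors of norm at most 2 if \<open>x\<close> and \<open>y\<close> are unit vectors; homogeneity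
  does the rest.\<close>

lemma sesquilinear_bounded_of_quadratic:
  fixes b :: "'h::complex_hilbert \<Rightarrow> 'h \<Rightarrow> complex"
  assumes add1: "\<And>x y z. b (x + y) z = b x z + b y z" and add2: "\<And>x y z. b x (y + z) = b x y + b x z"
    and scale1: "\<And>c x y. b (c *\<^sub>C x) y = c * b x y" and scale2: "\<And>c x y. b x (c *\<^sub>C y) = cnj c * b x y"
    and bound: "\<And>x. cmod (b x x) \<le> K * (norm x)\<^sup>2"
  shows "cmod (b x y) \<le> 4 * K * norm x * norm y"
proof -
  have unit: "cmod (b x y) \<le> 4 * K" if "norm x = 1" "norm y = 1" for x y
  proof -
    have "K \<ge> 0"
      using order_trans[OF norm_ge_zero bound[of x]] that(1) by simp
    have b4: "cmod (b (x + c *\<^sub>C y) (x + c *\<^sub>C y)) \<le> 4 * K" if "cmod c = 1" for c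
    proof -
      have "norm (x + c *\<^sub>C y) \<le> 2"
        using norm_triangle_ineq[of x "c *\<^sub>C y"] \<open>norm x = 1\<close> \<open>norm y = 1\<close> that
        by (simp add: norm_scaleC)
      then have "(norm (x + c *\<^sub>C y))\<^sup>2 \<le> 2\<^sup>2"
        by (intro power_mono) auto
      then show ?thesis
        using bound[of "x + c *\<^sub>C y"] mult_left_mono[OF _ \<open>K \<ge> 0\<close>] by fastforce
    qed
    have "4 * b x y = b (x + 1 *\<^sub>C y) (x + 1 *\<^sub>C y) - b (x + (-1) *\<^sub>C y) (x + (-1) *\<^sub>C y)
        + \<i> * b (x + \<i> *\<^sub>C y) (x + \<i> *\<^sub>C y) - \<i> * b (x + (- \<i>) *\<^sub>C y) (x + (- \<i>) *\<^sub>C y)"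
      unfolding add1 add2 scale1 scale2 by (simp add: algebra_simps)
    also have "cmod \<dots> \<le> 4 * K + 4 * K + 4 * K + 4 * K"
      using b4[of 1] b4[of "-1"] b4[of \<i>] b4[of "- \<i>"]
      by (intro order_trans[OF norm_triangle_ineq4] order_trans[OF norm_triangle_ineq] add_mono)
        (auto simp: norm_mult)
    finally show ?thesis
      by (simp add: norm_mult)
  qed
  show ?thesis
  proof (cases "x = 0 \<or> y = 0")
    case True
    then show ?thesis
      using scale1[of 0 0] scale2[of _ 0 0] by auto
  next
    case False
    have "cmod (b (of_real (1 / norm x) *\<^sub>C x) (of_real (1 / norm y) *\<^sub>C y)) \<le> 4 * K"
      using False by (intro unit) (auto simp: norm_scaleC norm_divide)
    then have "cmod (b x y) / (norm x * norm y) \<le> 4 * K"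
      unfolding scale1 scale2 by (simp add: norm_mult norm_divide mult.commute)
    then show ?thesis
      using False by (simp add: pos_divide_le_eq mult_ac)
  qed
qed

text \<open>\<open>T_iff\<close> is the factorization of \<open>T\<close> read backwards: with
  \<open>x = A^(1/2) u\<close> the equation \<open>T u = f\<close> becomes
  \<open>x + V x = A^(-1/2) f\<close>, which involves bounded operators only. The denominators in
  \<open>V_entries\<close> come from applying \<open>A^(-1/2)\<close> to both arguments of the
  form.\<close>

locale perturbed_diagonal = orth_family P
  for P :: "nat \<Rightarrow> 'h::complex_hilbert \<Rightarrow> 'h" +
  fixes m w :: "nat \<Rightarrow> real" and V :: "'h \<Rightarrow> 'h" and D :: "'h set" and T :: "'h \<Rightarrow> 'h"
  assumes m_pos: "0 < m k" and m_mono: "strict_mono m" and m_lim: "filterlim m at_top sequentially"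
    and w_nonneg: "0 \<le> w k" and w_summable: "summable (\<lambda>k. (w k)\<^sup>2 / m k)"
    and V_bounded: "bounded_clinear V"
    and V_entries: "cmod (cinner (V (P j x)) (P k y)) \<le>
      w j / sqrt (m j) * (w k / sqrt (m k)) * norm (P j x) * norm (P k y)"
    and T_iff: "u \<in> D \<and> T u = f \<longleftrightarrow>
      (\<exists>x. u = inv_sqrt_diag m x \<and>
        x + V x = inv_sqrt_diag m f)"

section \<open>Boundedness of the form and the factorization of the operator\<close>

locale perturbed_form = discrete_selfadjoint_op D A m
  for D :: "'h::complex_hilbert set" and A m +
  fixes DB :: "'h set" and B :: "'h \<Rightarrow> 'h" and v t :: "'h \<Rightarrow> 'h \<Rightarrow> complex"
    and DT :: "'h set" and T :: "'h \<Rightarrow> 'h" and w :: "nat \<Rightarrow> real"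
  assumes sqrt_op: "is_sqrt_op D A DB B"
    and v: "sesquilinear_on DB v"
    and v_entries: "f \<in> DB \<Longrightarrow> g \<in> DB \<Longrightarrow>
      cmod (v (orth_proj (E j) f) (orth_proj (E k) g)) \<le>
        w j * w k * norm (orth_proj (E j) f) * norm (orth_proj (E k) g)"
    and t: "t f g = cinner (B f) (B g) + v f g"
    and t_closed: "closed_sectorial_form DB t"
    and T: "m_sectorial_op_of_form DB t DT T"
begin

abbreviation K where "K \<equiv> inv_sqrt_diag m"

lemmas K_in = inverse_sqrt_op_in[OF sqrt_op]
  and B_K = sqrt_op_inverse_right[OF sqrt_op]
  and K_B = sqrt_op_inverse_left[OF sqrt_op]
  and K_bounded = bounded_clinear_diag[OF inverse_sqrt_bound, folded inv_sqrt_diag_def]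

lemma t_sesquilinear: "sesquilinear_on DB t"
  using t_closed by (simp add: closed_sectorial_form_def sectorial_form_def)

lemma K_sym: "cinner (K x) y = cinner x (K y)"
  unfolding inv_sqrt_diag_def using cinner_diag[OF inverse_sqrt_bound] by simp

lemma t_sector: "\<exists>\<gamma> c. 0 \<le> c \<and> (\<forall>f\<in>DB. \<gamma> * (norm f)\<^sup>2 \<le> Re (t f f) \<and>
    \<bar>Im (t f f)\<bar> \<le> c * (Re (t f f) - \<gamma> * (norm f)\<^sup>2))"
proof -
  obtain \<gamma> c where c: "0 \<le> c" and sec: "\<And>f. f \<in> DB \<Longrightarrow> norm f = 1 \<Longrightarrow> t f f \<in> sector \<gamma> c"
    using t_closed unfolding closed_sectorial_form_def sectorial_form_def by blast
  have DB: "csubspace DB"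
    and scale: "\<And>a b f g. f \<in> DB \<Longrightarrow> g \<in> DB \<Longrightarrow> t (a *\<^sub>C f) g = a * t f g \<and> t f (b *\<^sub>C g) = cnj b * t f g"
    using t_sesquilinear by (auto simp: sesquilinear_on_def)
  have "\<gamma> * (norm f)\<^sup>2 \<le> Re (t f f) \<and> \<bar>Im (t f f)\<bar> \<le> c * (Re (t f f) - \<gamma> * (norm f)\<^sup>2)"
    if f: "f \<in> DB" for f
  proof (cases "f = 0")
    case True
    then show ?thesis
      using scale[of 0 0 0] complex_vector.subspace_0[OF DB] by simp
  next
    case False
    define r where "r = 1 / norm f"
    have r: "r > 0" "r\<^sup>2 * (norm f)\<^sup>2 = 1"
      using False by (auto simp: r_def power_divide)
    have rf: "complex_of_real r *\<^sub>C f \<in> DB"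
      using f DB by (simp add: complex_vector.subspace_scale)
    have "t (of_real r *\<^sub>C f) (of_real r *\<^sub>C f) = of_real (r\<^sup>2) * t f f"
      using scale[OF f rf] scale[OF f f] by (simp add: power2_eq_square)
    moreover have "t (of_real r *\<^sub>C f) (of_real r *\<^sub>C f) \<in> sector \<gamma> c"
      using False by (intro sec rf) (simp add: norm_scaleC r_def norm_divide)
    ultimately have *: "\<gamma> \<le> r\<^sup>2 * Re (t f f)" "\<bar>r\<^sup>2 * Im (t f f)\<bar> \<le> c * (r\<^sup>2 * Re (t f f) - \<gamma>)"
      by (simp_all add: sector_def)
    have g: "\<gamma> = r\<^sup>2 * (\<gamma> * (norm f)\<^sup>2)"
      using r(2) by (simp add: mult.left_commute)
    have "r\<^sup>2 * (\<gamma> * (norm f)\<^sup>2) \<le> r\<^sup>2 * Re (t f f)"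
      using *(1) by (simp only: g[symmetric])
    moreover have "r\<^sup>2 * \<bar>Im (t f f)\<bar> \<le> r\<^sup>2 * (c * (Re (t f f) - \<gamma> * (norm f)\<^sup>2))"
    proof -
      have "c * (r\<^sup>2 * Re (t f f) - \<gamma>) = c * (r\<^sup>2 * Re (t f f) - r\<^sup>2 * (\<gamma> * (norm f)\<^sup>2))"
        using g by simp
      also have "\<dots> = r\<^sup>2 * (c * (Re (t f f) - \<gamma> * (norm f)\<^sup>2))"
        by (simp only: right_diff_distrib mult_ac)
      finally have "c * (r\<^sup>2 * Re (t f f) - \<gamma>) = r\<^sup>2 * (c * (Re (t f f) - \<gamma> * (norm f)\<^sup>2))" .
      with *(2) have "\<bar>r\<^sup>2 * Im (t f f)\<bar> \<le> r\<^sup>2 * (c * (Re (t f f) - \<gamma> * (norm f)\<^sup>2))"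
        by (simp only:)
      then show ?thesis
        by (simp only: abs_mult abs_power2)
    qed
    ultimately show ?thesis
      using r(1) by simp
  qed
  then show ?thesis using c by blast
qed

text \<open>Pulled back by \<open>K\<close>, the form is defined on the whole space, and closedness
  of \<open>t\<close> is the closedness that \<open>closed_quadratic_form_bounded\<close> asks for:
  an everywhere defined closed form is bounded.\<close>

lemma t_K_bound: "\<exists>C\<ge>0. \<forall>x. cmod (t (K x) (K x)) \<le> C * (norm x)\<^sup>2"
proof -
  obtain \<gamma> c where c: "0 \<le> c"
    and sec: "\<And>f. f \<in> DB \<Longrightarrow> \<gamma> * (norm f)\<^sup>2 \<le> Re (t f f)"
      "\<And>f. f \<in> DB \<Longrightarrow> \<bar>Im (t f f)\<bar> \<le> c * (Re (t f f) - \<gamma> * (norm f)\<^sup>2)"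
    using t_sector by blast
  have add: "\<And>f g h. f \<in> DB \<Longrightarrow> g \<in> DB \<Longrightarrow> h \<in> DB \<Longrightarrow> t (f + g) h = t f h + t g h \<and> t h (f + g) = t h f + t h g"
    and scale: "\<And>a f g. f \<in> DB \<Longrightarrow> g \<in> DB \<Longrightarrow> t (a *\<^sub>C f) g = a * t f g \<and> t f (a *\<^sub>C g) = cnj a * t f g"
    using t_sesquilinear by (auto simp: sesquilinear_on_def)
  note K_add = bounded_clinear_add[OF K_bounded] and K_diff = bounded_clinear_diff[OF K_bounded]
    and K_scale = bounded_clinear_scaleC[OF K_bounded]
  \<comment> \<open>The shift by \<open>\<gamma> - 1\<close>, one below the vertex, makes
    \<open>q\<close> dominate the squared norm; sectoriality then makes it dominate the imaginary
    part as well.\<close>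
  define q where "q x = Re (t (K x) (K x)) - (\<gamma> - 1) * (norm (K x))\<^sup>2" for x
  have q_ge: "(norm (K x))\<^sup>2 \<le> q x" for x
    using sec(1)[OF K_in[of x]] by (simp add: q_def algebra_simps)
  define C1 where "C1 = 1 + \<bar>\<gamma> - 1\<bar> + c"
  have t_le: "cmod (t (K x) (K x)) \<le> C1 * q x" for x
  proof -
    have n: "0 \<le> (norm (K x))\<^sup>2" by simp
    have "q x \<ge> 0" using q_ge[of x] n by linarith
    have "\<bar>Re (t (K x) (K x))\<bar> \<le> q x + \<bar>\<gamma> - 1\<bar> * (norm (K x))\<^sup>2"
    proof -
      have "Re (t (K x) (K x)) = q x + (\<gamma> - 1) * (norm (K x))\<^sup>2"
        by (simp add: q_def)
      then show ?thesis
        using \<open>q x \<ge> 0\<close> abs_triangle_ineq[of "q x" "(\<gamma> - 1) * (norm (K x))\<^sup>2"] by (simp add: abs_mult)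
    qed
    also have "\<dots> \<le> q x + \<bar>\<gamma> - 1\<bar> * q x"
      using q_ge[of x] by (intro add_left_mono mult_left_mono) auto
    finally have 1: "\<bar>Re (t (K x) (K x))\<bar> \<le> q x + \<bar>\<gamma> - 1\<bar> * q x" .
    have "\<bar>Im (t (K x) (K x))\<bar> \<le> c * (q x - (norm (K x))\<^sup>2)"
      using sec(2)[OF K_in[of x]] by (simp add: q_def algebra_simps)
    also have "\<dots> \<le> c * q x"
      using c n by (intro mult_left_mono) auto
    finally show ?thesis
      using 1 cmod_le[of "t (K x) (K x)"] by (simp add: C1_def algebra_simps)
  qed
  have "\<exists>C\<ge>0. \<forall>x. q x \<le> C * (norm x)\<^sup>2"
  proof (rule closed_quadratic_form_bounded)
    show q0: "0 \<le> q x" for x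
      using q_ge[of x] by (meson order_trans zero_le_power2)
    have q_scale: "q (a *\<^sub>C x) = (cmod a)\<^sup>2 * q x" for a x
    proof -
      have "t (a *\<^sub>C K x) (a *\<^sub>C K x) = a * cnj a * t (K x) (K x)"
        using scale[OF K_in[of "a *\<^sub>C x"] K_in[of x], of a] scale[OF K_in[of x] K_in[of "a *\<^sub>C x"], of a]
          scale[OF K_in[of x] K_in[of x], of a] by (simp add: K_scale)
      also have "\<dots> = of_real ((cmod a)\<^sup>2) * t (K x) (K x)"
        by (simp only: complex_norm_square)
      finally show ?thesis
        by (simp add: q_def K_scale norm_scaleC power_mult_distrib algebra_simps)
    qed
    show "q (r *\<^sub>R x) = r\<^sup>2 * q x" for r x
      using q_scale[of "of_real r" x] by (simp add: scaleC_of_real)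
    have parallelogram: "q (x + y) + q (x + (-1) *\<^sub>C y) = 2 * q x + 2 * q y" for x y
    proof -
      have "t (K x + a *\<^sub>C K y) (K x + a *\<^sub>C K y) =
          t (K x) (K x) + cnj a * t (K x) (K y) + a * t (K y) (K x) + a * cnj a * t (K y) (K y)" for a
        using add[OF K_in[of x] K_in[of "a *\<^sub>C y"]] K_in[of "x + a *\<^sub>C y"] K_in[of x]
          K_in[of "a *\<^sub>C y"] K_in[of y]
        by (simp add: K_add K_scale scale algebra_simps)
      from this[of 1] this[of "-1"]
      have "t (K x + K y) (K x + K y) + t (K x + (-1) *\<^sub>C K y) (K x + (-1) *\<^sub>C K y) =
          2 * t (K x) (K x) + 2 * t (K y) (K y)"
        by (simp add: algebra_simps)
      from arg_cong[OF this, of Re]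
      have 1: "Re (t (K x + K y) (K x + K y)) + Re (t (K x + (-1) *\<^sub>C K y) (K x + (-1) *\<^sub>C K y)) =
          2 * Re (t (K x) (K x)) + 2 * Re (t (K y) (K y))"
        by simp
      have 2: "(norm (K x + K y))\<^sup>2 + (norm (K x + (-1) *\<^sub>C K y))\<^sup>2 =
          2 * (norm (K x))\<^sup>2 + 2 * (norm (K y))\<^sup>2"
        using norm_parallelogram[of "K x" "K y"] by (simp add: scaleC.minus_left)
      have "q (x + y) + q (x + (-1) *\<^sub>C y) =
          (Re (t (K x + K y) (K x + K y)) + Re (t (K x + (-1) *\<^sub>C K y) (K x + (-1) *\<^sub>C K y))) -
          (\<gamma> - 1) * ((norm (K x + K y))\<^sup>2 + (norm (K x + (-1) *\<^sub>C K y))\<^sup>2)"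
        unfolding q_def K_add K_scale by (simp only: distrib_left)
      then show ?thesis
        unfolding 1 2 q_def by (simp add: algebra_simps)
    qed
    show "q (x + y) \<le> 2 * q x + 2 * q y" for x y
      using parallelogram[of x y] q0[of "x + (-1) *\<^sub>C y"] by linarith
    fix u :: "nat \<Rightarrow> 'h" and x
    assume u: "u \<longlonglongrightarrow> x" and cauchy: "\<And>e. e > 0 \<Longrightarrow> \<exists>N. \<forall>m\<ge>N. \<forall>n\<ge>N. q (u m - u n) < e"
    have Ku: "(\<lambda>n. K (u n)) \<longlonglongrightarrow> K x"
      by (rule bounded_clinear_tendsto[OF K_bounded u])
    have "C1 > 0"
      using c by (simp add: C1_def)
    have "((\<lambda>(i, j). t (K (u i) - K (u j)) (K (u i) - K (u j))) \<longlongrightarrow> 0) (sequentially \<times>\<^sub>F sequentially)"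
    proof (rule tendstoI)
      fix e :: real assume "e > 0"
      then obtain N where N: "\<And>i j. i \<ge> N \<Longrightarrow> j \<ge> N \<Longrightarrow> q (u i - u j) < e / C1"
        using cauchy[of "e / C1"] \<open>C1 > 0\<close> by auto
      have "dist (t (K (u i) - K (u j)) (K (u i) - K (u j))) 0 < e" if "i \<ge> N" "j \<ge> N" for i j
        using N[OF that] t_le[of "u i - u j"] \<open>C1 > 0\<close>
        by (simp add: K_diff pos_less_divide_eq mult.commute) 
      then show "\<forall>\<^sub>F p in sequentially \<times>\<^sub>F sequentially.
          dist (case p of (i, j) \<Rightarrow> t (K (u i) - K (u j)) (K (u i) - K (u j))) 0 < e"
        unfolding eventually_prod_sequentially by (intro exI[of _ N]) auto
    qed
    moreover have "range (\<lambda>n. K (u n)) \<subseteq> DB"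
      using K_in by auto
    ultimately have "(\<lambda>n. t (K (u n) - K x) (K (u n) - K x)) \<longlonglongrightarrow> 0"
      using t_closed Ku unfolding closed_sectorial_form_def by blast
    then have 1: "(\<lambda>n. Re (t (K (u n) - K x) (K (u n) - K x))) \<longlonglongrightarrow> Re 0"
      by (intro tendsto_intros)
    have "(\<lambda>n. Re (t (K (u n) - K x) (K (u n) - K x)) - (\<gamma> - 1) * (norm (K (u n) - K x))\<^sup>2) \<longlonglongrightarrow>
        Re 0 - (\<gamma> - 1) * (norm (K x - K x))\<^sup>2"
      by (intro tendsto_intros 1 Ku)
    then show "(\<lambda>n. q (u n - x)) \<longlonglongrightarrow> 0"
      by (simp add: q_def K_diff)
  qed
  then obtain C where C: "C \<ge> 0" "\<And>x. q x \<le> C * (norm x)\<^sup>2"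
    by blast
  have "cmod (t (K x) (K x)) \<le> C1 * C * (norm x)\<^sup>2" for x
  proof -
    have "C1 * q x \<le> C1 * (C * (norm x)\<^sup>2)"
      using c by (intro mult_left_mono C) (simp add: C1_def)
    then show ?thesis
      using t_le[of x] by simp
  qed
  then show ?thesis
    using c C(1) by (intro exI[of _ "C1 * C"]) (auto simp: C1_def)
qed

lemma form_operator:
  obtains V where "bounded_clinear V" "\<And>x y. cinner (V x) y = v (K x) (K y)"
proof -
  obtain C where C: "C \<ge> 0" "\<And>x. cmod (t (K x) (K x)) \<le> C * (norm x)\<^sup>2"
    using t_K_bound by blast
  have add: "\<And>f g h. f \<in> DB \<Longrightarrow> g \<in> DB \<Longrightarrow> h \<in> DB \<Longrightarrow> v (f + g) h = v f h + v g h \<and> v h (f + g) = v h f + v h g"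
    and scale: "\<And>a f g. f \<in> DB \<Longrightarrow> g \<in> DB \<Longrightarrow> v (a *\<^sub>C f) g = a * v f g \<and> v f (a *\<^sub>C g) = cnj a * v f g"
    using v by (auto simp: sesquilinear_on_def)
  define b where "b x y = v (K x) (K y)" for x y
  have b: "b (x + y) z = b x z + b y z" "b x (y + z) = b x y + b x z"
      "b (a *\<^sub>C x) y = a * b x y" "b x (a *\<^sub>C y) = cnj a * b x y" for x y z a
    using add scale K_in
    by (simp_all add: b_def bounded_clinear_add[OF K_bounded] bounded_clinear_scaleC[OF K_bounded])
  have "cmod (b x x) \<le> (C + 1) * (norm x)\<^sup>2" for x
  proof -
    \<comment> \<open>Since \<open>B (K x) = x\<close>, the unperturbed form turns into the inner
      product.\<close>
    have "b x x = t (K x) (K x) - cinner x x"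
      by (simp add: t B_K b_def)
    then have "cmod (b x x) \<le> cmod (t (K x) (K x)) + cmod (cinner x x)"
      by (simp add: norm_triangle_ineq4)
    also have "\<dots> \<le> C * (norm x)\<^sup>2 + (norm x)\<^sup>2"
      using C(2)[of x] by (simp add: cinner_self norm_power)
    finally show ?thesis
      by (simp add: algebra_simps)
  qed
  then have "cmod (b x y) \<le> 4 * (C + 1) * norm x * norm y" for x y
    using sesquilinear_bounded_of_quadratic[of b] b by blast
  then obtain V where "bounded_clinear V" "\<And>x y. cinner (V x) y = b x y"
    using bounded_sesquilinear_operator[of b "4 * (C + 1)"] b by metis
  then show ?thesis
    using that by (simp add: b_def)
qed

text \<open>The converse is the maximality of \<open>T\<close>. The resolvent of \<open>T\<close> at
  a point \<open>l\<close> far to the left yields \<open>u'\<close> in the domain that solves the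
  equation which \<open>u\<close> solves weakly; the difference \<open>e\<close> satisfies
  \<open>t e e = l * (norm e)\<^sup>2\<close>, and as \<open>l\<close> lies to the left of the
  sector, \<open>e = 0\<close>.\<close>

lemma T_iff_form:
  "u \<in> DT \<and> T u = f \<longleftrightarrow> u \<in> DB \<and> (\<forall>g\<in>DB. t u g = cinner f g)"
proof
  assume "u \<in> DT \<and> T u = f"
  then show "u \<in> DB \<and> (\<forall>g\<in>DB. t u g = cinner f g)"
    using T by (auto simp: m_sectorial_op_of_form_def)
next
  assume u: "u \<in> DB \<and> (\<forall>g\<in>DB. t u g = cinner f g)"
  obtain \<gamma> c where sec: "\<And>f. f \<in> DB \<Longrightarrow> \<gamma> * (norm f)\<^sup>2 \<le> Re (t f f)"
    using t_sector by blast
  have T': "DT \<subseteq> DB" "\<And>f g. f \<in> DT \<Longrightarrow> g \<in> DB \<Longrightarrow> cinner (T f) g = t f g"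
    using T by (auto simp: m_sectorial_op_of_form_def)
  obtain \<alpha> where \<alpha>: "m_accretive DT (\<lambda>f. T f + \<alpha> *\<^sub>R f)"
    using T by (auto simp: m_sectorial_op_of_form_def m_sectorial_def)
  \<comment> \<open>Large enough for the resolvent of the shifted operator to exist and for
    \<open>l = - s - \<alpha>\<close> to be less than \<open>\<gamma>\<close>.\<close>
  define s where "s = \<bar>\<alpha>\<bar> + \<bar>\<gamma>\<bar> + 1"
  have "0 < Re (complex_of_real s)"
    by (simp add: s_def)
  then have "- complex_of_real s \<in> resolvent_set DT (\<lambda>f. T f + \<alpha> *\<^sub>R f)"
    using \<alpha> unfolding m_accretive_def by blast
  then have "complex_of_real (- s) \<in> resolvent_set DT (\<lambda>f. T f + \<alpha> *\<^sub>R f)"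
    by simp
  note R = op_resolvent_in[OF this] op_resolvent_right[OF this]
  define l where "l = - s - \<alpha>"
  define u' where "u' = op_resolvent DT (\<lambda>f. T f + \<alpha> *\<^sub>R f) (complex_of_real (- s)) (l *\<^sub>R u - f)"
  have u': "u' \<in> DT" "- s *\<^sub>R u' - (T u' + \<alpha> *\<^sub>R u') = l *\<^sub>R u - f"
    using R[of "l *\<^sub>R u - f"] by (simp_all add: u'_def scaleC_of_real[symmetric])
  then have Tu': "T u' = f - l *\<^sub>R (u - u')"
    by (simp add: l_def algebra_simps)
  define e where "e = u - u'"
  have DB: "csubspace DB"
    using t_sesquilinear by (simp add: sesquilinear_on_def)
  have eDB: "e \<in> DB"
    using u u'(1) T'(1) DB by (auto simp: e_def intro: complex_vector.subspace_diff)
  have "t u e = t u' e + t e e"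
    using t_sesquilinear u'(1) T'(1) eDB unfolding sesquilinear_on_def
    by (metis e_def add_diff_cancel_left' add.commute diff_add_cancel subsetD)
  moreover have "t u e = cinner f e"
    using u eDB by blast
  moreover have "t u' e = cinner f e - l * cinner e e"
    using T'(2)[OF u'(1) eDB] by (simp add: Tu' e_def cinner.diff_left cinner.scaleR_left scaleR_conv_of_real)
  ultimately have "t e e = of_real (l * (norm e)\<^sup>2)"
    by (simp add: cinner_self)
  then have "\<gamma> * (norm e)\<^sup>2 \<le> l * (norm e)\<^sup>2"
    using sec[OF eDB] by simp
  moreover have "l < \<gamma>"
    by (simp add: l_def s_def)
  ultimately have "e = 0"
    by (auto simp: mult_le_cancel_right)
  then show "u \<in> DT \<and> T u = f"
    using u'(1) Tu' by (simp add: e_def)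
qed

lemma perturbed_diagonal:
  assumes m_lim: "filterlim m at_top sequentially" and w: "\<And>k. 0 \<le> w k"
    and w_summable: "summable (\<lambda>k. (w k)\<^sup>2 / m k)"
  shows "\<exists>V. perturbed_diagonal (\<lambda>k. orth_proj (E k)) m w V DT T"
proof -
  obtain V where V: "bounded_clinear V" "\<And>x y. cinner (V x) y = v (K x) (K y)"
    using form_operator by blast
  have "perturbed_diagonal (\<lambda>k. orth_proj (E k)) m w V DT T"
  proof (unfold_locales)
    fix j k x y
    have PK: "orth_proj (E j) (K x) = complex_of_real (1 / sqrt (m j)) *\<^sub>C orth_proj (E j) x" for j x
      unfolding inv_sqrt_diag_def by (rule P_diag[OF inverse_sqrt_bound])
    have KP: "K (orth_proj (E j) x) = orth_proj (E j) (K x)" for j x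
    proof (rule P_ext)
      show "orth_proj (E k) (K (orth_proj (E j) x)) = orth_proj (E k) (orth_proj (E j) (K x))" for k
        by (cases "k = j") (simp_all add: PK P_idem P_orth bounded_clinear_scaleC[OF P_bounded])
    qed
    have norm_PK: "norm (orth_proj (E j) (K x)) = norm (orth_proj (E j) x) / sqrt (m j)" for j x
      using m_pos[of j] by (simp add: PK norm_scaleC norm_divide)
    show "cmod (cinner (V (orth_proj (E j) x)) (orth_proj (E k) y)) \<le>
        w j / sqrt (m j) * (w k / sqrt (m k)) * norm (orth_proj (E j) x) * norm (orth_proj (E k) y)"
      unfolding V(2) KP using v_entries[OF K_in[of x] K_in[of y], of j k]
      by (simp add: norm_PK field_simps)
  next
    fix u f
    show "u \<in> DT \<and> T u = f \<longleftrightarrow> (\<exists>x. u = K x \<and> x + V x = K f)"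
      unfolding T_iff_form
    proof
      assume u: "u \<in> DB \<and> (\<forall>g\<in>DB. t u g = cinner f g)"
      then have Ku: "K (B u) = u"
        using K_B by blast
      have "B u + V (B u) = K f"
      proof (rule cinner_eqI)
        fix y
        have "cinner f (K y) = t u (K y)"
          using u K_in by simp
        also have "\<dots> = cinner (B u) y + v (K (B u)) (K y)"
          by (simp add: t B_K Ku)
        finally show "cinner (B u + V (B u)) y = cinner (K f) y"
          by (simp add: K_sym cinner_add_left V)
      qed
      then show "\<exists>x. u = K x \<and> x + V x = K f"
        using Ku by metis
    next
      assume "\<exists>x. u = K x \<and> x + V x = K f"
      then obtain x where x: "u = K x" "x + V x = K f" by blast
      have "t u g = cinner f g" if "g \<in> DB" for g
      proof -
        have "t u g = t (K x) (K (B g))"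
          by (simp add: x K_B[OF that])
        also have "\<dots> = cinner (x + V x) (B g)"
          by (simp add: t B_K V cinner_add_left)
        also have "\<dots> = cinner f g"
          by (simp add: x(2) K_sym K_B[OF that])
        finally show ?thesis .
      qed
      then show "u \<in> DB \<and> (\<forall>g\<in>DB. t u g = cinner f g)"
        using x(1) K_in by auto
    qed
  qed (use m_pos m_mono assms V in auto)
  then show ?thesis by blast
qed

end

section \<open>The resolvent of the perturbed operator\<close>

context orth_family
begin

text \<open>Finite for square-summable \<open>a\<close>, by Cauchy-Schwarz. If the blocks of an
  operator are bounded by \<open>a j * a k\<close>, its form is bounded by a product of two such
  sums, as for an operator of rank one.\<close>

definition weighted_norm :: "(nat \<Rightarrow> real) \<Rightarrow> 'h \<Rightarrow> real" where
  "weighted_norm a x = (\<Sum>k. a k * norm (P k x))"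

lemma weighted_norm_P:
  "weighted_norm a (P j x) = a j * norm (P j x)"
proof -
  have "(\<lambda>k. a k * norm (P k (P j x))) = (\<lambda>k. if k = j then a k * norm (P k x) else 0)"
    by (auto simp: P_orth P_idem)
  then show ?thesis
    unfolding weighted_norm_def using sums_unique[OF sums_single[of j "\<lambda>k. a k * norm (P k x)"]]
    by simp
qed

context
  fixes a :: "nat \<Rightarrow> real"
  assumes a: "\<And>k. 0 \<le> a k" and a_summable: "summable (\<lambda>k. (a k)\<^sup>2)"
begin

lemma weighted_norm_partial_le:
  assumes "finite I"
  shows "(\<Sum>k\<in>I. a k * norm (P k x))\<^sup>2 \<le> (\<Sum>k. (a k)\<^sup>2) * (norm x)\<^sup>2"
proof -
  have "(\<Sum>k\<in>I. a k * norm (P k x))\<^sup>2 \<le> (\<Sum>k\<in>I. (a k)\<^sup>2) * (\<Sum>k\<in>I. (norm (P k x))\<^sup>2)"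
    by (rule Cauchy_Schwarz_ineq_sum)
  also have "\<dots> \<le> (\<Sum>k. (a k)\<^sup>2) * (\<Sum>k. (norm (P k x))\<^sup>2)"
    using assms a_summable norm_P_summable
    by (intro mult_mono sum_le_suminf suminf_nonneg sum_nonneg) auto
  also have "(\<Sum>k. (norm (P k x))\<^sup>2) = (norm x)\<^sup>2"
    using norm_P_sums by (metis sums_unique)
  finally show ?thesis .
qed

lemma weighted_norm_summable: "summable (\<lambda>k. a k * norm (P k x))"
proof (rule summableI_nonneg_bounded)
  show "(\<Sum>k<n. a k * norm (P k x)) \<le> sqrt ((\<Sum>k. (a k)\<^sup>2) * (norm x)\<^sup>2)" for n
    using weighted_norm_partial_le[of "{..<n}" x] by (intro real_le_rsqrt) auto
qed (simp add: a)

lemma weighted_norm_nonneg: "0 \<le> weighted_norm a x"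
  unfolding weighted_norm_def by (intro suminf_nonneg weighted_norm_summable) (simp add: a)

lemma weighted_norm_power2_le: "(weighted_norm a x)\<^sup>2 \<le> (\<Sum>k. (a k)\<^sup>2) * (norm x)\<^sup>2"
proof -
  have "(\<lambda>n. (\<Sum>k<n. a k * norm (P k x))\<^sup>2) \<longlonglongrightarrow> (weighted_norm a x)\<^sup>2"
    unfolding weighted_norm_def by (intro tendsto_intros summable_LIMSEQ weighted_norm_summable)
  then show ?thesis
    by (rule LIMSEQ_le_const2) (auto intro: weighted_norm_partial_le)
qed

lemma weighted_norm_triangle: "weighted_norm a (x + y) \<le> weighted_norm a x + weighted_norm a y"
proof -
  have "weighted_norm a (x + y) \<le> (\<Sum>k. a k * norm (P k x) + a k * norm (P k y))"
    unfolding weighted_norm_def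
  proof (intro suminf_le summable_add weighted_norm_summable)
    show "a k * norm (P k (x + y)) \<le> a k * norm (P k x) + a k * norm (P k y)" for k
      using mult_left_mono[OF norm_triangle_ineq[of "P k x" "P k y"] a[of k]]
      by (simp add: bounded_clinear_add[OF P_bounded] distrib_left)
  qed
  also have "\<dots> = weighted_norm a x + weighted_norm a y"
    unfolding weighted_norm_def by (intro suminf_add[symmetric] weighted_norm_summable)
  finally show ?thesis .
qed

context
  fixes Y :: "'h \<Rightarrow> 'h"
  assumes Y: "bounded_clinear Y"
    and Y_entries: "\<And>j k x y. cmod (cinner (Y (P j x)) (P k y)) \<le>
      a j * a k * norm (P j x) * norm (P k y)"
begin

lemma dominated_form_bound: "cmod (cinner (Y x) y) \<le> weighted_norm a x * weighted_norm a y"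
proof -
  let ?s = "\<lambda>n x. \<Sum>j<n. P j x"
  have "(\<lambda>n. cmod (cinner (Y (?s n x)) (?s n y))) \<longlonglongrightarrow> cmod (cinner (Y x) y)"
    using P_sums[of x] P_sums[of y] unfolding sums_def
    by (intro tendsto_norm cinner.tendsto bounded_clinear_tendsto[OF Y])
  moreover have "cmod (cinner (Y (?s n x)) (?s n y)) \<le> weighted_norm a x * weighted_norm a y" for n
  proof -
    have "cinner (Y (?s n x)) (?s n y) = (\<Sum>j<n. \<Sum>k<n. cinner (Y (P j x)) (P k y))"
      by (simp add: bounded_clinear_sum[OF Y] cinner.sum_left cinner.sum_right) (rule sum.swap)
    also have "cmod \<dots> \<le> (\<Sum>j<n. \<Sum>k<n. (a j * norm (P j x)) * (a k * norm (P k y)))"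
      using Y_entries by (intro sum_norm_le) (simp add: mult_ac)
    also have "\<dots> = (\<Sum>j<n. a j * norm (P j x)) * (\<Sum>k<n. a k * norm (P k y))"
      by (simp add: sum_product)
    also have "\<dots> \<le> weighted_norm a x * weighted_norm a y"
      unfolding weighted_norm_def
      using a by (intro mult_mono sum_le_suminf suminf_nonneg weighted_norm_summable sum_nonneg) auto
    finally show ?thesis .
  qed
  ultimately show ?thesis
    by (intro LIMSEQ_le_const2) auto
qed

lemma dominated_norm_le: "norm (Y x) \<le> (\<Sum>k. (a k)\<^sup>2) * norm x"
proof (cases "Y x = 0")
  case True
  then show ?thesis
    using a_summable by (simp add: suminf_nonneg)
next
  case False
  have wn: "weighted_norm a z \<le> sqrt (\<Sum>k. (a k)\<^sup>2) * norm z" for z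
  proof (rule power2_le_imp_le)
    show "(weighted_norm a z)\<^sup>2 \<le> (sqrt (\<Sum>k. (a k)\<^sup>2) * norm z)\<^sup>2"
      using weighted_norm_power2_le[of z] suminf_nonneg[OF a_summable] by (simp add: power_mult_distrib)
    show "0 \<le> sqrt (\<Sum>k. (a k)\<^sup>2) * norm z"
      using suminf_nonneg[OF a_summable] by simp
  qed
  have "(norm (Y x))\<^sup>2 = cmod (cinner (Y x) (Y x))"
    by (simp add: cinner_self norm_power)
  also have "\<dots> \<le> weighted_norm a x * weighted_norm a (Y x)"
    by (rule dominated_form_bound)
  also have "\<dots> \<le> (sqrt (\<Sum>k. (a k)\<^sup>2) * norm x) * (sqrt (\<Sum>k. (a k)\<^sup>2) * norm (Y x))"
    using suminf_nonneg[OF a_summable] by (intro mult_mono wn weighted_norm_nonneg) auto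
  also have "\<dots> = (\<Sum>k. (a k)\<^sup>2) * norm x * norm (Y x)"
    using suminf_nonneg[OF a_summable] by (simp add: mult_ac)
  finally show ?thesis
    using False by (simp add: power2_eq_square)
qed

lemma dominated_norm_P_le: "norm (P j (Y x)) \<le> a j * weighted_norm a x"
proof (cases "P j (Y x) = 0")
  case True
  then show ?thesis
    using a weighted_norm_nonneg by simp
next
  case False
  have "cinner (Y x) (P j (Y x)) = cinner (P j (Y x)) (P j (Y x))"
    by (metis P_sym P_idem)
  then have "(norm (P j (Y x)))\<^sup>2 = cmod (cinner (Y x) (P j (Y x)))"
    by (simp add: cinner_self norm_power)
  also have "\<dots> \<le> weighted_norm a x * (a j * norm (P j (Y x)))"
    using dominated_form_bound[of x "P j (Y x)"] by (simp add: weighted_norm_P)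
  finally show ?thesis
    using False by (simp add: power2_eq_square mult_ac)
qed

text \<open>A bound in the weighted norm itself, not only in the norm of the space, is what lets the
  solution of \<open>y = y0 + Y y\<close> inherit the product form of the estimate.\<close>

lemma dominated_weighted_norm_le: "weighted_norm a (Y x) \<le> (\<Sum>k. (a k)\<^sup>2) * weighted_norm a x"
proof -
  have "weighted_norm a (Y x) \<le> (\<Sum>k. (a k)\<^sup>2 * weighted_norm a x)"
    unfolding weighted_norm_def[of a "Y x"]
  proof (intro suminf_le weighted_norm_summable summable_mult2 a_summable)
    show "a k * norm (P k (Y x)) \<le> (a k)\<^sup>2 * weighted_norm a x" for k
      using mult_left_mono[OF dominated_norm_P_le[of k x] a[of k]] by (simp add: power2_eq_square mult_ac)
  qed
  also have "\<dots> = (\<Sum>k. (a k)\<^sup>2) * weighted_norm a x"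
    by (rule suminf_mult2[OF a_summable, symmetric])
  finally show ?thesis .
qed

end
end
end

section \<open>The resolvent estimate\<close>

context perturbed_diagonal
begin

abbreviation K where "K \<equiv> inv_sqrt_diag m"

definition eps :: "complex \<Rightarrow> real" where
  "eps z = (\<Sum>k. (w k)\<^sup>2 / cmod (z - of_real (m k)))"

text \<open>In \<open>resolvent_estimate\<close> this is the weighted norm of
  \<open>L (K f)\<close>: the weights there have the square root of the distance in the denominator,
  and \<open>L (K f)\<close> contributes a second one.\<close>

definition alpha :: "complex \<Rightarrow> 'h \<Rightarrow> real" where
  "alpha z = weighted_norm (\<lambda>k. w k / cmod (z - of_real (m k)))"

lemma far_from_z: "\<exists>N. \<forall>k\<ge>N. m k \<le> 2 * cmod (z - of_real (m k))"
proof -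
  obtain N where N: "\<And>k. k \<ge> N \<Longrightarrow> 2 * cmod z \<le> m k"
    using m_lim unfolding filterlim_at_top eventually_sequentially by metis
  have "m k \<le> 2 * cmod (z - of_real (m k))" if "k \<ge> N" for k
    using N[OF that] norm_triangle_ineq2[of "complex_of_real (m k)" z] m_pos[of k]
    by (simp add: norm_minus_commute)
  then show ?thesis by blast
qed

text \<open>No condition on \<open>z\<close> is imposed: at an eigenvalue the quotient is 0 because
  division by zero gives zero, and for large \<open>k\<close> it is at most 2.\<close>

lemma ratio_bounded: "\<exists>C\<ge>0. \<forall>k. m k / cmod (z - of_real (m k)) \<le> C"
proof -
  obtain N where N: "\<And>k. k \<ge> N \<Longrightarrow> m k \<le> 2 * cmod (z - of_real (m k))"
    using far_from_z by blast
  define C where "C = 2 + (\<Sum>k<N. m k / cmod (z - of_real (m k)))"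
  have pos: "0 \<le> m k / cmod (z - of_real (m k))" for k
    using m_pos[of k] by simp
  have "m k / cmod (z - of_real (m k)) \<le> C" for k
  proof (cases "k < N")
    case True
    then have "m k / cmod (z - of_real (m k)) \<le> (\<Sum>k<N. m k / cmod (z - of_real (m k)))"
      using pos by (intro member_le_sum) auto
    then show ?thesis by (simp add: C_def)
  next
    case False
    then have "m k / cmod (z - of_real (m k)) \<le> 2"
      using N[of k] m_pos[of k] by (auto simp: divide_le_eq not_less)
    then show ?thesis
      using sum_nonneg[of "{..<N}" "\<lambda>k. m k / cmod (z - of_real (m k))"] pos by (simp add: C_def)
  qed
  moreover have "C \<ge> 0"
    unfolding C_def using pos by (intro add_nonneg_nonneg sum_nonneg) auto
  ultimately show ?thesis by blast
qed

lemma eps_summable: "summable (\<lambda>k. (w k)\<^sup>2 / cmod (z - of_real (m k)))"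
proof -
  obtain C where C: "\<And>k. m k / cmod (z - of_real (m k)) \<le> C"
    using ratio_bounded by blast
  show ?thesis
  proof (rule summable_comparison_test'[where N = 0])
    show "summable (\<lambda>k. C * ((w k)\<^sup>2 / m k))"
      by (intro summable_mult w_summable)
    fix k
    have "(w k)\<^sup>2 / cmod (z - of_real (m k)) = (m k / cmod (z - of_real (m k))) * ((w k)\<^sup>2 / m k)"
      using m_pos[of k] by simp
    also have "\<dots> \<le> C * ((w k)\<^sup>2 / m k)"
      using m_pos[of k] by (intro mult_right_mono C) auto
    finally show "norm ((w k)\<^sup>2 / cmod (z - of_real (m k))) \<le> C * ((w k)\<^sup>2 / m k)"
      by simp
  qed
qed

lemma eps_nonneg: "0 \<le> eps z"
  unfolding eps_def by (intro suminf_nonneg eps_summable) simp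

lemma m_ge: "m 0 \<le> m k"
  using strict_mono_less_eq[OF m_mono, of 0 k] by simp

lemma inverse_dist_bounded: "\<exists>C\<ge>0. \<forall>k. 1 / cmod (z - of_real (m k)) \<le> C"
proof -
  obtain C where C: "C \<ge> 0" "\<And>k. m k / cmod (z - of_real (m k)) \<le> C"
    using ratio_bounded by blast
  have "1 / cmod (z - of_real (m k)) \<le> C / m 0" for k
  proof -
    have "m 0 * (1 / cmod (z - of_real (m k))) \<le> m k * (1 / cmod (z - of_real (m k)))"
      using m_ge by (intro mult_right_mono) auto
    also have "\<dots> \<le> C"
      using C(2)[of k] by simp
    finally show ?thesis
      using m_pos[of 0] by (simp add: pos_le_divide_eq mult.commute)
  qed
  then show ?thesis
    using C(1) m_pos[of 0] by (intro exI[of _ "C / m 0"]) auto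
qed

lemma alpha_weights_nonneg: "0 \<le> w k / cmod (z - of_real (m k))"
  using w_nonneg by simp

lemma alpha_weights_summable: "summable (\<lambda>k. (w k / cmod (z - of_real (m k)))\<^sup>2)"
proof -
  obtain C where C: "\<And>k. 1 / cmod (z - of_real (m k)) \<le> C"
    using inverse_dist_bounded by blast
  show ?thesis
  proof (rule summable_comparison_test'[where N = 0])
    show "summable (\<lambda>k. C * ((w k)\<^sup>2 / cmod (z - of_real (m k))))"
      by (intro summable_mult eps_summable)
    fix k
    have "(w k / cmod (z - of_real (m k)))\<^sup>2 =
        1 / cmod (z - of_real (m k)) * ((w k)\<^sup>2 / cmod (z - of_real (m k)))"
      by (simp add: power2_eq_square)
    also have "\<dots> \<le> C * ((w k)\<^sup>2 / cmod (z - of_real (m k)))"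
      by (intro mult_right_mono C) auto
    finally show "norm ((w k / cmod (z - of_real (m k)))\<^sup>2) \<le> C * ((w k)\<^sup>2 / cmod (z - of_real (m k)))"
      by simp
  qed
qed

lemmas alpha_nonneg = weighted_norm_nonneg[OF alpha_weights_nonneg alpha_weights_summable,
    folded alpha_def]

definition R0 :: "complex \<Rightarrow> 'h \<Rightarrow> 'h" where
  "R0 z = diag (\<lambda>k. 1 / (z - of_real (m k)))"

lemma R0_bounded_weights: "\<exists>C\<ge>0. \<forall>k. cmod (1 / (z - of_real (m k))) \<le> C"
  using inverse_dist_bounded[of z] by (simp add: norm_divide)

lemma R0_bounded: "bounded_clinear (R0 z)"
proof -
  obtain C where C: "\<And>k. cmod (1 / (z - of_real (m k))) \<le> C"
    using R0_bounded_weights by blast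
  show ?thesis
    unfolding R0_def by (rule bounded_clinear_diag[OF C])
qed

lemma P_R0: "P k (R0 z x) = (1 / (z - of_real (m k))) *\<^sub>C P k x"
proof -
  obtain C where C: "\<And>k. cmod (1 / (z - of_real (m k))) \<le> C"
    using R0_bounded_weights by blast
  show ?thesis
    unfolding R0_def by (rule P_diag[OF C])
qed

lemma K_weights: "cmod (complex_of_real (1 / sqrt (m k))) \<le> 1 / sqrt (m 0)"
proof -
  have "sqrt (m 0) \<le> sqrt (m k)"
    using m_ge by simp
  then show ?thesis
    using m_pos[of 0] m_pos[of k] by (simp add: frac_le norm_divide)
qed

lemma P_K: "P k (K x) = complex_of_real (1 / sqrt (m k)) *\<^sub>C P k x"
  unfolding inv_sqrt_diag_def by (rule P_diag[OF K_weights])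

lemma K_bounded: "bounded_clinear K"
  unfolding inv_sqrt_diag_def by (rule bounded_clinear_diag[OF K_weights])

text \<open>
  With \<open>L = diag (sqrt (m / (z - m)))\<close> the equation \<open>(z - T) u = f\<close> becomes \<open>y - L V L y = L K f\<close>,
  \<open>u = K L y\<close>, and \<open>L V L\<close> is a contraction whenever \<open>eps z < 1\<close>.
\<close>

lemma resolvent_estimate:
  assumes z: "\<And>k. z \<noteq> of_real (m k)" and eps: "eps z < 1"
  shows "z \<in> resolvent_set D T"
    and "cmod (cinner (op_resolvent D T z f - R0 z f) g) \<le> alpha z f * alpha z g / (1 - eps z)"
proof -
  \<comment> \<open>Complex square roots, so \<open>L\<close> is in general not self-adjoint; on the
    other side of the form its adjoint appears, with the conjugate weights.\<close>
  define l where "l k = csqrt (of_real (m k) / (z - of_real (m k)))" for k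
  have l2: "l k * l k = of_real (m k) / (z - of_real (m k))" for k
    by (simp add: l_def flip: power2_eq_square)
  have l0: "l k \<noteq> 0" for k
    using z[of k] m_pos[of k] by (simp add: l_def)
  have norm_l: "cmod (l k) = sqrt (m k) / sqrt (cmod (z - of_real (m k)))" for k
  proof -
    have "(cmod (l k))\<^sup>2 = m k / cmod (z - of_real (m k))"
      using arg_cong[OF l2[of k], of cmod] m_pos[of k]
      by (simp add: norm_mult norm_divide power2_eq_square)
    then show ?thesis
      by (metis norm_ge_zero real_sqrt_divide real_sqrt_unique)
  qed
  obtain C where C: "C \<ge> 0" "\<And>k. m k / cmod (z - of_real (m k)) \<le> C"
    using ratio_bounded by blast
  have l_le: "cmod (l k) \<le> sqrt C" for k
    using C(2)[of k] by (simp add: norm_l flip: real_sqrt_divide)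
  have li_le: "cmod (1 / l k) \<le> sqrt (cmod z / m 0 + 1)" for k
  proof -
    have "cmod (1 / l k) = sqrt (cmod (z - of_real (m k)) / m k)"
      by (simp add: norm_divide norm_l real_sqrt_divide)
    also have "cmod (z - of_real (m k)) / m k \<le> (cmod z + m k) / m k"
      using norm_triangle_ineq4[of z "of_real (m k)"] m_pos[of k] by (intro divide_right_mono) auto
    also have "(cmod z + m k) / m k = cmod z / m k + 1"
      using m_pos[of k] by (simp add: field_simps)
    also have "cmod z / m k \<le> cmod z / m 0"
      using m_ge[of k] m_pos[of 0] by (intro divide_left_mono) auto
    finally show ?thesis by simp
  qed
  define L where "L = diag l"
  define L' where "L' = diag (\<lambda>k. 1 / l k)"
  have PL: "P k (L x) = l k *\<^sub>C P k x" and PL': "P k (L' x) = (1 / l k) *\<^sub>C P k x" for k x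
    unfolding L_def L'_def by (rule P_diag[OF l_le] P_diag[OF li_le])+
  have L: "bounded_clinear L" and L': "bounded_clinear L'"
    unfolding L_def L'_def by (rule bounded_clinear_diag[OF l_le] bounded_clinear_diag[OF li_le])+
  have LL': "L (L' x) = x" and L'L: "L' (L x) = x" for x
    by (rule P_ext, simp add: PL PL' l0)+
  \<comment> \<open>With \<open>u = K x\<close> the equation \<open>z *\<^sub>C u - T u = f\<close>
    reads \<open>z *\<^sub>C K (K x) - x - V x = K f\<close>; its first two terms form the square of
    the diagonal operator \<open>L'\<close>.\<close>
  have M0: "L' (L' x) = z *\<^sub>C K (K x) - x" for x
  proof (rule P_ext)
    fix k
    have "1 / (l k * l k) = z / of_real (m k) - 1"
      unfolding l2 using m_pos[of k] by (simp add: field_simps)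
    moreover have "complex_of_real (1 / sqrt (m k)) * complex_of_real (1 / sqrt (m k)) = 1 / of_real (m k)"
      using m_pos[of k] by (simp flip: of_real_mult)
    ultimately show "P k (L' (L' x)) = P k (z *\<^sub>C K (K x) - x)"
      by (simp add: PL' P_K bounded_clinear_diff[OF P_bounded] bounded_clinear_scaleC[OF P_bounded]
          scaleC.diff_left del: of_real_divide)
  qed
  have KLLK: "K (L (L (K x))) = R0 z x" for x
  proof (rule P_ext)
    fix k
    have "complex_of_real (1 / sqrt (m k)) * complex_of_real (1 / sqrt (m k)) = 1 / of_real (m k)"
      using m_pos[of k] by (simp flip: of_real_mult)
    then have "complex_of_real (1 / sqrt (m k)) * (l k * (l k * complex_of_real (1 / sqrt (m k)))) =
        1 / (z - of_real (m k))"
      using l2[of k] m_pos[of k] by (simp add: mult_ac del: of_real_divide)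
    then show "P k (K (L (L (K x)))) = P k (R0 z x)"
      by (simp add: P_K PL P_R0 scaleC_scaleC del: of_real_divide)
  qed
  define Y where "Y x = L (V (L x))" for x
  have Y: "bounded_clinear Y"
    unfolding Y_def by (rule bounded_clinear_compose[OF L bounded_clinear_compose[OF V_bounded L]])
  define a where "a k = w k / sqrt (cmod (z - of_real (m k)))" for k
  have a: "0 \<le> a k" for k
    using w_nonneg by (simp add: a_def)
  have a2: "(a k)\<^sup>2 = (w k)\<^sup>2 / cmod (z - of_real (m k))" for k
    by (simp add: a_def power_divide)
  have a_summable: "summable (\<lambda>k. (a k)\<^sup>2)"
    unfolding a2 by (rule eps_summable)
  have eps_a: "(\<Sum>k. (a k)\<^sup>2) = eps z"
    by (simp add: a2 eps_def)
  have Y_entries: "cmod (cinner (Y (P j x)) (P k y)) \<le> a j * a k * norm (P j x) * norm (P k y)" for j k x y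
  proof -
    have "L (P j x) = l j *\<^sub>C P j x"
    proof (rule P_ext)
      show "P k (L (P j x)) = P k (l j *\<^sub>C P j x)" for k
        by (cases "k = j") (simp_all add: PL P_idem P_orth bounded_clinear_scaleC[OF P_bounded])
    qed
    moreover have "cinner (L x) (P k y) = l k * cinner x (P k y)" for x
    proof -
      have "cinner (L x) (P k y) = cinner (P k (L x)) (P k y)"
        by (simp add: P_sym P_idem)
      then show ?thesis
        by (simp add: PL cinner_scaleC_left P_sym P_idem)
    qed
    ultimately have "cinner (Y (P j x)) (P k y) = l k * l j * cinner (V (P j x)) (P k y)"
      by (simp add: Y_def bounded_clinear_scaleC[OF V_bounded] cinner_scaleC_left)
    then have "cmod (cinner (Y (P j x)) (P k y)) \<le>
        cmod (l k) * cmod (l j) * (w j / sqrt (m j) * (w k / sqrt (m k)) * norm (P j x) * norm (P k y))"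
      using mult_left_mono[OF V_entries[of j x k y], of "cmod (l k) * cmod (l j)"] by (simp add: norm_mult)
    also have "\<dots> = a j * a k * norm (P j x) * norm (P k y)"
      using m_pos[of j] m_pos[of k] by (simp add: norm_l a_def field_simps)
    finally show ?thesis .
  qed
  note dom = a a_summable Y Y_entries
  have Y_le: "norm (Y x) \<le> eps z * norm x" for x
    using dominated_norm_le[OF dom, of x] by (simp add: eps_a)
  note bij = bij_id_minus_contraction[OF Y eps Y_le]
  define G where "G = inv (\<lambda>x. x - Y x)"
  have G: "bounded_clinear G" and G_eq: "G x - Y (G x) = x" and G_unique: "y - Y y = x \<Longrightarrow> G x = y" for x y
  proof -
    show "bounded_clinear G"
      unfolding G_def by (rule bij(2))
    show "G x - Y (G x) = x"
      unfolding G_def using surj_f_inv_f[OF bij_is_surj[OF bij(1)], of x] .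
    show "G x = y" if "y - Y y = x"
      unfolding G_def using that inv_f_f[OF bij_is_inj[OF bij(1)], of y] by simp
  qed
  define R where "R f = K (L (G (L (K f))))" for f
  note K_linear = bounded_clinear_diff[OF K_bounded] bounded_clinear_scaleC[OF K_bounded]
  have R_right: "R f \<in> D \<and> T (R f) = z *\<^sub>C R f - f" for f
    unfolding T_iff
  proof (intro exI conjI)
    define x where "x = L (G (L (K f)))"
    show "R f = K x" by (simp add: R_def x_def)
    have "L' (G (L (K f)) - Y (G (L (K f)))) = K f"
      unfolding G_eq by (rule L'L)
    then have "L' (L' x) - V x = K f"
      by (simp add: bounded_clinear_diff[OF L'] Y_def x_def L'L)
    then show "x + V x = K (z *\<^sub>C R f - f)"
      by (simp add: M0 K_linear R_def flip: x_def) (simp add: algebra_simps)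
  qed
  have R_left: "R (z *\<^sub>C u - T u) = u" if u: "u \<in> D" for u
  proof -
    obtain x where x: "u = K x" "x + V x = K (T u)"
      using T_iff[of u "T u"] u by blast
    have "L' (L' x) - V x = K (z *\<^sub>C u - T u)"
      using x by (simp add: M0 K_linear) (simp add: algebra_simps)
    then have "L (L' (L' x)) - L (V x) = L (K (z *\<^sub>C u - T u))"
      using bounded_clinear_diff[OF L] by metis
    then have "L' x - Y (L' x) = L (K (z *\<^sub>C u - T u))"
      by (simp add: LL' Y_def)
    then have "G (L (K (z *\<^sub>C u - T u))) = L' x"
      by (rule G_unique)
    then show ?thesis
      by (simp add: R_def LL' x(1))
  qed
  have R: "bounded_clinear R"
    unfolding R_def
    by (rule bounded_clinear_compose[OF K_bounded bounded_clinear_compose[OF L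
          bounded_clinear_compose[OF G bounded_clinear_compose[OF L K_bounded]]]])
  have bij_T: "bij_betw (\<lambda>f. z *\<^sub>C f - T f) D UNIV"
    by (rule bij_betw_byWitness[where f' = R]) (use R_left R_right in auto)
  have op_R: "op_resolvent D T z = R"
  proof
    show "op_resolvent D T z f = R f" for f
      unfolding op_resolvent_def
      by (rule inv_into_f_eq[OF bij_betw_imp_inj_on[OF bij_T]]) (use R_right in auto)
  qed
  show "z \<in> resolvent_set D T"
    using bij_T R by (simp add: resolvent_set_def op_R)
  define y0 where "y0 = L (K f)"
  define y where "y = G y0"
  have y: "y = y0 + Y y"
    using G_eq[of y0] by (simp add: y_def algebra_simps)
  \<comment> \<open>The last term is absorbed on the left, which produces the denominator
    \<open>1 - eps z\<close>.\<close>
  have "weighted_norm a y \<le> weighted_norm a y0 + eps z * weighted_norm a y"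
    using weighted_norm_triangle[OF a a_summable, of y0 "Y y"] dominated_weighted_norm_le[OF dom, of y] y
    by (simp add: eps_a)
  then have wy: "weighted_norm a y \<le> weighted_norm a y0 / (1 - eps z)"
    using eps by (simp add: field_simps)
  \<comment> \<open>The adjoint of \<open>L\<close> after \<open>K\<close>, applied to
    \<open>g\<close>; conjugation leaves the weighted norm unchanged.\<close>
  define h where "h = diag (\<lambda>k. cnj (l k)) (K g)"
  have ckl: "a k * (cmod (l k) * (norm (P k x) / sqrt (m k))) = w k / cmod (z - of_real (m k)) * norm (P k x)"
    for k x
    using m_pos[of k] by (simp add: norm_l a_def field_simps)
  have Ph: "P k h = cnj (l k) *\<^sub>C P k (K g)" for k
    unfolding h_def by (rule P_diag[where C = "sqrt C"]) (simp add: l_le)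
  have norm_PK: "norm (P k (K x)) = norm (P k x) / sqrt (m k)" for k x
    using m_pos[of k] by (simp add: P_K norm_scaleC norm_divide)
  have wy0: "weighted_norm a y0 = alpha z f"
    unfolding weighted_norm_def alpha_def y0_def PL norm_scaleC norm_PK ckl ..
  have wh: "weighted_norm a h = alpha z g"
    unfolding weighted_norm_def alpha_def Ph norm_scaleC complex_mod_cnj norm_PK ckl ..
  have K_sym: "cinner (K x) y = cinner x (K y)" for x y
    unfolding inv_sqrt_diag_def using cinner_diag[OF K_weights] by simp
  have "cinner (R f - R0 z f) g = cinner (K (L (Y y))) g"
  proof -
    have "R f = K (L y)"
      by (simp add: R_def y_def y0_def)
    also have "\<dots> = K (L y0) + K (L (Y y))"
      using y bounded_clinear_add[OF L] bounded_clinear_add[OF K_bounded] by metis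
    also have "K (L y0) = R0 z f"
      by (simp add: y0_def KLLK)
    finally show ?thesis by simp
  qed
  also have "\<dots> = cinner (Y y) h"
    unfolding K_sym L_def h_def by (rule cinner_diag[OF l_le])
  also have "cmod \<dots> \<le> weighted_norm a y * weighted_norm a h"
    by (rule dominated_form_bound[OF dom])
  also have "\<dots> \<le> alpha z f / (1 - eps z) * alpha z g"
    using wy unfolding wy0 wh by (intro mult_right_mono alpha_nonneg)
  finally show "cmod (cinner (op_resolvent D T z f - R0 z f) g) \<le> alpha z f * alpha z g / (1 - eps z)"
    unfolding op_R by (simp add: mult.commute)
qed

end

section \<open>Contour integrals\<close>

definition contour :: "(real \<Rightarrow> complex) \<Rightarrow> bool" where
  "contour \<gamma> \<longleftrightarrow> (\<exists>c r. 0 < r \<and> \<gamma> = circlepath c r) \<or> (\<exists>a b. \<gamma> = rectpath a b)"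

lemma contour_circlepath: "0 < r \<Longrightarrow> contour (circlepath c r)"
  and contour_rectpath: "contour (rectpath a b)"
  by (auto simp: contour_def)

lemma
  assumes "contour \<gamma>"
  shows contour_valid_path: "valid_path \<gamma>" and contour_closed: "pathfinish \<gamma> = pathstart \<gamma>"
    and contour_path: "path \<gamma>"
  using assms by (auto simp: contour_def valid_path_imp_path)

definition contour_piece :: "(real \<Rightarrow> complex) \<Rightarrow> bool" where
  "contour_piece p \<longleftrightarrow> (\<exists>c r. p = circlepath c r) \<or> (\<exists>a b. p = linepath a b)"

lemma
  assumes "contour_piece p"
  shows contour_piece_valid_path: "valid_path p"
    and contour_piece_derivative: "continuous_on {0..1} (\<lambda>t. vector_derivative p (at t))"
    and contour_piece_integrable: "continuous_on (path_image p) f \<Longrightarrow> f contour_integrable_on p"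
proof -
  consider c r where "p = circlepath c r" | a b where "p = linepath a b"
    using assms by (auto simp: contour_piece_def)
  note cases = this
  show "valid_path p"
    by (cases rule: cases) auto
  show "continuous_on {0..1} (\<lambda>t. vector_derivative p (at t))"
    by (cases rule: cases) (auto simp: vector_derivative_circlepath intro!: continuous_intros)
  show "f contour_integrable_on p" if "continuous_on (path_image p) f"
    using that by (cases rule: cases)
      (auto intro: contour_integrable_continuous_circlepath contour_integrable_continuous_linepath)
qed

text \<open>A rectangle, as one path, has a derivative with jumps. Cutting it into its sides
  restores the continuous derivative that exchanging two contour integrals requires.\<close>

lemma contour_pieces:
  assumes "contour \<gamma>"
  obtains ps where "\<And>p. p \<in> set ps \<Longrightarrow> contour_piece p \<and> path_image p \<subseteq> path_image \<gamma>"
    and "\<And>f. continuous_on (path_image \<gamma>) f \<Longrightarrow>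
      f contour_integrable_on \<gamma> \<and> contour_integral \<gamma> f = (\<Sum>p\<leftarrow>ps. contour_integral p f)"
proof -
  consider c r where "\<gamma> = circlepath c r" | a b where "\<gamma> = rectpath a b"
    using assms by (auto simp: contour_def)
  then show thesis
  proof cases
    case 1
    then show ?thesis
      by (intro that[of "[\<gamma>]"]) (auto simp: contour_piece_def intro: contour_integrable_continuous_circlepath)
  next
    case (2 a b)
    define c d where "c = Complex (Re b) (Im a)" and "d = Complex (Re a) (Im b)"
    have \<gamma>: "\<gamma> = linepath a c +++ linepath c b +++ linepath b d +++ linepath d a"
      by (simp add: 2 rectpath_def c_def d_def Let_def)
    have img: "path_image \<gamma> = closed_segment a c \<union> closed_segment c b \<union> closed_segment b d \<union> closed_segment d a"
      by (auto simp: \<gamma> path_image_join)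
    show ?thesis
    proof (rule that[of "[linepath a c, linepath c b, linepath b d, linepath d a]"])
      fix f :: "complex \<Rightarrow> complex"
      assume f: "continuous_on (path_image \<gamma>) f"
      have "f contour_integrable_on linepath a c" "f contour_integrable_on linepath c b"
        "f contour_integrable_on linepath b d" "f contour_integrable_on linepath d a"
        by (intro contour_integrable_continuous_linepath continuous_on_subset[OF f], auto simp: img)+
      then show "f contour_integrable_on \<gamma> \<and> contour_integral \<gamma> f =
          (\<Sum>p\<leftarrow>[linepath a c, linepath c b, linepath b d, linepath d a]. contour_integral p f)"
        by (simp add: \<gamma> valid_path_join)
    qed (auto simp: contour_piece_def img)
  qed
qed

lemma contour_integrable_continuous:
  "contour \<gamma> \<Longrightarrow> continuous_on (path_image \<gamma>) f \<Longrightarrow> f contour_integrable_on \<gamma>"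
  using contour_pieces by metis

text \<open>A Cauchy integral is even differentiable off its path, by differentiation under the
  integral sign.\<close>

lemma Cauchy_kernel_continuous:
  assumes p: "contour_piece p" and h: "continuous_on (path_image p) h"
  shows "continuous_on (- path_image p) (\<lambda>z. contour_integral p (\<lambda>w. h w / (w - z)))"
proof -
  let ?G = "\<lambda>z. contour_integral p (\<lambda>w. h w / (w - z))"
  have "compact ((\<lambda>t. vector_derivative p (at t)) ` {0..1})"
    by (intro compact_continuous_image contour_piece_derivative p) auto
  then obtain B where B: "\<And>t. t \<in> {0..1} \<Longrightarrow> norm (vector_derivative p (at t)) \<le> B"
    by (meson bounded_iff compact_imp_bounded image_eqI)
  have "(?G has_field_derivative (of_nat 1 * contour_integral p (\<lambda>u. h u / (u - z) ^ Suc 1))) (at z)"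
    if z: "z \<in> UNIV - path_image p" for z
  proof (rule Cauchy_next_derivative(2)[where S = UNIV and B = B, OF h B _ _ _ _ z])
    fix w assume "w \<in> UNIV - path_image p"
    then have "(\<lambda>u. h u / (u - w) ^ 1) contour_integrable_on p"
      by (intro contour_piece_integrable p continuous_intros h) auto
    then show "((\<lambda>u. h u / (u - w) ^ 1) has_contour_integral ?G w) p"
      using has_contour_integral_integral by fastforce
  qed (use contour_piece_valid_path[OF p] in auto)
  then show ?thesis
    by (intro continuous_at_imp_continuous_on ballI DERIV_isCont) auto
qed

lemma continuous_on_sum_list:
  fixes f :: "'a \<Rightarrow> 'b::topological_space \<Rightarrow> 'c::topological_monoid_add"
  assumes "\<And>x. x \<in> set xs \<Longrightarrow> continuous_on S (f x)"
  shows "continuous_on S (\<lambda>y. \<Sum>x\<leftarrow>xs. f x y)"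
  using assms by (induction xs) (auto intro!: continuous_intros)

lemma contour_integral_sum_list:
  assumes "\<And>x. x \<in> set xs \<Longrightarrow> f x contour_integrable_on p"
  shows "contour_integral p (\<lambda>y. \<Sum>x\<leftarrow>xs. f x y) = (\<Sum>x\<leftarrow>xs. contour_integral p (f x))"
    and "(\<lambda>y. \<Sum>x\<leftarrow>xs. f x y) contour_integrable_on p"
proof -
  have "(\<lambda>y. \<Sum>x\<leftarrow>xs. f x y) contour_integrable_on p \<and>
      contour_integral p (\<lambda>y. \<Sum>x\<leftarrow>xs. f x y) = (\<Sum>x\<leftarrow>xs. contour_integral p (f x))"
    using assms
  proof (induction xs)
    case (Cons a xs)
    then show ?case
      by (auto simp: contour_integral_add intro: contour_integrable_add)
  qed (auto simp: contour_integrable_on_def intro: has_contour_integral_0)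
  then show "contour_integral p (\<lambda>y. \<Sum>x\<leftarrow>xs. f x y) = (\<Sum>x\<leftarrow>xs. contour_integral p (f x))"
    "(\<lambda>y. \<Sum>x\<leftarrow>xs. f x y) contour_integrable_on p" by auto
qed

text \<open>The contours are disjoint, so the kernel is continuous on the product of two pieces and
  Fubini's theorem applies to each pair. The inner integral on the right is, up to a constant
  factor, a winding number.\<close>

lemma Cauchy_kernel_swap:
  assumes \<gamma>: "contour \<gamma>" and \<gamma>': "contour \<gamma>'" and disj: "path_image \<gamma> \<inter> path_image \<gamma>' = {}"
    and h: "continuous_on (path_image \<gamma>') h"
  shows "continuous_on (path_image \<gamma>) (\<lambda>z. contour_integral \<gamma>' (\<lambda>w. h w / (w - z)))"
    and "contour_integral \<gamma> (\<lambda>z. contour_integral \<gamma>' (\<lambda>w. h w / (w - z))) =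
      contour_integral \<gamma>' (\<lambda>w. h w * contour_integral \<gamma> (\<lambda>z. 1 / (w - z)))"
proof -
  obtain ps where ps: "\<And>p. p \<in> set ps \<Longrightarrow> contour_piece p \<and> path_image p \<subseteq> path_image \<gamma>"
    and int: "\<And>f. continuous_on (path_image \<gamma>) f \<Longrightarrow>
      f contour_integrable_on \<gamma> \<and> contour_integral \<gamma> f = (\<Sum>p\<leftarrow>ps. contour_integral p f)"
    using contour_pieces[OF \<gamma>] by metis
  obtain qs where qs: "\<And>p. p \<in> set qs \<Longrightarrow> contour_piece p \<and> path_image p \<subseteq> path_image \<gamma>'"
    and int': "\<And>f. continuous_on (path_image \<gamma>') f \<Longrightarrow>
      f contour_integrable_on \<gamma>' \<and> contour_integral \<gamma>' f = (\<Sum>p\<leftarrow>qs. contour_integral p f)"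
    using contour_pieces[OF \<gamma>'] by metis
  have kernel: "continuous_on (path_image \<gamma>') (\<lambda>w. h w / (w - z))" if "z \<in> path_image \<gamma>" for z
    using disj that by (intro continuous_intros h) auto
  have 1: "contour_integral \<gamma>' (\<lambda>w. h w / (w - z)) = (\<Sum>q\<leftarrow>qs. contour_integral q (\<lambda>w. h w / (w - z)))"
    if "z \<in> path_image \<gamma>" for z
    using int' kernel[OF that] by blast
  have hq: "continuous_on (path_image q) h" if "q \<in> set qs" for q
    using qs[OF that] h continuous_on_subset by blast
  have cont_q: "continuous_on (path_image \<gamma>) (\<lambda>z. contour_integral q (\<lambda>w. h w / (w - z)))"
    if "q \<in> set qs" for q
    using disj qs[OF that]
    by (intro continuous_on_subset[OF Cauchy_kernel_continuous[OF _ hq[OF that]]]) auto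
  then have "continuous_on (path_image \<gamma>) (\<lambda>z. \<Sum>q\<leftarrow>qs. contour_integral q (\<lambda>w. h w / (w - z)))"
    by (rule continuous_on_sum_list)
  then show cont: "continuous_on (path_image \<gamma>) (\<lambda>z. contour_integral \<gamma>' (\<lambda>w. h w / (w - z)))"
    using 1 by (simp cong: continuous_on_cong)
  have swap: "contour_integral p (\<lambda>z. contour_integral q (\<lambda>w. h w / (w - z))) =
      contour_integral q (\<lambda>w. h w * contour_integral p (\<lambda>z. 1 / (w - z)))"
    if p: "p \<in> set ps" and q: "q \<in> set qs" for p q
  proof -
    have pq: "path_image p \<inter> path_image q = {}"
      using ps[OF p] qs[OF q] disj by blast
    have "contour_integral p (\<lambda>z. contour_integral q (\<lambda>w. h w / (w - z))) =
        contour_integral q (\<lambda>w. contour_integral p (\<lambda>z. h w / (w - z)))"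
    proof (rule contour_integral_swap)
      have "continuous_on (path_image p \<times> path_image q) (\<lambda>x. h (snd x) / (snd x - fst x))"
        using pq by (intro continuous_intros continuous_on_compose2[OF hq[OF q]]) auto
      then show "continuous_on (path_image p \<times> path_image q) (\<lambda>(z, w). h w / (w - z))"
        by (simp add: case_prod_unfold)
    qed (use ps[OF p] qs[OF q] contour_piece_valid_path contour_piece_derivative in auto)
    also have "\<dots> = contour_integral q (\<lambda>w. h w * contour_integral p (\<lambda>z. 1 / (w - z)))"
    proof (rule contour_integral_cong[OF refl])
      fix w assume w: "w \<in> path_image q"
      have "(\<lambda>z. 1 / (w - z)) contour_integrable_on p"
        using w pq ps[OF p] by (intro contour_piece_integrable continuous_intros) auto
      from contour_integral_lmul[OF this, of "h w"]
      show "contour_integral p (\<lambda>z. h w / (w - z)) = h w * contour_integral p (\<lambda>z. 1 / (w - z))"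
        by simp
    qed
    finally show ?thesis .
  qed
  have int_inv: "contour_integral \<gamma> (\<lambda>z. 1 / (w - z)) = (\<Sum>p\<leftarrow>ps. contour_integral p (\<lambda>z. 1 / (w - z)))"
    if "w \<in> path_image \<gamma>'" for w
  proof -
    have "w \<notin> path_image \<gamma>"
      using that disj by blast
    then have "continuous_on (path_image \<gamma>) (\<lambda>z. 1 / (w - z))"
      by (auto intro!: continuous_intros)
    then show ?thesis
      using int by blast
  qed
  have inv_cont: "continuous_on (path_image \<gamma>') (\<lambda>w. contour_integral p (\<lambda>z. 1 / (w - z)))" if "p \<in> set ps" for p
  proof -
    have "continuous_on (path_image \<gamma>') (\<lambda>w. contour_integral p (\<lambda>z. - 1 / (z - w)))"
      using disj ps[OF that]
      by (intro continuous_on_subset[OF Cauchy_kernel_continuous[of p "\<lambda>_. - 1"]]) auto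
    moreover have "- 1 / (z - w) = 1 / (w - z)" for z w :: complex
      by (metis minus_diff_eq minus_divide_divide minus_minus)
    ultimately show ?thesis
      by simp
  qed
  have "contour_integral \<gamma> (\<lambda>z. contour_integral \<gamma>' (\<lambda>w. h w / (w - z))) =
      (\<Sum>p\<leftarrow>ps. contour_integral p (\<lambda>z. contour_integral \<gamma>' (\<lambda>w. h w / (w - z))))"
    using int[OF cont] by blast
  also have "\<dots> = (\<Sum>p\<leftarrow>ps. \<Sum>q\<leftarrow>qs. contour_integral p (\<lambda>z. contour_integral q (\<lambda>w. h w / (w - z))))"
  proof (rule arg_cong[where f = sum_list], rule map_cong[OF refl])
    fix p assume p: "p \<in> set ps"
    have "contour_integral p (\<lambda>z. contour_integral \<gamma>' (\<lambda>w. h w / (w - z))) =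
        contour_integral p (\<lambda>z. \<Sum>q\<leftarrow>qs. contour_integral q (\<lambda>w. h w / (w - z)))"
      using 1 ps[OF p] by (intro contour_integral_cong) auto
    also have "\<dots> = (\<Sum>q\<leftarrow>qs. contour_integral p (\<lambda>z. contour_integral q (\<lambda>w. h w / (w - z))))"
      using ps[OF p] cont_q
      by (intro contour_integral_sum_list contour_piece_integrable) (auto intro: continuous_on_subset)
    finally show "contour_integral p (\<lambda>z. contour_integral \<gamma>' (\<lambda>w. h w / (w - z))) =
        (\<Sum>q\<leftarrow>qs. contour_integral p (\<lambda>z. contour_integral q (\<lambda>w. h w / (w - z))))" .
  qed
  also have "\<dots> = (\<Sum>q\<leftarrow>qs. \<Sum>p\<leftarrow>ps. contour_integral p (\<lambda>z. contour_integral q (\<lambda>w. h w / (w - z))))"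
    by (induction ps) (simp_all add: sum_list_addf)
  also have "\<dots> = (\<Sum>q\<leftarrow>qs. \<Sum>p\<leftarrow>ps. contour_integral q (\<lambda>w. h w * contour_integral p (\<lambda>z. 1 / (w - z))))"
    using swap by (simp cong: map_cong)
  also have "\<dots> = (\<Sum>q\<leftarrow>qs. contour_integral q (\<lambda>w. h w * contour_integral \<gamma> (\<lambda>z. 1 / (w - z))))"
  proof (rule arg_cong[where f = sum_list], rule map_cong[OF refl])
    fix q assume q: "q \<in> set qs"
    have "contour_integral \<gamma> (\<lambda>z. 1 / (w - z)) = (\<Sum>p\<leftarrow>ps. contour_integral p (\<lambda>z. 1 / (w - z)))"
      if "w \<in> path_image q" for w
      using that qs[OF q] int_inv by blast
    then have "contour_integral q (\<lambda>w. h w * contour_integral \<gamma> (\<lambda>z. 1 / (w - z))) =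
        contour_integral q (\<lambda>w. \<Sum>p\<leftarrow>ps. h w * contour_integral p (\<lambda>z. 1 / (w - z)))"
      by (intro contour_integral_cong) (auto simp: sum_list_const_mult)
    also have "\<dots> = (\<Sum>p\<leftarrow>ps. contour_integral q (\<lambda>w. h w * contour_integral p (\<lambda>z. 1 / (w - z))))"
      using qs[OF q]
      by (intro contour_integral_sum_list contour_piece_integrable continuous_intros hq[OF q]
          continuous_on_subset[OF inv_cont]) auto
    finally show "(\<Sum>p\<leftarrow>ps. contour_integral q (\<lambda>w. h w * contour_integral p (\<lambda>z. 1 / (w - z)))) =
        contour_integral q (\<lambda>w. h w * contour_integral \<gamma> (\<lambda>z. 1 / (w - z)))" by simp
  qed
  also have "\<dots> = contour_integral \<gamma>' (\<lambda>w. h w * contour_integral \<gamma> (\<lambda>z. 1 / (w - z)))"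
  proof -
    have "continuous_on (path_image \<gamma>') (\<lambda>w. h w * contour_integral \<gamma> (\<lambda>z. 1 / (w - z)))"
    proof -
      have "continuous_on (path_image \<gamma>') (\<lambda>w. h w * (\<Sum>p\<leftarrow>ps. contour_integral p (\<lambda>z. 1 / (w - z))))"
        by (intro continuous_intros h continuous_on_sum_list inv_cont)
      moreover have "contour_integral \<gamma> (\<lambda>z. 1 / (w - z)) = (\<Sum>p\<leftarrow>ps. contour_integral p (\<lambda>z. 1 / (w - z)))"
        if "w \<in> path_image \<gamma>'" for w
        using that by (rule int_inv)
      ultimately show ?thesis
        by (simp cong: continuous_on_cong)
    qed
    then show ?thesis
      using int' by simp
  qed
  finally show "contour_integral \<gamma> (\<lambda>z. contour_integral \<gamma>' (\<lambda>w. h w / (w - z))) =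
      contour_integral \<gamma>' (\<lambda>w. h w * contour_integral \<gamma> (\<lambda>z. 1 / (w - z)))" .
qed

text \<open>Going along the first path, over \<open>q\<close> to the second, backwards along it and
  back over \<open>q\<close> gives one closed path whose winding number vanishes off
  \<open>S\<close>; the global Cauchy theorem applies to it and the two passages over
  \<open>q\<close> cancel.\<close>

lemma contour_integral_eq_of_winding_number:
  assumes S: "open S" and f: "f holomorphic_on S"
    and \<gamma>: "valid_path \<gamma>" "pathfinish \<gamma> = pathstart \<gamma>" "path_image \<gamma> \<subseteq> S"
    and \<gamma>': "valid_path \<gamma>'" "pathfinish \<gamma>' = pathstart \<gamma>'" "path_image \<gamma>' \<subseteq> S"
    and conn: "connected_component S (pathstart \<gamma>) (pathstart \<gamma>')"
    and wn: "\<And>z. z \<notin> S \<Longrightarrow> winding_number \<gamma> z = winding_number \<gamma>' z"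
  shows "contour_integral \<gamma> f = contour_integral \<gamma>' f"
proof -
  let ?C = "connected_component_set S (pathstart \<gamma>)"
  obtain q where q: "polynomial_function q" "path_image q \<subseteq> ?C"
    "pathstart q = pathstart \<gamma>" "pathfinish q = pathstart \<gamma>'"
  proof -
    have "pathstart \<gamma> \<in> S"
      using \<gamma> by auto
    then show ?thesis
      using connected_open_polynomial_connected[of ?C "pathstart \<gamma>" "pathstart \<gamma>'"] conn that
        open_connected_component[OF S] connected_connected_component connected_component_refl by blast
  qed
  have qS: "path_image q \<subseteq> S"
    using q(2) connected_component_subset by blast
  have vq: "valid_path q"
    using q(1) by (rule valid_path_polynomial_function)
  let ?g = "\<gamma> +++ (q +++ (reversepath \<gamma>' +++ reversepath q))"
  have valid: "valid_path ?g"
    using \<gamma> \<gamma>' q vq by (intro valid_path_join) auto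
  have img: "path_image ?g \<subseteq> S"
    using \<gamma> \<gamma>' q qS by (simp add: path_image_join)
  have "(f has_contour_integral 0) ?g"
  proof (rule Cauchy_theorem_global[OF S f valid _ img])
    fix z assume z: "z \<notin> S"
    then have "z \<notin> path_image \<gamma>" "z \<notin> path_image \<gamma>'" "z \<notin> path_image q"
      using \<gamma> \<gamma>' qS by auto
    then show "winding_number ?g z = 0"
      using \<gamma> \<gamma>' q vq wn[OF z]
      by (simp add: winding_number_join winding_number_reversepath valid_path_imp_path path_image_join)
  qed (use q in simp)
  then have "contour_integral ?g f = 0"
    by (rule contour_integral_unique)
  moreover have "f contour_integrable_on \<gamma>" "f contour_integrable_on \<gamma>'" "f contour_integrable_on q"
    using \<gamma> \<gamma>' vq qS by (auto intro: contour_integrable_holomorphic_simple[OF f S])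
  ultimately show ?thesis
    using \<gamma> \<gamma>' q vq
    by (simp add: contour_integral_reversepath contour_integrable_reversepath valid_path_join valid_path_imp_reverse)
qed

text \<open>Two closed paths joined by a path \<open>q\<close>, traversed in both directions, form a
  single closed path whose winding numbers are the sums; this reduces to the comparison of two
  paths.\<close>

lemma contour_integral_add_of_winding_number:
  assumes S: "open S" and f: "f holomorphic_on S"
    and \<gamma>: "valid_path \<gamma>" "pathfinish \<gamma> = pathstart \<gamma>" "path_image \<gamma> \<subseteq> S"
    and \<gamma>1: "valid_path \<gamma>1" "pathfinish \<gamma>1 = pathstart \<gamma>1" "path_image \<gamma>1 \<subseteq> S"
    and \<gamma>2: "valid_path \<gamma>2" "pathfinish \<gamma>2 = pathstart \<gamma>2" "path_image \<gamma>2 \<subseteq> S"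
    and conn: "connected_component S (pathstart \<gamma>) (pathstart \<gamma>1)"
      "connected_component S (pathstart \<gamma>1) (pathstart \<gamma>2)"
    and wn: "\<And>z. z \<notin> S \<Longrightarrow> winding_number \<gamma> z = winding_number \<gamma>1 z + winding_number \<gamma>2 z"
  shows "contour_integral \<gamma> f = contour_integral \<gamma>1 f + contour_integral \<gamma>2 f"
proof -
  let ?C = "connected_component_set S (pathstart \<gamma>1)"
  obtain q where q: "polynomial_function q" "path_image q \<subseteq> ?C"
    "pathstart q = pathstart \<gamma>1" "pathfinish q = pathstart \<gamma>2"
  proof -
    have "pathstart \<gamma>1 \<in> S"
      using \<gamma>1 by auto
    then show ?thesis
      using connected_open_polynomial_connected[of ?C "pathstart \<gamma>1" "pathstart \<gamma>2"] conn that
        open_connected_component[OF S] connected_connected_component connected_component_refl by blast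
  qed
  have qS: "path_image q \<subseteq> S"
    using q(2) connected_component_subset by blast
  have vq: "valid_path q"
    using q(1) by (rule valid_path_polynomial_function)
  let ?g = "\<gamma>1 +++ (q +++ (\<gamma>2 +++ reversepath q))"
  have "contour_integral \<gamma> f = contour_integral ?g f"
  proof (rule contour_integral_eq_of_winding_number[OF S f \<gamma>])
    fix z assume z: "z \<notin> S"
    then have "z \<notin> path_image \<gamma>1" "z \<notin> path_image \<gamma>2" "z \<notin> path_image q"
      using \<gamma>1 \<gamma>2 qS by auto
    then show "winding_number \<gamma> z = winding_number ?g z"
      using \<gamma>1 \<gamma>2 q vq wn[OF z]
      by (simp add: winding_number_join winding_number_reversepath valid_path_imp_path path_image_join)
  qed (use \<gamma>1 \<gamma>2 q vq qS conn in \<open>auto simp: path_image_join intro!: valid_path_join\<close>)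
  moreover have "f contour_integrable_on \<gamma>1" "f contour_integrable_on \<gamma>2" "f contour_integrable_on q"
    using \<gamma>1 \<gamma>2 vq qS by (auto intro: contour_integrable_holomorphic_simple[OF f S])
  ultimately show ?thesis
    using \<gamma>1 \<gamma>2 q vq
    by (simp add: contour_integral_reversepath contour_integrable_reversepath valid_path_join valid_path_imp_reverse)
qed

section \<open>Riesz projections\<close>

text \<open>The derivative is constant inside the piece; at its ends it may be anything, but two
  points do not affect integrability.\<close>

lemma linear_piece_integrable:
  fixes F :: "complex \<Rightarrow> 'b::banach"
  assumes cd: "c < d" "{c..d} \<subseteq> {0..1}" and g: "\<And>s. s \<in> {c<..<d} \<Longrightarrow> \<gamma> s = p + s *\<^sub>R q"
    and cont: "continuous_on {0..1} (\<lambda>s. F (\<gamma> s))"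
  shows "(\<lambda>s. \<phi> (vector_derivative \<gamma> (at s within {0..1})) *\<^sub>R F (\<gamma> s)) integrable_on {c..d}"
proof -
  have "vector_derivative \<gamma> (at s within {0..1}) = q" if s: "s \<in> {c<..<d}" for s
  proof -
    have "((\<lambda>s. p + s *\<^sub>R q) has_vector_derivative q) (at s)"
      by (auto intro!: derivative_eq_intros)
    then have "(\<gamma> has_vector_derivative q) (at s)"
      by (rule has_vector_derivative_transform_within_open[OF _ open_greaterThanLessThan s]) (simp add: g)
    moreover have "s \<in> {0<..<1}"
      using s cd by (auto simp: subset_iff)
        (meson atLeastAtMost_iff greaterThanLessThan_iff less_imp_le order_le_less_trans order_less_le_trans order_refl)+
    ultimately show ?thesis
      using vector_derivative_at_within_ivl[of \<gamma> q s 0 1] by auto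
  qed
  then have eq: "\<phi> (vector_derivative \<gamma> (at s within {0..1})) *\<^sub>R F (\<gamma> s) = \<phi> q *\<^sub>R F (\<gamma> s)"
    if "s \<in> {c..d} - {c, d}" for s
    using that by simp
  have "continuous_on {c..d} (\<lambda>s. \<phi> q *\<^sub>R F (\<gamma> s))"
    using cd(2) by (intro continuous_on_scaleR continuous_on_const continuous_on_subset[OF cont])
  then have "(\<lambda>s. \<phi> q *\<^sub>R F (\<gamma> s)) integrable_on {c..d}"
    by (rule integrable_continuous_interval)
  from integrable_spike_finite[OF _ eq this, of "{c, d}"] show ?thesis
    by simp
qed

text \<open>\<open>riesz_projection\<close> integrates operators, which here form a real Banach
  space. A complex derivative therefore enters through its real and imaginary part, and
  \<open>\<phi>\<close> will be one of these.\<close>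

lemma contour_weighted_integrable:
  fixes F :: "complex \<Rightarrow> 'b::banach" and \<phi> :: "complex \<Rightarrow> real"
  assumes \<gamma>: "contour \<gamma>" and F: "continuous_on (path_image \<gamma>) F" and \<phi>: "continuous_on UNIV \<phi>"
  shows "(\<lambda>s. \<phi> (vector_derivative \<gamma> (at s within {0..1})) *\<^sub>R F (\<gamma> s)) integrable_on {0..1}"
proof -
  have cont: "continuous_on {0..1} (\<lambda>s. F (\<gamma> s))"
    using contour_path[OF \<gamma>] unfolding path_def path_image_def
    by (intro continuous_on_compose2[OF F]) (auto simp: path_image_def)
  consider c r where "\<gamma> = circlepath c r" | a b where "\<gamma> = rectpath a b"
    using \<gamma> by (auto simp: contour_def)
  then show ?thesis
  proof cases
    case (1 c r)
    have "continuous_on {0..1} (\<lambda>s. \<phi> (vector_derivative \<gamma> (at s within {0..1})))"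
    proof -
      have "continuous_on {0..1} (\<lambda>s. \<phi> (2 * pi * \<i> * r * exp (2 * of_real pi * \<i> * of_real s)))"
        by (intro continuous_on_compose2[OF \<phi>] continuous_intros) auto
      then show ?thesis
        by (rule continuous_on_eq) (simp add: 1 vector_derivative_circlepath01)
    qed
    then show ?thesis
      by (intro integrable_continuous_interval continuous_intros cont)
  next
    case (2 a b)
    define c d where "c = Complex (Re b) (Im a)" and "d = Complex (Re a) (Im b)"
    have \<gamma>_eq: "\<gamma> = linepath a c +++ linepath c b +++ linepath b d +++ linepath d a"
      by (simp add: 2 rectpath_def c_def d_def Let_def)
    let ?I = "\<lambda>s. \<phi> (vector_derivative \<gamma> (at s within {0..1})) *\<^sub>R F (\<gamma> s)"
    \<comment> \<open>The nested joins of \<open>rectpath\<close> change sides at the parameters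
      \<open>1/2\<close>, \<open>3/4\<close> and \<open>7/8\<close>.\<close>
    have i1: "?I integrable_on {0..1/2}"
      by (rule linear_piece_integrable[where p = a and q = "2 *\<^sub>R (c - a)", OF _ _ _ cont])
        (auto simp: \<gamma>_eq joinpaths_def linepath_def algebra_simps)
    have i2: "?I integrable_on {1/2..3/4}"
      by (rule linear_piece_integrable[where p = "c - 2 *\<^sub>R (b - c)" and q = "4 *\<^sub>R (b - c)", OF _ _ _ cont])
        (auto simp: \<gamma>_eq joinpaths_def linepath_def algebra_simps)
    have i3: "?I integrable_on {3/4..7/8}"
      by (rule linear_piece_integrable[where p = "b - 6 *\<^sub>R (d - b)" and q = "8 *\<^sub>R (d - b)", OF _ _ _ cont])
        (auto simp: \<gamma>_eq joinpaths_def linepath_def algebra_simps)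
    have i4: "?I integrable_on {7/8..1}"
      by (rule linear_piece_integrable[where p = "d - 7 *\<^sub>R (a - d)" and q = "8 *\<^sub>R (a - d)", OF _ _ _ cont])
        (auto simp: \<gamma>_eq joinpaths_def linepath_def algebra_simps)
    show ?thesis
      by (rule Henstock_Kurzweil_Integration.integrable_combine[OF _ _ i1 Henstock_Kurzweil_Integration.integrable_combine[OF _ _ i2
              Henstock_Kurzweil_Integration.integrable_combine[OF _ _ i3 i4]]]) auto
  qed
qed

section \<open>Resolvents and their contour integrals\<close>

locale linear_operator =
  fixes D :: "'h::complex_hilbert set" and T :: "'h \<Rightarrow> 'h"
  assumes linear: "linear_op D T"
begin

abbreviation R where "R z \<equiv> op_resolvent D T z"
abbreviation rho where "rho \<equiv> resolvent_set D T"
abbreviation riesz where "riesz \<equiv> riesz_projection D T"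

lemma resolvent_identity:
  assumes "z \<in> rho" "w \<in> rho"
  shows "R z x - R w x = (w - z) *\<^sub>C R z (R w x)"
proof -
  note z = bounded_clinear_op_resolvent[OF assms(1)]
  have "x = (z *\<^sub>C R w x - T (R w x)) + (w - z) *\<^sub>C R w x"
    using op_resolvent_right[OF assms(2), of x] by (simp add: scaleC.diff_left)
  then have "R z x = R z (z *\<^sub>C R w x - T (R w x)) + R z ((w - z) *\<^sub>C R w x)"
    using bounded_clinear_add[OF z] by metis
  also have "\<dots> = R w x + (w - z) *\<^sub>C R z (R w x)"
    using op_resolvent_left[OF assms(1) op_resolvent_in[OF assms(2)]]
    by (simp add: bounded_clinear_scaleC[OF z])
  finally show ?thesis by simp
qed

lemma resolvent_product:
  assumes "z \<in> rho" "w \<in> rho" "z \<noteq> w"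
  shows "R z (R w x) = (1 / (z - w)) *\<^sub>C (R w x - R z x)"
proof -
  have "R w x - R z x = - ((w - z) *\<^sub>C R z (R w x))"
    using resolvent_identity[OF assms(1,2), of x] by (simp add: algebra_simps)
  also have "\<dots> = (z - w) *\<^sub>C R z (R w x)"
    by (simp add: scaleC.diff_left)
  finally show ?thesis
    using assms(3) by (simp add: scaleC_scaleC)
qed

text \<open>\<open>z - T\<close> is the composition of \<open>1 - Y\<close> after
  \<open>w - T\<close>, where \<open>Y\<close> is \<open>(w - z)\<close> times the resolvent at
  \<open>w\<close> and has norm below 1.\<close>

lemma resolvent_set_nearby:
  assumes w: "w \<in> rho" and K: "\<And>x. norm (R w x) \<le> K * norm x" and z: "cmod (z - w) * K < 1"
  shows "z \<in> rho"
proof -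
  note Rw = bounded_clinear_op_resolvent[OF w]
  define Y where "Y x = (w - z) *\<^sub>C R w x" for x
  have Y: "bounded_clinear Y"
    unfolding Y_def by (rule bounded_clinear_scaleC_fun[OF Rw])
  have Y_le: "norm (Y x) \<le> cmod (z - w) * K * norm x" for x
    using mult_left_mono[OF K[of x], of "cmod (z - w)"]
    by (simp add: Y_def norm_scaleC norm_minus_commute mult.assoc)
  note bij = bij_id_minus_contraction[OF Y z Y_le]
  define G where "G = inv (\<lambda>x. x - Y x)"
  have G: "bounded_clinear G" and G_eq: "G x - Y (G x) = x" and G_unique: "y - Y y = x \<Longrightarrow> G x = y" for x y
  proof -
    show "bounded_clinear G"
      unfolding G_def by (rule bij(2))
    show "G x - Y (G x) = x"
      unfolding G_def using surj_f_inv_f[OF bij_is_surj[OF bij(1)], of x] .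
    show "G x = y" if "y - Y y = x"
      unfolding G_def using that inv_f_f[OF bij_is_inj[OF bij(1)], of y] by simp
  qed
  have decomp: "z *\<^sub>C f - T f = (w *\<^sub>C f - T f) - (w - z) *\<^sub>C f" for f
    by (simp add: scaleC.diff_left)
  have right: "z *\<^sub>C R w (G x) - T (R w (G x)) = x" for x
    unfolding decomp op_resolvent_right[OF w] using G_eq[of x] by (simp add: Y_def)
  have left: "R w (G (z *\<^sub>C f - T f)) = f" if f: "f \<in> D" for f
  proof -
    define x where "x = w *\<^sub>C f - T f"
    have Rx: "R w x = f"
      unfolding x_def by (rule op_resolvent_left[OF w f])
    have "x - Y x = z *\<^sub>C f - T f"
      unfolding decomp x_def[symmetric] by (simp add: Y_def Rx)
    then show ?thesis
      using G_unique Rx by metis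
  qed
  have bij_T: "bij_betw (\<lambda>f. z *\<^sub>C f - T f) D UNIV"
    by (rule bij_betw_byWitness[where f' = "\<lambda>x. R w (G x)"])
      (use left right op_resolvent_in[OF w] in auto)
  have "R z = (\<lambda>x. R w (G x))"
  proof
    show "R z x = R w (G x)" for x
      unfolding op_resolvent_def[of _ _ z]
      by (rule inv_into_f_eq[OF bij_betw_imp_inj_on[OF bij_T]])
        (use right op_resolvent_in[OF w] in auto)
  qed
  then show ?thesis
    using bij_T bounded_clinear_compose[OF Rw G] by (simp add: resolvent_set_def)
qed

lemma resolvent_set_open: "open rho"
  unfolding open_contains_ball
proof
  fix w assume w: "w \<in> rho"
  obtain K where K: "K > 0" "\<And>x. norm (R w x) \<le> K * norm x"
    using bounded_clinear_bound[OF bounded_clinear_op_resolvent[OF w]] by blast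
  have "z \<in> rho" if "z \<in> ball w (1 / K)" for z
    using that K(1)
    by (intro resolvent_set_nearby[OF w K(2)])
      (simp add: dist_norm norm_minus_commute pos_less_divide_eq)
  then show "\<exists>e>0. ball w e \<subseteq> rho"
    using K(1) by (intro exI[of _ "1 / K"]) auto
qed

text \<open>Within \<open>1 / (2 * K)\<close> of \<open>w\<close> the resolvent identity first gives
  the common norm bound \<open>2 * K\<close>, by absorbing half of the left side; inserted into the
  identity again, it gives the Lipschitz constant.\<close>

lemma resolvent_locally_lipschitz:
  assumes w: "w \<in> rho"
  obtains e L where "e > 0" "L \<ge> 0" "ball w e \<subseteq> rho"
    "\<And>z x. z \<in> ball w e \<Longrightarrow> norm (R z x - R w x) \<le> L * cmod (z - w) * norm x"
proof -
  obtain K where K: "K > 0" "\<And>x. norm (R w x) \<le> K * norm x"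
    using bounded_clinear_bound[OF bounded_clinear_op_resolvent[OF w]] by blast
  show ?thesis
  proof (rule that[of "1 / (2 * K)" "2 * K * K"])
    show sub: "ball w (1 / (2 * K)) \<subseteq> rho"
    proof
      fix z assume "z \<in> ball w (1 / (2 * K))"
      then show "z \<in> rho"
        using K(1) by (intro resolvent_set_nearby[OF w K(2)])
          (simp add: dist_norm norm_minus_commute pos_less_divide_eq mult.assoc)
    qed
    fix z x assume z: "z \<in> ball w (1 / (2 * K))"
    have zw: "cmod (w - z) * K \<le> 1 / 2"
      using z K(1) by (simp add: dist_norm pos_less_divide_eq mult.assoc)
    have bound: "norm (R z y) \<le> 2 * K * norm y" for y
    proof -
      have "R w y - R z y = (z - w) *\<^sub>C R w (R z y)"
        using z sub w by (intro resolvent_identity) auto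
      then have "norm (R z y) \<le> norm (R w y) + norm ((z - w) *\<^sub>C R w (R z y))"
        by (metis norm_triangle_sub norm_minus_commute add.commute diff_add_cancel norm_triangle_ineq4 add_diff_cancel_left' diff_diff_eq2)
      also have "norm ((z - w) *\<^sub>C R w (R z y)) \<le> (cmod (w - z) * K) * norm (R z y)"
        using mult_left_mono[OF K(2)[of "R z y"], of "cmod (w - z)"]
        by (simp add: norm_scaleC norm_minus_commute mult.assoc)
      also have "\<dots> \<le> 1 / 2 * norm (R z y)"
        by (intro mult_right_mono zw) auto
      finally show ?thesis
        using K(2)[of y] by simp
    qed
    have "z \<in> rho"
      using z sub by blast
    then have "norm (R z x - R w x) = cmod (z - w) * norm (R z (R w x))"
      by (simp add: resolvent_identity w norm_scaleC norm_minus_commute)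
    also have "\<dots> \<le> cmod (z - w) * (2 * K * (K * norm x))"
      using bound[of "R w x"] K by (intro mult_left_mono) (auto intro: order_trans)
    finally show "norm (R z x - R w x) \<le> 2 * K * K * cmod (z - w) * norm x"
      by (simp add: mult_ac)
  qed (use K in auto)
qed

lemma resolvent_blinfun_continuous: "continuous_on rho (\<lambda>z. Blinfun (R z))"
proof (rule continuous_at_imp_continuous_on, rule ballI)
  fix w assume w: "w \<in> rho"
  obtain e L where e: "e > 0" "L \<ge> 0" "ball w e \<subseteq> rho"
    "\<And>z x. z \<in> ball w e \<Longrightarrow> norm (R z x - R w x) \<le> L * cmod (z - w) * norm x"
    using resolvent_locally_lipschitz[OF w] by metis
  have apply_R: "blinfun_apply (Blinfun (R z)) = R z" if "z \<in> rho" for z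
    using bounded_clinear_op_resolvent[OF that] bounded_clinear_bounded_linear
      bounded_linear_Blinfun_apply by blast
  have "norm (Blinfun (R z) - Blinfun (R w)) \<le> L * cmod (z - w)" if z: "z \<in> ball w e" for z
  proof (rule norm_blinfun_bound)
    show "norm (blinfun_apply (Blinfun (R z) - Blinfun (R w)) x) \<le> L * cmod (z - w) * norm x" for x
      using e(3,4) z w by (auto simp: blinfun.diff_left apply_R)
  qed (use e in simp)
  then have "\<forall>\<^sub>F z in at w. norm (Blinfun (R z) - Blinfun (R w)) \<le> L * cmod (z - w)"
    using e(1) by (intro eventually_at_in_open'[THEN eventually_mono, of "ball w e"]) auto
  moreover have "((\<lambda>z. L * cmod (z - w)) \<longlongrightarrow> 0) (at w)"
    by (rule tendsto_eq_intros refl | simp)+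
  ultimately have "((\<lambda>z. Blinfun (R z) - Blinfun (R w)) \<longlongrightarrow> 0) (at w)"
    by (rule Lim_null_comparison)
  then show "isCont (\<lambda>z. Blinfun (R z)) w"
    unfolding isCont_def by (rule LIM_zero_cancel)
qed

lemma resolvent_weakly_continuous: "continuous_on rho (\<lambda>z. cinner (R z f) g)"
proof -
  have "continuous_on rho (\<lambda>z. cinner (blinfun_apply (Blinfun (R z)) f) g)"
    by (intro bounded_linear.continuous_on[OF cinner.bounded_linear_left]
        bounded_linear.continuous_on[OF blinfun.bounded_linear_left] resolvent_blinfun_continuous)
  moreover have "blinfun_apply (Blinfun (R z)) = R z" if "z \<in> rho" for z
    using bounded_clinear_op_resolvent[OF that] bounded_clinear_bounded_linear
      bounded_linear_Blinfun_apply by blast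
  ultimately show ?thesis
    by (simp cong: continuous_on_cong)
qed

lemma resolvent_holomorphic: "(\<lambda>z. cinner (R z f) g) holomorphic_on rho"
  unfolding holomorphic_on_open[OF resolvent_set_open]
proof (intro ballI exI)
  fix w assume w: "w \<in> rho"
  have "((\<lambda>z. - cinner (R z (R w f)) g) \<longlongrightarrow> - cinner (R w (R w f)) g) (at w)"
    using resolvent_weakly_continuous[of "R w f" g] w resolvent_set_open
    by (intro tendsto_minus) (auto simp: continuous_on_eq_continuous_at isCont_def)
  moreover have "\<forall>\<^sub>F z in at w. (cinner (R z f) g - cinner (R w f) g) / (z - w) = - cinner (R z (R w f)) g"
  proof -
    have "\<forall>\<^sub>F z in at w. z \<in> rho \<and> z \<noteq> w"
      using eventually_at_in_open[OF resolvent_set_open w] by (simp add: eventually_conj_iff)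
    then show ?thesis
    proof eventually_elim
      case (elim z)
      have "cinner (R z f) g - cinner (R w f) g = (w - z) * cinner (R z (R w f)) g"
        using resolvent_identity[of z w f] elim w
        by (simp add: cinner.diff_left[symmetric] cinner_scaleC_left)
      then show ?case
        using elim by (simp add: field_simps)
    qed
  qed
  ultimately have "((\<lambda>z. (cinner (R z f) g - cinner (R w f) g) / (z - w)) \<longlongrightarrow> - cinner (R w (R w f)) g) (at w)"
    using tendsto_cong by fast
  then show "((\<lambda>z. cinner (R z f) g) has_field_derivative - cinner (R w (R w f)) g) (at w)"
    by (simp add: has_field_derivative_iff)
qed

context
  fixes \<gamma> :: "real \<Rightarrow> complex"
  assumes \<gamma>: "contour \<gamma>" and image: "path_image \<gamma> \<subseteq> rho"
begin

text \<open>The bridge from the operator-valued integral to scalar contour integrals: once the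
  integrand is known to be integrable, a continuous functional of the operator may be taken
  inside.\<close>

lemma riesz_has_contour_integral:
  "((\<lambda>z. cinner (R z f) g) has_contour_integral (2 * of_real pi * \<i>) * cinner (riesz \<gamma> f) g) \<gamma>"
proof -
  \<comment> \<open>Multiplication by \<i> as an operator, since only real scalars act on the space
    of bounded operators.\<close>
  define J where "J = Blinfun (\<lambda>x::'h. \<i> *\<^sub>C x)"
  have J: "blinfun_apply J x = \<i> *\<^sub>C x" for x
    unfolding J_def
    using bounded_clinear_bounded_linear[OF bounded_clinear_scaleC_fun[OF bounded_clinear_ident]]
    by (subst bounded_linear_Blinfun_apply) auto
  define d where "d s = vector_derivative \<gamma> (at s within {0..1})" for s
  define I where "I s = Blinfun (\<lambda>x. d s *\<^sub>C R (\<gamma> s) x)" for s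
  have in_rho: "\<gamma> s \<in> rho" if "s \<in> {0..1}" for s
    using image that by (auto simp: path_image_def)
  have apply_R: "blinfun_apply (Blinfun (R z)) = R z" if "z \<in> rho" for z
    using bounded_clinear_op_resolvent[OF that] bounded_clinear_bounded_linear
      bounded_linear_Blinfun_apply by blast
  have apply_I: "blinfun_apply (I s) x = d s *\<^sub>C R (\<gamma> s) x" if "s \<in> {0..1}" for s x
    unfolding I_def
    using bounded_clinear_bounded_linear[OF bounded_clinear_scaleC_fun[OF
          bounded_clinear_op_resolvent[OF in_rho[OF that]]]]
    by (subst bounded_linear_Blinfun_apply) auto
  have I_eq: "I s = Re (d s) *\<^sub>R Blinfun (R (\<gamma> s)) + Im (d s) *\<^sub>R (J o\<^sub>L Blinfun (R (\<gamma> s)))"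
    if "s \<in> {0..1}" for s
  proof (rule blinfun_eqI)
    fix x
    have "d s *\<^sub>C R (\<gamma> s) x = (of_real (Re (d s)) + of_real (Im (d s)) * \<i>) *\<^sub>C R (\<gamma> s) x"
      by (metis complex_eq mult.commute)
    then show "blinfun_apply (I s) x =
        blinfun_apply (Re (d s) *\<^sub>R Blinfun (R (\<gamma> s)) + Im (d s) *\<^sub>R (J o\<^sub>L Blinfun (R (\<gamma> s)))) x"
      using that in_rho[OF that]
      by (simp add: apply_I apply_R blinfun.add_left blinfun.scaleR_left J scaleC_add_left
          scaleC_of_real flip: scaleC_scaleC)
  qed
  have cont: "continuous_on (path_image \<gamma>) (\<lambda>z. Blinfun (R z))"
    using image by (rule continuous_on_subset[OF resolvent_blinfun_continuous])
  have cont_J: "continuous_on (path_image \<gamma>) (\<lambda>z. J o\<^sub>L Blinfun (R z))"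
    by (intro bounded_linear.continuous_on[OF bounded_bilinear.bounded_linear_right[OF
          bounded_bilinear_blinfun_compose]] cont)
  have "(\<lambda>s. Re (d s) *\<^sub>R Blinfun (R (\<gamma> s)) + Im (d s) *\<^sub>R (J o\<^sub>L Blinfun (R (\<gamma> s)))) integrable_on {0..1}"
    unfolding d_def
    by (intro integrable_add contour_weighted_integrable[OF \<gamma> cont]
        contour_weighted_integrable[OF \<gamma> cont_J] linear_continuous_on bounded_linear_Re bounded_linear_Im)
  then have "I integrable_on {0..1}"
    using I_eq by (subst integrable_cong[where g = "\<lambda>s. Re (d s) *\<^sub>R Blinfun (R (\<gamma> s)) +
        Im (d s) *\<^sub>R (J o\<^sub>L Blinfun (R (\<gamma> s)))"]) auto
  then have "(I has_integral integral {0..1} I) {0..1}"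
    by (rule integrable_integral)
  moreover have "bounded_linear (\<lambda>X. cinner (blinfun_apply X f) g)"
    using bounded_linear_compose[OF cinner.bounded_linear_left[of g] blinfun.bounded_linear_left[of f]] .
  ultimately have "((\<lambda>X. cinner (blinfun_apply X f) g) \<circ> I has_integral
      cinner (blinfun_apply (integral {0..1} I) f) g) {0..1}"
    by (rule has_integral_linear)
  then have "((\<lambda>s. cinner (R (\<gamma> s) f) g * vector_derivative \<gamma> (at s within {0..1})) has_integral
      cinner (blinfun_apply (integral {0..1} I) f) g) {0..1}"
    by (rule has_integral_eq[rotated]) (simp add: apply_I cinner_scaleC_left d_def mult.commute)
  moreover have "(2 * of_real pi * \<i>) * cinner (riesz \<gamma> f) g = cinner (blinfun_apply (integral {0..1} I) f) g"
    by (simp add: riesz_projection_def I_def[abs_def] d_def cinner_scaleC_left)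
  ultimately show ?thesis
    by (simp add: has_contour_integral_def)
qed

lemma cinner_riesz:
  "cinner (riesz \<gamma> f) g = contour_integral \<gamma> (\<lambda>z. cinner (R z f) g) / (2 * of_real pi * \<i>)"
  using contour_integral_unique[OF riesz_has_contour_integral, of f g] by simp

lemma bounded_clinear_riesz: "bounded_clinear (riesz \<gamma>)"
proof -
  define X where "X = integral {0..1} (\<lambda>s. Blinfun (\<lambda>g.
      vector_derivative \<gamma> (at s within {0..1}) *\<^sub>C op_resolvent D T (\<gamma> s) g))"
  define c where "c = 1 / (2 * of_real pi * \<i>)"
  have riesz_X: "riesz \<gamma> f = c *\<^sub>C blinfun_apply X f" for f
    by (simp add: riesz_projection_def X_def c_def)
  have int: "(\<lambda>z. cinner (R z f) g) contour_integrable_on \<gamma>" for f g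
    using riesz_has_contour_integral by (auto simp: contour_integrable_on_def)
  show ?thesis
  proof (rule bounded_clinearI)
    show "riesz \<gamma> (x + y) = riesz \<gamma> x + riesz \<gamma> y" for x y
      by (simp add: riesz_X blinfun.add_right scaleC_add_right)
    show "riesz \<gamma> (a *\<^sub>C x) = a *\<^sub>C riesz \<gamma> x" for a x
    proof (rule cinner_eqI)
      fix g
      have "contour_integral \<gamma> (\<lambda>z. cinner (R z (a *\<^sub>C x)) g) = contour_integral \<gamma> (\<lambda>z. a * cinner (R z x) g)"
        using image by (intro contour_integral_cong)
          (auto simp: bounded_clinear_scaleC[OF bounded_clinear_op_resolvent] cinner_scaleC_left)
      then show "cinner (riesz \<gamma> (a *\<^sub>C x)) g = cinner (a *\<^sub>C riesz \<gamma> x) g"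
        by (simp add: cinner_riesz cinner_scaleC_left contour_integral_lmul[OF int])
    qed
    show "norm (riesz \<gamma> x) \<le> cmod c * norm X * norm x" for x
      using norm_blinfun[of X x] by (simp add: riesz_X norm_scaleC mult.assoc mult_left_mono)
  qed
qed

end

text \<open>
  The resolvent identity splits the double integral, and Fubini's theorem turns the inner
  integrals into winding numbers.
\<close>

lemma riesz_product:
  assumes \<gamma>: "contour \<gamma>" "path_image \<gamma> \<subseteq> rho" and \<gamma>': "contour \<gamma>'" "path_image \<gamma>' \<subseteq> rho"
    and disj: "path_image \<gamma> \<inter> path_image \<gamma>' = {}"
    and a: "\<And>w. w \<in> path_image \<gamma>' \<Longrightarrow> winding_number \<gamma> w = a"
    and b: "\<And>z. z \<in> path_image \<gamma> \<Longrightarrow> winding_number \<gamma>' z = b"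
  shows "riesz \<gamma> (riesz \<gamma>' f) = a *\<^sub>C riesz \<gamma>' f + b *\<^sub>C riesz \<gamma> f"
proof (rule cinner_eqI)
  fix g
  define c where "c = 2 * of_real pi * \<i>"
  have c0: "c \<noteq> 0" by (simp add: c_def)
  define H where "H z = cinner (R z f) g" for z
  have H: "continuous_on rho H"
    unfolding H_def by (rule resolvent_weakly_continuous)
  have H1: "continuous_on (path_image \<gamma>) H" and H2: "continuous_on (path_image \<gamma>') H"
    using continuous_on_subset[OF H] \<gamma> \<gamma>' by auto
  have wn': "contour_integral \<gamma>' (\<lambda>w. 1 / (w - z)) = c * b" if z: "z \<in> path_image \<gamma>" for z
  proof -
    have "z \<notin> path_image \<gamma>'"
      using z disj by auto
    then show ?thesis
      using winding_number_valid_path[OF contour_valid_path[OF \<gamma>'(1)], of z] b[OF z]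
      by (simp add: c_def)
  qed
  have wn: "contour_integral \<gamma> (\<lambda>z. 1 / (w - z)) = - (c * a)" if w: "w \<in> path_image \<gamma>'" for w
  proof -
    have "w \<notin> path_image \<gamma>"
      using w disj by auto
    then have "contour_integral \<gamma> (\<lambda>z. 1 / (z - w)) = c * a"
      using winding_number_valid_path[OF contour_valid_path[OF \<gamma>(1)], of w] a[OF w] by (simp add: c_def)
    moreover have "contour_integral \<gamma> (\<lambda>z. 1 / (w - z)) = contour_integral \<gamma> (\<lambda>z. - (1 / (z - w)))"
      by (metis minus_diff_eq minus_divide_right)
    ultimately show ?thesis
      by (simp add: contour_integral_neg)
  qed
  define G where "G z = contour_integral \<gamma>' (\<lambda>w. H w / (w - z))" for z
  have G: "continuous_on (path_image \<gamma>) G"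
    unfolding G_def by (rule Cauchy_kernel_swap(1)[OF \<gamma>(1) \<gamma>'(1) disj H2])
  have int_G: "contour_integral \<gamma> G = - (c * a) * contour_integral \<gamma>' H"
  proof -
    have "contour_integral \<gamma> G = contour_integral \<gamma>' (\<lambda>w. H w * contour_integral \<gamma> (\<lambda>z. 1 / (w - z)))"
      unfolding G_def by (rule Cauchy_kernel_swap(2)[OF \<gamma>(1) \<gamma>'(1) disj H2])
    also have "\<dots> = contour_integral \<gamma>' (\<lambda>w. - (c * a) * H w)"
      using wn by (intro contour_integral_cong) auto
    also have "\<dots> = - (c * a) * contour_integral \<gamma>' H"
      by (intro contour_integral_lmul contour_integrable_continuous \<gamma>' H2)
    finally show ?thesis .
  qed
  have inner: "cinner (R z (riesz \<gamma>' f)) g = (b * H z) - G z / c" if z: "z \<in> path_image \<gamma>" for z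
  proof -
    have z': "z \<in> rho" "z \<notin> path_image \<gamma>'"
      using z \<gamma> disj by auto
    \<comment> \<open>The adjoint of the resolvent moves it to the other side of the inner product,
      where the contour formula for \<open>riesz \<gamma>'\<close> can be used with the vector
      \<open>Z g\<close>.\<close>
    obtain Z where Z: "\<And>x y. cinner (R z x) y = cinner x (Z y)"
      using bounded_clinear_adjoint[OF bounded_clinear_op_resolvent[OF z'(1)]] by metis
    have "c * cinner (R z (riesz \<gamma>' f)) g = contour_integral \<gamma>' (\<lambda>w. cinner (R z (R w f)) g)"
      using cinner_riesz[OF \<gamma>', of f "Z g"] c0 by (simp add: Z c_def)
    also have "\<dots> = contour_integral \<gamma>' (\<lambda>w. H z * (1 / (w - z)) - H w / (w - z))"
    proof (rule contour_integral_cong[OF refl])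
      fix w assume w: "w \<in> path_image \<gamma>'"
      then have "w \<in> rho" "z \<noteq> w"
        using \<gamma>' z' by auto
      then show "cinner (R z (R w f)) g = H z * (1 / (w - z)) - H w / (w - z)"
        by (simp add: resolvent_product[OF z'(1)] H_def cinner_scaleC_left cinner.diff_left)
          (simp add: divide_simps, simp add: algebra_simps)
    qed
    also have "\<dots> = contour_integral \<gamma>' (\<lambda>w. H z * (1 / (w - z))) - contour_integral \<gamma>' (\<lambda>w. H w / (w - z))"
      using z' by (intro contour_integral_diff contour_integrable_continuous \<gamma>' continuous_intros H2) auto
    also have "contour_integral \<gamma>' (\<lambda>w. H z * (1 / (w - z))) = H z * (c * b)"
      using z' wn'[OF z]
      by (subst contour_integral_lmul) (auto intro!: contour_integrable_continuous \<gamma>' continuous_intros)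
    finally have "c * cinner (R z (riesz \<gamma>' f)) g = H z * (c * b) - G z"
      by (simp add: G_def)
    then show ?thesis
      using c0 by (simp add: field_simps)
  qed
  have "c * cinner (riesz \<gamma> (riesz \<gamma>' f)) g = contour_integral \<gamma> (\<lambda>z. cinner (R z (riesz \<gamma>' f)) g)"
    using c0 by (simp add: cinner_riesz[OF \<gamma>] c_def)
  also have "\<dots> = contour_integral \<gamma> (\<lambda>z. b * H z - (1 / c) * G z)"
    using inner by (intro contour_integral_cong) auto
  also have "\<dots> = contour_integral \<gamma> (\<lambda>z. b * H z) - contour_integral \<gamma> (\<lambda>z. (1 / c) * G z)"
    by (intro contour_integral_diff contour_integrable_continuous \<gamma> continuous_intros H1 G)
  also have "\<dots> = b * contour_integral \<gamma> H - (1 / c) * contour_integral \<gamma> G"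
    by (simp only: contour_integral_lmul contour_integrable_continuous \<gamma> H1 G)
  also have "\<dots> = b * contour_integral \<gamma> H + a * contour_integral \<gamma>' H"
    using c0 by (simp add: int_G)
  also have "contour_integral \<gamma> H = c * cinner (riesz \<gamma> f) g"
    using c0 by (simp add: cinner_riesz[OF \<gamma>] c_def H_def[abs_def])
  also have "contour_integral \<gamma>' H = c * cinner (riesz \<gamma>' f) g"
    using c0 by (simp add: cinner_riesz[OF \<gamma>'] c_def H_def[abs_def])
  finally have "c * cinner (riesz \<gamma> (riesz \<gamma>' f)) g =
      c * (a * cinner (riesz \<gamma>' f) g + b * cinner (riesz \<gamma> f) g)"
    by (simp add: algebra_simps)
  then show "cinner (riesz \<gamma> (riesz \<gamma>' f)) g = cinner (a *\<^sub>C riesz \<gamma>' f + b *\<^sub>C riesz \<gamma> f) g"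
    using c0 by (simp add: cinner_add_left cinner_scaleC_left)
qed

lemma riesz_eq_of_winding_number:
  assumes \<gamma>: "contour \<gamma>" "path_image \<gamma> \<subseteq> rho" and \<gamma>': "contour \<gamma>'" "path_image \<gamma>' \<subseteq> rho"
    and conn: "connected_component rho (pathstart \<gamma>) (pathstart \<gamma>')"
    and wn: "\<And>z. z \<notin> rho \<Longrightarrow> winding_number \<gamma> z = winding_number \<gamma>' z"
  shows "riesz \<gamma> = riesz \<gamma>'"
proof (rule ext, rule cinner_eqI)
  show "cinner (riesz \<gamma> f) g = cinner (riesz \<gamma>' f) g" for f g
    using contour_integral_eq_of_winding_number[OF resolvent_set_open resolvent_holomorphic
        contour_valid_path[OF \<gamma>(1)] contour_closed[OF \<gamma>(1)] \<gamma>(2)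
        contour_valid_path[OF \<gamma>'(1)] contour_closed[OF \<gamma>'(1)] \<gamma>'(2) conn wn]
    by (simp add: cinner_riesz \<gamma> \<gamma>')
qed

lemma riesz_add_of_winding_number:
  assumes \<gamma>: "contour \<gamma>" "path_image \<gamma> \<subseteq> rho" and \<gamma>1: "contour \<gamma>1" "path_image \<gamma>1 \<subseteq> rho"
    and \<gamma>2: "contour \<gamma>2" "path_image \<gamma>2 \<subseteq> rho"
    and conn: "connected_component rho (pathstart \<gamma>) (pathstart \<gamma>1)"
      "connected_component rho (pathstart \<gamma>1) (pathstart \<gamma>2)"
    and wn: "\<And>z. z \<notin> rho \<Longrightarrow> winding_number \<gamma> z = winding_number \<gamma>1 z + winding_number \<gamma>2 z"
  shows "riesz \<gamma> f = riesz \<gamma>1 f + riesz \<gamma>2 f"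
proof (rule cinner_eqI)
  show "cinner (riesz \<gamma> f) g = cinner (riesz \<gamma>1 f + riesz \<gamma>2 f) g" for g
    using contour_integral_add_of_winding_number[OF resolvent_set_open resolvent_holomorphic
        contour_valid_path[OF \<gamma>(1)] contour_closed[OF \<gamma>(1)] \<gamma>(2)
        contour_valid_path[OF \<gamma>1(1)] contour_closed[OF \<gamma>1(1)] \<gamma>1(2)
        contour_valid_path[OF \<gamma>2(1)] contour_closed[OF \<gamma>2(1)] \<gamma>2(2) conn wn, of f g]
    by (simp add: cinner_riesz \<gamma> \<gamma>1 \<gamma>2 cinner_add_left add_divide_distrib)
qed

end

section \<open>Products of projections belonging to circles and rectangles\<close>

lemma winding_number_circlepath_outside:
  assumes "0 < r" "r < cmod (z - c)"
  shows "winding_number (circlepath c r) z = 0"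
proof (rule winding_number_zero_outside[of _ "cball c r"])
  show "path_image (circlepath c r) \<subseteq> cball c r"
    using assms by (auto simp: path_image_circlepath_nonneg)
qed (use assms in \<open>auto simp: dist_norm norm_minus_commute\<close>)

context linear_operator
begin

text \<open>The product formula needs disjoint contours, so a projection is multiplied with a copy
  of itself on a smaller circle. By compactness the open resolvent set contains a thin annulus
  inside the circle, and the winding numbers agree off that annulus.\<close>

lemma riesz_circle_shrink:
  assumes r: "0 < r" and image: "path_image (circlepath c r) \<subseteq> rho"
  obtains r' where "0 < r'" "r' < r" "path_image (circlepath c r') \<subseteq> rho"
    "riesz (circlepath c r') = riesz (circlepath c r)"
proof -
  have sphere: "sphere c r \<subseteq> rho"
    using image r by (simp add: path_image_circlepath_nonneg)
  obtain e where e: "e > 0" "(\<Union>x\<in>sphere c r. ball x e) \<subseteq> rho"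
    using compact_subset_open_imp_ball_epsilon_subset[OF compact_sphere resolvent_set_open sphere] .
  define r' where "r' = r - min e r / 2"
  have r': "0 < r'" "r' < r" "r - r' < e"
    using r e(1) by (auto simp: r'_def min_def)
  have annulus: "z \<in> rho" if z: "r' \<le> cmod (z - c)" "cmod (z - c) \<le> r" for z
  proof -
    \<comment> \<open>The radial projection of \<open>z\<close> to the circle; its distance from
      \<open>z\<close> is \<open>r - cmod (z - c)\<close>.\<close>
    define p where "p = c + of_real (r / cmod (z - c)) * (z - c)"
    have pos: "cmod (z - c) > 0"
      using z r' by linarith
    have p: "p \<in> sphere c r"
      using pos r by (simp add: p_def dist_norm norm_mult norm_divide)
    have "p - z = of_real (r / cmod (z - c) - 1) * (z - c)"
      by (simp add: p_def algebra_simps)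
    then have "dist p z = \<bar>r / cmod (z - c) - 1\<bar> * cmod (z - c)"
      by (simp only: dist_norm norm_mult norm_of_real)
    moreover have "1 \<le> r / cmod (z - c)"
      using pos z by simp
    ultimately have "dist p z = r - cmod (z - c)"
      using pos by (simp add: left_diff_distrib)
    then have "z \<in> ball p e"
      using z r' by simp
    then show ?thesis
      using e(2) p by blast
  qed
  have image': "path_image (circlepath c r') \<subseteq> rho"
    using annulus r' by (auto simp: path_image_circlepath_nonneg dist_norm norm_minus_commute)
  have "riesz (circlepath c r') = riesz (circlepath c r)"
  proof (rule riesz_eq_of_winding_number)
    have "closed_segment (c + of_real r') (c + of_real r) \<subseteq> rho"
    proof
      fix z assume "z \<in> closed_segment (c + of_real r') (c + of_real r)"
      then obtain u where u: "0 \<le> u" "u \<le> 1"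
        "z = (1 - u) *\<^sub>R (c + of_real r') + u *\<^sub>R (c + of_real r)"
        by (auto simp: closed_segment_def)
      have "z - c = of_real (r' + u * (r - r'))"
        unfolding u(3) by (simp add: scaleR_conv_of_real algebra_simps)
      then have "cmod (z - c) = r' + u * (r - r')"
        using u r' by (simp del: of_real_add of_real_mult of_real_diff)
      moreover have "u * (r - r') \<le> 1 * (r - r')" "0 \<le> u * (r - r')"
        using u r' by (intro mult_right_mono mult_nonneg_nonneg; simp)+
      ultimately show "z \<in> rho"
        by (intro annulus) auto
    qed
    then show "connected_component rho (pathstart (circlepath c r')) (pathstart (circlepath c r))"
      unfolding connected_component_def
      by (intro exI[of _ "closed_segment (c + of_real r') (c + of_real r)"]) auto
    fix z assume "z \<notin> rho"
    then have "cmod (z - c) < r' \<or> r < cmod (z - c)"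
      using annulus[of z] not_le by blast
    then show "winding_number (circlepath c r') z = winding_number (circlepath c r) z"
      using r' r by (auto simp: winding_number_circlepath winding_number_circlepath_outside)
  qed (use r r' image image' in \<open>auto intro: contour_circlepath\<close>)
  then show ?thesis
    using that r' image' by blast
qed

lemma riesz_circle_idempotent:
  assumes r: "0 < r" and image: "path_image (circlepath c r) \<subseteq> rho"
  shows "riesz (circlepath c r) (riesz (circlepath c r) f) = riesz (circlepath c r) f"
proof -
  obtain r' where r': "0 < r'" "r' < r" "path_image (circlepath c r') \<subseteq> rho"
    "riesz (circlepath c r') = riesz (circlepath c r)"
    using riesz_circle_shrink[OF assms] .
  have "riesz (circlepath c r) (riesz (circlepath c r') f) =
      1 *\<^sub>C riesz (circlepath c r') f + 0 *\<^sub>C riesz (circlepath c r) f"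
    using r r' image
    by (intro riesz_product contour_circlepath winding_number_circlepath winding_number_circlepath_outside)
      (auto simp: path_image_circlepath_nonneg dist_norm norm_minus_commute)
  then show ?thesis
    by (simp add: r'(4))
qed

text \<open>A smaller rectangle with the same projection makes the product formula applicable: the
  outer contour winds once about the inner one, the inner one does not wind about the outer.\<close>

lemma riesz_rect_idempotent:
  assumes ab: "Re a < Re b" "Im a < Im b" and image: "path_image (rectpath a b) \<subseteq> rho"
  shows "riesz (rectpath a b) (riesz (rectpath a b) f) = riesz (rectpath a b) f"
proof -
  have "compact (path_image (rectpath a b))"
    by (intro compact_path_image) simp
  then obtain e where e: "e > 0" "(\<Union>x\<in>path_image (rectpath a b). ball x e) \<subseteq> rho"
    using compact_subset_open_imp_ball_epsilon_subset[OF _ resolvent_set_open image] by blast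
  \<comment> \<open>Below \<open>e\<close> so that the frame stays in the resolvent set; at most a
    third of each side length so that the inner rectangle is not degenerate.\<close>
  define s where "s = min (e / 2) (min ((Re b - Re a) / 3) ((Im b - Im a) / 3))"
  have s: "0 < s" "s < e" "Re a + s < Re b - s" "Im a + s < Im b - s"
    using e(1) ab by (auto simp: s_def min_def field_simps)
  define a' b' where "a' = a + Complex s s" and "b' = b - Complex s s"
  have ab': "Re a' = Re a + s" "Im a' = Im a + s" "Re b' = Re b - s" "Im b' = Im b - s"
    by (simp_all add: a'_def b'_def)
  have frame: "z \<in> rho" if z: "z \<in> cbox a b" "z \<notin> box a' b'" for z
  proof -
    have near: "z \<in> rho" if "p \<in> path_image (rectpath a b)" "cmod (p - z) \<le> s" for p
    proof -
      have "z \<in> ball p e"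
        using that s by (simp add: dist_norm)
      then show ?thesis
        using e(2) that(1) by blast
    qed
    have z': "Re a \<le> Re z" "Re z \<le> Re b" "Im a \<le> Im z" "Im z \<le> Im b"
      using z(1) by (auto simp: in_cbox_complex_iff)
    consider "Re z \<le> Re a + s" | "Re b - s \<le> Re z" | "Im z \<le> Im a + s" | "Im b - s \<le> Im z"
      using z(2) by (force simp: in_box_complex_iff ab')
    then show ?thesis
    proof cases
      case 1
      then show ?thesis
        using z' ab by (intro near[of "Complex (Re a) (Im z)"]) (auto simp: path_image_rectpath cmod_def)
    next
      case 2
      then show ?thesis
        using z' ab by (intro near[of "Complex (Re b) (Im z)"]) (auto simp: path_image_rectpath cmod_def)
    next
      case 3
      then show ?thesis
        using z' ab by (intro near[of "Complex (Re z) (Im a)"]) (auto simp: path_image_rectpath cmod_def)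
    next
      case 4
      then show ?thesis
        using z' ab by (intro near[of "Complex (Re z) (Im b)"]) (auto simp: path_image_rectpath cmod_def)
    qed
  qed
  have img': "path_image (rectpath a' b') = cbox a' b' - box a' b'"
    using s ab' by (intro path_image_rectpath_cbox_minus_box) auto
  have img: "path_image (rectpath a b) = cbox a b - box a b"
    using ab by (intro path_image_rectpath_cbox_minus_box) auto
  have image': "path_image (rectpath a' b') \<subseteq> rho"
    unfolding img' using s by (auto simp: in_cbox_complex_iff ab' intro!: frame)
  have eq: "riesz (rectpath a b) = riesz (rectpath a' b')"
  proof (rule riesz_eq_of_winding_number)
    have "closed_segment a a' \<subseteq> rho"
    proof
      fix z assume "z \<in> closed_segment a a'"
      then obtain u where u: "0 \<le> u" "u \<le> 1" "z = (1 - u) *\<^sub>R a + u *\<^sub>R a'"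
        by (auto simp: closed_segment_def)
      define t where "t = u * s"
      have z: "Re z = Re a + t" "Im z = Im a + t"
        unfolding u(3) t_def by (simp_all add: ab' algebra_simps)
      have us: "0 \<le> t" "t \<le> s"
        unfolding t_def using u s mult_right_mono[of u 1 s] by auto
      show "z \<in> rho"
        using us s by (intro frame) (auto simp: in_cbox_complex_iff in_box_complex_iff z ab')
    qed
    then show "connected_component rho (pathstart (rectpath a b)) (pathstart (rectpath a' b'))"
      unfolding connected_component_def by (intro exI[of _ "closed_segment a a'"]) auto
    fix z assume "z \<notin> rho"
    then consider "z \<notin> cbox a b" | "z \<in> box a' b'"
      using frame by blast
    then show "winding_number (rectpath a b) z = winding_number (rectpath a' b') z"
    proof cases
      case 1
      then have "z \<notin> cbox a' b'"
        using s by (auto simp: in_cbox_complex_iff ab')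
      then show ?thesis
        using 1 ab ab' s by (simp add: winding_number_rectpath_outside)
    next
      case 2
      then have "z \<in> box a b"
        using s by (auto simp: in_box_complex_iff ab')
      then show ?thesis
        using 2 by (simp add: winding_number_rectpath)
    qed
  qed (use image image' in \<open>auto intro: contour_rectpath\<close>)
  have "riesz (rectpath a b) (riesz (rectpath a' b') f) =
      1 *\<^sub>C riesz (rectpath a' b') f + 0 *\<^sub>C riesz (rectpath a b) f"
  proof (rule riesz_product)
    have sub: "cbox a' b' \<subseteq> box a b"
      using s by (auto simp: in_box_complex_iff in_cbox_complex_iff ab')
    show "path_image (rectpath a b) \<inter> path_image (rectpath a' b') = {}"
      unfolding img img' using sub by blast
    show "winding_number (rectpath a b) w = 1" if "w \<in> path_image (rectpath a' b')" for w
      using that sub by (intro winding_number_rectpath) (auto simp: img')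
    show "winding_number (rectpath a' b') w = 0" if "w \<in> path_image (rectpath a b)" for w
      using that sub s ab' by (intro winding_number_rectpath_outside) (auto simp: img)
  qed (use image image' in \<open>auto intro: contour_rectpath\<close>)
  then show ?thesis
    by (simp flip: eq)
qed

text \<open>The discs may touch, as the discs about consecutive eigenvalues can; shrinking one of
  them separates the contours.\<close>

lemma riesz_circles_disjoint:
  assumes r1: "0 < r1" "path_image (circlepath c1 r1) \<subseteq> rho"
    and r2: "0 < r2" "path_image (circlepath c2 r2) \<subseteq> rho" and sep: "r1 + r2 \<le> cmod (c1 - c2)"
  shows "riesz (circlepath c1 r1) (riesz (circlepath c2 r2) f) = 0"
proof -
  obtain r' where r': "0 < r'" "r' < r1" "path_image (circlepath c1 r') \<subseteq> rho"
    "riesz (circlepath c1 r') = riesz (circlepath c1 r1)"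
    using riesz_circle_shrink[OF r1] .
  have 1: "r' < cmod (w - c1)" if "cmod (w - c2) = r2" for w
    using norm_triangle_ineq4[of "w - c2" "w - c1"] that sep r' by (simp add: norm_minus_commute)
  have 2: "r2 < cmod (w - c2)" if "cmod (w - c1) = r'" for w
    using norm_triangle_ineq4[of "w - c2" "w - c1"] that sep r' by (simp add: norm_minus_commute)
  have "riesz (circlepath c1 r') (riesz (circlepath c2 r2) f) =
      0 *\<^sub>C riesz (circlepath c2 r2) f + 0 *\<^sub>C riesz (circlepath c1 r') f"
    using r1 r2 r' 1 2
    by (intro riesz_product contour_circlepath winding_number_circlepath_outside)
      (force simp: path_image_circlepath_nonneg dist_norm norm_minus_commute)+
  then show ?thesis
    by (simp add: r'(4))
qed

text \<open>The disc may touch the right side of the rectangle, so here too the circle is shrunk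
  before the product formula is applied.\<close>

lemma
  assumes ab: "Re a < Re b" "Im a < Im b" "path_image (rectpath a b) \<subseteq> rho"
    and r: "0 < r" "path_image (circlepath c r) \<subseteq> rho" and sep: "Re b + r \<le> Re c"
  shows riesz_rect_circle_disjoint: "riesz (rectpath a b) (riesz (circlepath c r) f) = 0"
    and riesz_circle_rect_disjoint: "riesz (circlepath c r) (riesz (rectpath a b) f) = 0"
proof -
  obtain r' where r': "0 < r'" "r' < r" "path_image (circlepath c r') \<subseteq> rho"
    "riesz (circlepath c r') = riesz (circlepath c r)"
    using riesz_circle_shrink[OF r] .
  have 1: "w \<notin> cbox a b" if "w \<in> path_image (circlepath c r')" for w
  proof -
    have "cmod (c - w) = r'"
      using that r' by (simp add: path_image_circlepath_nonneg dist_norm)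
    then have "Re c - Re w \<le> r'"
      using complex_Re_le_cmod[of "c - w"] by simp
    then show ?thesis
      using sep r' by (auto simp: in_cbox_complex_iff)
  qed
  have 2: "r' < cmod (w - c)" if "w \<in> path_image (rectpath a b)" for w
  proof -
    have "Re w \<le> Re b"
      using that path_image_rectpath_subset_cbox[of a b] ab by (auto simp: in_cbox_complex_iff)
    then show ?thesis
      using complex_Re_le_cmod[of "c - w"] sep r' by (simp add: norm_minus_commute)
  qed
  have wn1: "winding_number (rectpath a b) w = 0" if "w \<in> path_image (circlepath c r')" for w
    using 1[OF that] ab by (intro winding_number_rectpath_outside) auto
  have wn2: "winding_number (circlepath c r') w = 0" if "w \<in> path_image (rectpath a b)" for w
    using 2[OF that] r' by (intro winding_number_circlepath_outside) auto
  have disj: "path_image (rectpath a b) \<inter> path_image (circlepath c r') = {}"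
    using 1 path_image_rectpath_subset_cbox[of a b] ab by fastforce
  note * = contour_rectpath contour_circlepath[OF r'(1)]
  have "riesz (rectpath a b) (riesz (circlepath c r') f) =
      0 *\<^sub>C riesz (circlepath c r') f + 0 *\<^sub>C riesz (rectpath a b) f"
    by (rule riesz_product[OF *(1) ab(3) *(2) r'(3) disj wn1 wn2])
  then show "riesz (rectpath a b) (riesz (circlepath c r) f) = 0"
    by (simp add: r'(4))
  have "riesz (circlepath c r') (riesz (rectpath a b) f) =
      0 *\<^sub>C riesz (rectpath a b) f + 0 *\<^sub>C riesz (circlepath c r') f"
    using disj by (intro riesz_product[OF *(2) r'(3) *(1) ab(3) _ wn2 wn1]) auto
  then show "riesz (circlepath c r) (riesz (rectpath a b) f) = 0"
    by (simp add: r'(4))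
qed

end

section \<open>Similarity of the tail of the spectral decomposition\<close>

text \<open>The test vector is \<open>\<Delta> x\<close> scaled to the length of \<open>x\<close>,
  which makes the two squares equal.\<close>

lemma norm_le_of_form_bound:
  fixes \<Delta> :: "'h::complex_hilbert \<Rightarrow> 'h"
  assumes c: "\<And>x y. cmod (cinner (\<Delta> x) y) \<le> c * ((norm x)\<^sup>2 + (norm y)\<^sup>2)"
    and "\<Delta> 0 = 0" "0 \<le> c"
  shows "norm (\<Delta> x) \<le> 2 * c * norm x"
proof (cases "\<Delta> x = 0 \<or> x = 0")
  case True
  then show ?thesis
    using assms(2,3) by auto
next
  case False
  define s where "s = norm x / norm (\<Delta> x)"
  have "norm (\<Delta> x) * norm x = cmod (cinner (\<Delta> x) (s *\<^sub>R \<Delta> x))"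
    using False by (simp add: s_def cinner.scaleR_right cinner_self norm_mult norm_power power2_eq_square)
  also have "\<dots> \<le> c * ((norm x)\<^sup>2 + (norm (s *\<^sub>R \<Delta> x))\<^sup>2)"
    by (rule c)
  also have "\<dots> = 2 * c * norm x * norm x"
    using False by (simp add: s_def power2_eq_square)
  finally show ?thesis
    using False by simp
qed

lemma has_integral_Poisson_kernel:
  fixes d :: real
  assumes "d > 0" "h \<ge> 0"
  shows "((\<lambda>y. d / (d\<^sup>2 + y\<^sup>2)) has_integral arctan (h / d) - arctan (- h / d)) {- h..h}"
proof (rule fundamental_theorem_of_calculus)
  fix y
  have "((\<lambda>y. arctan (y / d)) has_real_derivative d / (d\<^sup>2 + y\<^sup>2)) (at y within {- h..h})"
    using assms(1)
    by (auto intro!: derivative_eq_intros simp: field_simps power2_eq_square)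
  then show "((\<lambda>y. arctan (y / d)) has_vector_derivative d / (d\<^sup>2 + y\<^sup>2)) (at y within {- h..h})"
    by (simp add: has_real_derivative_iff_has_vector_derivative)
qed (use assms in simp)

text \<open>Over the whole line each kernel integrates to \<pi>, so neither \<open>h\<close> nor the
  distances \<open>d j\<close> enter the bound.\<close>

lemma vertical_contour_integral_bound:
  fixes c d :: "'i \<Rightarrow> real"
  assumes h: "h > 0" and F: "F contour_integrable_on linepath (Complex x (- h)) (Complex x h)"
    and J: "finite J" and c: "\<And>j. j \<in> J \<Longrightarrow> c j \<ge> 0" and d: "\<And>j. j \<in> J \<Longrightarrow> d j > 0"
    and bound: "\<And>y. y \<in> {- h..h} \<Longrightarrow> cmod (F (Complex x y)) \<le> (\<Sum>j\<in>J. c j * (d j / ((d j)\<^sup>2 + y\<^sup>2)))"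
  shows "cmod (contour_integral (linepath (Complex x (- h)) (Complex x h)) F) \<le> pi * (\<Sum>j\<in>J. c j)"
proof -
  let ?I = "contour_integral (linepath (Complex x (- h)) (Complex x h)) F"
  have F': "((\<lambda>y. F (Complex x y)) has_integral - \<i> * ?I) {- h..h}"
    using has_contour_integral_integral[OF F] h
      has_contour_integral_linepath_same_Re_iff[of "Complex x (- h)" x "Complex x h" "- h" h F ?I]
    by simp
  define \<Phi> where "\<Phi> y = (\<Sum>j\<in>J. c j * (d j / ((d j)\<^sup>2 + y\<^sup>2)))" for y
  have \<Phi>: "(\<Phi> has_integral (\<Sum>j\<in>J. c j * (arctan (h / d j) - arctan (- h / d j)))) {- h..h}"
    unfolding \<Phi>_def using d h
    by (intro has_integral_sum[OF J] has_integral_mult_right has_integral_Poisson_kernel) auto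
  have "norm (integral {- h..h} (\<lambda>y. F (Complex x y))) \<le> integral {- h..h} \<Phi>"
    using F' \<Phi> bound
    by (intro integral_norm_bound_integral) (auto simp: \<Phi>_def norm_mult integrable_on_def)
  also have "integral {- h..h} \<Phi> = (\<Sum>j\<in>J. c j * (arctan (h / d j) - arctan (- h / d j)))"
    using \<Phi> by (rule integral_unique)
  also have "\<dots> \<le> (\<Sum>j\<in>J. c j * pi)"
  proof (intro sum_mono mult_left_mono c)
    show "arctan (h / d j) - arctan (- h / d j) \<le> pi" for j
      using arctan_ubound[of "h / d j"] arctan_lbound[of "- h / d j"] by linarith
  qed
  also have "integral {- h..h} (\<lambda>y. F (Complex x y)) = - \<i> * ?I"
    using F' by (rule integral_unique)
  finally show ?thesis
    by (simp add: sum_distrib_left mult.commute norm_mult)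
qed

section \<open>Contour integrals compared with those of the diagonal operator\<close>

context perturbed_diagonal
begin

lemma linear_op_T: "linear_op D T"
proof -
  have ex: "\<exists>x. f = K x \<and> x + V x = K (T f)" if "f \<in> D" for f
    using T_iff[of f "T f"] that by blast
  have add: "f + g \<in> D \<and> T (f + g) = T f + T g" if fg: "f \<in> D" "g \<in> D" for f g
  proof -
    obtain x y where "f = K x" "x + V x = K (T f)" "g = K y" "y + V y = K (T g)"
      using ex fg by metis
    then have "f + g = K (x + y) \<and> (x + y) + V (x + y) = K (T f + T g)"
      by (simp add: bounded_clinear_add[OF K_bounded] bounded_clinear_add[OF V_bounded] algebra_simps)
    then show ?thesis
      using T_iff by blast
  qed
  have scale: "c *\<^sub>C f \<in> D \<and> T (c *\<^sub>C f) = c *\<^sub>C T f" if f: "f \<in> D" for c f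
  proof -
    obtain x where "f = K x" "x + V x = K (T f)"
      using ex[OF f] by blast
    then have "c *\<^sub>C f = K (c *\<^sub>C x) \<and> c *\<^sub>C x + V (c *\<^sub>C x) = K (c *\<^sub>C T f)"
      by (simp add: bounded_clinear_scaleC[OF K_bounded] bounded_clinear_scaleC[OF V_bounded]
          flip: scaleC_add_right)
    then show ?thesis
      using T_iff by blast
  qed
  have "0 \<in> D"
    using T_iff[of 0 0] bounded_clinear_zero[OF K_bounded] bounded_clinear_zero[OF V_bounded]
    by (metis add_0)
  then show ?thesis
    using add scale by (auto simp: linear_op_def intro!: complex_vector.subspaceI)
qed

sublocale linear_operator D T
  by unfold_locales (rule linear_op_T)

definition partial :: "nat \<Rightarrow> 'h \<Rightarrow> 'h" where
  "partial M x = (\<Sum>j<M. P j x)"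

lemma P_partial: "P k (partial M x) = (if k < M then P k x else 0)"
proof -
  have "P k (partial M x) = (\<Sum>j<M. if j = k then P k x else 0)"
    unfolding partial_def bounded_clinear_sum[OF P_bounded] by (intro sum.cong) (auto simp: P_idem P_orth)
  then show ?thesis by simp
qed

lemma partial_tendsto: "(\<lambda>M. partial M x) \<longlonglongrightarrow> x"
  using P_sums[of x] by (simp add: sums_def partial_def)

lemma sum_norm_P_le: "finite J \<Longrightarrow> (\<Sum>j\<in>J. (norm (P j x))\<^sup>2) \<le> (norm x)\<^sup>2"
  using sum_le_suminf[OF norm_P_summable[of x]] sums_unique[OF norm_P_sums[of x]] by simp

lemma alpha_partial: "alpha z (partial M x) = (\<Sum>j<M. w j / cmod (z - of_real (m j)) * norm (P j x))"
proof -
  have "alpha z (partial M x) = (\<Sum>k\<in>{..<M}. w k / cmod (z - of_real (m k)) * norm (P k (partial M x)))"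
    unfolding alpha_def weighted_norm_def by (rule suminf_finite) (auto simp: P_partial)
  then show ?thesis
    by (simp add: P_partial)
qed

lemma alpha_P: "alpha z (P k x) = w k / cmod (z - of_real (m k)) * norm (P k x)"
  unfolding alpha_def by (rule weighted_norm_P)

lemma eps_partial_le: "finite J \<Longrightarrow> (\<Sum>j\<in>J. (w j)\<^sup>2 / cmod (z - of_real (m j))) \<le> eps z"
  unfolding eps_def by (intro sum_le_suminf eps_summable) auto

text \<open>On a truncated vector the unperturbed resolvent is a finite sum of simple poles, so its
  contour integral is a finite sum of winding numbers. Bounds uniform in \<open>M\<close> are passed
  to the limit afterwards.\<close>

lemma riesz_difference:
  assumes \<gamma>: "contour \<gamma>" "path_image \<gamma> \<subseteq> rho" and m: "\<And>j. complex_of_real (m j) \<notin> path_image \<gamma>"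
  shows "((\<lambda>z. cinner (R z (partial M x) - R0 z (partial M x)) g) has_contour_integral
    (2 * of_real pi * \<i>) * (cinner (riesz \<gamma> (partial M x)) g -
      (\<Sum>j<M. winding_number \<gamma> (m j) * cinner (P j x) g))) \<gamma>"
proof -
  have R0_P: "R0 z (P j x) = (1 / (z - of_real (m j))) *\<^sub>C P j x" for z j
  proof (rule P_ext)
    show "P k (R0 z (P j x)) = P k ((1 / (z - of_real (m j))) *\<^sub>C P j x)" for k
      by (cases "k = j") (simp_all add: P_R0 P_idem P_orth bounded_clinear_scaleC[OF P_bounded])
  qed
  have "((\<lambda>z. 1 / (z - of_real (m j))) has_contour_integral 2 * of_real pi * \<i> * winding_number \<gamma> (m j)) \<gamma>" for j
    using has_contour_integral_winding_number[OF contour_valid_path[OF \<gamma>(1)] m[of j]] by simp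
  then have "((\<lambda>z. \<Sum>j<M. 1 / (z - of_real (m j)) * cinner (P j x) g) has_contour_integral
      (\<Sum>j<M. 2 * of_real pi * \<i> * winding_number \<gamma> (m j) * cinner (P j x) g)) \<gamma>"
    by (intro has_contour_integral_sum has_contour_integral_rmul) auto
  moreover have "(\<Sum>j<M. 1 / (z - of_real (m j)) * cinner (P j x) g) = cinner (R0 z (partial M x)) g" for z
    by (simp add: partial_def bounded_clinear_sum[OF R0_bounded] cinner.sum_left R0_P cinner_scaleC_left)
  moreover have "(\<Sum>j<M. 2 * of_real pi * \<i> * winding_number \<gamma> (m j) * cinner (P j x) g) =
      2 * of_real pi * \<i> * (\<Sum>j<M. winding_number \<gamma> (m j) * cinner (P j x) g)"
    by (simp add: sum_distrib_left mult.assoc)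
  ultimately show ?thesis
    using has_contour_integral_diff[OF riesz_has_contour_integral[OF \<gamma>]]
    by (simp add: cinner.diff_left right_diff_distrib)
qed

lemma nearest_index: "\<exists>n. \<forall>j. \<bar>x - m n\<bar> \<le> \<bar>x - m j\<bar>"
proof -
  obtain N where N: "\<And>j. j \<ge> N \<Longrightarrow> x + \<bar>x - m 0\<bar> \<le> m j"
    using m_lim unfolding filterlim_at_top eventually_sequentially by metis
  have "Min ((\<lambda>j. \<bar>x - m j\<bar>) ` {..N}) \<in> (\<lambda>j. \<bar>x - m j\<bar>) ` {..N}"
    by (intro Min_in) auto
  from this[unfolded image_iff]
  obtain n where n: "n \<le> N" "Min ((\<lambda>j. \<bar>x - m j\<bar>) ` {..N}) = \<bar>x - m n\<bar>"
    by blast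
  have small: "\<bar>x - m n\<bar> \<le> \<bar>x - m j\<bar>" if "j \<le> N" for j
    unfolding n(2)[symmetric] using that by (intro Min_le) auto
  have "\<bar>x - m n\<bar> \<le> \<bar>x - m j\<bar>" for j
  proof (cases "j \<le> N")
    case False
    then show ?thesis
      using N[of j] small[of 0] by linarith
  qed (rule small)
  then show ?thesis by blast
qed

text \<open>From index \<open>J\<close> on, \<open>Re z \<le> X\<close> keeps \<open>z\<close> at
  distance at least half of \<open>m j\<close>, and the tail is small by \<open>w_summable\<close>;
  the finitely many other terms are small because \<open>z\<close> is at distance at least
  \<open>h\<close> from every eigenvalue.\<close>

lemma eps_far:
  assumes "e > 0"
  shows "\<exists>h0>0. \<forall>h\<ge>h0. \<forall>z. Re z \<le> X \<and> (h \<le> \<bar>Im z\<bar> \<or> Re z \<le> - h) \<longrightarrow>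
    eps z \<le> e \<and> (\<forall>k. h \<le> cmod (z - of_real (m k)))"
proof -
  obtain J1 where J1: "\<And>n. n \<ge> J1 \<Longrightarrow> norm (\<Sum>i. (w (i + n))\<^sup>2 / m (i + n)) < e / 4"
    using suminf_exist_split[OF _ w_summable, of "e / 4"] assms by auto
  obtain J2 where J2: "\<And>j. j \<ge> J2 \<Longrightarrow> 2 * X \<le> m j"
    using m_lim unfolding filterlim_at_top eventually_sequentially by metis
  define J where "J = max J1 J2"
  define W where "W = (\<Sum>j<J. (w j)\<^sup>2)"
  \<comment> \<open>Makes the terms below \<open>J\<close> contribute at most
    \<open>e / 2\<close>.\<close>
  define h0 where "h0 = 2 * W / e + 1"
  have "W \<ge> 0"
    by (simp add: W_def sum_nonneg)
  then have "h0 > 0"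
    using assms by (simp add: h0_def add_nonneg_pos)
  moreover have "eps z \<le> e \<and> (\<forall>k. h \<le> cmod (z - of_real (m k)))"
    if h: "h \<ge> h0" and z: "Re z \<le> X" "h \<le> \<bar>Im z\<bar> \<or> Re z \<le> - h" for h z
  proof
    show dist: "\<forall>k. h \<le> cmod (z - of_real (m k))"
    proof
      fix k
      show "h \<le> cmod (z - of_real (m k))"
        using z(2) m_pos[of k] abs_Im_le_cmod[of "z - of_real (m k)"] abs_Re_le_cmod[of "z - of_real (m k)"]
        by auto
    qed
    have "h > 0"
      using h \<open>h0 > 0\<close> by linarith
    then have pos: "0 < cmod (z - of_real (m k))" for k
      using dist less_le_trans by blast
    let ?f = "\<lambda>j. (w j)\<^sup>2 / cmod (z - of_real (m j))"
    have "eps z = (\<Sum>j. ?f (j + J)) + (\<Sum>j<J. ?f j)"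
      unfolding eps_def by (rule suminf_split_initial_segment[OF eps_summable])
    also have "(\<Sum>j<J. ?f j) \<le> (\<Sum>j<J. (w j)\<^sup>2 / h)"
      using dist \<open>h > 0\<close> pos by (intro sum_mono divide_left_mono mult_pos_pos) auto
    also have "(\<Sum>j<J. (w j)\<^sup>2 / h) = W / h"
      by (simp add: W_def sum_divide_distrib)
    also have "W / h \<le> e / 2"
    proof -
      have "2 * W / e \<le> h"
        using h by (simp add: h0_def)
      then show ?thesis
        using \<open>h > 0\<close> assms by (simp add: field_simps)
    qed
    also have "(\<Sum>j. ?f (j + J)) \<le> (\<Sum>j. 2 * ((w (j + J))\<^sup>2 / m (j + J)))"
    proof (intro suminf_le summable_mult summable_ignore_initial_segment eps_summable w_summable)
      fix j
      have "m (j + J) \<le> 2 * cmod (z - of_real (m (j + J)))"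
      proof -
        have "2 * X \<le> m (j + J)"
          by (rule J2) (simp add: J_def)
        moreover have "\<bar>Re z - m (j + J)\<bar> \<le> cmod (z - of_real (m (j + J)))"
          using abs_Re_le_cmod[of "z - of_real (m (j + J))"] by simp
        ultimately show ?thesis
          using z(1) by linarith
      qed
      then have "(w (j + J))\<^sup>2 / cmod (z - of_real (m (j + J))) \<le> (w (j + J))\<^sup>2 / (m (j + J) / 2)"
        using m_pos[of "j + J"] by (intro divide_left_mono mult_pos_pos) auto
      then show "?f (j + J) \<le> 2 * ((w (j + J))\<^sup>2 / m (j + J))"
        by (simp add: mult.commute)
    qed
    also have "\<dots> = 2 * (\<Sum>j. (w (j + J))\<^sup>2 / m (j + J))"
      by (intro suminf_mult summable_ignore_initial_segment w_summable)
    also have "\<dots> \<le> e / 2"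
      using J1[of J] by (simp add: J_def abs_le_iff)
    finally show "eps z \<le> e" by simp
  qed
  ultimately show ?thesis by blast
qed

end

section \<open>Circles about the eigenvalues and the Schur test\<close>

locale perturbed_diagonal_gaps = perturbed_diagonal P m w V D T
  for P :: "nat \<Rightarrow> 'h::complex_hilbert \<Rightarrow> 'h" and m w V D T +
  fixes r :: "nat \<Rightarrow> real"
  assumes r_pos: "0 < r k" and r_sep: "j \<noteq> k \<Longrightarrow> 2 * r k \<le> \<bar>m j - m k\<bar>"
    and sigma_lim: "(\<lambda>n. eps (complex_of_real (m n)) + (w n)\<^sup>2 / r n) \<longlonglongrightarrow> 0"
begin

text \<open>The term with index \<open>n\<close> of \<open>eps (m n)\<close> vanishes, because division by zero gives zero.\<close>

definition sigma :: "nat \<Rightarrow> real" where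
  "sigma n = eps (complex_of_real (m n)) + (w n)\<^sup>2 / r n"

text \<open>With \<open>r n\<close> on the diagonal the two summands of \<open>sigma n\<close>
  become one sum over all \<open>j\<close>. Half of \<open>gap n j\<close> is also a lower bound for
  the distance from \<open>m j\<close> to the nth circle.\<close>

definition gap :: "nat \<Rightarrow> nat \<Rightarrow> real" where
  "gap n j = (if j = n then r n else \<bar>m n - m j\<bar>)"

definition X :: "nat \<Rightarrow> real" where
  "X N = m N + r N"

definition rect :: "nat \<Rightarrow> real \<Rightarrow> real \<Rightarrow> real \<Rightarrow> complex" where
  "rect N h h' = rectpath (Complex (- h) (- h')) (Complex (X N) h')"

definition circ :: "nat \<Rightarrow> real \<Rightarrow> complex" where
  "circ k = circlepath (of_real (m k)) (r k)"

definition E :: "nat \<Rightarrow> 'h \<Rightarrow> 'h" where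
  "E N x = (\<Sum>k\<le>N. P k x)"

lemma m_less: "j < k \<Longrightarrow> m j < m k"
  using m_mono by (rule strict_monoD)

lemma m_neq: "j \<noteq> k \<Longrightarrow> m j \<noteq> m k"
  using strict_mono_eq[OF m_mono] by simp

lemma gap_pos: "0 < gap n j"
  using r_pos m_neq[of n j] by (auto simp: gap_def)

lemma gap_commute: "gap n j = gap j n"
  by (auto simp: gap_def)

lemma r_add_le: "j \<noteq> k \<Longrightarrow> r j + r k \<le> \<bar>m j - m k\<bar>"
  using r_sep[of j k] r_sep[of k j] by linarith

lemma X_le: "N < k \<Longrightarrow> X N \<le> m k - r k"
  using r_add_le[of N k] m_less[of N k] by (simp add: X_def)

lemma X_mono: "N < k \<Longrightarrow> X N < X k"
  using X_le[of N k] r_pos[of k] by (simp add: X_def)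

lemma X_pos: "0 < X N"
  using m_pos r_pos by (simp add: X_def add_pos_pos)

lemma sigma_partial_le:
  assumes "finite J"
  shows "(\<Sum>j\<in>J. (w j)\<^sup>2 / gap n j) \<le> sigma n"
proof -
  have "(\<Sum>j\<in>J. (w j)\<^sup>2 / gap n j) =
      (\<Sum>j\<in>J. (w j)\<^sup>2 / cmod (of_real (m n) - of_real (m j)) + (if j = n then (w n)\<^sup>2 / r n else 0))"
    by (intro sum.cong) (auto simp: gap_def simp flip: of_real_diff)
  also have "\<dots> = (\<Sum>j\<in>J. (w j)\<^sup>2 / cmod (of_real (m n) - of_real (m j))) + (if n \<in> J then (w n)\<^sup>2 / r n else 0)"
    using assms by (simp add: sum.distrib)
  also have "\<dots> \<le> sigma n"
    unfolding sigma_def using assms r_pos[of n] by (intro add_mono eps_partial_le) auto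
  finally show ?thesis .
qed

text \<open>If \<open>m n\<close> is the eigenvalue nearest to \<open>Re z\<close>, then
  \<open>z\<close> is at least half as far from \<open>m j\<close> as \<open>m n\<close> is, so
  replacing \<open>m n\<close> by \<open>z\<close> at most doubles each term with
  \<open>j \<noteq> n\<close>; the remaining term is controlled by \<open>far\<close>.\<close>

lemma eps_le_sigma:
  assumes near: "\<And>j. \<bar>Re z - m n\<bar> \<le> \<bar>Re z - m j\<bar>" and far: "r n \<le> cmod (z - of_real (m n))"
  shows "eps z \<le> 2 * sigma n" and "z \<noteq> of_real (m j)"
proof -
  have Re_le: "\<bar>m n - m j\<bar> \<le> 2 * cmod (z - of_real (m j))" for j
    using near[of j] abs_Re_le_cmod[of "z - of_real (m j)"] by (simp add: abs_if split: if_splits)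
  show "z \<noteq> of_real (m j)"
  proof
    assume z: "z = of_real (m j)"
    then have "m n = m j"
      using near[of j] by simp
    then show False
      using far r_pos[of n] z by simp
  qed
  have "eps z \<le> (\<Sum>j. 2 * ((w j)\<^sup>2 / cmod (of_real (m n) - of_real (m j))) + (if j = n then (w j)\<^sup>2 / r j else 0))"
    unfolding eps_def
  proof (intro suminf_le eps_summable summable_add summable_mult)
    show "summable (\<lambda>j. if j = n then (w j)\<^sup>2 / r j else 0)"
      by simp
    fix j
    show "(w j)\<^sup>2 / cmod (z - of_real (m j)) \<le>
        2 * ((w j)\<^sup>2 / cmod (of_real (m n) - of_real (m j))) + (if j = n then (w j)\<^sup>2 / r j else 0)"
    proof (cases "j = n")
      case True
      then show ?thesis
        using far r_pos[of n] by (auto intro!: divide_left_mono mult_pos_pos)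
    next
      case False
      have pos: "\<bar>m n - m j\<bar> > 0"
        using m_neq[of n j] False by simp
      have "(w j)\<^sup>2 / cmod (z - of_real (m j)) \<le> (w j)\<^sup>2 / (\<bar>m n - m j\<bar> / 2)"
        using Re_le[of j] pos by (intro divide_left_mono mult_pos_pos) auto
      then show ?thesis
        using False by (simp add: mult.commute flip: of_real_diff)
    qed
  qed
  also have "\<dots> = (\<Sum>j. 2 * ((w j)\<^sup>2 / cmod (of_real (m n) - of_real (m j)))) + (\<Sum>j. if j = n then (w j)\<^sup>2 / r j else 0)"
    by (intro suminf_add[symmetric] summable_mult eps_summable) simp
  also have "(\<Sum>j. 2 * ((w j)\<^sup>2 / cmod (of_real (m n) - of_real (m j)))) = 2 * eps (of_real (m n))"
    unfolding eps_def by (rule suminf_mult[OF eps_summable])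
  also have "(\<Sum>j. if j = n then (w j)\<^sup>2 / r j else 0) = (w n)\<^sup>2 / r n"
    using sums_unique[OF sums_single[of n "\<lambda>j. (w j)\<^sup>2 / r j"]] by simp
  also have "2 * eps (of_real (m n)) + (w n)\<^sup>2 / r n \<le> 2 * sigma n"
    using divide_nonneg_pos[OF zero_le_power2[of "w n"] r_pos[of n]] unfolding sigma_def distrib_left
    by linarith
  finally show "eps z \<le> 2 * sigma n" .
qed

text \<open>To the right of \<open>X N\<close> the nearest eigenvalue has index at least
  \<open>N\<close>, the range in which \<open>sigma\<close> is small.\<close>

lemma eps_le_sigma_right:
  assumes z: "X N \<le> Re z" and far: "\<And>k. k > N \<Longrightarrow> r k \<le> cmod (z - of_real (m k))"
  shows "\<exists>n\<ge>N. eps z \<le> 2 * sigma n" and "z \<noteq> of_real (m j)"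
proof -
  obtain n where n: "\<And>j. \<bar>Re z - m n\<bar> \<le> \<bar>Re z - m j\<bar>"
    using nearest_index by metis
  have "n \<ge> N"
  proof (rule ccontr)
    assume "\<not> n \<ge> N"
    then have "m n < m N" by (intro m_less) simp
    then show False
      using n[of N] z r_pos[of N] by (simp add: X_def)
  qed
  moreover have rn: "r n \<le> cmod (z - of_real (m n))"
  proof (cases "n = N")
    case True
    then show ?thesis
      using z abs_Re_le_cmod[of "z - of_real (m n)"] by (simp add: X_def)
  next
    case False
    then show ?thesis
      using far \<open>n \<ge> N\<close> by simp
  qed
  ultimately show "\<exists>n\<ge>N. eps z \<le> 2 * sigma n"
    using eps_le_sigma(1)[OF n rn] by blast
  show "z \<noteq> of_real (m j)"
    by (rule eps_le_sigma(2)[OF n rn])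
qed

lemma far_of_Re:
  assumes "Re z \<le> X N" "N < k"
  shows "r k \<le> cmod (z - of_real (m k))"
  using X_le[OF assms(2)] assms(1) abs_Re_le_cmod[of "z - of_real (m k)"] by simp

lemma circ_image: "path_image (circ k) = sphere (of_real (m k)) (r k)"
  using r_pos[of k] by (simp add: circ_def path_image_circlepath_nonneg)

lemma contour_circ: "contour (circ k)" and contour_rect: "contour (rect N h h')"
  unfolding circ_def rect_def by (intro contour_circlepath contour_rectpath r_pos)+

lemma circ_far:
  assumes z: "z \<in> sphere (of_real (m k)) (r k)" and "N < k"
  shows "X N \<le> Re z" and "r j \<le> cmod (z - of_real (m j))"
proof -
  have zk: "cmod (z - of_real (m k)) = r k"
    using z by (simp add: dist_norm norm_minus_commute)
  then show "X N \<le> Re z"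
    using X_le[OF \<open>N < k\<close>] abs_Re_le_cmod[of "z - of_real (m k)"] by simp
  show "r j \<le> cmod (z - of_real (m j))"
  proof (cases "j = k")
    case False
    have "\<bar>m k - m j\<bar> \<le> cmod (z - of_real (m k)) + cmod (z - of_real (m j))"
      using norm_triangle_ineq4[of "z - of_real (m j)" "z - of_real (m k)"] by (simp flip: of_real_diff)
    then show ?thesis
      using r_add_le[of j k] False zk by (simp add: abs_minus_commute)
  qed (use zk in simp)
qed

lemma circ_dist_ge:
  assumes z: "z \<in> sphere (of_real (m k)) (r k)"
  shows "gap k j / 2 \<le> cmod (z - of_real (m j))"
proof (cases "j = k")
  case True
  then show ?thesis
    using z r_pos[of k] by (simp add: gap_def dist_norm norm_minus_commute)
next
  case False
  have "\<bar>m k - m j\<bar> \<le> cmod (z - of_real (m k)) + cmod (z - of_real (m j))"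
    using norm_triangle_ineq4[of "z - of_real (m j)" "z - of_real (m k)"] by (simp flip: of_real_diff)
  moreover have "cmod (z - of_real (m k)) = r k"
    using z by (simp add: dist_norm norm_minus_commute)
  ultimately show ?thesis
    using r_sep[of j k] False by (simp add: gap_def abs_minus_commute)
qed

lemma winding_circ:
  "winding_number (circ k) (of_real (m j)) = (if j = k then 1 else 0)"
proof (cases "j = k")
  case True
  then show ?thesis
    unfolding circ_def using r_pos[of k] by (simp add: winding_number_circlepath)
next
  case False
  then have "r k < cmod (complex_of_real (m j) - of_real (m k))"
    using r_sep[of j k] r_pos[of k] by (simp flip: of_real_diff)
  then show ?thesis
    unfolding circ_def using False r_pos[of k] by (simp add: winding_number_circlepath_outside)
qed

context
  fixes N :: nat and \<delta> :: real
  assumes \<delta>: "0 < \<delta>" "\<delta> \<le> 1 / 16" and sigma_le: "\<And>n. n \<ge> N \<Longrightarrow> sigma n \<le> \<delta>"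
begin

lemma eps_le_right:
  assumes "X N \<le> Re z" "\<And>k. k > N \<Longrightarrow> r k \<le> cmod (z - of_real (m k))"
  shows "eps z \<le> 2 * \<delta>"
  using eps_le_sigma_right(1)[OF assms] sigma_le by fastforce

lemma resolvent_right:
  assumes "X N \<le> Re z" "\<And>k. k > N \<Longrightarrow> r k \<le> cmod (z - of_real (m k))"
  shows "z \<in> rho" and "cmod (cinner (R z f - R0 z f) g) \<le> 2 * (alpha z f * alpha z g)"
proof -
  have e: "eps z \<le> 1 / 2"
    using eps_le_right[OF assms] \<delta> by simp
  show "z \<in> rho"
    using e eps_le_sigma_right(2)[OF assms] by (intro resolvent_estimate) auto
  have "cmod (cinner (R z f - R0 z f) g) \<le> alpha z f * alpha z g / (1 - eps z)"
    using e eps_le_sigma_right(2)[OF assms] by (intro resolvent_estimate) auto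
  also have "\<dots> \<le> alpha z f * alpha z g / (1 / 2)"
    using e by (intro divide_left_mono mult_nonneg_nonneg alpha_nonneg) auto
  finally show "cmod (cinner (R z f - R0 z f) g) \<le> 2 * (alpha z f * alpha z g)"
    by simp
qed

lemma circ_subset:
  assumes "N < k"
  shows "path_image (circ k) \<subseteq> rho"
proof
  fix z assume "z \<in> path_image (circ k)"
  then have z: "z \<in> sphere (of_real (m k)) (r k)"
    by (simp add: circ_image)
  show "z \<in> rho"
    by (intro resolvent_right(1) circ_far[OF z assms])
qed

text \<open>Testing against the range of \<open>P k\<close> collapses one factor of the estimate to
  \<open>w k / r k\<close> times a norm, and the length of the circle cancels \<open>r k\<close>.
  The other factor is a row of the matrix for the Schur test.\<close>

lemma circ_projection_difference:
  assumes k: "N < k"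
  shows "norm (P k (riesz (circ k) (partial M x) - P k (partial M x))) \<le>
    4 * w k * (\<Sum>j<M. w j / gap k j * norm (P j x))"
proof -
  define \<Delta> where "\<Delta> = riesz (circ k) (partial M x) - P k (partial M x)"
  define s where "s = (\<Sum>j<M. w j / gap k j * norm (P j x))"
  have s: "s \<ge> 0"
    unfolding s_def
    by (intro sum_nonneg mult_nonneg_nonneg divide_nonneg_pos w_nonneg gap_pos norm_ge_zero)
  have bound: "cmod (cinner \<Delta> (P k y)) \<le> 4 * w k * s * norm (P k y)" for y
  proof -
    define g where "g = P k y"
    have not_image: "complex_of_real (m j) \<notin> path_image (circ k)" for j
      using circ_far(2)[OF _ k, of "of_real (m j)" j] r_pos[of j] by (auto simp: circ_image)
    have sum: "(\<Sum>j<M. winding_number (circ k) (of_real (m j)) * cinner (P j x) g) = cinner (P k (partial M x)) g"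
    proof -
      have "(\<Sum>j<M. winding_number (circ k) (of_real (m j)) * cinner (P j x) g) =
          (\<Sum>j<M. if j = k then cinner (P k x) g else 0)"
        by (intro sum.cong) (auto simp: winding_circ)
      then show ?thesis
        by (simp add: P_partial)
    qed
    have int: "((\<lambda>z. cinner (R z (partial M x) - R0 z (partial M x)) g) has_contour_integral
        (2 * of_real pi * \<i>) * cinner \<Delta> g) (circlepath (of_real (m k)) (r k))"
      using riesz_difference[OF contour_circ circ_subset[OF k] not_image, of M x g]
      unfolding sum by (simp add: \<Delta>_def cinner.diff_left circ_def)
    define B where "B = 2 * ((2 * s) * (w k / r k * norm g))"
    have "cmod (2 * of_real pi * \<i> * cinner \<Delta> g) \<le> B * (2 * pi * r k)"
    proof (rule has_contour_integral_bound_circlepath[OF int])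
      show "0 \<le> B"
        using s w_nonneg[of k] r_pos[of k] by (simp add: B_def)
      fix z assume "cmod (z - complex_of_real (m k)) = r k"
      then have z: "z \<in> sphere (of_real (m k)) (r k)"
        by (simp add: dist_norm norm_minus_commute)
      have "alpha z (partial M x) \<le> (\<Sum>j<M. 2 * (w j / gap k j * norm (P j x)))"
        unfolding alpha_partial
      proof (intro sum_mono)
        fix j
        have "w j / cmod (z - of_real (m j)) \<le> w j / (gap k j / 2)"
          using circ_dist_ge[OF z, of j] gap_pos[of k j] w_nonneg[of j]
          by (intro divide_left_mono mult_pos_pos) auto
        then have "w j / cmod (z - of_real (m j)) * norm (P j x) \<le> w j / (gap k j / 2) * norm (P j x)"
          by (intro mult_right_mono) auto
        then show "w j / cmod (z - of_real (m j)) * norm (P j x) \<le> 2 * (w j / gap k j * norm (P j x))"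
          by (simp add: mult_ac)
      qed
      also have "\<dots> = 2 * s"
        by (simp add: s_def sum_distrib_left)
      finally have a1: "alpha z (partial M x) \<le> 2 * s" .
      have a2: "alpha z g = w k / r k * norm g"
        using z by (simp add: g_def alpha_P P_idem dist_norm norm_minus_commute)
      have "cmod (cinner (R z (partial M x) - R0 z (partial M x)) g) \<le>
          2 * (alpha z (partial M x) * alpha z g)"
        by (intro resolvent_right(2) circ_far[OF z k])
      also have "\<dots> \<le> B"
        unfolding B_def a2[symmetric] using a1 by (intro mult_left_mono mult_right_mono alpha_nonneg) auto
      finally show "cmod (cinner (R z (partial M x) - R0 z (partial M x)) g) \<le> B" .
    qed (rule r_pos)
    then have "(2 * pi) * cmod (cinner \<Delta> g) \<le> (2 * pi) * (B * r k)"
      by (simp add: norm_mult mult_ac)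
    then have "cmod (cinner \<Delta> g) \<le> B * r k"
      by simp
    also have "B * r k = 4 * w k * s * norm g"
      using r_pos[of k] by (simp add: B_def)
    finally show ?thesis
      by (simp add: g_def)
  qed
  have "cinner \<Delta> (P k \<Delta>) = cinner (P k \<Delta>) (P k \<Delta>)"
    by (metis P_sym P_idem)
  then have "(norm (P k \<Delta>))\<^sup>2 \<le> 4 * w k * s * norm (P k \<Delta>)"
    using bound[of \<Delta>] by (simp add: cinner_self norm_power)
  moreover have "0 \<le> 4 * w k * s"
    using s w_nonneg[of k] by simp
  ultimately have "norm (P k \<Delta>) \<le> 4 * w k * s"
    by (cases "P k \<Delta> = 0") (auto simp: power2_eq_square)
  then show ?thesis
    by (simp add: \<Delta>_def s_def)
qed

text \<open>A Schur test for the matrix \<open>w k * w j / gap k j\<close>; its rows are weighted by \<open>w\<close>.\<close>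

lemma kato_sum_bound:
  assumes C: "\<And>n. sigma n \<le> C"
  shows "(\<Sum>k\<in>{N<..L}. (norm (P k (riesz (circ k) x - P k x)))\<^sup>2) \<le> 16 * \<delta> * C * (norm x)\<^sup>2"
proof -
  have fin: "(\<Sum>k\<in>{N<..L}. (norm (P k (riesz (circ k) (partial M x) - P k (partial M x))))\<^sup>2) \<le>
      16 * \<delta> * C * (norm x)\<^sup>2" for M
  proof -
    define a where "a j = norm (P j x)" for j
    have row: "(norm (P k (riesz (circ k) (partial M x) - P k (partial M x))))\<^sup>2 \<le>
        16 * \<delta> * (\<Sum>j<M. (a j)\<^sup>2 * ((w k)\<^sup>2 / gap k j))" if k: "k \<in> {N<..L}" for k
    proof -
      \<comment> \<open>Splitting \<open>1 / gap k j\<close> evenly between the factors lets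
        Cauchy-Schwarz produce the row sum, which is at most \<open>sigma k\<close>.\<close>
      have "(\<Sum>j<M. w j / gap k j * a j)\<^sup>2 =
          (\<Sum>j<M. (w j / sqrt (gap k j)) * (a j / sqrt (gap k j)))\<^sup>2"
        using gap_pos[of k] by (simp add: less_imp_le)
      also have "\<dots> \<le> (\<Sum>j<M. (w j / sqrt (gap k j))\<^sup>2) * (\<Sum>j<M. (a j / sqrt (gap k j))\<^sup>2)"
        by (rule Cauchy_Schwarz_ineq_sum)
      also have "\<dots> = (\<Sum>j<M. (w j)\<^sup>2 / gap k j) * (\<Sum>j<M. (a j)\<^sup>2 / gap k j)"
        using gap_pos[of k] by (simp add: power_divide less_imp_le)
      also have "\<dots> \<le> \<delta> * (\<Sum>j<M. (a j)\<^sup>2 / gap k j)"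
        using sigma_partial_le[of "{..<M}" k] sigma_le[of k] k gap_pos[of k]
        by (intro mult_right_mono sum_nonneg) (auto simp: less_imp_le)
      finally have cs: "(\<Sum>j<M. w j / gap k j * a j)\<^sup>2 \<le> \<delta> * (\<Sum>j<M. (a j)\<^sup>2 / gap k j)" .
      have "(norm (P k (riesz (circ k) (partial M x) - P k (partial M x))))\<^sup>2 \<le>
          (4 * w k * (\<Sum>j<M. w j / gap k j * a j))\<^sup>2"
        unfolding a_def using circ_projection_difference[of k M x] k by (intro power_mono) auto
      also have "\<dots> = 16 * (w k)\<^sup>2 * (\<Sum>j<M. w j / gap k j * a j)\<^sup>2"
        by (simp add: power_mult_distrib)
      also have "\<dots> \<le> 16 * (w k)\<^sup>2 * (\<delta> * (\<Sum>j<M. (a j)\<^sup>2 / gap k j))"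
        by (intro mult_left_mono cs) auto
      also have "\<dots> = 16 * \<delta> * (\<Sum>j<M. (a j)\<^sup>2 * ((w k)\<^sup>2 / gap k j))"
        by (simp add: sum_distrib_left mult_ac)
      finally show ?thesis .
    qed
    have "(\<Sum>k\<in>{N<..L}. (norm (P k (riesz (circ k) (partial M x) - P k (partial M x))))\<^sup>2) \<le>
        (\<Sum>k\<in>{N<..L}. 16 * \<delta> * (\<Sum>j<M. (a j)\<^sup>2 * ((w k)\<^sup>2 / gap k j)))"
      by (intro sum_mono row)
    also have "\<dots> = 16 * \<delta> * (\<Sum>j<M. (a j)\<^sup>2 * (\<Sum>k\<in>{N<..L}. (w k)\<^sup>2 / gap k j))"
      by (simp add: sum_distrib_left) (subst sum.swap, simp add: sum_distrib_left)
    \<comment> \<open>A column sum is at most \<open>sigma j\<close>, but \<open>j\<close> may be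
      less than \<open>N\<close>, so only the global bound is available.\<close>
    also have "\<dots> \<le> 16 * \<delta> * (\<Sum>j<M. (a j)\<^sup>2 * C)"
    proof (intro mult_left_mono sum_mono)
      show "(\<Sum>k\<in>{N<..L}. (w k)\<^sup>2 / gap k j) \<le> C" for j
        using sigma_partial_le[of "{N<..L}" j] C[of j] by (simp add: gap_commute[of j])
    qed (use \<delta> in auto)
    also have "\<dots> = 16 * \<delta> * (C * (\<Sum>j<M. (a j)\<^sup>2))"
      by (simp add: sum_distrib_left mult.commute)
    also have "\<dots> \<le> 16 * \<delta> * (C * (norm x)\<^sup>2)"
    proof -
      have "0 \<le> sigma 0"
        using eps_nonneg r_pos[of 0] by (simp add: sigma_def)
      then have "0 \<le> C"
        using C[of 0] by linarith
      then show ?thesis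
        unfolding a_def using \<delta> by (intro mult_left_mono sum_norm_P_le) auto
    qed
    finally show ?thesis by (simp add: mult_ac)
  qed
  have "(\<lambda>M. \<Sum>k\<in>{N<..L}. (norm (P k (riesz (circ k) (partial M x) - P k (partial M x))))\<^sup>2) \<longlonglongrightarrow>
      (\<Sum>k\<in>{N<..L}. (norm (P k (riesz (circ k) x - P k x)))\<^sup>2)"
    by (intro tendsto_sum tendsto_power tendsto_norm bounded_clinear_tendsto[OF P_bounded] tendsto_diff
        partial_tendsto bounded_clinear_tendsto[OF bounded_clinear_riesz[OF contour_circ circ_subset]]) auto
  then show ?thesis
    by (rule LIMSEQ_le_const2) (use fin in blast)
qed

end

end

section \<open>Large rectangles and the similarity of the tail\<close>

context perturbed_diagonal_gaps
begin

lemma P_E: "P k (E N x) = (if k \<le> N then P k x else 0)"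
proof -
  have "P k (E N x) = (\<Sum>j\<le>N. if j = k then P k x else 0)"
    unfolding E_def bounded_clinear_sum[OF P_bounded] by (intro sum.cong) (auto simp: P_idem P_orth)
  then show ?thesis by simp
qed

lemma E_bounded: "bounded_clinear (E N)"
  unfolding E_def by (intro bounded_clinear_sum_fun P_bounded)

lemma winding_rect:
  assumes "h > 0" "h' > 0"
  shows "winding_number (rect N h h') (of_real (m j)) = (if j \<le> N then 1 else 0)"
proof (cases "j \<le> N")
  case True
  then have "m j < X N"
    using m_less[of j N] r_pos[of N] by (cases "j = N") (auto simp: X_def)
  then have "complex_of_real (m j) \<in> box (Complex (- h) (- h')) (Complex (X N) h')"
    using assms m_pos[of j] by (simp add: in_box_complex_iff)
  then show ?thesis
    using True by (simp add: rect_def winding_number_rectpath)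
next
  case False
  then have "X N < m j"
    using X_le[of N j] r_pos[of j] by simp
  then have "complex_of_real (m j) \<notin> cbox (Complex (- h) (- h')) (Complex (X N) h')"
    by (simp add: in_cbox_complex_iff)
  then show ?thesis
    using False assms X_pos[of N] by (simp add: rect_def winding_number_rectpath_outside)
qed

lemma circ_idempotent:
  assumes "path_image (circ k) \<subseteq> rho"
  shows "riesz (circ k) (riesz (circ k) f) = riesz (circ k) f"
  using assms riesz_circle_idempotent[OF r_pos] unfolding circ_def by blast

lemma circ_disjoint:
  assumes "path_image (circ j) \<subseteq> rho" "path_image (circ k) \<subseteq> rho" "j \<noteq> k"
  shows "riesz (circ j) (riesz (circ k) f) = 0"
  unfolding circ_def
  by (rule riesz_circles_disjoint[OF r_pos _ r_pos])
    (use assms r_add_le[of j k] in \<open>simp_all add: circ_def flip: of_real_diff\<close>)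

lemma
  assumes h: "h > 0" "h' > 0" and image: "path_image (rect N h h') \<subseteq> rho"
  shows rect_idempotent: "riesz (rect N h h') (riesz (rect N h h') f) = riesz (rect N h h') f"
    and rect_circ_disjoint: "N < k \<Longrightarrow> path_image (circ k) \<subseteq> rho \<Longrightarrow>
      riesz (rect N h h') (riesz (circ k) f) = 0"
    and circ_rect_disjoint: "N < k \<Longrightarrow> path_image (circ k) \<subseteq> rho \<Longrightarrow>
      riesz (circ k) (riesz (rect N h h') f) = 0"
proof -
  have ab: "Re (Complex (- h) (- h')) < Re (Complex (X N) h')" "Im (Complex (- h) (- h')) < Im (Complex (X N) h')"
    using h X_pos[of N] by auto
  note image' = image[unfolded rect_def]
  show "riesz (rect N h h') (riesz (rect N h h') f) = riesz (rect N h h') f"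
    unfolding rect_def by (rule riesz_rect_idempotent[OF ab image'])
  assume k: "N < k" and c: "path_image (circ k) \<subseteq> rho"
  have sep: "Re (Complex (X N) h') + r k \<le> Re (complex_of_real (m k))"
    using X_le[OF k] by simp
  show "riesz (rect N h h') (riesz (circ k) f) = 0" "riesz (circ k) (riesz (rect N h h') f) = 0"
    unfolding rect_def circ_def
    by (rule riesz_rect_circle_disjoint[OF ab image' r_pos c[unfolded circ_def] sep]
        riesz_circle_rect_disjoint[OF ab image' r_pos c[unfolded circ_def] sep])+
qed

context
  fixes N :: nat and \<delta> h :: real
  assumes \<delta>: "0 < \<delta>" "\<delta> \<le> 1 / 16" and sigma_le: "\<And>n. n \<ge> N \<Longrightarrow> sigma n \<le> \<delta>"
    and h: "0 < h" "X N \<le> h"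
    and far: "\<And>z. Re z \<le> X N \<Longrightarrow> h \<le> \<bar>Im z\<bar> \<or> Re z \<le> - h \<Longrightarrow>
      eps z \<le> \<delta> \<and> (\<forall>k. h \<le> cmod (z - of_real (m k)))"
begin

lemma circ_subset': "N < k \<Longrightarrow> path_image (circ k) \<subseteq> rho"
  using circ_subset[OF \<delta>] sigma_le by blast

lemma
  assumes "X N \<le> Re z" "\<And>k. k > N \<Longrightarrow> r k \<le> cmod (z - of_real (m k))"
  shows resolvent_right': "z \<in> rho" "cmod (cinner (R z f - R0 z f) g) \<le> 2 * (alpha z f * alpha z g)"
  using resolvent_right[OF \<delta> _ assms] sigma_le by blast+

lemma resolvent_far:
  assumes "Re z \<le> X N" "h \<le> \<bar>Im z\<bar> \<or> Re z \<le> - h"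
  shows "z \<in> rho" and "cmod (cinner (R z f - R0 z f) g) \<le> 2 * (alpha z f * alpha z g)"
proof -
  have e: "eps z \<le> 1 / 2" and z: "z \<noteq> of_real (m k)" for k
  proof -
    show "eps z \<le> 1 / 2"
      using far[OF assms] \<delta> by simp
    have "0 < cmod (z - of_real (m k))"
      using far[OF assms] h(1) less_le_trans by blast
    then show "z \<noteq> of_real (m k)"
      by auto
  qed
  show "z \<in> rho"
    using e z by (intro resolvent_estimate) auto
  have "cmod (cinner (R z f - R0 z f) g) \<le> alpha z f * alpha z g / (1 - eps z)"
    using e z by (intro resolvent_estimate) auto
  also have "\<dots> \<le> alpha z f * alpha z g / (1 / 2)"
    using e by (intro divide_left_mono mult_nonneg_nonneg alpha_nonneg) auto
  finally show "cmod (cinner (R z f - R0 z f) g) \<le> 2 * (alpha z f * alpha z g)"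
    by simp
qed

lemma spectrum_located:
  assumes "z \<notin> rho"
  shows "(- h < Re z \<and> Re z \<le> X N \<and> \<bar>Im z\<bar> \<le> h) \<or> (\<exists>k>N. cmod (z - of_real (m k)) < r k)"
proof (cases "Re z \<le> X N")
  case True
  then show ?thesis
    using resolvent_far(1)[where z = z] assms by force
next
  case False
  then show ?thesis
    using resolvent_right'(1)[where z = z] assms by force
qed

lemma rect_image_cases:
  assumes "z \<in> path_image (rect N h h)"
  shows "Re z = X N \<or> (Re z \<le> X N \<and> (h \<le> \<bar>Im z\<bar> \<or> Re z \<le> - h))"
proof -
  have "z \<in> path_image (rectpath (Complex (- h) (- h)) (Complex (X N) h))"
    using assms by (simp add: rect_def)
  then show ?thesis
    using h X_pos[of N] by (subst (asm) path_image_rectpath) auto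
qed

lemma rect_subset: "path_image (rect N h h) \<subseteq> rho"
proof
  fix z assume "z \<in> path_image (rect N h h)"
  then consider "Re z = X N" | "Re z \<le> X N" "h \<le> \<bar>Im z\<bar> \<or> Re z \<le> - h"
    using rect_image_cases by blast
  then show "z \<in> rho"
  proof cases
    case 1
    then show ?thesis
      by (intro resolvent_right'(1) far_of_Re) auto
  qed (rule resolvent_far(1))
qed

text \<open>One factor of the distance goes into \<open>eps\<close>, the other is at least
  \<open>h\<close>; the resulting \<open>1 / h\<close> cancels against the length of a side.\<close>

lemma alpha_partial_far:
  assumes "Re z \<le> X N" "h \<le> \<bar>Im z\<bar> \<or> Re z \<le> - h"
  shows "(alpha z (partial M x))\<^sup>2 \<le> \<delta> / h * (norm x)\<^sup>2"
proof -
  have e: "eps z \<le> \<delta>" and z: "h \<le> cmod (z - of_real (m k))" for k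
    using far[OF assms] by auto
  have "(alpha z (partial M x))\<^sup>2 \<le>
      (\<Sum>j<M. (w j / cmod (z - of_real (m j)))\<^sup>2) * (\<Sum>j<M. (norm (P j x))\<^sup>2)"
    unfolding alpha_partial by (rule Cauchy_Schwarz_ineq_sum)
  also have "\<dots> \<le> \<delta> / h * (norm x)\<^sup>2"
  proof (intro mult_mono sum_norm_P_le sum_nonneg)
    have "(\<Sum>j<M. (w j / cmod (z - of_real (m j)))\<^sup>2) \<le> (\<Sum>j<M. (w j)\<^sup>2 / cmod (z - of_real (m j)) * (1 / h))"
    proof (intro sum_mono)
      fix j
      have "(w j / cmod (z - of_real (m j)))\<^sup>2 = (w j)\<^sup>2 / cmod (z - of_real (m j)) * (1 / cmod (z - of_real (m j)))"
        by (simp add: power2_eq_square)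
      also have "\<dots> \<le> (w j)\<^sup>2 / cmod (z - of_real (m j)) * (1 / h)"
        using z[of j] h(1) less_le_trans[OF h(1) z[of j]]
        by (intro mult_left_mono divide_left_mono mult_pos_pos) auto
      finally show "(w j / cmod (z - of_real (m j)))\<^sup>2 \<le> (w j)\<^sup>2 / cmod (z - of_real (m j)) * (1 / h)" .
    qed
    also have "\<dots> = (\<Sum>j<M. (w j)\<^sup>2 / cmod (z - of_real (m j))) * (1 / h)"
      by (rule sum_distrib_right[symmetric])
    also have "\<dots> \<le> \<delta> * (1 / h)"
      using e h(1) eps_partial_le[where J = "{..<M}" and z = z] by (intro mult_right_mono) auto
    finally show "(\<Sum>j<M. (w j / cmod (z - of_real (m j)))\<^sup>2) \<le> \<delta> / h"
      by simp
  qed (use \<delta> h in auto)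
  finally show ?thesis .
qed

lemma alpha_partial_right:
  assumes z: "z = Complex (X N) y"
  shows "(alpha z (partial M x))\<^sup>2 \<le>
    (\<Sum>j<M. 2 * \<delta> * (norm (P j x))\<^sup>2 * (\<bar>X N - m j\<bar> / (\<bar>X N - m j\<bar>\<^sup>2 + y\<^sup>2)))"
proof -
  define d where "d j = \<bar>X N - m j\<bar>" for j
  have d: "d j > 0" for j
    using eps_le_sigma_right(2)[where N = N and z = "of_real (X N)" and j = j]
          far_of_Re[where N = N and z = "of_real (X N)"]
    by (auto simp: d_def simp flip: of_real_diff)
  have dz: "(cmod (z - of_real (m j)))\<^sup>2 = (d j)\<^sup>2 + y\<^sup>2" for j
    by (simp add: z cmod_def d_def)
  \<comment> \<open>Weighted with \<open>sqrt (d j)\<close>, Cauchy-Schwarz separates a sum bounded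
    by \<open>eps\<close> at the real point \<open>X N\<close> from a sum of Poisson kernels in
    \<open>y\<close>.\<close>
  have "alpha z (partial M x) = (\<Sum>j<M. (w j / sqrt (d j)) * (sqrt (d j) * norm (P j x) / cmod (z - of_real (m j))))"
    unfolding alpha_partial
  proof (intro sum.cong refl)
    fix j
    have "sqrt (d j) \<noteq> 0"
      using d[of j] by simp
    then show "w j / cmod (z - of_real (m j)) * norm (P j x) =
        (w j / sqrt (d j)) * (sqrt (d j) * norm (P j x) / cmod (z - of_real (m j)))"
      by (simp add: field_simps)
  qed
  then have "(alpha z (partial M x))\<^sup>2 \<le>
      (\<Sum>j<M. (w j / sqrt (d j))\<^sup>2) * (\<Sum>j<M. (sqrt (d j) * norm (P j x) / cmod (z - of_real (m j)))\<^sup>2)"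
    by (simp only: Cauchy_Schwarz_ineq_sum)
  also have "\<dots> = (\<Sum>j<M. (w j)\<^sup>2 / d j) * (\<Sum>j<M. (norm (P j x))\<^sup>2 * (d j / ((d j)\<^sup>2 + y\<^sup>2)))"
    using d by (simp add: power_divide power_mult_distrib dz less_imp_le mult.commute)
  also have "\<dots> \<le> (2 * \<delta>) * (\<Sum>j<M. (norm (P j x))\<^sup>2 * (d j / ((d j)\<^sup>2 + y\<^sup>2)))"
  proof (intro mult_right_mono sum_nonneg)
    have "(\<Sum>j<M. (w j)\<^sup>2 / d j) = (\<Sum>j<M. (w j)\<^sup>2 / cmod (of_real (X N) - of_real (m j)))"
      by (simp add: d_def flip: of_real_diff)
    also have "\<dots> \<le> eps (of_real (X N))"
      by (rule eps_partial_le) simp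
    also have "\<dots> \<le> 2 * \<delta>"
      by (intro eps_le_right[OF \<delta> sigma_le] far_of_Re) auto
    finally show "(\<Sum>j<M. (w j)\<^sup>2 / d j) \<le> 2 * \<delta>" .
    show "0 \<le> (norm (P j x))\<^sup>2 * (d j / ((d j)\<^sup>2 + y\<^sup>2))" for j
      using d[of j] by (intro mult_nonneg_nonneg divide_nonneg_nonneg) auto
  qed
  also have "\<dots> = (\<Sum>j<M. 2 * \<delta> * (norm (P j x))\<^sup>2 * (d j / ((d j)\<^sup>2 + y\<^sup>2)))"
    by (simp add: sum_distrib_left mult.assoc)
  finally show ?thesis
    by (simp add: d_def)
qed

text \<open>
  On the right side of the rectangle the resolvent difference is dominated by Poisson kernels,
  whose integrals are bounded independently of \<open>h\<close>; the other sides contribute little.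
\<close>

lemma rect_form_bound_partial:
  "cmod (cinner (riesz (rect N h h) (partial M x) - E N (partial M x)) (partial M y)) \<le>
    2 * \<delta> * ((norm x)\<^sup>2 + (norm y)\<^sup>2)"
proof -
  define g where "g = partial M y"
  define \<Delta> where "\<Delta> = riesz (rect N h h) (partial M x) - E N (partial M x)"
  define F where "F z = cinner (R z (partial M x) - R0 z (partial M x)) g" for z
  define s where "s = (norm x)\<^sup>2 + (norm y)\<^sup>2"
  have not_image: "complex_of_real (m j) \<notin> path_image (rect N h h)" for j
  proof
    assume "complex_of_real (m j) \<in> path_image (rect N h h)"
    then have "Re (complex_of_real (m j)) = X N"
      using rect_image_cases h(1) m_pos[of j] by fastforce
    then show False
      using eps_le_sigma_right(2)[where N = N and z = "of_real (X N)" and j = j]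
          far_of_Re[where N = N and z = "of_real (X N)"] by auto
  qed
  have sum: "(\<Sum>j<M. winding_number (rect N h h) (of_real (m j)) * cinner (P j x) g) = cinner (E N (partial M x)) g"
  proof -
    have "E N (partial M x) = (\<Sum>j<M. if j \<le> N then P j x else 0)"
    proof (rule P_ext)
      fix k
      have "P k (\<Sum>j<M. if j \<le> N then P j x else 0) = (\<Sum>j<M. if j = k then (if k \<le> N then P k x else 0) else 0)"
        unfolding bounded_clinear_sum[OF P_bounded] by (intro sum.cong) (auto simp: P_idem P_orth)
      then show "P k (E N (partial M x)) = P k (\<Sum>j<M. if j \<le> N then P j x else 0)"
        by (simp add: P_E P_partial)
    qed
    then have "cinner (E N (partial M x)) g = (\<Sum>j<M. if j \<le> N then cinner (P j x) g else 0)"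
      by (simp add: cinner.sum_left if_distrib[of "\<lambda>u. cinner u g"] cong: if_cong)
    then show ?thesis
      using h(1) by (simp add: winding_rect if_distrib[of "\<lambda>u. u * _"] cong: if_cong)
  qed
  have int: "(F has_contour_integral (2 * of_real pi * \<i>) * cinner \<Delta> g) (rect N h h)"
    using riesz_difference[OF contour_rect rect_subset not_image, of M x g]
    unfolding sum by (simp add: \<Delta>_def F_def[abs_def] cinner.diff_left)
  define a1 a2 a3 a4 where "a1 = Complex (- h) (- h)" and "a2 = Complex (X N) (- h)"
    and "a3 = Complex (X N) h" and "a4 = Complex (- h) h"
  have rect_eq: "rect N h h = linepath a1 a2 +++ linepath a2 a3 +++ linepath a3 a4 +++ linepath a4 a1"
    by (simp add: rect_def rectpath_def Let_def a1_def a2_def a3_def a4_def)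
  have integrable: "F contour_integrable_on linepath a1 a2" "F contour_integrable_on linepath a2 a3"
    "F contour_integrable_on linepath a3 a4" "F contour_integrable_on linepath a4 a1"
    using int by (auto simp: contour_integrable_on_def[symmetric] rect_eq valid_path_join
        dest!: has_contour_integral_integrable)
  have total: "(2 * of_real pi * \<i>) * cinner \<Delta> g = contour_integral (linepath a1 a2) F +
      (contour_integral (linepath a2 a3) F + (contour_integral (linepath a3 a4) F + contour_integral (linepath a4 a1) F))"
    using contour_integral_unique[OF int] integrable by (simp add: rect_eq valid_path_join)
  have two: "2 * (u * v) \<le> u\<^sup>2 + v\<^sup>2" for u v :: real
    using sum_squares_ge_zero[of "u - v" 0] by (simp add: power2_eq_square algebra_simps)
  have F_far: "cmod (F z) \<le> \<delta> / h * s" if z: "Re z \<le> X N" "h \<le> \<bar>Im z\<bar> \<or> Re z \<le> - h" for z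
  proof -
    have "cmod (F z) \<le> 2 * (alpha z (partial M x) * alpha z g)"
      unfolding F_def by (rule resolvent_far(2)[OF z])
    also have "\<dots> \<le> (alpha z (partial M x))\<^sup>2 + (alpha z g)\<^sup>2"
      by (rule two)
    also have "\<dots> \<le> \<delta> / h * (norm x)\<^sup>2 + \<delta> / h * (norm y)\<^sup>2"
      unfolding g_def by (intro add_mono alpha_partial_far z)
    finally show ?thesis
      by (simp add: s_def distrib_left)
  qed
  have s0: "0 \<le> s" and B0: "0 \<le> \<delta> / h * s"
    using \<delta> h by (auto simp: s_def)
  have side: "cmod (contour_integral (linepath a b) F) \<le> 2 * \<delta> * s"
    if int: "F contour_integrable_on linepath a b" and len: "cmod (b - a) \<le> 2 * h"
      and seg: "\<And>z. z \<in> closed_segment a b \<Longrightarrow> Re z \<le> X N \<and> (h \<le> \<bar>Im z\<bar> \<or> Re z \<le> - h)" for a b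
  proof -
    have "cmod (contour_integral (linepath a b) F) \<le> \<delta> / h * s * cmod (b - a)"
      using seg by (intro has_contour_integral_bound_linepath[OF has_contour_integral_integral[OF int] B0] F_far) auto
    also have "\<dots> \<le> \<delta> / h * s * (2 * h)"
      using len B0 by (intro mult_left_mono) auto
    finally show ?thesis
      using h(1) by (simp add: mult_ac)
  qed
  have bottom: "cmod (contour_integral (linepath a1 a2) F) \<le> 2 * \<delta> * s"
  proof (rule side[OF integrable(1)])
    \<comment> \<open>The assumption \<open>X N \<le> h\<close> keeps the horizontal sides as short
      as the vertical ones.\<close>
    show "cmod (a2 - a1) \<le> 2 * h"
      using h X_pos[of N] by (simp add: a1_def a2_def cmod_def)
    show "Re z \<le> X N \<and> (h \<le> \<bar>Im z\<bar> \<or> Re z \<le> - h)" if "z \<in> closed_segment a1 a2" for z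
      using that h X_pos[of N] by (auto simp: a1_def a2_def closed_segment_same_Im closed_segment_eq_real_ivl split: if_splits)
  qed
  have top: "cmod (contour_integral (linepath a3 a4) F) \<le> 2 * \<delta> * s"
  proof (rule side[OF integrable(3)])
    show "cmod (a4 - a3) \<le> 2 * h"
      using h X_pos[of N] by (simp add: a3_def a4_def cmod_def)
    show "Re z \<le> X N \<and> (h \<le> \<bar>Im z\<bar> \<or> Re z \<le> - h)" if "z \<in> closed_segment a3 a4" for z
      using that h X_pos[of N] by (auto simp: a3_def a4_def closed_segment_same_Im closed_segment_eq_real_ivl split: if_splits)
  qed
  have left: "cmod (contour_integral (linepath a4 a1) F) \<le> 2 * \<delta> * s"
  proof (rule side[OF integrable(4)])
    have "a1 - a4 = of_real (2 * h) * (- \<i>)"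
      by (simp add: a1_def a4_def complex_eq_iff)
    then show "cmod (a1 - a4) \<le> 2 * h"
      using h(1) by (simp only: norm_mult norm_of_real) simp
    show "Re z \<le> X N \<and> (h \<le> \<bar>Im z\<bar> \<or> Re z \<le> - h)" if "z \<in> closed_segment a4 a1" for z
      using that h X_pos[of N] by (auto simp: a1_def a4_def closed_segment_same_Re)
  qed
  have right: "cmod (contour_integral (linepath a2 a3) F) \<le> pi * (2 * \<delta> * s)"
  proof -
    define c where "c j = 2 * \<delta> * (norm (P j x))\<^sup>2 + 2 * \<delta> * (norm (P j y))\<^sup>2" for j
    have "cmod (contour_integral (linepath a2 a3) F) \<le> pi * (\<Sum>j<M. c j)"
      unfolding a2_def a3_def
    proof (rule vertical_contour_integral_bound[where d = "\<lambda>j. \<bar>X N - m j\<bar>"])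
      show "F contour_integrable_on linepath (Complex (X N) (- h)) (Complex (X N) h)"
        using integrable(2) by (simp add: a2_def a3_def)
      show "0 < \<bar>X N - m j\<bar>" for j
        using eps_le_sigma_right(2)[where N = N and z = "of_real (X N)" and j = j]
          far_of_Re[where N = N and z = "of_real (X N)"]
        by (auto simp flip: of_real_diff)
      fix t
      let ?z = "Complex (X N) t"
      have "cmod (F ?z) \<le> 2 * (alpha ?z (partial M x) * alpha ?z g)"
        unfolding F_def by (intro resolvent_right'(2) far_of_Re) auto
      also have "\<dots> \<le> (alpha ?z (partial M x))\<^sup>2 + (alpha ?z g)\<^sup>2"
        by (rule two)
      also have "\<dots> \<le> (\<Sum>j<M. 2 * \<delta> * (norm (P j x))\<^sup>2 * (\<bar>X N - m j\<bar> / (\<bar>X N - m j\<bar>\<^sup>2 + t\<^sup>2))) +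
          (\<Sum>j<M. 2 * \<delta> * (norm (P j y))\<^sup>2 * (\<bar>X N - m j\<bar> / (\<bar>X N - m j\<bar>\<^sup>2 + t\<^sup>2)))"
        unfolding g_def by (intro add_mono alpha_partial_right refl)
      also have "\<dots> = (\<Sum>j<M. c j * (\<bar>X N - m j\<bar> / (\<bar>X N - m j\<bar>\<^sup>2 + t\<^sup>2)))"
        by (simp only: c_def distrib_right sum.distrib)
      finally show "cmod (F ?z) \<le> (\<Sum>j<M. c j * (\<bar>X N - m j\<bar> / (\<bar>X N - m j\<bar>\<^sup>2 + t\<^sup>2)))" .
    qed (use \<delta> h in \<open>auto simp: c_def\<close>)
    also have "(\<Sum>j<M. c j) = 2 * \<delta> * (\<Sum>j<M. (norm (P j x))\<^sup>2) + 2 * \<delta> * (\<Sum>j<M. (norm (P j y))\<^sup>2)"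
      by (simp add: c_def sum.distrib sum_distrib_left)
    also have "pi * \<dots> \<le> pi * (2 * \<delta> * (norm x)\<^sup>2 + 2 * \<delta> * (norm y)\<^sup>2)"
      using \<delta> by (intro mult_left_mono add_mono sum_norm_P_le) auto
    finally show ?thesis
      by (simp add: s_def distrib_left)
  qed
  have "2 * pi * cmod (cinner \<Delta> g) = cmod ((2 * of_real pi * \<i>) * cinner \<Delta> g)"
    by (simp add: norm_mult)
  also have "\<dots> \<le> 2 * \<delta> * s + (pi * (2 * \<delta> * s) + (2 * \<delta> * s + 2 * \<delta> * s))"
    unfolding total
    by (intro order_trans[OF norm_triangle_ineq] add_mono bottom right top left)
  \<comment> \<open>Since \<open>3 < pi\<close>, the other three sides together cost no more than
    the right side.\<close>
  also have "\<dots> \<le> 2 * pi * (2 * \<delta> * s)"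
  proof -
    have "3 * (2 * \<delta> * s) \<le> pi * (2 * \<delta> * s)"
      using pi_gt3 \<delta> s0 by (intro mult_right_mono) auto
    then show ?thesis by linarith
  qed
  finally show ?thesis
    using pi_gt_zero by (simp add: \<Delta>_def g_def s_def)
qed

lemma rect_difference_bound: "norm (riesz (rect N h h) x - E N x) \<le> 4 * \<delta> * norm x"
proof -
  define \<Delta> where "\<Delta> x = riesz (rect N h h) x - E N x" for x
  have \<Delta>: "bounded_clinear \<Delta>"
    unfolding \<Delta>_def
    by (intro bounded_clinear_diff_fun bounded_clinear_riesz contour_rect rect_subset E_bounded)
  have "cmod (cinner (\<Delta> x) y) \<le> 2 * \<delta> * ((norm x)\<^sup>2 + (norm y)\<^sup>2)" for x y
  proof -
    have "(\<lambda>M. cmod (cinner (\<Delta> (partial M x)) (partial M y))) \<longlonglongrightarrow> cmod (cinner (\<Delta> x) y)"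
      by (intro tendsto_norm cinner.tendsto bounded_clinear_tendsto[OF \<Delta>] partial_tendsto)
    then show ?thesis
      by (rule LIMSEQ_le_const2) (use rect_form_bound_partial in \<open>auto simp: \<Delta>_def\<close>)
  qed
  from norm_le_of_form_bound[OF this bounded_clinear_zero[OF \<Delta>]] \<delta>
  show ?thesis
    by (simp add: \<Delta>_def)
qed

text \<open>\<open>W\<close> differs from the identity by an operator of norm at most
  \<open>1 / 2\<close>. Applying a projection before \<open>W\<close> or the matching block after it
  leaves the same blocks, because the Riesz projections are idempotent and annihilate each
  other.\<close>

lemma tail_similarity:
  assumes C: "\<And>n. sigma n \<le> C" "\<delta> * C \<le> 1 / 128"
  shows "\<exists>W. bounded_clinear W \<and> bij W \<and> bounded_clinear (inv W) \<and>
    (\<forall>x. E N (W x) = W (riesz (rect N h h) x)) \<and> (\<forall>k>N. \<forall>x. P k (W x) = W (riesz (circ k) x))"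
proof -
  define S where "S = riesz (rect N h h)"
  define Q where "Q k = riesz (circ k)" for k
  have S: "bounded_clinear S"
    unfolding S_def by (intro bounded_clinear_riesz contour_rect rect_subset)
  have Q: "bounded_clinear (Q k)" if "N < k" for k
    unfolding Q_def by (rule bounded_clinear_riesz[OF contour_circ circ_subset'[OF that]])
  \<comment> \<open>The kth block of \<open>W x - x\<close>, from the rectangle if
    \<open>k \<le> N\<close> and from the kth circle otherwise.\<close>
  define z where "z k x = (if k \<le> N then P k (S x - E N x) else P k (Q k x - P k x))" for k x
  have P_z: "P k (z k x) = z k x" for k x
    by (simp add: z_def P_idem)
  have z_partial: "(\<Sum>k<n. (norm (z k x))\<^sup>2) \<le> 1 / 4 * (norm x)\<^sup>2" for n x
  proof -
    have "(\<Sum>k<n. (norm (z k x))\<^sup>2) \<le> (\<Sum>k\<in>{..N} \<union> {N<..n}. (norm (z k x))\<^sup>2)"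
      by (intro sum_mono2) auto
    also have "\<dots> = (\<Sum>k\<le>N. (norm (z k x))\<^sup>2) + (\<Sum>k\<in>{N<..n}. (norm (z k x))\<^sup>2)"
      by (intro sum.union_disjoint) auto
    also have "(\<Sum>k\<le>N. (norm (z k x))\<^sup>2) = (\<Sum>k\<le>N. (norm (P k (S x - E N x)))\<^sup>2)"
      by (intro sum.cong) (auto simp: z_def)
    also have "\<dots> \<le> (norm (S x - E N x))\<^sup>2"
      by (intro sum_norm_P_le) simp
    also have "\<dots> \<le> (4 * \<delta> * norm x)\<^sup>2"
      unfolding S_def by (intro power_mono rect_difference_bound) auto
    also have "\<dots> = 16 * \<delta> * \<delta> * (norm x)\<^sup>2"
      by (simp add: power2_eq_square)
    also have "(\<Sum>k\<in>{N<..n}. (norm (z k x))\<^sup>2) = (\<Sum>k\<in>{N<..n}. (norm (P k (Q k x - P k x)))\<^sup>2)"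
      by (intro sum.cong) (auto simp: z_def)
    also have "\<dots> \<le> 16 * \<delta> * C * (norm x)\<^sup>2"
      unfolding Q_def by (rule kato_sum_bound[OF \<delta> sigma_le C(1)])
    also have "16 * \<delta> * \<delta> * (norm x)\<^sup>2 + 16 * \<delta> * C * (norm x)\<^sup>2 = (16 * (\<delta> * \<delta>) + 16 * (\<delta> * C)) * (norm x)\<^sup>2"
      by (simp add: algebra_simps)
    \<comment> \<open>The two parts contribute at most \<open>1 / 16\<close> and
      \<open>1 / 8\<close>; this is where the thresholds for \<open>\<delta>\<close> and
      \<open>\<delta> * C\<close> are used.\<close>
    also have "\<dots> \<le> 1 / 4 * (norm x)\<^sup>2"
    proof (rule mult_right_mono)
      have "\<delta> * \<delta> \<le> 1 / 16 * (1 / 16)"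
        using \<delta> by (intro mult_mono) auto
      then show "16 * (\<delta> * \<delta>) + 16 * (\<delta> * C) \<le> 1 / 4"
        using C(2) by linarith
    qed simp
    finally show ?thesis by simp
  qed
  have z_summable: "summable (\<lambda>k. (norm (z k x))\<^sup>2)" for x
    by (rule summableI_nonneg_bounded[OF _ z_partial]) simp
  define Y where "Y x = - (\<Sum>k. z k x)" for x
  have PY: "P k (Y x) = - z k x" for k x
    unfolding Y_def bounded_clinear_minus[OF P_bounded]
    using P_series(3)[of "\<lambda>k. z k x" k] P_z z_summable by simp
  have Y_le: "norm (Y x) \<le> 1 / 2 * norm x" for x
  proof (rule power2_le_imp_le)
    have "(norm (Y x))\<^sup>2 = (\<Sum>k. (norm (z k x))\<^sup>2)"
      unfolding Y_def norm_minus_cancel by (rule P_series(2)[OF P_z z_summable])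
    also have "\<dots> \<le> 1 / 4 * (norm x)\<^sup>2"
      by (intro suminf_le_const z_summable z_partial)
    finally show "(norm (Y x))\<^sup>2 \<le> (1 / 2 * norm x)\<^sup>2"
      by (simp add: power_mult_distrib power_divide)
  qed simp
  have Y: "bounded_clinear Y"
  proof (rule bounded_clinearI[OF _ _ Y_le])
    show "Y (x + y) = Y x + Y y" for x y
      by (rule P_ext) (simp add: PY z_def bounded_clinear_add[OF P_bounded] bounded_clinear_diff[OF P_bounded]
          bounded_clinear_add[OF S] bounded_clinear_add[OF Q] bounded_clinear_add[OF E_bounded])
    show "Y (c *\<^sub>C x) = c *\<^sub>C Y x" for c x
      by (rule P_ext) (simp add: PY z_def bounded_clinear_scaleC[OF P_bounded] bounded_clinear_diff[OF P_bounded]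
          bounded_clinear_scaleC[OF S] bounded_clinear_scaleC[OF Q] bounded_clinear_scaleC[OF E_bounded]
          scaleC.diff_right scaleC.minus_right)
  qed
  define W where "W x = x - Y x" for x
  have W: "bounded_clinear W" "bij W" "bounded_clinear (inv W)"
    using bij_id_minus_contraction[OF Y _ Y_le] bounded_clinear_diff_fun[OF bounded_clinear_ident Y]
    by (simp_all add: W_def[abs_def])
  have PW: "P k (W x) = (if k \<le> N then P k (S x) else P k (Q k x))" for k x
    by (simp add: W_def bounded_clinear_diff[OF P_bounded] PY z_def P_E P_idem)
  have SS: "S (S x) = S x" for x
    unfolding S_def by (rule rect_idempotent[OF h(1) h(1) rect_subset])
  have QS: "Q k (S x) = 0" and SQ: "S (Q k x) = 0" if "N < k" for k x
    unfolding S_def Q_def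
    by (rule circ_rect_disjoint[OF h(1) h(1) rect_subset that circ_subset'[OF that]]
        rect_circ_disjoint[OF h(1) h(1) rect_subset that circ_subset'[OF that]])+
  have QQ: "Q k (Q k x) = Q k x" if "N < k" for k x
    unfolding Q_def by (rule circ_idempotent[OF circ_subset'[OF that]])
  have QQ': "Q j (Q k x) = 0" if "N < j" "N < k" "j \<noteq> k" for j k x
    unfolding Q_def by (rule circ_disjoint[OF circ_subset'[OF that(1)] circ_subset'[OF that(2)] that(3)])
  have "E N (W x) = W (S x)" for x
    by (rule P_ext) (simp add: P_E PW SS QS)
  moreover have "P k (W x) = W (Q k x)" if k: "N < k" for k x
  proof (rule P_ext)
    show "P j (P k (W x)) = P j (W (Q k x))" for j
      using k by (cases "j = k") (auto simp: PW P_idem P_orth SQ QQ QQ')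
  qed
  ultimately show ?thesis
    using W unfolding S_def Q_def by blast
qed

end

lemma tail_parameters:
  obtains N0 :: nat and \<delta> C :: real where "0 < \<delta>" "\<delta> \<le> 1 / 16" "\<And>n. n \<ge> N0 \<Longrightarrow> sigma n \<le> \<delta>"
    "\<And>n. sigma n \<le> C" "\<delta> * C \<le> 1 / 128"
proof -
  have lim: "sigma \<longlonglongrightarrow> 0"
    using sigma_lim by (simp add: sigma_def[abs_def])
  then have "Bseq sigma"
    by (intro convergent_imp_Bseq convergentI)
  then obtain C where C: "C > 0" "\<And>n. norm (sigma n) \<le> C"
    by (auto elim: BseqE)
  have "sigma n \<le> C" for n
    using C(2)[of n] by auto
  \<comment> \<open>The second bound compensates the column sums of the Schur test, known only to be
    at most \<open>C\<close>.\<close>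
  moreover define \<delta> where "\<delta> = min (1 / 16) (1 / (128 * C))"
  have \<delta>: "0 < \<delta>" "\<delta> \<le> 1 / 16" "\<delta> \<le> 1 / (128 * C)"
    using C(1) by (auto simp: \<delta>_def)
  moreover have "\<delta> * C \<le> 1 / 128"
    using mult_right_mono[OF \<delta>(3), of C] C(1) by simp
  moreover have "\<forall>\<^sub>F n in sequentially. sigma n < \<delta>"
    using lim \<delta>(1) by (rule order_tendstoD)
  then obtain N0 where "\<And>n. n \<ge> N0 \<Longrightarrow> sigma n \<le> \<delta>"
    by (auto simp: eventually_sequentially intro: less_imp_le)
  ultimately show ?thesis
    using that by blast
qed

text \<open>Stated for all large \<open>N\<close> and \<open>h\<close>, because the rectangle will
  have to contain a prescribed one.\<close>

lemma eventually_similar: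
  obtains N0 :: nat where "\<And>N. N \<ge> N0 \<Longrightarrow> \<exists>h0>0. \<forall>h\<ge>h0.
    (\<forall>z. z \<notin> rho \<longrightarrow> (- h < Re z \<and> Re z \<le> X N \<and> \<bar>Im z\<bar> \<le> h) \<or> (\<exists>k>N. cmod (z - of_real (m k)) < r k)) \<and>
    path_image (rect N h h) \<subseteq> rho \<and> (\<forall>k>N. path_image (circ k) \<subseteq> rho) \<and>
    (\<exists>W. bounded_clinear W \<and> bij W \<and> bounded_clinear (inv W) \<and>
      (\<forall>x. E N (W x) = W (riesz (rect N h h) x)) \<and> (\<forall>k>N. \<forall>x. P k (W x) = W (riesz (circ k) x)))"
proof -
  obtain N0 :: nat and \<delta> C where \<delta>: "0 < \<delta>" "\<delta> \<le> 1 / 16" and small: "\<And>n. n \<ge> N0 \<Longrightarrow> sigma n \<le> \<delta>"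
    and C: "\<And>n. sigma n \<le> C" "\<delta> * C \<le> 1 / 128"
    using tail_parameters by metis
  show ?thesis
  proof (rule that[of N0])
    fix N assume "N \<ge> N0"
    then have sigma_le: "sigma n \<le> \<delta>" if "n \<ge> N" for n
      using small that by simp
    obtain h0 where h0: "h0 > 0" "\<And>h z. h \<ge> h0 \<Longrightarrow> Re z \<le> X N \<Longrightarrow> h \<le> \<bar>Im z\<bar> \<or> Re z \<le> - h \<Longrightarrow>
        eps z \<le> \<delta> \<and> (\<forall>k. h \<le> cmod (z - of_real (m k)))"
      using eps_far[OF \<delta>(1), of "X N"] by blast
    show "\<exists>h0>0. \<forall>h\<ge>h0.
      (\<forall>z. z \<notin> rho \<longrightarrow> (- h < Re z \<and> Re z \<le> X N \<and> \<bar>Im z\<bar> \<le> h) \<or> (\<exists>k>N. cmod (z - of_real (m k)) < r k)) \<and>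
      path_image (rect N h h) \<subseteq> rho \<and> (\<forall>k>N. path_image (circ k) \<subseteq> rho) \<and>
      (\<exists>W. bounded_clinear W \<and> bij W \<and> bounded_clinear (inv W) \<and>
        (\<forall>x. E N (W x) = W (riesz (rect N h h) x)) \<and> (\<forall>k>N. \<forall>x. P k (W x) = W (riesz (circ k) x)))"
    proof (intro exI[of _ "max h0 (X N)"] conjI allI impI)
      show "0 < max h0 (X N)"
        using h0(1) by simp
      fix h assume h: "max h0 (X N) \<le> h"
      then have h': "0 < h" "X N \<le> h"
        using h0(1) by auto
      have far: "eps z \<le> \<delta> \<and> (\<forall>k. h \<le> cmod (z - of_real (m k)))"
        if "Re z \<le> X N" "h \<le> \<bar>Im z\<bar> \<or> Re z \<le> - h" for z
        using h0(2)[OF _ that] h by simp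
      note a = \<delta> sigma_le h' far
      show "(- h < Re z \<and> Re z \<le> X N \<and> \<bar>Im z\<bar> \<le> h) \<or> (\<exists>k>N. cmod (z - of_real (m k)) < r k)"
        if "z \<notin> rho" for z
        by (rule spectrum_located[OF a that])
      show "path_image (rect N h h) \<subseteq> rho"
        by (rule rect_subset[OF a])
      show "path_image (circ k) \<subseteq> rho" if "k > N" for k
        by (rule circ_subset[OF \<delta> sigma_le that])
      show "\<exists>W. bounded_clinear W \<and> bij W \<and> bounded_clinear (inv W) \<and>
        (\<forall>x. E N (W x) = W (riesz (rect N h h) x)) \<and> (\<forall>k>N. \<forall>x. P k (W x) = W (riesz (circ k) x))"
        by (rule tail_similarity[OF a C])
    qed
  qed
qed

end

section \<open>Projections of equal rank\<close>

definition orthonormal_set :: "'h::complex_inner set \<Rightarrow> bool" where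
  "orthonormal_set B \<longleftrightarrow> (\<forall>x\<in>B. \<forall>y\<in>B. cinner x y = (if x = y then 1 else 0))"

text \<open>Two members are \<open>sqrt 2\<close> apart, so points of a countable dense set within
  \<open>1 / 2\<close> of them are distinct.\<close>

lemma orthonormal_set_countable:
  fixes B :: "'h::complex_inner set"
  assumes sep: "separable_space (euclidean :: 'h topology)" and B: "orthonormal_set B"
  shows "countable B"
proof -
  obtain C :: "'h set" where C: "countable C" "closure C = UNIV"
    using sep by (auto simp: separable_space_def)
  have "\<exists>c\<in>C. dist c b < 1 / 2" for b
    using C(2) closure_approachable[of b C] by (metis UNIV_I half_gt_zero_iff zero_less_one)
  then obtain c where c: "\<And>b. c b \<in> C" "\<And>b. dist (c b) b < 1 / 2"
    by metis
  have "inj_on c B"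
  proof (rule inj_onI, rule ccontr)
    fix x y assume xy: "x \<in> B" "y \<in> B" "c x = c y" "x \<noteq> y"
    have "norm (x - y) < 1"
      using norm_triangle_ineq4[of "c x - y" "c x - x"] c(2)[of x] c(2)[of y] xy(3)
      by (simp add: dist_norm)
    moreover have "inner x x = 1" "inner y y = 1" "inner x y = 0" "inner y x = 0"
      using B xy by (simp_all add: orthonormal_set_def inner_conv_Re_cinner)
    then have "(norm (x - y))\<^sup>2 = 2"
      by (simp add: power2_norm_eq_inner inner_diff_left inner_diff_right)
    ultimately show False
      using power_mono[of "norm (x - y)" 1 2] by simp
  qed
  moreover have "c ` B \<subseteq> C"
    using c(1) by blast
  ultimately show ?thesis
    using C(1) countable_image_inj_on countable_subset by blast
qed

lemma maximal_orthonormal_set: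
  fixes M :: "'h::complex_inner set"
  assumes M: "csubspace M"
  obtains B where "B \<subseteq> M" "orthonormal_set B" "\<And>x. x \<in> M \<Longrightarrow> (\<And>b. b \<in> B \<Longrightarrow> cinner x b = 0) \<Longrightarrow> x = 0"
proof -
  define \<A> where "\<A> = {B. B \<subseteq> M \<and> orthonormal_set B}"
  have "\<exists>B\<in>\<A>. \<forall>X\<in>\<A>. B \<subseteq> X \<longrightarrow> X = B"
  proof (rule subset_Zorn')
    fix \<C> assume "subset.chain \<A> \<C>"
    then have sub: "\<C> \<subseteq> \<A>" and total: "\<And>X Y. X \<in> \<C> \<Longrightarrow> Y \<in> \<C> \<Longrightarrow> X \<subseteq> Y \<or> Y \<subseteq> X"
      by (auto simp: subset_chain_def)
    have "cinner x y = (if x = y then 1 else 0)" if xy: "x \<in> \<Union>\<C>" "y \<in> \<Union>\<C>" for x y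
    proof -
      obtain X Y where "X \<in> \<C>" "x \<in> X" "Y \<in> \<C>" "y \<in> Y"
        using xy by blast
      then obtain Z where "Z \<in> \<C>" "x \<in> Z" "y \<in> Z"
        using total by blast
      then show ?thesis
        using sub by (auto simp: \<A>_def orthonormal_set_def)
    qed
    then show "\<Union>\<C> \<in> \<A>"
      using sub by (auto simp: \<A>_def orthonormal_set_def)
  qed
  then obtain B where B: "B \<in> \<A>" and max: "\<And>X. X \<in> \<A> \<Longrightarrow> B \<subseteq> X \<Longrightarrow> X = B"
    by blast
  have "x = 0" if x: "x \<in> M" "\<And>b. b \<in> B \<Longrightarrow> cinner x b = 0" for x
  proof (rule ccontr)
    assume "x \<noteq> 0"
    define y where "y = (1 / norm x) *\<^sub>R x"
    have y: "y \<in> M" "cinner y y = 1"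
      using x(1) M \<open>x \<noteq> 0\<close> by (auto simp: y_def csubspace_scaleR cinner_self)
    have yb: "cinner y b = 0" "cinner b y = 0" if "b \<in> B" for b
    proof -
      show "cinner y b = 0"
        using x(2)[OF that] by (simp add: y_def cinner.scaleR_left)
      then show "cinner b y = 0"
        by (metis cinner_commute complex_cnj_zero)
    qed
    then have "y \<notin> B"
      using y(2) by force
    have "insert y B \<in> \<A>"
      using B y yb \<open>y \<notin> B\<close> by (auto simp: \<A>_def orthonormal_set_def)
    then show False
      using max[of "insert y B"] \<open>y \<notin> B\<close> by blast
  qed
  then show ?thesis
    using that B by (auto simp: \<A>_def)
qed

lemma orthonormal_set_independent:
  assumes B: "orthonormal_set B"
  shows "\<not> cdependent B"
proof
  assume "cdependent B"
  then obtain t u where t: "finite t" "t \<subseteq> B" "(\<Sum>v\<in>t. u v *\<^sub>C v) = 0" and "\<exists>v\<in>t. u v \<noteq> 0"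
    unfolding complex_vector.dependent_explicit by blast
  then obtain v where v: "v \<in> t" "u v \<noteq> 0"
    by blast
  have "cinner (\<Sum>b\<in>t. u b *\<^sub>C b) v = (\<Sum>b\<in>t. if b = v then u v else 0)"
    unfolding cinner.sum_left cinner_scaleC_left
    using B t(2) v(1) by (intro sum.cong) (auto simp: orthonormal_set_def subset_iff)
  then show False
    using t v by simp
qed

text \<open>The rank is algebraic, whereas \<open>total\<close> speaks of orthogonality. For finite
  \<open>B\<close> the Fourier sum \<open>y\<close> shows that \<open>B\<close> spans the range; for
  infinite \<open>B\<close> linear independence excludes a finite spanning set.\<close>

lemma orthonormal_basis_rank:
  fixes A :: "'h::complex_inner \<Rightarrow> 'h"
  assumes M: "csubspace (range A)" and B: "B \<subseteq> range A" "orthonormal_set B"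
    and total: "\<And>x. x \<in> range A \<Longrightarrow> (\<And>b. b \<in> B \<Longrightarrow> cinner x b = 0) \<Longrightarrow> x = 0"
  shows "op_rank A = (if finite B then enat (card B) else \<infinity>)"
proof (cases "finite B")
  case True
  have "range A \<subseteq> cspan B"
  proof
    fix x assume x: "x \<in> range A"
    define y where "y = (\<Sum>b\<in>B. cinner x b *\<^sub>C b)"
    have y: "y \<in> cspan B"
      unfolding y_def
      by (intro complex_vector.span_sum complex_vector.span_scale complex_vector.span_base)
    have "y \<in> range A"
      unfolding y_def using B(1) by (intro complex_vector.subspace_sum complex_vector.subspace_scale M) auto
    moreover have "cinner y b = cinner x b" if "b \<in> B" for b
    proof -
      have "cinner y b = (\<Sum>a\<in>B. if a = b then cinner x b else 0)"
        unfolding y_def cinner.sum_left cinner_scaleC_left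
        using B(2) that by (intro sum.cong) (auto simp: orthonormal_set_def)
      then show ?thesis
        using True that by simp
    qed
    ultimately have "x - y = 0"
      using M x by (intro total complex_vector.subspace_diff) (auto simp: cinner.diff_left)
    then show "x \<in> cspan B"
      using y by simp
  qed
  moreover from this have "cdim (range A) = card B"
    using B orthonormal_set_independent by (intro complex_vector.dim_unique) auto
  ultimately show ?thesis
    using True by (auto simp: op_rank_def)
next
  case False
  have "\<not> (\<exists>B'. finite B' \<and> range A \<subseteq> cspan B')"
  proof
    assume "\<exists>B'. finite B' \<and> range A \<subseteq> cspan B'"
    then obtain B' where "finite B'" "B \<subseteq> cspan B'"
      using B(1) by blast
    then show False
      using complex_vector.independent_span_bound[of B' B] orthonormal_set_independent[OF B(2)] False
      by blast
  qed
  then show ?thesis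
    using False by (simp add: op_rank_def)
qed

text \<open>The members with index outside \<open>I\<close> are zero.\<close>

definition orthonormal_sequence :: "nat set \<Rightarrow> (nat \<Rightarrow> 'h::complex_inner) \<Rightarrow> bool" where
  "orthonormal_sequence I e \<longleftrightarrow> (\<forall>i j. cinner (e i) (e j) = (if i = j \<and> i \<in> I then 1 else 0))"

text \<open>Reading the index set off the rank gives projections of equal rank the same index set,
  finite or not; separability provides the enumeration in the infinite case.\<close>

lemma orthonormal_sequence_of_rank:
  fixes A :: "'h::complex_inner \<Rightarrow> 'h"
  assumes sep: "separable_space (euclidean :: 'h topology)" and M: "csubspace (range A)"
  obtains e where "orthonormal_sequence {i. enat i < op_rank A} e" "\<And>i. e i \<in> range A"
    "\<And>x. x \<in> range A \<Longrightarrow> (\<And>i. cinner x (e i) = 0) \<Longrightarrow> x = 0"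
proof -
  obtain B where B: "B \<subseteq> range A" "orthonormal_set B"
    "\<And>x. x \<in> range A \<Longrightarrow> (\<And>b. b \<in> B \<Longrightarrow> cinner x b = 0) \<Longrightarrow> x = 0"
    using maximal_orthonormal_set[OF M] by blast
  define I where "I = {i. enat i < op_rank A}"
  have rank: "op_rank A = (if finite B then enat (card B) else \<infinity>)"
    by (rule orthonormal_basis_rank[OF M B])
  have "\<exists>f. bij_betw f I B"
  proof (cases "finite B")
    case True
    then have "I = {0..<card B}"
      by (auto simp: I_def rank)
    then show ?thesis
      using ex_bij_betw_nat_finite[OF True] by simp
  next
    case False
    then have "I = UNIV"
      by (auto simp: I_def rank)
    moreover obtain g :: "'h \<Rightarrow> nat" where "bij_betw g B UNIV"
      using countableE_infinite[OF orthonormal_set_countable[OF sep B(2)] False] .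
    ultimately show ?thesis
      using bij_betw_inv by blast
  qed
  then obtain f where f: "bij_betw f I B" by blast
  define e where "e i = (if i \<in> I then f i else 0)" for i
  have eB: "e i \<in> B" if "i \<in> I" for i
    using f that by (auto simp: e_def bij_betw_def)
  have "orthonormal_sequence I e"
    unfolding orthonormal_sequence_def
  proof (intro allI)
    fix i j
    show "cinner (e i) (e j) = (if i = j \<and> i \<in> I then 1 else 0)"
    proof (cases "i \<in> I \<and> j \<in> I")
      case True
      then have "e i = e j \<longleftrightarrow> i = j"
        using f by (auto simp: e_def bij_betw_def inj_on_def)
      then show ?thesis
        using B(2) eB True by (auto simp: orthonormal_set_def)
    qed (auto simp: e_def)
  qed
  moreover have "e i \<in> range A" for i
    using eB[of i] B(1) complex_vector.subspace_0[OF M] by (cases "i \<in> I") (auto simp: e_def)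
  moreover have "x = 0" if "x \<in> range A" "\<And>i. cinner x (e i) = 0" for x
  proof (rule B(3)[OF that(1)])
    fix b assume "b \<in> B"
    then obtain i where "i \<in> I" "b = e i"
      using f by (auto simp: bij_betw_def e_def)
    then show "cinner x b = 0"
      using that(2) by simp
  qed
  ultimately show ?thesis
    using that by (simp add: I_def)
qed

section \<open>Isomorphisms between ranges of equal rank\<close>

context
  fixes e e' :: "nat \<Rightarrow> 'h::complex_hilbert" and I :: "nat set"
  assumes e: "orthonormal_sequence I e" and e': "orthonormal_sequence I e'"
begin

lemma bessel: "(\<Sum>i<n. (cmod (cinner x (e i)))\<^sup>2) \<le> (norm x)\<^sup>2"
proof -
  define y where "y = (\<Sum>i<n. cinner x (e i) *\<^sub>C e i)"
  have e0: "e i = 0" if "i \<notin> I" for i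
    using e that unfolding orthonormal_sequence_def by (metis cinner_self norm_eq_zero of_real_eq_0_iff zero_eq_power2)
  have norm_e: "(norm (cinner x (e i) *\<^sub>C e i))\<^sup>2 = (cmod (cinner x (e i)))\<^sup>2" for i
  proof (cases "i \<in> I")
    case True
    then have "cinner (e i) (e i) = 1"
      using e by (simp add: orthonormal_sequence_def)
    then have "norm (e i) = 1"
      by (metis cinner_self norm_ge_zero of_real_eq_1_iff power2_eq_1_iff le_minus_one_simps(3))
    then show ?thesis
      by (simp add: norm_scaleC)
  qed (simp add: e0)
  have "(norm y)\<^sup>2 = (\<Sum>i<n. (norm (cinner x (e i) *\<^sub>C e i))\<^sup>2)"
    unfolding y_def using e
    by (intro norm_sum_orthogonal) (auto simp: cinner_scaleC_left cinner_scaleC_right orthonormal_sequence_def)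
  then have y2: "(norm y)\<^sup>2 = (\<Sum>i<n. (cmod (cinner x (e i)))\<^sup>2)"
    by (simp add: norm_e)
  have "cinner x y = (\<Sum>i<n. of_real ((cmod (cinner x (e i)))\<^sup>2))"
    unfolding y_def cinner.sum_right cinner_scaleC_right
    by (simp only: complex_norm_square mult.commute[of "cnj _"])
  then have "inner x y = (norm y)\<^sup>2"
    by (simp add: inner_conv_Re_cinner y2)
  then show ?thesis
    using norm_diff_scaleR_power2[of x 1 y] zero_le_power2[of "norm (x - 1 *\<^sub>R y)"] by (simp add: y2)
qed

text \<open>The partial isometry that sends \<open>e i\<close> to \<open>e' i\<close> and vanishes
  on the orthogonal complement of the \<open>e i\<close>.\<close>

definition transfer_op :: "'h \<Rightarrow> 'h" where
  "transfer_op x = (\<Sum>i. cinner x (e i) *\<^sub>C e' i)"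

lemma transfer_op_norm_le: "(norm (cinner x (e i) *\<^sub>C e' i))\<^sup>2 \<le> (cmod (cinner x (e i)))\<^sup>2"
proof -
  have "(norm (e' i))\<^sup>2 = Re (cinner (e' i) (e' i))"
    by (simp add: cinner_self)
  also have "\<dots> \<le> 1"
    using e' by (simp add: orthonormal_sequence_def)
  finally have "(norm (e' i))\<^sup>2 \<le> 1" .
  then show ?thesis
    by (simp add: norm_scaleC power_mult_distrib mult_left_le)
qed

lemma transfer_op_series:
  shows "(\<lambda>i. cinner x (e i) *\<^sub>C e' i) sums transfer_op x" and "norm (transfer_op x) \<le> norm x"
proof -
  have sum: "summable (\<lambda>i. (cmod (cinner x (e i)))\<^sup>2)"
    by (rule summableI_nonneg_bounded[OF _ bessel]) simp
  have sum': "summable (\<lambda>i. (norm (cinner x (e i) *\<^sub>C e' i))\<^sup>2)"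
    using transfer_op_norm_le by (intro summable_comparison_test'[OF sum, where N = 0]) auto
  have orth: "cinner (cinner x (e i) *\<^sub>C e' i) (cinner x (e j) *\<^sub>C e' j) = 0" if "i \<noteq> j" for i j
    using that e' by (simp add: cinner_scaleC_left cinner_scaleC_right orthonormal_sequence_def)
  note * = orthogonal_series[OF orth sum']
  show "(\<lambda>i. cinner x (e i) *\<^sub>C e' i) sums transfer_op x"
    unfolding transfer_op_def using *(1) by (rule summable_sums)
  have "(norm (transfer_op x))\<^sup>2 = (\<Sum>i. (norm (cinner x (e i) *\<^sub>C e' i))\<^sup>2)"
    unfolding transfer_op_def by (rule *(2))
  also have "\<dots> \<le> (\<Sum>i. (cmod (cinner x (e i)))\<^sup>2)"
    by (intro suminf_le transfer_op_norm_le sum sum')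
  also have "\<dots> \<le> (norm x)\<^sup>2"
    by (intro suminf_le_const sum bessel)
  finally show "norm (transfer_op x) \<le> norm x"
    by (rule power2_le_imp_le) simp
qed

lemma bounded_clinear_transfer_op: "bounded_clinear transfer_op"
proof (rule bounded_clinearI[where K = 1])
  show "transfer_op (x + y) = transfer_op x + transfer_op y" for x y
    using transfer_op_series(1)[of "x + y"] sums_add[OF transfer_op_series(1)[of x] transfer_op_series(1)[of y]]
    by (auto simp: cinner_add_left scaleC_add_left intro: sums_unique2)
  show "transfer_op (c *\<^sub>C x) = c *\<^sub>C transfer_op x" for c x
  proof -
    have "(\<lambda>i. c *\<^sub>C cinner x (e i) *\<^sub>C e' i) sums (c *\<^sub>C transfer_op x)"
      by (intro bounded_linear.sums[OF scaleC.bounded_linear_right] transfer_op_series)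
    then show ?thesis
      using transfer_op_series(1)[of "c *\<^sub>C x"] sums_unique2
      by (simp add: cinner_scaleC_left scaleC_scaleC)
  qed
qed (simp add: transfer_op_series)

lemma cinner_transfer_op: "cinner (transfer_op x) (e' j) = cinner x (e j)"
proof -
  have "(\<lambda>i. cinner (cinner x (e i) *\<^sub>C e' i) (e' j)) sums cinner (transfer_op x) (e' j)"
    by (intro bounded_linear.sums[OF cinner.bounded_linear_left] transfer_op_series)
  moreover have "cinner (cinner x (e i) *\<^sub>C e' i) (e' j) = (if i = j then cinner x (e i) else 0)" for i
  proof -
    have "e i = 0" if "i \<notin> I"
      using e that unfolding orthonormal_sequence_def by (metis cinner_self norm_eq_zero of_real_eq_0_iff zero_eq_power2)
    then show ?thesis
      using e' by (cases "i \<in> I") (auto simp: cinner_scaleC_left orthonormal_sequence_def)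
  qed
  ultimately show ?thesis
    using sums_single[of j "\<lambda>i. cinner x (e i)"] sums_unique2 by simp
qed

lemma transfer_op_in:
  assumes M: "csubspace M" "closed M" and "\<And>i. e' i \<in> M"
  shows "transfer_op x \<in> M"
proof -
  have "(\<Sum>i<n. cinner x (e i) *\<^sub>C e' i) \<in> M" for n
    by (intro complex_vector.subspace_sum complex_vector.subspace_scale M assms)
  then show ?thesis
    using transfer_op_series(1)[of x] M(2) unfolding sums_def by (metis closed_sequentially)
qed

end

lemma
  fixes A :: "'h::complex_hilbert \<Rightarrow> 'h"
  assumes A: "bounded_clinear A" and idem: "\<And>x. A (A x) = A x"
  shows csubspace_range_projection: "csubspace (range A)" and closed_range_projection: "closed (range A)"
proof -
  have range: "range A = {x. A x = x}"
    using idem by (metis (mono_tags, lifting) UNIV_I image_iff mem_Collect_eq subsetI subset_antisym)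
  show "csubspace (range A)"
    unfolding range
    by (rule complex_vector.subspaceI)
      (auto simp: bounded_clinear_zero[OF A] bounded_clinear_add[OF A] bounded_clinear_scaleC[OF A])
  have "closed {x. A x = x}"
    using bounded_clinear_bounded_linear[OF A]
    by (intro closed_Collect_eq linear_continuous_on continuous_on_id)
  then show "closed (range A)"
    by (simp add: range)
qed

text \<open>The projections may be oblique: only their ranges matter, closed as the sets of fixed
  vectors. Partial isometries between orthonormal bases of the ranges serve as \<open>U\<close> and
  \<open>U'\<close>.\<close>

lemma projections_equal_rank:
  fixes A B :: "'h::complex_hilbert \<Rightarrow> 'h"
  assumes sep: "separable_space (euclidean :: 'h topology)"
    and A: "bounded_clinear A" "\<And>x. A (A x) = A x" and B: "bounded_clinear B" "\<And>x. B (B x) = B x"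
    and rank: "op_rank A = op_rank B"
  obtains U U' where "bounded_clinear U" "bounded_clinear U'"
    "\<And>x. B (U x) = U x" "\<And>x. U' (U (A x)) = A x" "\<And>y. A (U' y) = U' y" "\<And>y. U (U' (B y)) = B y"
proof -
  note MA = csubspace_range_projection[OF A] closed_range_projection[OF A]
    and MB = csubspace_range_projection[OF B] closed_range_projection[OF B]
  let ?I = "{i. enat i < op_rank A}"
  obtain e where e: "orthonormal_sequence ?I e" "\<And>i. e i \<in> range A"
    "\<And>x. x \<in> range A \<Longrightarrow> (\<And>i. cinner x (e i) = 0) \<Longrightarrow> x = 0"
    using orthonormal_sequence_of_rank[OF sep MA(1)] by blast
  obtain f where f: "orthonormal_sequence ?I f" "\<And>i. f i \<in> range B"
    "\<And>x. x \<in> range B \<Longrightarrow> (\<And>i. cinner x (f i) = 0) \<Longrightarrow> x = 0"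
    using orthonormal_sequence_of_rank[OF sep MB(1)] unfolding rank by blast
  let ?U = "transfer_op e f" and ?U' = "transfer_op f e"
  have in_B: "?U x \<in> range B" for x
    by (rule transfer_op_in[OF e(1) f(1) MB f(2)])
  have in_A: "?U' x \<in> range A" for x
    by (rule transfer_op_in[OF f(1) e(1) MA e(2)])
  show ?thesis
  proof (rule that[of ?U ?U'])
    show "bounded_clinear ?U" "bounded_clinear ?U'"
      by (rule bounded_clinear_transfer_op[OF e(1) f(1)] bounded_clinear_transfer_op[OF f(1) e(1)])+
    show "B (?U x) = ?U x" for x
      using in_B[of x] B(2) by auto
    show "A (?U' y) = ?U' y" for y
      using in_A[of y] A(2) by auto
    have "A x - ?U' (?U (A x)) = 0" for x
    proof (rule e(3))
      show "A x - ?U' (?U (A x)) \<in> range A"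
        using in_A by (intro complex_vector.subspace_diff MA) auto
      show "cinner (A x - ?U' (?U (A x))) (e i) = 0" for i
        by (simp add: cinner.diff_left cinner_transfer_op[OF f(1) e(1)] cinner_transfer_op[OF e(1) f(1)])
    qed
    then show "?U' (?U (A x)) = A x" for x
      by simp
    have "B x - ?U (?U' (B x)) = 0" for x
    proof (rule f(3))
      show "B x - ?U (?U' (B x)) \<in> range B"
        using in_B by (intro complex_vector.subspace_diff MB) auto
      show "cinner (B x - ?U (?U' (B x))) (f i) = 0" for i
        by (simp add: cinner.diff_left cinner_transfer_op[OF f(1) e(1)] cinner_transfer_op[OF e(1) f(1)])
    qed
    then show "?U (?U' (B x)) = B x" for x
      by simp
  qed
qed

text \<open>\<open>W\<close> maps one range onto the other, and carries spanning and independent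
  sets along. This yields the equalities of ranks in the existence of a localization.\<close>

lemma op_rank_similar:
  fixes A B W :: "'h::complex_inner \<Rightarrow> 'h"
  assumes W: "bounded_clinear W" "bij W" and BW: "\<And>x. B (W x) = W (A x)" and A: "csubspace (range A)"
  shows "op_rank A = op_rank B"
proof -
  interpret W: Vector_Spaces.linear "scaleC :: complex \<Rightarrow> 'h \<Rightarrow> 'h" scaleC W
    by unfold_locales (simp_all add: bounded_clinear_add[OF W(1)] bounded_clinear_scaleC[OF W(1)])
  have inj: "inj W"
    using W(2) by (rule bij_is_inj)
  have "range B = range (\<lambda>x. B (W x))"
    using bij_is_surj[OF W(2)] by (metis full_SetCompr_eq image_image)
  then have range_B: "range B = W ` range A"
    by (simp add: BW image_image)
  have span_image: "cspan (W ` X) = W ` cspan X" for X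
    unfolding cspan_def by (rule W.span_image)
  have iff: "(\<exists>X. finite X \<and> range A \<subseteq> cspan X) \<longleftrightarrow> (\<exists>X. finite X \<and> range B \<subseteq> cspan X)"
  proof
    assume "\<exists>X. finite X \<and> range A \<subseteq> cspan X"
    then obtain X where "finite X" "range A \<subseteq> cspan X" by blast
    then show "\<exists>X. finite X \<and> range B \<subseteq> cspan X"
      unfolding range_B by (intro exI[of _ "W ` X"]) (auto simp: span_image)
  next
    assume "\<exists>X. finite X \<and> range B \<subseteq> cspan X"
    then obtain X where X: "finite X" "W ` range A \<subseteq> cspan X"
      unfolding range_B by blast
    have "X = W ` (inv W ` X)"
      using W(2) by (simp add: bij_is_surj image_f_inv_f)
    then have "W ` range A \<subseteq> W ` cspan (inv W ` X)"
      using X(2) span_image by metis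
    then have "range A \<subseteq> cspan (inv W ` X)"
      using inj by (simp add: inj_image_subset_iff)
    then show "\<exists>X. finite X \<and> range A \<subseteq> cspan X"
      using X(1) by blast
  qed
  obtain Y where Y: "Y \<subseteq> range A" "\<not> cdependent Y" "range A \<subseteq> cspan Y" "card Y = cdim (range A)"
    using complex_vector.basis_exists by blast
  have "cdim (W ` range A) = card (W ` Y)"
  proof (rule complex_vector.dim_unique)
    show "W ` range A \<subseteq> cspan (W ` Y)"
      using Y(3) by (auto simp: span_image)
    show "\<not> cdependent (W ` Y)"
      unfolding cdependent_def using inj
      by (intro W.independent_injective_image[OF Y(2)[unfolded cdependent_def]] inj_on_subset[OF inj]) auto
  qed (use Y(1) in auto)
  also have "card (W ` Y) = card Y"
    using inj by (intro card_image) (auto intro: inj_on_subset)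
  finally show ?thesis
    using iff Y(4) by (simp add: op_rank_def range_B)
qed

text \<open>
  \<open>W1\<close> is kept on the kernel of \<open>S\<close>, and replaced on the range of \<open>S\<close> by isomorphisms between the
  ranges of the individual projections, which exist because the ranks agree.
\<close>

lemma similarity_refine:
  fixes A Q :: "'i \<Rightarrow> 'h::complex_hilbert \<Rightarrow> 'h" and S E W1 :: "'h \<Rightarrow> 'h"
  assumes sep: "separable_space (euclidean :: 'h topology)" and I: "finite I"
    and A: "\<And>i. i \<in> I \<Longrightarrow> bounded_clinear (A i)" "\<And>i x. i \<in> I \<Longrightarrow> A i (A i x) = A i x"
      "\<And>i j x. i \<in> I \<Longrightarrow> j \<in> I \<Longrightarrow> i \<noteq> j \<Longrightarrow> A i (A j x) = 0"
    and Q: "\<And>i. i \<in> I \<Longrightarrow> bounded_clinear (Q i)" "\<And>i x. i \<in> I \<Longrightarrow> Q i (Q i x) = Q i x"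
      "\<And>i j x. i \<in> I \<Longrightarrow> j \<in> I \<Longrightarrow> i \<noteq> j \<Longrightarrow> Q i (Q j x) = 0"
    and S: "\<And>x. S x = (\<Sum>i\<in>I. A i x)" and E: "\<And>x. E x = (\<Sum>i\<in>I. Q i x)"
    and W1: "bounded_clinear W1" "bij W1" "bounded_clinear (inv W1)" and EW1: "\<And>x. E (W1 x) = W1 (S x)"
    and rank: "\<And>i. i \<in> I \<Longrightarrow> op_rank (A i) = op_rank (Q i)"
  obtains W where "bounded_clinear W" "bij W" "bounded_clinear (inv W)"
    "\<And>i x. i \<in> I \<Longrightarrow> Q i (W x) = W (A i x)"
    "\<And>R R' x. bounded_clinear R \<Longrightarrow> (\<And>x. R (W1 x) = W1 (R' x)) \<Longrightarrow>
      (\<And>i x. i \<in> I \<Longrightarrow> R (Q i x) = 0) \<Longrightarrow> (\<And>i x. i \<in> I \<Longrightarrow> A i (R' x) = 0) \<Longrightarrow> R (W x) = W (R' x)"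
proof -
  have "\<forall>i\<in>I. \<exists>p. bounded_clinear (fst p) \<and> bounded_clinear (snd p) \<and> (\<forall>x. Q i (fst p x) = fst p x) \<and>
      (\<forall>x. snd p (fst p (A i x)) = A i x) \<and> (\<forall>y. A i (snd p y) = snd p y) \<and>
      (\<forall>y. fst p (snd p (Q i y)) = Q i y)" (is "\<forall>i\<in>I. \<exists>p. ?good i p")
  proof
    fix i assume i: "i \<in> I"
    obtain U U' where "bounded_clinear U" "bounded_clinear U'" "\<And>x. Q i (U x) = U x"
      "\<And>x. U' (U (A i x)) = A i x" "\<And>y. A i (U' y) = U' y" "\<And>y. U (U' (Q i y)) = Q i y"
      using projections_equal_rank[OF sep A(1)[OF i] A(2)[OF i] Q(1)[OF i] Q(2)[OF i] rank[OF i]]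
      by blast
    then show "\<exists>p. ?good i p"
      by (intro exI[of _ "(U, U')"]) simp
  qed
  from bchoice[OF this] obtain p where p: "\<forall>i\<in>I. ?good i (p i)" by blast
  define U U' where "U i = fst (p i)" and "U' i = snd (p i)" for i
  have U: "\<And>i. i \<in> I \<Longrightarrow> bounded_clinear (U i)" and U': "\<And>i. i \<in> I \<Longrightarrow> bounded_clinear (U' i)"
    and QU: "\<And>i x. i \<in> I \<Longrightarrow> Q i (U i x) = U i x" and U'U: "\<And>i x. i \<in> I \<Longrightarrow> U' i (U i (A i x)) = A i x"
    and AU': "\<And>i x. i \<in> I \<Longrightarrow> A i (U' i x) = U' i x" and UU': "\<And>i x. i \<in> I \<Longrightarrow> U i (U' i (Q i x)) = Q i x"
    using p by (simp_all add: U_def U'_def)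
  have S_bounded: "bounded_clinear S" and E_bounded: "bounded_clinear E"
    using bounded_clinear_sum_fun[of I A] bounded_clinear_sum_fun[of I Q] A(1) Q(1)
    by (simp_all add: S[abs_def] E[abs_def])
  have delta: "(\<Sum>j\<in>I. if j = i then f j else 0) = f i" if "i \<in> I" for f :: "'i \<Rightarrow> 'h" and i
    using I that by simp
  have AS: "A i (S x) = A i x" and SA: "S (A i x) = A i x" if i: "i \<in> I" for i x
  proof -
    have "A i (S x) = (\<Sum>j\<in>I. if j = i then A j x else 0)"
      unfolding S bounded_clinear_sum[OF A(1)[OF i]] using i by (intro sum.cong) (auto simp: A)
    then show "A i (S x) = A i x" by (simp only: delta[OF i])
    have "S (A i x) = (\<Sum>j\<in>I. if j = i then A j x else 0)"
      unfolding S using i by (intro sum.cong) (auto simp: A)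
    then show "S (A i x) = A i x" by (simp only: delta[OF i])
  qed
  have QE: "Q i (E x) = Q i x" and EQ: "E (Q i x) = Q i x" if i: "i \<in> I" for i x
  proof -
    have "Q i (E x) = (\<Sum>j\<in>I. if j = i then Q j x else 0)"
      unfolding E bounded_clinear_sum[OF Q(1)[OF i]] using i by (intro sum.cong) (auto simp: Q)
    then show "Q i (E x) = Q i x" by (simp only: delta[OF i])
    have "E (Q i x) = (\<Sum>j\<in>I. if j = i then Q j x else 0)"
      unfolding E using i by (intro sum.cong) (auto simp: Q)
    then show "E (Q i x) = Q i x" by (simp only: delta[OF i])
  qed
  have W1I: "W1 (inv W1 x) = x" and IW1: "inv W1 (W1 x) = x" for x
    using W1(2) by (simp_all add: bij_is_surj surj_f_inv_f bij_is_inj)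
  have EI: "inv W1 (E x) = S (inv W1 x)" for x
    using EW1[of "inv W1 x"] IW1 W1I by metis
  define W where "W x = (\<Sum>i\<in>I. U i (A i x)) + W1 (x - S x)" for x
  define Z where "Z y = (\<Sum>i\<in>I. U' i (Q i y)) + inv W1 (y - E y)" for y
  have W: "bounded_clinear W"
    unfolding W_def
    by (intro bounded_clinear_add_fun bounded_clinear_sum_fun
        bounded_clinear_compose[OF U A(1)] bounded_clinear_compose[OF W1(1)]
        bounded_clinear_diff_fun bounded_clinear_ident S_bounded)
  have Z: "bounded_clinear Z"
    unfolding Z_def
    by (intro bounded_clinear_add_fun bounded_clinear_sum_fun
        bounded_clinear_compose[OF U' Q(1)] bounded_clinear_compose[OF W1(3)]
        bounded_clinear_diff_fun bounded_clinear_ident E_bounded)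
  have SU': "S (U' i x) = U' i x" if i: "i \<in> I" for i x
    using SA[OF i, of "U' i x"] AU'[OF i, of x] by simp
  have S_diff: "S (x - S x) = 0" for x
  proof -
    have "S (S x) = S x"
      unfolding S[of "S x"] by (subst (2) S) (intro sum.cong refl AS)
    then show ?thesis
      by (simp add: bounded_clinear_diff[OF S_bounded])
  qed
  have A_diff: "A i (x - S x) = 0" if "i \<in> I" for i x
    using AS[OF that] by (simp add: bounded_clinear_diff[OF A(1)[OF that]])
  have Q_W1_diff: "Q i (W1 (x - S x)) = 0" if i: "i \<in> I" for i x
    using QE[OF i, of "W1 (x - S x)"] by (simp add: EW1 S_diff bounded_clinear_zero[OF W1(1)] bounded_clinear_zero[OF Q(1)[OF i]])
  have QW: "Q i (W x) = U i (A i x)" if i: "i \<in> I" for i x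
  proof -
    have "Q i (\<Sum>j\<in>I. U j (A j x)) = (\<Sum>j\<in>I. if j = i then U j (A j x) else 0)"
      unfolding bounded_clinear_sum[OF Q(1)[OF i]]
    proof (intro sum.cong refl)
      fix j assume j: "j \<in> I"
      show "Q i (U j (A j x)) = (if j = i then U j (A j x) else 0)"
        using Q(3)[OF i j, of "U j (A j x)"] QU[OF j, of "A j x"] by (auto simp: QU[OF i])
    qed
    then show ?thesis
      using delta[OF i, of "\<lambda>j. U j (A j x)"] Q_W1_diff[OF i]
      by (simp add: W_def bounded_clinear_add[OF Q(1)[OF i]])
  qed
  have WA: "W (A i x) = U i (A i x)" if i: "i \<in> I" for i x
  proof -
    have "(\<Sum>j\<in>I. U j (A j (A i x))) = (\<Sum>j\<in>I. if j = i then U j (A j x) else 0)"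
      using i by (intro sum.cong) (auto simp: A bounded_clinear_zero[OF U])
    then show ?thesis
      using delta[OF i, of "\<lambda>j. U j (A j x)"] by (simp add: W_def SA[OF i] bounded_clinear_zero[OF W1(1)])
  qed
  have ZW: "Z (W x) = x" for x
  proof -
    have "E (W x) = (\<Sum>i\<in>I. U i (A i x))"
      unfolding E using QW by simp
    then have "W x - E (W x) = W1 (x - S x)"
      by (simp add: W_def)
    then have "Z (W x) = (\<Sum>i\<in>I. U' i (U i (A i x))) + (x - S x)"
      unfolding Z_def using QW IW1 by simp
    also have "(\<Sum>i\<in>I. U' i (U i (A i x))) = S x"
      using U'U by (simp add: S)
    finally show ?thesis by simp
  qed
  have WZ: "W (Z y) = y" for y
  proof -
    have SZ2: "S (inv W1 (y - E y)) = 0"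
    proof -
      have "E (E y) = E y"
        unfolding E[of "E y"] by (subst (2) E) (intro sum.cong refl QE)
      then have "inv W1 (E (y - E y)) = 0"
        by (simp add: bounded_clinear_diff[OF E_bounded] bounded_clinear_zero[OF W1(3)])
      then show ?thesis
        by (simp add: EI)
    qed
    have A0: "A i (inv W1 (y - E y)) = 0" if i: "i \<in> I" for i
      using AS[OF i, of "inv W1 (y - E y)"] by (simp add: SZ2 bounded_clinear_zero[OF A(1)[OF i]])
    have AZ: "A i (Z y) = U' i (Q i y)" if i: "i \<in> I" for i
    proof -
      have "A i (\<Sum>j\<in>I. U' j (Q j y)) = (\<Sum>j\<in>I. if j = i then U' j (Q j y) else 0)"
        unfolding bounded_clinear_sum[OF A(1)[OF i]]
      proof (intro sum.cong refl)
        fix j assume j: "j \<in> I"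
        show "A i (U' j (Q j y)) = (if j = i then U' j (Q j y) else 0)"
          using A(3)[OF i j, of "U' j (Q j y)"] AU'[OF j, of "Q j y"] by (auto simp: AU'[OF i])
      qed
      then show ?thesis
        using delta[OF i, of "\<lambda>j. U' j (Q j y)"] A0[OF i]
        by (simp add: Z_def bounded_clinear_add[OF A(1)[OF i]])
    qed
    have "S (Z y) = (\<Sum>i\<in>I. U' i (Q i y))"
      unfolding S using AZ by simp
    then have "Z y - S (Z y) = inv W1 (y - E y)"
      by (simp add: Z_def)
    then have "W (Z y) = (\<Sum>i\<in>I. U i (U' i (Q i y))) + (y - E y)"
      unfolding W_def using AZ W1I by simp
    also have "(\<Sum>i\<in>I. U i (U' i (Q i y))) = E y"
      using UU' by (simp add: E)
    finally show ?thesis by simp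
  qed
  have bij: "bij W"
    by (rule o_bij[of Z]) (auto simp: ZW WZ)
  have inv: "inv W = Z"
    by (rule inv_equality) (auto simp: ZW WZ)
  show ?thesis
  proof (rule that[OF W bij])
    show "bounded_clinear (inv W)"
      using Z by (simp add: inv)
    show "Q i (W x) = W (A i x)" if "i \<in> I" for i x
      by (simp add: QW[OF that] WA[OF that])
    \<comment> \<open>A pair already intertwined by \<open>W1\<close> and annihilated by the
      corrected projections, such as those of an index beyond the large rectangle; the new operator
      intertwines it too.\<close>
    fix R R' :: "'h \<Rightarrow> 'h" and x
    assume R: "bounded_clinear R" "\<And>x. R (W1 x) = W1 (R' x)" "\<And>i x. i \<in> I \<Longrightarrow> R (Q i x) = 0"
      "\<And>i x. i \<in> I \<Longrightarrow> A i (R' x) = 0"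
    have "R (U i (A i x)) = 0" if "i \<in> I" for i
      using R(3)[OF that, of "U i (A i x)"] QU[OF that] by simp
    then have "R (\<Sum>i\<in>I. U i (A i x)) = 0"
      by (simp add: bounded_clinear_sum[OF R(1)])
    moreover have "R (W1 (S x)) = 0"
      unfolding EW1[symmetric] E by (simp add: bounded_clinear_sum[OF R(1)] R(3))
    ultimately have "R (W x) = W1 (R' x)"
      by (simp add: W_def bounded_clinear_add[OF R(1)] bounded_clinear_diff[OF W1(1)]
          bounded_clinear_diff[OF R(1)] R(2))
    moreover have "S (R' x) = 0" "(\<Sum>i\<in>I. U i (A i (R' x))) = 0"
      using R(4) by (simp_all add: S bounded_clinear_zero[OF U])
    ultimately show "R (W x) = W (R' x)"
      by (simp add: W_def)
  qed
qed

section \<open>Completeness and similarity\<close>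

context perturbed_diagonal_gaps
begin

lemma disc_bounds:
  assumes "cmod (z - of_real (m k)) < r k"
  shows "Re z < X k" "\<bar>Im z\<bar> < X k" "j < k \<Longrightarrow> X j < Re z" "j \<noteq> k \<Longrightarrow> r j < cmod (z - of_real (m j))"
proof -
  have Re: "\<bar>Re z - m k\<bar> < r k" and Im: "\<bar>Im z\<bar> < r k"
    using assms abs_Re_le_cmod[of "z - of_real (m k)"] abs_Im_le_cmod[of "z - of_real (m k)"] by auto
  show "X j < Re z" if "j < k"
    using Re X_le[OF that] by linarith
  show "Re z < X k"
    using Re by (simp add: X_def)
  show "\<bar>Im z\<bar> < X k"
    using Im m_pos[of k] by (simp add: X_def)
  show "r j < cmod (z - of_real (m j))" if "j \<noteq> k"
  proof -
    have "\<bar>m k - m j\<bar> \<le> cmod (z - of_real (m k)) + cmod (z - of_real (m j))"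
      using norm_triangle_ineq4[of "z - of_real (m j)" "z - of_real (m k)"] by (simp flip: of_real_diff)
    then show ?thesis
      using r_add_le[of j k] that assms by (simp add: abs_minus_commute)
  qed
qed

lemma rect_image:
  assumes "0 < h" "0 < h'"
  shows "path_image (rect N h h') =
    {z. (Re z = - h \<or> Re z = X N) \<and> \<bar>Im z\<bar> \<le> h' \<or> (\<bar>Im z\<bar> = h') \<and> - h \<le> Re z \<and> Re z \<le> X N}"
  unfolding rect_def using assms X_pos[of N] by (subst path_image_rectpath) (auto simp: abs_if)

lemma winding_rect_inside:
  assumes "0 < h" "0 < h'" "- h < Re z" "Re z < X N" "\<bar>Im z\<bar> < h'"
  shows "winding_number (rect N h h') z = 1"
  unfolding rect_def using assms by (intro winding_number_rectpath) (auto simp: in_box_complex_iff)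

lemma winding_rect_outside:
  assumes "0 < h" "0 < h'" "X N < Re z"
  shows "winding_number (rect N h h') z = 0"
  unfolding rect_def using assms X_pos[of N]
  by (intro winding_number_rectpath_outside) (auto simp: in_cbox_complex_iff)

context
  fixes N0 :: nat and h1 h2 :: real
  assumes h12: "0 < h1" "0 < h2"
    and spectrum: "\<And>z. z \<notin> rho \<Longrightarrow> (- h1 < Re z \<and> Re z \<le> X N0 \<and> \<bar>Im z\<bar> \<le> h2) \<or>
      (\<exists>k>N0. cmod (z - of_real (m k)) < r k)"
    and rect_rho: "path_image (rect N0 h1 h2) \<subseteq> rho"
    and circ_rho: "\<And>k. k > N0 \<Longrightarrow> path_image (circ k) \<subseteq> rho"
begin

text \<open>The boundary of the rectangle lies in the resolvent set, which makes the inequalities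
  strict.\<close>

lemma spectrum_cases:
  assumes "z \<notin> rho"
  obtains (rect) "- h1 < Re z" "Re z < X N0" "\<bar>Im z\<bar> < h2"
  | (disc) k where "N0 < k" "cmod (z - of_real (m k)) < r k"
proof -
  have "z \<notin> path_image (rect N0 h1 h2)"
    using rect_rho assms by blast
  then show ?thesis
    using spectrum[OF assms] that unfolding rect_image[OF h12] by force
qed

section \<open>Enlarging the rectangle and splitting off circles\<close>

context
  fixes h N1 assumes h: "h1 < h" "h2 < h" "X N1 \<le> h"
begin

lemma large_rect_subset:
  assumes N: "N0 \<le> N" "N \<le> N1"
  shows "path_image (rect N h h) \<subseteq> rho"
proof
  fix z assume z: "z \<in> path_image (rect N h h)"
  show "z \<in> rho"
  proof (rule ccontr)
    assume "z \<notin> rho"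
    then show False
    proof (cases rule: spectrum_cases)
      case rect
      have "X N0 \<le> X N"
        using X_mono[of N0 N] N by (cases "N0 = N") auto
      then show ?thesis
        using z rect h h12 by (subst (asm) rect_image) auto
    next
      case (disc k)
      show ?thesis
      proof (cases "k \<le> N")
        case True
        then have "X k \<le> X N" "X N \<le> X N1"
          using X_mono[of k N] X_mono[of N N1] N by (cases "k = N"; cases "N = N1"; auto)+
        then show ?thesis
          using z disc_bounds(1,2)[OF disc(2)] disc_bounds(3)[OF disc(2) disc(1)] X_pos[of N0] h h12
          by (subst (asm) rect_image) auto
      next
        case False
        then have "X N < Re z"
          using disc_bounds(3)[OF disc(2)] by simp
        then show ?thesis
          using z h h12 X_pos[of N] by (subst (asm) rect_image) auto
      qed
    qed
  qed
qed

text \<open>Both rectangles have the same right side, and no spectrum lies between them; the lower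
  left corners are joined by a segment to the left of the spectrum.\<close>

lemma riesz_large_rect_base: "N0 \<le> N1 \<Longrightarrow> riesz (rect N0 h h) = riesz (rect N0 h1 h2)"
proof (rule riesz_eq_of_winding_number[OF contour_rect _ contour_rect rect_rho])
  assume N: "N0 \<le> N1"
  show "path_image (rect N0 h h) \<subseteq> rho"
    by (rule large_rect_subset) (use N in auto)
  have "closed_segment (Complex (- h) (- h)) (Complex (- h1) (- h2)) \<subseteq> rho"
  proof
    fix z assume "z \<in> closed_segment (Complex (- h) (- h)) (Complex (- h1) (- h2))"
    then obtain u where u: "0 \<le> u" "u \<le> 1"
      "z = (1 - u) *\<^sub>R Complex (- h) (- h) + u *\<^sub>R Complex (- h1) (- h2)"
      by (auto simp: closed_segment_def)
    have "Re z = - h1 - (1 - u) * (h - h1)"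
      unfolding u(3) by (simp add: algebra_simps)
    moreover have "0 \<le> (1 - u) * (h - h1)"
      using u h by (intro mult_nonneg_nonneg) auto
    ultimately have Re: "Re z \<le> - h1"
      by linarith
    show "z \<in> rho"
    proof (rule ccontr)
      assume "z \<notin> rho"
      then show False
      proof (cases rule: spectrum_cases)
        case (disc k)
        then show ?thesis
          using disc_bounds(3)[OF disc(2) disc(1)] X_pos[of N0] Re h12 by simp
      qed (use Re in simp)
    qed
  qed
  then show "connected_component rho (pathstart (rect N0 h h)) (pathstart (rect N0 h1 h2))"
    unfolding connected_component_def rect_def
    by (intro exI[of _ "closed_segment (Complex (- h) (- h)) (Complex (- h1) (- h2))"]) auto
  fix z assume "z \<notin> rho"
  then show "winding_number (rect N0 h h) z = winding_number (rect N0 h1 h2) z"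
  proof (cases rule: spectrum_cases)
    case rect
    then show ?thesis
      using h h12 by (simp add: winding_rect_inside)
  next
    case (disc k)
    then show ?thesis
      using disc_bounds(3)[OF disc(2) disc(1)] h h12 by (simp add: winding_rect_outside)
  qed
qed

text \<open>Moving the right side from \<open>X N\<close> to \<open>X (Suc N)\<close> takes in
  exactly the spectrum inside the disc of index \<open>Suc N\<close>.\<close>

lemma riesz_large_rect_step:
  assumes N: "N0 \<le> N" "N < N1"
  shows "riesz (rect (Suc N) h h) f = riesz (rect N h h) f + riesz (circ (Suc N)) f"
proof (rule riesz_add_of_winding_number[OF contour_rect _ contour_rect _ contour_circ])
  have h0: "0 < h"
    using h h12 by simp
  show img1: "path_image (rect (Suc N) h h) \<subseteq> rho" and img: "path_image (rect N h h) \<subseteq> rho"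
    using N by (intro large_rect_subset; simp)+
  show "path_image (circ (Suc N)) \<subseteq> rho"
    using N by (intro circ_rho) simp
  show "connected_component rho (pathstart (rect (Suc N) h h)) (pathstart (rect N h h))"
  proof -
    have "pathstart (rect (Suc N) h h) \<in> rho"
      using img1 pathstart_in_path_image by blast
    then show ?thesis
      by (simp add: rect_def)
  qed
  show "connected_component rho (pathstart (rect N h h)) (pathstart (circ (Suc N)))"
  proof -
    have "pathstart (rect N h h) = pathstart (rect (Suc N) h h)"
      by (simp add: rect_def)
    \<comment> \<open>The circle starts at the real point \<open>X (Suc N)\<close>, where it touches
      the larger rectangle; the boundary of that rectangle connects the starting points.\<close>
    moreover have "pathstart (circ (Suc N)) \<in> path_image (rect (Suc N) h h)"
      using h0 by (simp add: circ_def rect_image X_def)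
    moreover have "connected (path_image (rect (Suc N) h h))"
      by (simp add: rect_def connected_path_image)
    ultimately show ?thesis
      unfolding connected_component_def using img1 by (metis pathstart_in_path_image)
  qed
  fix z assume "z \<notin> rho"
  then show "winding_number (rect (Suc N) h h) z =
      winding_number (rect N h h) z + winding_number (circ (Suc N)) z"
  proof (cases rule: spectrum_cases)
    case rect
    have "X N0 \<le> X N" "X N < X (Suc N)" "X N0 \<le> m (Suc N) - r (Suc N)"
      using X_mono[of N0 N] X_mono[of N "Suc N"] X_le[of N0 "Suc N"] N by (cases "N0 = N"; auto)+
    moreover from this rect have "r (Suc N) < cmod (z - of_real (m (Suc N)))"
      using abs_Re_le_cmod[of "z - of_real (m (Suc N))"] by simp
    ultimately show ?thesis
      using rect h h0 r_pos[of "Suc N"]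
      by (simp add: winding_rect_inside circ_def winding_number_circlepath_outside)
  next
    case (disc k)
    have Re: "- h < Re z"
      using disc_bounds(3)[OF disc(2) disc(1)] X_pos[of N0] h0 by linarith
    have far: "winding_number (circ (Suc N)) z = 0" if "k \<noteq> Suc N"
      unfolding circ_def using disc_bounds(4)[OF disc(2), of "Suc N"] that r_pos[of "Suc N"]
      by (intro winding_number_circlepath_outside) auto
    consider "k \<le> N" | "k = Suc N" | "Suc N < k"
      by linarith
    then show ?thesis
    proof cases
      case 1
      then have "X k \<le> X N" "X N < X (Suc N)" "X N < X N1"
        using X_mono[of k N] X_mono[of N "Suc N"] X_mono[of N N1] N by (cases "k = N"; auto)+
      then show ?thesis
        using 1 far disc_bounds(1,2)[OF disc(2)] h h0 Re by (simp add: winding_rect_inside)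
    next
      case 2
      have "X (Suc N) \<le> X N1"
        using X_mono[of "Suc N" N1] N by (cases "Suc N = N1") auto
      moreover have "winding_number (circ (Suc N)) z = 1"
        using disc(2) unfolding 2 circ_def by (rule winding_number_circlepath)
      ultimately show ?thesis
        using disc_bounds(1,2)[OF disc(2)] disc_bounds(3)[OF disc(2), of N] 2 h h0 Re
        by (simp add: winding_rect_inside winding_rect_outside)
    next
      case 3
      then show ?thesis
        using far disc_bounds(3)[OF disc(2), of "Suc N"] disc_bounds(3)[OF disc(2), of N] h0
        by (simp add: winding_rect_outside)
    qed
  qed
qed

lemma riesz_large_rect:
  assumes N: "N0 \<le> N" "N \<le> N1"
  shows "riesz (rect N h h) f = riesz (rect N0 h1 h2) f + (\<Sum>k\<in>{N0<..N}. riesz (circ k) f)"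
  using N
proof (induction N rule: dec_induct)
  case base
  then show ?case
    using riesz_large_rect_base by simp
next
  case (step N)
  have "{N0<..Suc N} = insert (Suc N) {N0<..N}"
    using step by auto
  then show ?case
    using step riesz_large_rect_step[of N f] by (simp add: add_ac)
qed

end

lemma localized_similarity:
  assumes sep: "separable_space (euclidean :: 'h topology)"
    and rank0: "op_rank (riesz (rect N0 h1 h2)) = op_rank (E N0)"
    and rank: "\<And>k. k > N0 \<Longrightarrow> op_rank (riesz (circ k)) = op_rank (P k)"
  obtains W where "bounded_clinear W" "bij W" "bounded_clinear (inv W)"
    "\<And>x. E N0 (W x) = W (riesz (rect N0 h1 h2) x)" "\<And>k x. k > N0 \<Longrightarrow> P k (W x) = W (riesz (circ k) x)"
proof -
  obtain N' :: nat where N': "\<And>N. N \<ge> N' \<Longrightarrow> \<exists>h0>0. \<forall>h\<ge>h0.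
    (\<forall>z. z \<notin> rho \<longrightarrow> (- h < Re z \<and> Re z \<le> X N \<and> \<bar>Im z\<bar> \<le> h) \<or> (\<exists>k>N. cmod (z - of_real (m k)) < r k)) \<and>
    path_image (rect N h h) \<subseteq> rho \<and> (\<forall>k>N. path_image (circ k) \<subseteq> rho) \<and>
    (\<exists>W. bounded_clinear W \<and> bij W \<and> bounded_clinear (inv W) \<and>
      (\<forall>x. E N (W x) = W (riesz (rect N h h) x)) \<and> (\<forall>k>N. \<forall>x. P k (W x) = W (riesz (circ k) x)))"
    by (rule eventually_similar) blast
  define N where "N = max N0 N'"
  have N: "N0 \<le> N" "N' \<le> N"
    by (simp_all add: N_def)
  obtain h0 where h0: "\<And>h. h \<ge> h0 \<Longrightarrow> \<exists>W. bounded_clinear W \<and> bij W \<and> bounded_clinear (inv W) \<and>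
      (\<forall>x. E N (W x) = W (riesz (rect N h h) x)) \<and> (\<forall>k>N. \<forall>x. P k (W x) = W (riesz (circ k) x))"
  proof -
    obtain h0 where "\<forall>h\<ge>h0.
      (\<forall>z. z \<notin> rho \<longrightarrow> (- h < Re z \<and> Re z \<le> X N \<and> \<bar>Im z\<bar> \<le> h) \<or> (\<exists>k>N. cmod (z - of_real (m k)) < r k)) \<and>
      path_image (rect N h h) \<subseteq> rho \<and> (\<forall>k>N. path_image (circ k) \<subseteq> rho) \<and>
      (\<exists>W. bounded_clinear W \<and> bij W \<and> bounded_clinear (inv W) \<and>
        (\<forall>x. E N (W x) = W (riesz (rect N h h) x)) \<and> (\<forall>k>N. \<forall>x. P k (W x) = W (riesz (circ k) x)))"
      using N'[OF N(2)] by (elim exE conjE)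
    then show ?thesis
      by (intro that[of h0]) (drule spec, drule mp, assumption, elim conjE, assumption)
  qed
  \<comment> \<open>Large enough for the tail similarity and for the rectangle to contain the given
    one strictly on its other three sides.\<close>
  define h where "h = Max {h0, h1 + 1, h2 + 1, X N}"
  have "h0 \<le> h" "h1 + 1 \<le> h" "h2 + 1 \<le> h" and hX: "X N \<le> h"
    unfolding h_def by (intro Max_ge; simp)+
  then have h: "h0 \<le> h" "h1 < h" "h2 < h"
    by auto
  obtain W1 where W1: "bounded_clinear W1" "bij W1" "bounded_clinear (inv W1)"
    "\<And>x. E N (W1 x) = W1 (riesz (rect N h h) x)" "\<And>k x. N < k \<Longrightarrow> P k (W1 x) = W1 (riesz (circ k) x)"
    using h0[OF h(1)] by blast
  \<comment> \<open>The index \<open>N0\<close> carries the given rectangle as a whole, the later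
    indices up to \<open>N\<close> the single circles that are split off the large
    rectangle.\<close>
  define A where "A i = (if i = N0 then riesz (rect N0 h1 h2) else riesz (circ i))" for i
  define Q where "Q i = (if i = N0 then E N0 else P i)" for i
  define I where "I = {N0..N}"
  have I: "I = insert N0 {N0<..N}" "finite I"
    using N by (auto simp: I_def)
  have A: "bounded_clinear (A i)" "A i (A i x) = A i x" if "i \<in> I" for i x
    using that rect_rho circ_rho h12
    by (auto simp: A_def I_def bounded_clinear_riesz contour_rect contour_circ rect_idempotent circ_idempotent)
  have A': "A i (A j x) = 0" if "i \<in> I" "j \<in> I" "i \<noteq> j" for i j x
    using that rect_rho circ_rho h12
    by (auto simp: A_def I_def rect_circ_disjoint circ_rect_disjoint circ_disjoint)
  have "E N0 (E N0 x) = E N0 x" for x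
    by (rule P_ext) (simp add: P_E)
  then have Q: "bounded_clinear (Q i)" "Q i (Q i x) = Q i x" if "i \<in> I" for i x
    by (simp_all add: Q_def E_bounded P_bounded P_idem)
  have Q': "Q i (Q j x) = 0" if "i \<in> I" "j \<in> I" "i \<noteq> j" for i j x
  proof (rule P_ext)
    show "P k (Q i (Q j x)) = P k 0" for k
      using that by (cases "k = i"; cases "k = j") (auto simp: Q_def I_def P_E P_orth P_idem)
  qed
  have S: "riesz (rect N h h) x = (\<Sum>i\<in>I. A i x)" for x
  proof -
    have "riesz (rect N h h) x = riesz (rect N0 h1 h2) x + (\<Sum>k\<in>{N0<..N}. riesz (circ k) x)"
      using riesz_large_rect[OF h(2,3) hX N(1)] by simp
    also have "(\<Sum>k\<in>{N0<..N}. riesz (circ k) x) = (\<Sum>k\<in>{N0<..N}. A k x)"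
      by (intro sum.cong) (auto simp: A_def)
    finally show ?thesis
      by (simp add: I(1) A_def)
  qed
  have EQ: "E N x = (\<Sum>i\<in>I. Q i x)" for x
  proof -
    have "{..N} = {..N0} \<union> {N0<..N}"
      using N by auto
    then have "E N x = E N0 x + (\<Sum>k\<in>{N0<..N}. P k x)"
      unfolding E_def by (simp add: sum.union_disjoint ivl_disj_int)
    also have "(\<Sum>k\<in>{N0<..N}. P k x) = (\<Sum>k\<in>{N0<..N}. Q k x)"
      by (intro sum.cong) (auto simp: Q_def)
    finally show ?thesis
      by (simp add: I(1) Q_def)
  qed
  have ranks: "op_rank (A i) = op_rank (Q i)" if "i \<in> I" for i
    using that rank0 rank by (auto simp: A_def Q_def I_def)
  obtain W where W: "bounded_clinear W" "bij W" "bounded_clinear (inv W)"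
    "\<And>i x. i \<in> I \<Longrightarrow> Q i (W x) = W (A i x)"
    and WR: "\<And>R R' x. bounded_clinear R \<Longrightarrow> (\<And>x. R (W1 x) = W1 (R' x)) \<Longrightarrow>
      (\<And>i x. i \<in> I \<Longrightarrow> R (Q i x) = 0) \<Longrightarrow> (\<And>i x. i \<in> I \<Longrightarrow> A i (R' x) = 0) \<Longrightarrow> R (W x) = W (R' x)"
    using similarity_refine[OF sep I(2) A A' Q Q' S EQ W1(1-3) W1(4) ranks] by blast
  show ?thesis
  proof (rule that[OF W(1-3)])
    show "E N0 (W x) = W (riesz (rect N0 h1 h2) x)" for x
      using W(4)[of N0 x] by (simp add: A_def Q_def I)
    fix k x assume k: "k > N0"
    show "P k (W x) = W (riesz (circ k) x)"
    proof (cases "k \<le> N")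
      case True
      then show ?thesis
        using W(4)[of k x] k by (simp add: A_def Q_def I)
    next
      case False
      show ?thesis
      proof (rule WR[OF P_bounded])
        show "P k (W1 x) = W1 (riesz (circ k) x)" for x
          using False by (intro W1) simp
        show "P k (Q i x) = 0" if "i \<in> I" for i x
          using that False by (auto simp: Q_def I_def P_E P_orth)
        show "A i (riesz (circ k) x) = 0" if "i \<in> I" for i x
          using that False k rect_rho circ_rho h12
          by (auto simp: A_def I_def rect_circ_disjoint circ_disjoint)
      qed
    qed
  qed
qed

lemma localized_complete:
  assumes W: "bounded_clinear W" "bij W" "bounded_clinear (inv W)"
    "\<And>x. E N0 (W x) = W (riesz (rect N0 h1 h2) x)" "\<And>k x. k > N0 \<Longrightarrow> P k (W x) = W (riesz (circ k) x)"
  shows "complete_system ({riesz (rect N0 h1 h2)} \<union> {riesz (circ k) | k. N0 < k})"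
proof -
  let ?span = "cspan (\<Union>Q\<in>{riesz (rect N0 h1 h2)} \<union> {riesz (circ k) | k. N0 < k}. range Q)"
  have IW: "inv W (W x) = x" for x
    using W(2) by (simp add: bij_is_inj)
  have in_span: "inv W (E M (W x)) \<in> ?span" if "N0 \<le> M" for M x
  proof -
    have "{..M} = {..N0} \<union> {N0<..M}"
      using that by auto
    then have "E M (W x) = E N0 (W x) + (\<Sum>k\<in>{N0<..M}. P k (W x))"
      unfolding E_def by (simp add: sum.union_disjoint ivl_disj_int)
    also have "\<dots> = W (riesz (rect N0 h1 h2) x) + (\<Sum>k\<in>{N0<..M}. W (riesz (circ k) x))"
      by (simp add: W)
    finally have "inv W (E M (W x)) = riesz (rect N0 h1 h2) x + (\<Sum>k\<in>{N0<..M}. riesz (circ k) x)"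
      by (simp add: bounded_clinear_add[OF W(3)] bounded_clinear_sum[OF W(3)] IW)
    also have "\<dots> \<in> ?span"
      by (intro complex_vector.span_add complex_vector.span_sum complex_vector.span_base) auto
    finally show ?thesis .
  qed
  have "x \<in> closure ?span" for x
  proof -
    \<comment> \<open>\<open>partial\<close> sums below its index and \<open>E\<close> up to it,
      hence the \<open>Suc\<close>; the shift by \<open>N0\<close> makes the whole sequence lie in
      the span.\<close>
    have "(\<lambda>M. partial (Suc (M + N0)) (W x)) \<longlonglongrightarrow> W x"
      using LIMSEQ_ignore_initial_segment[OF partial_tendsto[of "W x"], of "Suc N0"] by simp
    then have "(\<lambda>M. inv W (E (M + N0) (W x))) \<longlonglongrightarrow> inv W (W x)"
      unfolding partial_def lessThan_Suc_atMost E_def[symmetric]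
      by (rule bounded_clinear_tendsto[OF W(3)])
    then have "(\<lambda>M. inv W (E (M + N0) (W x))) \<longlonglongrightarrow> x"
      by (simp add: IW)
    then show ?thesis
      unfolding closure_sequential
      by (intro exI[of _ "\<lambda>M. inv W (E (M + N0) (W x))"]) (use in_span in auto)
  qed
  then show ?thesis
    unfolding complete_system_def by blast
qed

end

end

section \<open>Passage to indices starting at 1\<close>

lemma all_greater_Suc: "(\<forall>k>Suc n. Q k) \<longleftrightarrow> (\<forall>k>n. Q (Suc k))"
  by (metis Suc_less_eq Suc_lessE)

lemma all_in_Suc: "(\<Union>k\<in>{Suc n<..}. A k) = (\<Union>k\<in>{n<..}. A (Suc k))"
  by (auto elim!: Suc_lessE)

context perturbed_diagonal_gaps
begin

context
  fixes \<mu> :: "nat \<Rightarrow> real" and P0 :: "nat \<Rightarrow> 'h \<Rightarrow> 'h"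
  assumes shift: "\<And>k. \<mu> (Suc k) = m k" "\<And>k. gap_radius \<mu> (Suc k) = r k" "\<And>k. P0 (Suc k) = P k"
begin

lemma shift_eqs: "contour_disc \<mu> (Suc k) = circ k" "contour_zero \<mu> (Suc n) h h' = rect n h h'"
  "(\<Sum>k=1..Suc n. P0 k f) = E n f"
  "Pi_disc \<mu> (Suc k) = {z. cmod (z - of_real (m k)) < r k}"
  "Pi_zero \<mu> (Suc n) h h' = {z. - h < Re z \<and> Re z \<le> X n \<and> \<bar>Im z\<bar> \<le> h'}"
  by (simp_all add: contour_disc_def circ_def contour_zero_def rect_def X_def Pi_disc_def Pi_zero_def E_def shift
      sum.atLeast1_atMost_eq lessThan_Suc_atMost del: sum.cl_ivl_Suc sum.lessThan_Suc)

lemma spectrum_localized_iff: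
  "spectrum_localized D T \<mu> P0 (Suc n) h h' \<longleftrightarrow>
     0 < h \<and> 0 < h' \<and>
     (\<forall>z. z \<notin> rho \<longrightarrow> (- h < Re z \<and> Re z \<le> X n \<and> \<bar>Im z\<bar> \<le> h') \<or> (\<exists>k>n. cmod (z - of_real (m k)) < r k)) \<and>
     path_image (rect n h h') \<subseteq> rho \<and> (\<forall>k>n. path_image (circ k) \<subseteq> rho) \<and>
     op_rank (riesz (rect n h h')) = op_rank (E n) \<and>
     (\<forall>k>n. op_rank (riesz (circ k)) = op_rank (P k))"
proof -
  have sp: "op_spectrum D T \<subseteq> Pi_zero \<mu> (Suc n) h h' \<union> (\<Union>k\<in>{Suc n<..}. Pi_disc \<mu> k) \<longleftrightarrow>
    (\<forall>z. z \<notin> rho \<longrightarrow> (- h < Re z \<and> Re z \<le> X n \<and> \<bar>Im z\<bar> \<le> h') \<or> (\<exists>k>n. cmod (z - of_real (m k)) < r k))"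
    unfolding op_spectrum_def all_in_Suc shift_eqs by blast
  show ?thesis
    unfolding spectrum_localized_def Let_def sp unfolding all_greater_Suc shift_eqs shift
    by (intro iffI; elim conjE; intro conjI allI impI ext)
      (simp_all add: rect_circ_disjoint circ_rect_disjoint circ_disjoint)
qed

text \<open>For a large rectangle the ranks agree because the tail similarity intertwines each Riesz
  projection with its unperturbed counterpart.\<close>

lemma spectrum_localized_exists: "\<exists>N h h'. spectrum_localized D T \<mu> P0 N h h'"
proof -
  obtain n :: nat where "\<exists>h0>0. \<forall>h\<ge>h0.
    (\<forall>z. z \<notin> rho \<longrightarrow> (- h < Re z \<and> Re z \<le> X n \<and> \<bar>Im z\<bar> \<le> h) \<or> (\<exists>k>n. cmod (z - of_real (m k)) < r k)) \<and>
    path_image (rect n h h) \<subseteq> rho \<and> (\<forall>k>n. path_image (circ k) \<subseteq> rho) \<and>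
    (\<exists>W. bounded_clinear W \<and> bij W \<and> bounded_clinear (inv W) \<and>
      (\<forall>x. E n (W x) = W (riesz (rect n h h) x)) \<and> (\<forall>k>n. \<forall>x. P k (W x) = W (riesz (circ k) x)))"
    by (rule eventually_similar) blast
  then obtain h W where h: "0 < h"
    and sp: "\<forall>z. z \<notin> rho \<longrightarrow> (- h < Re z \<and> Re z \<le> X n \<and> \<bar>Im z\<bar> \<le> h) \<or> (\<exists>k>n. cmod (z - of_real (m k)) < r k)"
    and rect_rho: "path_image (rect n h h) \<subseteq> rho" and circ_rho: "\<forall>k>n. path_image (circ k) \<subseteq> rho"
    and W: "bounded_clinear W" "bij W"
      "\<forall>x. E n (W x) = W (riesz (rect n h h) x)" "\<forall>k>n. \<forall>x. P k (W x) = W (riesz (circ k) x)"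
    by (elim exE conjE) (drule spec, drule mp, rule order_refl, elim conjE exE, rule that; assumption)
  have "op_rank (riesz (rect n h h)) = op_rank (E n)"
    using W h rect_rho
    by (intro op_rank_similar[OF W(1,2)] csubspace_range_projection bounded_clinear_riesz)
      (auto simp: contour_rect rect_idempotent)
  moreover have "op_rank (riesz (circ k)) = op_rank (P k)" if "k > n" for k
    using W circ_rho that
    by (intro op_rank_similar[OF W(1,2)] csubspace_range_projection bounded_clinear_riesz)
      (auto simp: contour_circ circ_idempotent)
  ultimately show ?thesis
    using h sp rect_rho circ_rho by (intro exI[of _ "Suc n"] exI[of _ h]) (simp add: spectrum_localized_iff)
qed

lemma spectrum_localized_similarity:
  assumes sep: "separable_space (euclidean :: 'h topology)"
    and loc: "spectrum_localized D T \<mu> P0 N h h'"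
  shows "complete_system ({riesz (contour_zero \<mu> N h h')} \<union> {riesz (contour_disc \<mu> k) | k. N < k})"
    and "\<exists>W. bounded_clinear W \<and> boundedly_invertible W \<and>
      riesz (contour_zero \<mu> N h h') = inv W \<circ> (\<lambda>f. \<Sum>k=1..N. P0 k f) \<circ> W \<and>
      (\<forall>k>N. riesz (contour_disc \<mu> k) = inv W \<circ> P0 k \<circ> W)"
proof -
  obtain n where n: "N = Suc n"
    using loc by (cases N) (auto simp: spectrum_localized_def)
  have h: "0 < h" "0 < h'"
    and sp: "\<And>z. z \<notin> rho \<Longrightarrow> (- h < Re z \<and> Re z \<le> X n \<and> \<bar>Im z\<bar> \<le> h') \<or> (\<exists>k>n. cmod (z - of_real (m k)) < r k)"
    and rect_rho: "path_image (rect n h h') \<subseteq> rho" and circ_rho: "\<And>k. k > n \<Longrightarrow> path_image (circ k) \<subseteq> rho"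
    and ranks: "op_rank (riesz (rect n h h')) = op_rank (E n)"
      "\<And>k. k > n \<Longrightarrow> op_rank (riesz (circ k)) = op_rank (P k)"
    using loc unfolding n spectrum_localized_iff by blast+
  obtain W where W: "bounded_clinear W" "bij W" "bounded_clinear (inv W)"
    "\<And>x. E n (W x) = W (riesz (rect n h h') x)" "\<And>k x. k > n \<Longrightarrow> P k (W x) = W (riesz (circ k) x)"
    by (rule localized_similarity[OF h sp rect_rho circ_rho sep ranks]; (assumption | rule that; assumption))
  have "{riesz (contour_disc \<mu> k) | k. N < k} = {riesz (circ k) | k. n < k}"
    unfolding n by (auto elim!: Suc_lessE simp: shift_eqs) (metis Suc_less_eq shift_eqs(1))
  then show "complete_system ({riesz (contour_zero \<mu> N h h')} \<union> {riesz (contour_disc \<mu> k) | k. N < k})"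
    using localized_complete[OF h sp rect_rho circ_rho W] by (simp add: n shift_eqs)
  have IW: "inv W (W x) = x" for x
    using W(2) by (simp add: bij_is_inj)
  show "\<exists>W. bounded_clinear W \<and> boundedly_invertible W \<and>
      riesz (contour_zero \<mu> N h h') = inv W \<circ> (\<lambda>f. \<Sum>k=1..N. P0 k f) \<circ> W \<and>
      (\<forall>k>N. riesz (contour_disc \<mu> k) = inv W \<circ> P0 k \<circ> W)"
  proof (intro exI[of _ W] conjI)
    show "riesz (contour_zero \<mu> N h h') = inv W \<circ> (\<lambda>f. \<Sum>k=1..N. P0 k f) \<circ> W"
      unfolding n shift_eqs by (simp add: fun_eq_iff W(4) IW)
    show "\<forall>k>N. riesz (contour_disc \<mu> k) = inv W \<circ> P0 k \<circ> W"
      unfolding n all_greater_Suc shift_eqs by (simp add: shift fun_eq_iff W(5) IW)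
  qed (use W in \<open>simp_all add: boundedly_invertible_def\<close>)
qed

end

end

theorem theorem2p4:
  fixes D\<^sub>A D\<^sub>B D\<^sub>T :: "'h::complex_hilbert set"
    and A B T :: "'h \<Rightarrow> 'h"
    and \<mu> \<omega> :: "nat \<Rightarrow> real"
    and P0 :: "nat \<Rightarrow> 'h \<Rightarrow> 'h"
    and v t :: "'h \<Rightarrow> 'h \<Rightarrow> complex"
  assumes separable: "separable_space (euclidean :: 'h topology)"
    and A: "selfadjoint D\<^sub>A A"
    and spectrum_A: "op_spectrum D\<^sub>A A = {complex_of_real (\<mu> k) | k. 1 \<le> k}"
    and mu_pos: "0 < \<mu> 1"
    and mu_mono: "strict_mono_on {1..} \<mu>"
    and mu_lim: "filterlim \<mu> at_top sequentially"
    and P0: "\<And>k. P0 k = orth_proj (eigenspace D\<^sub>A A (complex_of_real (\<mu> k)))"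
    and B: "is_sqrt_op D\<^sub>A A D\<^sub>B B"
    and v: "sesquilinear_on D\<^sub>B v"
    and omega_nonneg: "\<And>j. 1 \<le> j \<Longrightarrow> 0 \<le> \<omega> j"
    and v_bound: "\<And>j k f g. 1 \<le> j \<Longrightarrow> 1 \<le> k \<Longrightarrow> f \<in> D\<^sub>B \<Longrightarrow> g \<in> D\<^sub>B \<Longrightarrow>
      cmod (v (P0 j f) (P0 k g)) \<le> \<omega> j * \<omega> k * norm (P0 j f) * norm (P0 k g)"
    and omega_summable: "(\<lambda>j. (\<omega> j)\<^sup>2 / \<mu> j) summable_on {1..}"
    and omega_small:
      "(\<lambda>n. (\<Sum>\<^sub>\<infinity>j\<in>{1..} - {n}. (\<omega> j)\<^sup>2 / \<bar>\<mu> n - \<mu> j\<bar>) + (\<omega> n)\<^sup>2 / gap_radius \<mu> n) \<in> o(\<lambda>_. 1)"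
    and t: "\<And>f g. t f g = cinner (B f) (B g) + v f g"
    and t_closed: "closed_sectorial_form D\<^sub>B t"
    and T: "m_sectorial_op_of_form D\<^sub>B t D\<^sub>T T"
  shows "(\<exists>N\<^sub>0 h\<^sub>1 h\<^sub>2. spectrum_localized D\<^sub>T T \<mu> P0 N\<^sub>0 h\<^sub>1 h\<^sub>2) \<and>
    (\<forall>N\<^sub>0 h\<^sub>1 h\<^sub>2. spectrum_localized D\<^sub>T T \<mu> P0 N\<^sub>0 h\<^sub>1 h\<^sub>2 \<longrightarrow>
      (let S\<^sub>0 = riesz_projection D\<^sub>T T (contour_zero \<mu> N\<^sub>0 h\<^sub>1 h\<^sub>2);
           P = (\<lambda>k. riesz_projection D\<^sub>T T (contour_disc \<mu> k))
       in complete_system ({S\<^sub>0} \<union> {P k | k. N\<^sub>0 < k}) \<and>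
          (\<exists>W. bounded_clinear W \<and> boundedly_invertible W \<and>
             S\<^sub>0 = inv W \<circ> (\<lambda>f. \<Sum>k=1..N\<^sub>0. P0 k f) \<circ> W \<and>
             (\<forall>k>N\<^sub>0. P k = inv W \<circ> P0 k \<circ> W))))"
proof -
  \<comment> \<open>The sequences of the theorem start at index 1, those of the locales at
    0.\<close>
  define m r w where "m k = \<mu> (Suc k)" and "r k = gap_radius \<mu> (Suc k)" and "w k = \<omega> (Suc k)" for k
  note defs = m_def r_def w_def
  have mono: "\<mu> i < \<mu> j" if "1 \<le> i" "i < j" for i j
    using mu_mono that by (auto simp: strict_mono_on_def)
  have m_mono: "strict_mono m"
    using mono by (simp add: strict_mono_def m_def)
  have m_pos: "0 < m k" for k
    using mu_pos mono[of 1 "Suc k"] by (cases k) (auto simp: m_def)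
  have "{complex_of_real (\<mu> k) | k. 1 \<le> k} = range (\<lambda>k. complex_of_real (m k))"
    unfolding m_def by (auto simp: image_iff) (metis Suc_le_D)
  then interpret discrete_selfadjoint_op D\<^sub>A A m
    using A spectrum_A m_pos m_mono by unfold_locales auto
  have P0': "P0 (Suc k) = orth_proj (E k)" for k
    by (simp add: P0 m_def)
  interpret perturbed_form D\<^sub>A A m D\<^sub>B B v t D\<^sub>T T w
    by unfold_locales
      (use v_bound[of "Suc _" "Suc _"] in \<open>simp_all add: B v t t_closed T P0' w_def\<close>)
  have range_Suc: "Suc ` UNIV = {1..}"
    by (auto simp: image_iff) (metis Suc_le_D)
  have "(\<lambda>k. (w k)\<^sup>2 / m k) summable_on UNIV"
    using omega_summable summable_on_reindex[of Suc UNIV "\<lambda>j. (\<omega> j)\<^sup>2 / \<mu> j"]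
    by (simp add: range_Suc o_def defs)
  then have w_summable: "summable (\<lambda>k. (w k)\<^sup>2 / m k)"
    by (rule summable_on_imp_summable)
  have m_lim: "filterlim m at_top sequentially"
    using mu_lim unfolding m_def by (rule filterlim_compose[OF _ filterlim_Suc])
  have w_nonneg: "0 \<le> w k" for k
    by (simp add: w_def omega_nonneg)
  obtain V where "perturbed_diagonal (\<lambda>k. orth_proj (E k)) m w V D\<^sub>T T"
    using perturbed_diagonal[OF m_lim w_nonneg w_summable] by blast
  then interpret pd: perturbed_diagonal "\<lambda>k. orth_proj (E k)" m w V D\<^sub>T T .
  have r_pos: "0 < r k" for k
    using mono[of "Suc k" "Suc (Suc k)"] mono[of k "Suc k"]
    by (cases k) (auto simp: r_def gap_radius_def numeral_2_eq_2)
  have r_sep: "2 * r k \<le> \<bar>m j - m k\<bar>" if "j \<noteq> k" for j k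
  proof (cases "j < k")
    case True
    then obtain l where l: "k = Suc l" "j \<le> l"
      by (cases k) auto
    then have "m j \<le> m l"
      using m_mono by (simp add: strict_mono_less_eq)
    moreover have "2 * r k \<le> m k - m l"
      using l by (simp add: r_def m_def gap_radius_def)
    ultimately show ?thesis by simp
  next
    case False
    then have "m (Suc k) \<le> m j"
      using that m_mono by (simp add: strict_mono_less_eq)
    moreover have "2 * r k \<le> m (Suc k) - m k"
      by (cases k) (auto simp: r_def m_def gap_radius_def numeral_2_eq_2)
    ultimately show ?thesis by simp
  qed
  have eps: "pd.eps (complex_of_real (m n)) = (\<Sum>\<^sub>\<infinity>j\<in>{1..} - {Suc n}. (\<omega> j)\<^sup>2 / \<bar>\<mu> (Suc n) - \<mu> j\<bar>)" for n
  proof -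
    have cm: "cmod (complex_of_real (m n) - of_real (m k)) = \<bar>\<mu> (Suc n) - \<mu> (Suc k)\<bar>" for k
      by (simp add: m_def flip: of_real_diff)
    have "pd.eps (complex_of_real (m n)) = (\<Sum>k. (\<omega> (Suc k))\<^sup>2 / \<bar>\<mu> (Suc n) - \<mu> (Suc k)\<bar>)"
      unfolding pd.eps_def cm by (simp add: w_def)
    also have "\<dots> = (\<Sum>\<^sub>\<infinity>k. (\<omega> (Suc k))\<^sup>2 / \<bar>\<mu> (Suc n) - \<mu> (Suc k)\<bar>)"
      using pd.eps_summable[of "complex_of_real (m n)"] unfolding cm w_def
      by (intro infsumI[symmetric] sums_nonneg_imp_has_sum summable_sums) simp_all
    also have "\<dots> = infsum (\<lambda>j. (\<omega> j)\<^sup>2 / \<bar>\<mu> (Suc n) - \<mu> j\<bar>) {1..}"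
      using infsum_reindex[of Suc UNIV "\<lambda>j. (\<omega> j)\<^sup>2 / \<bar>\<mu> (Suc n) - \<mu> j\<bar>"]
      by (simp add: range_Suc o_def)
    \<comment> \<open>The term with \<open>j = Suc n\<close> is 0, because division by zero gives
      zero.\<close>
    also have "\<dots> = (\<Sum>\<^sub>\<infinity>j\<in>{1..} - {Suc n}. (\<omega> j)\<^sup>2 / \<bar>\<mu> (Suc n) - \<mu> j\<bar>)"
      by (rule infsum_cong_neutral) auto
    finally show ?thesis .
  qed
  have "(\<lambda>n. (\<Sum>\<^sub>\<infinity>j\<in>{1..} - {n}. (\<omega> j)\<^sup>2 / \<bar>\<mu> n - \<mu> j\<bar>) + (\<omega> n)\<^sup>2 / gap_radius \<mu> n) \<longlonglongrightarrow> 0"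
    using smalloD_tendsto[OF omega_small] by simp
  then have sigma_lim: "(\<lambda>n. pd.eps (complex_of_real (m n)) + (w n)\<^sup>2 / r n) \<longlonglongrightarrow> 0"
    unfolding eps w_def r_def by (rule LIMSEQ_Suc)
  interpret gaps: perturbed_diagonal_gaps "\<lambda>k. orth_proj (E k)" m w V D\<^sub>T T r
    by unfold_locales (simp_all add: r_pos r_sep sigma_lim)
  note shift = m_def[symmetric] r_def[symmetric] P0'
  show ?thesis
    unfolding Let_def
    using gaps.spectrum_localized_exists[OF shift] gaps.spectrum_localized_similarity[OF shift separable] by blast
qed

end
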